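(* Let $\mathcal W=(\mathcal W_1,\mathcal W_2,\mathcal W_3)$ be a 3D white noise on $\mathbb T^2$, and let $\zeta$ be the (almost sure) limit in $\mathcal D'(\mathbb T^2)$, as $\varepsilon\to0$, of $\zeta^\varepsilon:=2G*(\xi^\varepsilon\times\overline{\xi^\varepsilon})$. Let $\kappa\in(0,\frac12)$. Then, almost surely, $\zeta\in E_{1-\kappa}$. Furthermore, there is a constant $C>0$ such that almost surely, for all $\varepsilon\ge0$ and $j=1,2,3$, $$\|\zeta^\varepsilon\|_{1-\kappa}\le C\,\|\mathcal W\|^2_{-1-\frac\kappa4},$$ $$|\zeta_j^\varepsilon-\zeta_j|_{1-\kappa}\le C\Big(|\mathcal W_{j_1}^\varepsilon-\mathcal W_{j_1}|_{-1-\frac\kappa4}|\mathcal W_{j_2}|_{-1-\frac\kappa4}+|\mathcal W_{j_2}^\varepsilon-\mathcal W_{j_2}|_{-1-\frac\kappa4}|\mathcal W_{j_1}|_{-1-\frac\kappa4}\Big),$$ where $j_1\equiv j+1$, $j_2\equiv j+2\pmod3$ with $j_1,j_2\in\{1,2,3\}$, and $\zeta^0:=\zeta$, $\mathcal W^0:=\mathcal W$.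
   Context: $\mathbb T^2=[-\pi,\pi]^2$ with opposite faces identified. $\times$ is the complex-bilinear cross product in $\mathbb C^3$; convolutions on $\mathbb T^2$ act componentwise. Green functions: $K$ is the real-valued mean-zero Green function of $-\Delta$ on $\mathbb T^2$ ($-\Delta K=\delta_0-(4\pi^2)^{-1}$); $G:=2\partial_zK=\partial_1K-i\partial_2K$, $\partial_z=\frac12(\partial_1-i\partial_2)$. White noise: $\mathcal W_j=\eta_j+\mathrm{Re}\big[\sum_{k\in\mathbb Z^2\setminus\{0\}}\eta_{kj}e^{i(k,x)}\big]$, $j=1,2,3$ (convergence in $\mathcal D'(\mathbb T^2)$), with $\eta_j$ i.i.d. standard real Gaussian and $\eta_{kj}$ i.i.d. standard complex Gaussian variables. $\mathcal W_j^\varepsilon=\rho_\varepsilon*\mathcal W_j$ with the standard mollifier $\rho_\varepsilon(x)=\varepsilon^{-2}\rho(x/\varepsilon)$, $\xi^\varepsilon_k=2i\,G*\mathcal W_k^\varepsilon$, $\xi^\varepsilon=(\xi_1^\varepsilon,\xi_2^\varepsilon,\xi_3^\varepsilon)$, $\varepsilon>0$. Spaces: for $\varphi\in C_c^\infty(B_1(0))$ ($B_1(0)\subset\mathbb R^2$ open unit ball), $\lambda\in(0,1]$, $x\in\mathbb T^2$, let $\varphi_x^\lambda(y)=\lambda^{-2}\varphi((y-x)/\lambda)$, extended periodically. Let $\mathscr B^r=\{\varphi\in C_c^\infty(B_1(0)):\|\partial^k\varphi\|_\infty\le1,\ |k|\le r\}$ and, for $\alpha\ge0$, $\mathscr B^0_\alpha=\{\varphi\in\mathscr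 B^0:\int\varphi(z)z^kdz=0,\ |k|\le\alpha\}$. For $\alpha<0$, $|f|_\alpha=\sup_{x,\lambda,\varphi\in\mathscr B^{[-\alpha+1]}}\lambda^{-\alpha}|f(\varphi_x^\lambda)|$; for non-integer $\alpha>0$, $|f|_\alpha=\sup_{x,\psi\in\mathscr B^0}|f(\psi^1_x)|+\sup_{x,\lambda,\varphi\in\mathscr B^0_\alpha}\lambda^{-\alpha}|f(\varphi_x^\lambda)|$. The little space $\mathcal Z^\alpha(\mathbb T^2)$ is the closure of $C^\infty(\mathbb T^2)$ in the space of distributions with $|f|_\alpha<\infty$ (complex-valued: $|f|_\alpha^2=|\mathrm{Re} f|_\alpha^2+|\mathrm{Im} f|_\alpha^2$). $E_\nu$ is the space of $f=(f_1,f_2,f_3)$ with $f_k\in\mathcal Z^\nu(\mathbb T^2)$ complex-valued; $\|f\|_\nu^2=\sum_k|f_k|_\nu^2$ for vector-valued $f$. *)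

theory Defs
  imports "HOL-Probability.Probability"
begin

text \<open>Functions on the torus are functions on the plane that are 2 pi-periodic in both coordinates.\<close>

definition pd :: "2 \<Rightarrow> (real^2 \<Rightarrow> real) \<Rightarrow> real^2 \<Rightarrow> real" where
  "pd i \<phi> x = frechet_derivative \<phi> (at x) (axis i 1)"

definition smooth :: "(real^2 \<Rightarrow> real) \<Rightarrow> bool" where
  "smooth \<phi> \<longleftrightarrow> (\<forall>is. foldr pd is \<phi> differentiable_on UNIV)"

definition mpd :: "nat \<Rightarrow> nat \<Rightarrow> (real^2 \<Rightarrow> real) \<Rightarrow> real^2 \<Rightarrow> real" where
  "mpd a b \<phi> = (pd 1 ^^ a) ((pd 2 ^^ b) \<phi>)"

definition lattice_shift :: "int^2 \<Rightarrow> real^2" where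
  "lattice_shift k = (\<chi> i. 2 * pi * of_int (k $ i))"

definition periodic :: "(real^2 \<Rightarrow> 'b) \<Rightarrow> bool" where
  "periodic f \<longleftrightarrow> (\<forall>x k. f (x + lattice_shift k) = f x)"

definition test_functions :: "(real^2 \<Rightarrow> real) set" where
  "test_functions = {\<phi>. smooth \<phi> \<and> periodic \<phi>}"

definition smooth_torus :: "(real^2 \<Rightarrow> complex) set" where
  "smooth_torus = {g. (\<lambda>x. Re (g x)) \<in> test_functions \<and> (\<lambda>x. Im (g x)) \<in> test_functions}"

text \<open>For compactly supported functions only finitely many terms of this sum are non-zero.\<close>

definition periodize :: "(real^2 \<Rightarrow> real) \<Rightarrow> real^2 \<Rightarrow> real" where
  "periodize f y = (\<Sum>\<^sub>\<infinity>k\<in>UNIV. f (y + lattice_shift k))"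

definition torus_box :: "(real^2) set" where
  "torus_box = cbox (\<chi> i. - pi) (\<chi> i. pi)"

text \<open>
  A complex-valued distribution is represented by its (real-linear) action on real test functions.
  In particular the real part of a distribution is the real part of its values. Values at functions
  outside \<^const>\<open>test_functions\<close> are irrelevant.
\<close>

type_synonym dist = "(real^2 \<Rightarrow> real) \<Rightarrow> complex"

definition is_dist :: "dist \<Rightarrow> bool" where
  "is_dist u \<longleftrightarrow>
     (\<forall>\<phi>\<in>test_functions. \<forall>\<psi>\<in>test_functions. \<forall>c.
        u (\<lambda>x. c * \<phi> x + \<psi> x) = of_real c * u \<phi> + u \<psi>) \<and>
     (\<exists>C N. \<forall>\<phi>\<in>test_functions.
        norm (u \<phi>) \<le> C * (\<Sum>a\<le>N. \<Sum>b\<le>N - a. SUP x. \<bar>mpd a b \<phi> x\<bar>))"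

definition fun_dist :: "(real^2 \<Rightarrow> complex) \<Rightarrow> dist" where
  "fun_dist g \<phi> = (LINT x:torus_box|lborel. g x * of_real (\<phi> x))"

definition dist_tendsto :: "('i \<Rightarrow> dist) \<Rightarrow> dist \<Rightarrow> 'i filter \<Rightarrow> bool" where
  "dist_tendsto u v F \<longleftrightarrow> is_dist v \<and> (\<forall>\<phi>\<in>test_functions. ((\<lambda>i. u i \<phi>) \<longlongrightarrow> v \<phi>) F)"

definition dist_has_sum :: "('i \<Rightarrow> dist) \<Rightarrow> dist \<Rightarrow> 'i set \<Rightarrow> bool" where
  "dist_has_sum u v I \<longleftrightarrow> is_dist v \<and> (\<forall>\<phi>\<in>test_functions. ((\<lambda>i. u i \<phi>) has_sum v \<phi>) I)"

definition dist_pd :: "2 \<Rightarrow> dist \<Rightarrow> dist" where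
  "dist_pd i u \<phi> = - u (pd i \<phi>)"

definition dist_laplace :: "dist \<Rightarrow> dist" where
  "dist_laplace u \<phi> = dist_pd 1 (dist_pd 1 u) \<phi> + dist_pd 2 (dist_pd 2 u) \<phi>"

definition dist_dz :: "dist \<Rightarrow> dist" where
  "dist_dz u \<phi> = (1/2) * (dist_pd 1 u \<phi> - \<i> * dist_pd 2 u \<phi>)"

text \<open>Convolution of a distribution with a smooth complex function on the torus: the
  complex-linear extension of the distribution is applied to \<open>y \<mapsto> g (x - y)\<close>.\<close>

definition conv :: "dist \<Rightarrow> (real^2 \<Rightarrow> complex) \<Rightarrow> real^2 \<Rightarrow> complex" where
  "conv u g x = u (\<lambda>y. Re (g (x - y))) + \<i> * u (\<lambda>y. Im (g (x - y)))"

definition bump_functions :: "(real^2 \<Rightarrow> real) set" where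
  "bump_functions = {\<phi>. smooth \<phi> \<and> closure {x. \<phi> x \<noteq> 0} \<subseteq> ball 0 1}"

definition rescale :: "(real^2 \<Rightarrow> real) \<Rightarrow> real \<Rightarrow> real^2 \<Rightarrow> real^2 \<Rightarrow> real" where
  "rescale \<phi> l x = periodize (\<lambda>y. \<phi> ((y - x) /\<^sub>R l) / l\<^sup>2)"

definition test_ball :: "nat \<Rightarrow> (real^2 \<Rightarrow> real) set" where
  "test_ball r = {\<phi> \<in> bump_functions. \<forall>a b x. a + b \<le> r \<longrightarrow> \<bar>mpd a b \<phi> x\<bar> \<le> 1}"

definition test_ball0 :: "real \<Rightarrow> (real^2 \<Rightarrow> real) set" where
  "test_ball0 \<alpha> = {\<phi> \<in> test_ball 0. \<forall>a b. real (a + b) \<le> \<alpha> \<longrightarrow>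
     (LINT z|lborel. \<phi> z * ((z $ 1) ^ a * (z $ 2) ^ b)) = 0}"

text \<open>The second branch is meant for non-integer \<open>\<alpha> > 0\<close>; the supremum over base points ranges over
  the plane, which by periodicity is the same as over the torus.\<close>

definition real_norm :: "real \<Rightarrow> ((real^2 \<Rightarrow> real) \<Rightarrow> real) \<Rightarrow> ennreal" where
  "real_norm \<alpha> f =
     (if \<alpha> < 0 then
        (SUP x. SUP l\<in>{0<..1}. SUP \<phi>\<in>test_ball (nat \<lfloor>- \<alpha> + 1\<rfloor>).
           ennreal (l powr (- \<alpha>) * \<bar>f (rescale \<phi> l x)\<bar>))
      else
        (SUP x. SUP \<psi>\<in>test_ball 0. ennreal \<bar>f (rescale \<psi> 1 x)\<bar>) +
        (SUP x. SUP l\<in>{0<..1}. SUP \<phi>\<in>test_ball0 \<alpha>.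
           ennreal (l powr (- \<alpha>) * \<bar>f (rescale \<phi> l x)\<bar>)))"

definition esqrt :: "ennreal \<Rightarrow> ennreal" where
  "esqrt a = (if a = \<infinity> then \<infinity> else ennreal (sqrt (enn2real a)))"

definition dist_norm :: "real \<Rightarrow> dist \<Rightarrow> ennreal" where
  "dist_norm \<alpha> f =
     esqrt ((real_norm \<alpha> (\<lambda>\<phi>. Re (f \<phi>)))\<^sup>2 + (real_norm \<alpha> (\<lambda>\<phi>. Im (f \<phi>)))\<^sup>2)"

definition vec_norm :: "real \<Rightarrow> (3 \<Rightarrow> dist) \<Rightarrow> ennreal" where
  "vec_norm \<nu> f = esqrt (\<Sum>k\<in>UNIV. (dist_norm \<nu> (f k))\<^sup>2)"

definition little_space :: "real \<Rightarrow> dist set" where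
  "little_space \<alpha> = {f. is_dist f \<and> dist_norm \<alpha> f < \<infinity> \<and>
     (\<forall>e>0. \<exists>g\<in>smooth_torus. dist_norm \<alpha> (\<lambda>\<phi>. f \<phi> - fun_dist g \<phi>) < e)}"

definition E_space :: "real \<Rightarrow> (3 \<Rightarrow> dist) set" where
  "E_space \<nu> = {f. \<forall>k. f k \<in> little_space \<nu>}"

text \<open>\<open>K\<close> is determined by this predicate up to Lebesgue-null sets, which do not affect
  the distribution it defines.\<close>

definition green_function :: "(real^2 \<Rightarrow> real) \<Rightarrow> bool" where
  "green_function K \<longleftrightarrow>
     periodic K \<and> K \<in> borel_measurable borel \<and> set_integrable lborel torus_box K \<and>
     (LINT x:torus_box|lborel. K x) = 0 \<and>
     (\<forall>\<phi>\<in>test_functions. - dist_laplace (fun_dist (\<lambda>x. of_real (K x))) \<phi>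
        = of_real (\<phi> 0) - fun_dist (\<lambda>x. 1 / (4 * of_real pi ^ 2)) \<phi>)"

definition G_dist :: "(real^2 \<Rightarrow> real) \<Rightarrow> dist" where
  "G_dist K \<phi> = 2 * dist_dz (fun_dist (\<lambda>x. of_real (K x))) \<phi>"

definition mollifier :: "(real^2 \<Rightarrow> real) \<Rightarrow> bool" where
  "mollifier \<rho> \<longleftrightarrow> \<rho> \<in> bump_functions \<and> (\<forall>x. 0 \<le> \<rho> x) \<and> (LINT x|lborel. \<rho> x) = 1"

definition fourier_mode :: "int^2 \<Rightarrow> real^2 \<Rightarrow> complex" where
  "fourier_mode k x = exp (\<i> * of_real (of_int (k $ 1) * x $ 1 + of_int (k $ 2) * x $ 2))"

text \<open>Centred circularly symmetric complex Gaussian variable with second absolute moment \<open>v\<close>.\<close>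

definition complex_gaussian :: "'a measure \<Rightarrow> real \<Rightarrow> ('a \<Rightarrow> complex) \<Rightarrow> bool" where
  "complex_gaussian M v X \<longleftrightarrow>
     distributed M lborel (\<lambda>\<omega>. Re (X \<omega>)) (normal_density 0 (sqrt (v / 2))) \<and>
     distributed M lborel (\<lambda>\<omega>. Im (X \<omega>)) (normal_density 0 (sqrt (v / 2))) \<and>
     prob_space.indep_var M borel (\<lambda>\<omega>. Re (X \<omega>)) borel (\<lambda>\<omega>. Im (X \<omega>))"

text \<open>
  All of the variables \<open>\<eta> j\<close> and \<open>\<theta> k j\<close> (\<open>k \<noteq> 0\<close>) are jointly independent; the family of
  independent variables below carries \<open>\<eta> j\<close> at the index \<open>(0, j)\<close>. Two normalizations of a standard
  complex Gaussian are in use: \<open>v = 1\<close> (unit second absolute moment) and \<open>v = 2\<close> (real and imaginary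
  parts of unit variance); the latter makes the covariance of the resulting field exactly
  \<open>4 pi^2\<close> times the delta function.
\<close>

definition white_noise :: "'a measure \<Rightarrow> real \<Rightarrow> ('a \<Rightarrow> 3 \<Rightarrow> dist) \<Rightarrow> bool" where
  "white_noise M v W \<longleftrightarrow>
     (\<exists>(\<eta> :: 3 \<Rightarrow> 'a \<Rightarrow> real) (\<theta> :: int^2 \<Rightarrow> 3 \<Rightarrow> 'a \<Rightarrow> complex).
        prob_space.indep_vars M (\<lambda>_. borel)
          (\<lambda>(k, j) \<omega>. if k = 0 then of_real (\<eta> j \<omega>) else \<theta> k j \<omega>) UNIV \<and>
        (\<forall>j. distributed M lborel (\<eta> j) (normal_density 0 1)) \<and>
        (\<forall>j k. k \<noteq> 0 \<longrightarrow> complex_gaussian M v (\<theta> k j)) \<and>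
        (AE \<omega> in M. \<forall>j. is_dist (W \<omega> j) \<and>
           (\<exists>S. dist_has_sum (\<lambda>k \<phi>. \<theta> k j \<omega> * fun_dist (fourier_mode k) \<phi>) S (- {0}) \<and>
                (\<forall>\<phi>\<in>test_functions.
                   W \<omega> j \<phi> = fun_dist (\<lambda>x. of_real (\<eta> j \<omega>)) \<phi> + of_real (Re (S \<phi>))))))"

text \<open>A mollifier on the plane acts on torus distributions through its periodization; the support of the
  rescaled mollifier may exceed a fundamental domain when the scale is large.\<close>

definition mollify :: "(real^2 \<Rightarrow> real) \<Rightarrow> real \<Rightarrow> dist \<Rightarrow> real^2 \<Rightarrow> complex" where
  "mollify \<rho> e w = conv w (\<lambda>x. of_real (periodize (\<lambda>y. \<rho> (y /\<^sub>R e) / e\<^sup>2) x))"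

definition W_eps :: "(real^2 \<Rightarrow> real) \<Rightarrow> (3 \<Rightarrow> dist) \<Rightarrow> real \<Rightarrow> 3 \<Rightarrow> dist" where
  "W_eps \<rho> w e j = (if e = 0 then w j else fun_dist (mollify \<rho> e (w j)))"

definition xi_eps :: "(real^2 \<Rightarrow> real) \<Rightarrow> (real^2 \<Rightarrow> real) \<Rightarrow> (3 \<Rightarrow> dist) \<Rightarrow> real \<Rightarrow> real^2 \<Rightarrow> complex^3"
  where "xi_eps K \<rho> w e x = (\<chi> k. 2 * \<i> * conv (G_dist K) (mollify \<rho> e (w k)) x)"

text \<open>The indices are elements of the three-element type, in which arithmetic is modulo 3.\<close>

definition ccross :: "complex^3 \<Rightarrow> complex^3 \<Rightarrow> complex^3" where
  "ccross a b = (\<chi> j. a $ (j + 1) * b $ (j + 2) - a $ (j + 2) * b $ (j + 1))"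

definition vcnj :: "complex^3 \<Rightarrow> complex^3" where
  "vcnj a = (\<chi> j. cnj (a $ j))"

definition zeta_eps :: "(real^2 \<Rightarrow> real) \<Rightarrow> (real^2 \<Rightarrow> real) \<Rightarrow> (3 \<Rightarrow> dist) \<Rightarrow> real \<Rightarrow> 3 \<Rightarrow> dist" where
  "zeta_eps K \<rho> w e j =
     fun_dist (\<lambda>x. 2 * conv (G_dist K)
       (\<lambda>y. ccross (xi_eps K \<rho> w e y) (vcnj (xi_eps K \<rho> w e y)) $ j) x)"

definition zeta_ext ::
  "(real^2 \<Rightarrow> real) \<Rightarrow> (real^2 \<Rightarrow> real) \<Rightarrow> (3 \<Rightarrow> dist) \<Rightarrow> (3 \<Rightarrow> dist) \<Rightarrow> real \<Rightarrow> 3 \<Rightarrow> dist" where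
  "zeta_ext K \<rho> w z e j = (if e = 0 then z j else zeta_eps K \<rho> w e j)"

end

theory Submission
  imports Defs
begin

text \<open>
  Writing \<open>u = K * W\<^sub>j\<^sub>+\<^sub>1\<close> and \<open>v = K * W\<^sub>j\<^sub>+\<^sub>2\<close>, the cross product makes \<open>\<zeta>\<^sub>j\<close> a constant multiple of
  \<open>(\<partial>\<^sub>2 + \<i> \<partial>\<^sub>1) (K * J (u, v))\<close>, where \<open>J (u, v) = \<partial>\<^sub>1 u \<partial>\<^sub>2 v - \<partial>\<^sub>2 u \<partial>\<^sub>1 v\<close> is the Jacobian. The gradients of
  \<open>u\<close> and \<open>v\<close> barely fail to be functions, so the product is not defined by itself, but the Jacobian
  structure saves it. Up to constants, \<open>K\<close> is a sum of smooth kernels \<open>\<kappa>\<^sub>n\<close> supported at scale \<open>2\<^sup>-\<^sup>n\<close>. In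
  the telescoping sum that replaces each of the three copies of \<open>K\<close> by its partial sums, every term
  contains one kernel \<open>\<kappa>\<^sub>n\<close>, and the cyclic symmetry of the trilinear form \<open>\<integral> \<phi> J (u, v)\<close> brings this small
  kernel outside the Jacobian. The terms are then summable, with room for almost one Hoelder derivative.

  The bounds for the white noise follow from this by density, once \<open>W\<close> is known to be the limit
  of its mollifications in regularity \<open>- 1 - \<alpha>\<close>. This is shown by Gaussian moment bounds for dyadic
  blocks of the Fourier series, in \<open>L\<^sup>2\<^sup>p\<close> with large \<open>p\<close>.
\<close>

section \<open>Smooth functions on the plane\<close>

text \<open>The exponents come from one count. Put \<open>q = 2 powr \<alpha>\<close> with \<alpha>
  a quarter of the final loss. The gradients of \<open>u\<close> and \<open>v\<close>, cut off at
  scale 2^-n, grow like q^n, and the outer kernel loses at most another q^n, because its second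
  derivatives diverge logarithmically. So one telescoping increment is bounded by (q^3/2)^n and its
  gradient by (q^3)^n. Interpolating at Hoelder exponent 1 - 4 \<alpha> multiplies q^(3n) by 2^(-4
  \<alpha> n) = q^(-4n): three powers of \<open>q\<close> pay for the factors, the fourth makes the
  series converge. The constant must depend neither on the noise nor on the mollification scale.
  Hence the estimate is proved for smooth data with a constant that sees them only through their
  negative norms, mollification is shown not to increase these norms, and limits are taken on single
  test functions. High moments are used because the norm is a supremum over uncountably many test
  functions: by Hoelder, the L^(2p) norm of a block controls all of them at once, at the price of a
  factor l^(-1/p).\<close>

lemma smooth_differentiable: "smooth \<phi> \<Longrightarrow> \<phi> differentiable (at x)"
  unfolding smooth_def by (drule spec[of _ "[]"]) (simp add: differentiable_on_def)

lemma smooth_pd: "smooth \<phi> \<Longrightarrow> smooth (pd i \<phi>)"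
  unfolding smooth_def
proof
  fix "is" assume "\<forall>is. foldr pd is \<phi> differentiable_on UNIV"
  then have "foldr pd (is @ [i]) \<phi> differentiable_on UNIV" by blast
  then show "foldr pd is (pd i \<phi>) differentiable_on UNIV" by simp
qed

text \<open>Smoothness follows from any class of differentiable functions closed under
  \<open>pd\<close>, so iterated derivatives never have to be computed. The classes used below are
  algebras, affine images, periodizations, radial functions, Fourier modes and convolutions.\<close>

lemma smooth_coinduct:
  assumes "P \<phi>"
    and "\<And>\<phi> x. P \<phi> \<Longrightarrow> \<phi> differentiable (at x)"
    and "\<And>\<phi> i. P \<phi> \<Longrightarrow> P (pd i \<phi>)"
  shows "smooth \<phi>"
proof -
  have "P (foldr pd is \<phi>)" for "is"
    by (induction "is") (auto intro: assms)
  then show ?thesis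
    unfolding smooth_def differentiable_on_def using assms(2) by auto
qed

lemma pd_eqI: "(\<phi> has_derivative D) (at x) \<Longrightarrow> pd i \<phi> x = D (axis i 1)"
  by (metis pd_def frechet_derivative_at)

lemma vec2_eq_axis: "(h::real^2) = (h $ 1) *\<^sub>R axis 1 1 + (h $ 2) *\<^sub>R axis 2 1"
  by (simp add: vec_eq_iff forall_2 axis_def)

lemma differentiable_has_derivative_pd:
  assumes "\<phi> differentiable (at x)"
  shows "(\<phi> has_derivative (\<lambda>h. h $ 1 * pd 1 \<phi> x + h $ 2 * pd 2 \<phi> x)) (at x)"
proof -
  define D where "D = frechet_derivative \<phi> (at x)"
  have D: "(\<phi> has_derivative D) (at x)"
    using assms by (simp add: D_def frechet_derivative_works)
  then have lin: "linear D" by (rule has_derivative_linear)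
  have "D h = h $ 1 * pd 1 \<phi> x + h $ 2 * pd 2 \<phi> x" for h
  proof -
    have "D h = D ((h $ 1) *\<^sub>R axis 1 1 + (h $ 2) *\<^sub>R axis 2 1)"
      using vec2_eq_axis[of h] by simp
    also have "\<dots> = (h $ 1) *\<^sub>R D (axis 1 1) + (h $ 2) *\<^sub>R D (axis 2 1)"
      by (simp add: linear_add[OF lin] linear_cmul[OF lin])
    finally show ?thesis by (simp add: pd_def D_def)
  qed
  then have "D = (\<lambda>h. h $ 1 * pd 1 \<phi> x + h $ 2 * pd 2 \<phi> x)" by blast
  then show ?thesis using D by simp
qed

lemmas smooth_has_derivative = differentiable_has_derivative_pd[OF smooth_differentiable]

lemma has_derivative_pdI:
  assumes "(\<phi> has_derivative (\<lambda>h. h $ 1 * a + h $ 2 * b)) (at x)"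
  shows "pd 1 \<phi> x = a" "pd 2 \<phi> x = b"
  using pd_eqI[OF assms, of 1] pd_eqI[OF assms, of 2] by (simp_all add: axis_def)

lemma smooth_continuous_on: "smooth \<phi> \<Longrightarrow> continuous_on S \<phi>"
  by (meson continuous_at_imp_continuous_on differentiable_imp_continuous_within smooth_differentiable)

lemma smooth_borel: "smooth \<phi> \<Longrightarrow> \<phi> \<in> borel_measurable borel"
  by (rule borel_measurable_continuous_onI[OF smooth_continuous_on])

lemma pd_const [simp]: "pd i (\<lambda>x. c) = (\<lambda>x. 0)"
  by (rule ext) (simp add: pd_eqI[OF has_derivative_const])

lemma smooth_const [simp]: "smooth (\<lambda>x. c)"
  by (rule smooth_coinduct[where P = "\<lambda>\<phi>. \<exists>c. \<phi> = (\<lambda>x. c)"]) auto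

lemma
  assumes "f differentiable (at x)" "g differentiable (at x)"
  shows pd_add_at: "pd i (\<lambda>x. f x + g x) x = pd i f x + pd i g x"
    and pd_diff_at: "pd i (\<lambda>x. f x - g x) x = pd i f x - pd i g x"
    and pd_mult_at: "pd i (\<lambda>x. f x * g x) x = pd i f x * g x + f x * pd i g x"
proof -
  have f: "(f has_derivative frechet_derivative f (at x)) (at x)"
    and g: "(g has_derivative frechet_derivative g (at x)) (at x)"
    using assms by (simp_all add: frechet_derivative_works)
  show "pd i (\<lambda>x. f x + g x) x = pd i f x + pd i g x"
    by (subst pd_eqI[OF has_derivative_add[OF f g]]) (simp add: pd_def)
  show "pd i (\<lambda>x. f x - g x) x = pd i f x - pd i g x"
    by (subst pd_eqI[OF has_derivative_diff[OF f g]]) (simp add: pd_def)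
  show "pd i (\<lambda>x. f x * g x) x = pd i f x * g x + f x * pd i g x"
    by (subst pd_eqI[OF has_derivative_mult[OF f g]]) (simp add: pd_def)
qed

text \<open>Closure of smooth functions under sums and products is obtained by coinduction on the
  algebra they generate, which is closed under \<^const>\<open>pd\<close> by the Leibniz rule.\<close>

inductive smooth_algebra :: "(real^2 \<Rightarrow> real) \<Rightarrow> bool" where
  base: "smooth \<phi> \<Longrightarrow> smooth_algebra \<phi>"
| add: "smooth_algebra \<phi> \<Longrightarrow> smooth_algebra \<psi> \<Longrightarrow> smooth_algebra (\<lambda>x. \<phi> x + \<psi> x)"
| mult: "smooth_algebra \<phi> \<Longrightarrow> smooth_algebra \<psi> \<Longrightarrow> smooth_algebra (\<lambda>x. \<phi> x * \<psi> x)"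

lemma smooth_algebra_differentiable: "smooth_algebra \<phi> \<Longrightarrow> \<phi> differentiable (at x)"
  by (induction rule: smooth_algebra.induct)
    (auto intro: smooth_differentiable differentiable_add differentiable_mult)

lemma smooth_algebra_pd: "smooth_algebra \<phi> \<Longrightarrow> smooth_algebra (pd i \<phi>)"
proof (induction rule: smooth_algebra.induct)
  case (base \<phi>)
  then show ?case by (simp add: smooth_algebra.base smooth_pd)
next
  case (add \<phi> \<psi>)
  have "pd i (\<lambda>x. \<phi> x + \<psi> x) = (\<lambda>x. pd i \<phi> x + pd i \<psi> x)"
    by (rule ext) (rule pd_add_at; rule smooth_algebra_differentiable; fact)
  then show ?case using add by (simp add: smooth_algebra.add)
next
  case (mult \<phi> \<psi>)
  have "pd i (\<lambda>x. \<phi> x * \<psi> x) = (\<lambda>x. pd i \<phi> x * \<psi> x + \<phi> x * pd i \<psi> x)"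
    by (rule ext) (rule pd_mult_at; rule smooth_algebra_differentiable; fact)
  then show ?case using mult by (simp add: smooth_algebra.add smooth_algebra.mult)
qed

lemma smooth_algebra_smooth: "smooth_algebra \<phi> \<Longrightarrow> smooth \<phi>"
  by (rule smooth_coinduct[where P = smooth_algebra])
    (auto intro: smooth_algebra_differentiable smooth_algebra_pd)

lemma smooth_add: "smooth \<phi> \<Longrightarrow> smooth \<psi> \<Longrightarrow> smooth (\<lambda>x. \<phi> x + \<psi> x)"
  by (rule smooth_algebra_smooth[OF smooth_algebra.add]) (rule smooth_algebra.base, assumption)+

lemma smooth_mult: "smooth \<phi> \<Longrightarrow> smooth \<psi> \<Longrightarrow> smooth (\<lambda>x. \<phi> x * \<psi> x)"
  by (rule smooth_algebra_smooth[OF smooth_algebra.mult]) (rule smooth_algebra.base, assumption)+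

lemma smooth_cmult: "smooth \<phi> \<Longrightarrow> smooth (\<lambda>x. c * \<phi> x)"
  by (intro smooth_mult smooth_const)

lemma smooth_uminus: "smooth \<phi> \<Longrightarrow> smooth (\<lambda>x. - \<phi> x)"
  using smooth_cmult[of \<phi> "-1"] by simp

lemma smooth_diff: "smooth \<phi> \<Longrightarrow> smooth \<psi> \<Longrightarrow> smooth (\<lambda>x. \<phi> x - \<psi> x)"
  using smooth_add[of \<phi> "\<lambda>x. - \<psi> x"] smooth_uminus[of \<psi>] by simp

lemma smooth_sum: "(\<And>k. k \<in> F \<Longrightarrow> smooth (f k)) \<Longrightarrow> smooth (\<lambda>x. \<Sum>k\<in>F. f k x)"
  by (induction F rule: infinite_finite_induct) (simp_all add: smooth_const smooth_add)

lemma pd_add: "smooth f \<Longrightarrow> smooth g \<Longrightarrow> pd i (\<lambda>x. f x + g x) = (\<lambda>x. pd i f x + pd i g x)"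
  by (rule ext) (simp add: pd_add_at smooth_differentiable)

lemma pd_diff: "smooth f \<Longrightarrow> smooth g \<Longrightarrow> pd i (\<lambda>x. f x - g x) = (\<lambda>x. pd i f x - pd i g x)"
  by (rule ext) (simp add: pd_diff_at smooth_differentiable)

lemma pd_mult: "smooth f \<Longrightarrow> smooth g \<Longrightarrow> pd i (\<lambda>x. f x * g x) = (\<lambda>x. pd i f x * g x + f x * pd i g x)"
  by (rule ext) (simp add: pd_mult_at smooth_differentiable)

lemma pd_cmult: "smooth f \<Longrightarrow> pd i (\<lambda>x. c * f x) = (\<lambda>x. c * pd i f x)"
  by (subst pd_mult) (simp_all add: smooth_const)

lemma pd_uminus: "smooth f \<Longrightarrow> pd i (\<lambda>x. - f x) = (\<lambda>x. - pd i f x)"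
  using pd_cmult[of f i "-1"] by simp

lemma pd_sum: "(\<And>k. k \<in> F \<Longrightarrow> smooth (f k)) \<Longrightarrow> pd i (\<lambda>x. \<Sum>k\<in>F. f k x) = (\<lambda>x. \<Sum>k\<in>F. pd i (f k) x)"
  by (induction F rule: infinite_finite_induct) (simp_all add: pd_add smooth_sum)

lemma affine_differentiable_pd:
  assumes "\<phi> differentiable (at (a + c *\<^sub>R x))"
  shows "(\<lambda>x. \<phi> (a + c *\<^sub>R x)) differentiable (at x)"
    and "pd i (\<lambda>x. \<phi> (a + c *\<^sub>R x)) x = c * pd i \<phi> (a + c *\<^sub>R x)"
proof -
  have g: "((\<lambda>x. a + c *\<^sub>R x) has_derivative (\<lambda>h. c *\<^sub>R h)) (at x)"
    by (auto intro!: derivative_eq_intros)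
  have d: "((\<lambda>x. \<phi> (a + c *\<^sub>R x)) has_derivative
      (\<lambda>h. (c *\<^sub>R h) $ 1 * pd 1 \<phi> (a + c *\<^sub>R x) + (c *\<^sub>R h) $ 2 * pd 2 \<phi> (a + c *\<^sub>R x))) (at x)"
    by (rule has_derivative_compose[OF g differentiable_has_derivative_pd[OF assms]])
  then show "(\<lambda>x. \<phi> (a + c *\<^sub>R x)) differentiable (at x)"
    by (auto simp: differentiable_def)
  show "pd i (\<lambda>x. \<phi> (a + c *\<^sub>R x)) x = c * pd i \<phi> (a + c *\<^sub>R x)"
    using exhaust_2[of i] by (subst pd_eqI[OF d]) (auto simp: axis_def)
qed

lemma pd_affine: "smooth \<phi> \<Longrightarrow> pd i (\<lambda>x. \<phi> (a + c *\<^sub>R x)) = (\<lambda>x. c * pd i \<phi> (a + c *\<^sub>R x))"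
  by (rule ext) (simp add: affine_differentiable_pd smooth_differentiable)

lemma smooth_affine:
  assumes "smooth \<phi>"
  shows "smooth (\<lambda>x. \<phi> (a + c *\<^sub>R x))"
\<comment> \<open>Each derivative brings out a factor \<open>c\<close>, so the class must contain
  scalar multiples.\<close>
proof (rule smooth_coinduct[where P = "\<lambda>f. \<exists>\<phi> b. smooth \<phi> \<and> f = (\<lambda>x. b * \<phi> (a + c *\<^sub>R x))"])
  show "\<exists>\<psi> b. smooth \<psi> \<and> (\<lambda>x. \<phi> (a + c *\<^sub>R x)) = (\<lambda>x. b * \<psi> (a + c *\<^sub>R x))"
    using assms by (intro exI[of _ \<phi>] exI[of _ 1]) auto
next
  fix f x assume "\<exists>\<phi> b. smooth \<phi> \<and> f = (\<lambda>x. b * \<phi> (a + c *\<^sub>R x))"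
  then show "f differentiable (at x)"
    by (elim exE conjE, hypsubst)
      (rule differentiable_mult[OF differentiable_const
        affine_differentiable_pd(1)[OF smooth_differentiable]])
next
  fix f i assume "\<exists>\<phi> b. smooth \<phi> \<and> f = (\<lambda>x. b * \<phi> (a + c *\<^sub>R x))"
  then obtain \<psi> b where \<psi>: "smooth \<psi>" and f: "f = (\<lambda>x. b * \<psi> (a + c *\<^sub>R x))" by auto
  have "pd i f = (\<lambda>x. (b * c) * pd i \<psi> (a + c *\<^sub>R x))"
    unfolding f using \<psi>
    by (intro ext) (subst pd_mult_at, auto simp: affine_differentiable_pd smooth_differentiable)
  then show "\<exists>\<phi> b. smooth \<phi> \<and> pd i f = (\<lambda>x. b * \<phi> (a + c *\<^sub>R x))"
    using smooth_pd[OF \<psi>] by blast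
qed

lemma
  assumes "smooth \<phi>"
  shows smooth_reflect: "smooth (\<lambda>y. \<phi> (x - y))"
    and pd_reflect: "pd i (\<lambda>y. \<phi> (x - y)) = (\<lambda>y. - pd i \<phi> (x - y))"
  using smooth_affine[OF assms, of x "-1"] pd_affine[OF assms, of i x "-1"] by simp_all

lemma
  assumes "smooth \<phi>"
  shows smooth_shift: "smooth (\<lambda>y. \<phi> (y + x))"
    and pd_shift: "pd i (\<lambda>y. \<phi> (y + x)) = (\<lambda>y. pd i \<phi> (y + x))"
  using smooth_affine[OF assms, of x 1] pd_affine[OF assms, of i x 1] by (simp_all add: add.commute)

lemma smooth_line_derivative:
  assumes "smooth \<phi>"
  shows "((\<lambda>s. \<phi> (x + s *\<^sub>R axis i 1)) has_real_derivative pd i \<phi> (x + s *\<^sub>R axis i 1)) (at s)"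
proof -
  have g: "((\<lambda>s. x + s *\<^sub>R axis i 1) has_derivative (\<lambda>h. h *\<^sub>R axis i 1)) (at s)"
    by (auto intro!: derivative_eq_intros)
  show ?thesis
    using has_derivative_compose[OF g smooth_has_derivative[OF assms]] exhaust_2[of i]
    by (auto simp: has_field_derivative_def axis_def mult_commute_abs)
qed

lemma pd_commute:
  assumes "smooth \<phi>"
  shows "pd i (pd j \<phi>) = pd j (pd i \<phi>)"
proof
  fix x :: "real^2"
  let ?e = "\<lambda>i. axis i 1 :: real^2"
  text \<open>Both mixed partial derivatives are values of the second difference quotient.\<close>
  have quot: "\<exists>s t. 0 < s \<and> s < h \<and> 0 < t \<and> t < h \<and>
      \<phi> (x + h *\<^sub>R ?e i + h *\<^sub>R ?e j) - \<phi> (x + h *\<^sub>R ?e i) - \<phi> (x + h *\<^sub>R ?e j) + \<phi> x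
        = h\<^sup>2 * pd j (pd i \<phi>) (x + s *\<^sub>R ?e i + t *\<^sub>R ?e j)" if "h > 0" for h i j
  proof -
    define g where "g s = \<phi> (x + h *\<^sub>R ?e j + s *\<^sub>R ?e i) - \<phi> (x + s *\<^sub>R ?e i)" for s
    have "(g has_real_derivative pd i \<phi> (x + h *\<^sub>R ?e j + s *\<^sub>R ?e i) - pd i \<phi> (x + s *\<^sub>R ?e i)) (at s)" for s
      unfolding g_def by (intro DERIV_diff smooth_line_derivative assms)
    from MVT2[OF \<open>h > 0\<close> this] obtain s where s: "0 < s" "s < h"
      "g h - g 0 = h * (pd i \<phi> (x + h *\<^sub>R ?e j + s *\<^sub>R ?e i) - pd i \<phi> (x + s *\<^sub>R ?e i))"
      by auto
    have "((\<lambda>t. pd i \<phi> (x + s *\<^sub>R ?e i + t *\<^sub>R ?e j)) has_real_derivative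
        pd j (pd i \<phi>) (x + s *\<^sub>R ?e i + t *\<^sub>R ?e j)) (at t)" for t
      by (intro smooth_line_derivative smooth_pd assms)
    from MVT2[OF \<open>h > 0\<close> this] obtain t where t: "0 < t" "t < h"
      "pd i \<phi> (x + s *\<^sub>R ?e i + h *\<^sub>R ?e j) - pd i \<phi> (x + s *\<^sub>R ?e i)
        = h * pd j (pd i \<phi>) (x + s *\<^sub>R ?e i + t *\<^sub>R ?e j)"
      by auto
    have "\<phi> (x + h *\<^sub>R ?e i + h *\<^sub>R ?e j) - \<phi> (x + h *\<^sub>R ?e i) - \<phi> (x + h *\<^sub>R ?e j) + \<phi> x = g h - g 0"
      by (simp add: g_def algebra_simps)
    also have "\<dots> = h\<^sup>2 * pd j (pd i \<phi>) (x + s *\<^sub>R ?e i + t *\<^sub>R ?e j)"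
      unfolding s(3) using t(3) by (simp add: power2_eq_square algebra_simps)
    finally show ?thesis using s t by blast
  qed
  have lim: "((\<lambda>h. (\<phi> (x + h *\<^sub>R ?e i + h *\<^sub>R ?e j) - \<phi> (x + h *\<^sub>R ?e i) - \<phi> (x + h *\<^sub>R ?e j) + \<phi> x) / h\<^sup>2)
      \<longlongrightarrow> pd j (pd i \<phi>) x) (at_right 0)" for i j
  proof (rule tendstoI)
    fix e :: real assume "e > 0"
    have "isCont (pd j (pd i \<phi>)) x"
      using smooth_continuous_on[OF smooth_pd[OF smooth_pd[OF assms]], of UNIV]
      by (simp add: continuous_on_eq_continuous_at)
    then obtain d where d: "d > 0" "\<And>y. dist y x < d \<Longrightarrow> dist (pd j (pd i \<phi>) y) (pd j (pd i \<phi>) x) < e"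
      using \<open>e > 0\<close> unfolding continuous_at_eps_delta by blast
    have "dist ((\<phi> (x + h *\<^sub>R ?e i + h *\<^sub>R ?e j) - \<phi> (x + h *\<^sub>R ?e i) - \<phi> (x + h *\<^sub>R ?e j) + \<phi> x) / h\<^sup>2)
        (pd j (pd i \<phi>) x) < e" if h: "0 < h" "h < d / 2" for h
    proof -
      obtain s t where st: "0 < s" "s < h" "0 < t" "t < h" and
        eq: "\<phi> (x + h *\<^sub>R ?e i + h *\<^sub>R ?e j) - \<phi> (x + h *\<^sub>R ?e i) - \<phi> (x + h *\<^sub>R ?e j) + \<phi> x
        = h\<^sup>2 * pd j (pd i \<phi>) (x + s *\<^sub>R ?e i + t *\<^sub>R ?e j)"
        using quot[OF h(1), of i j] by blast
      have "dist (x + s *\<^sub>R ?e i + t *\<^sub>R ?e j) x = norm (s *\<^sub>R ?e i + t *\<^sub>R ?e j)"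
        by (simp add: dist_norm add.assoc)
      also have "\<dots> \<le> norm (s *\<^sub>R ?e i) + norm (t *\<^sub>R ?e j)" by (rule norm_triangle_ineq)
      also have "\<dots> < d" using st h by (simp add: norm_axis_1)
      finally show ?thesis using d(2) eq h by simp
    qed
    then show "\<forall>\<^sub>F h in at_right 0. dist ((\<phi> (x + h *\<^sub>R ?e i + h *\<^sub>R ?e j) - \<phi> (x + h *\<^sub>R ?e i)
        - \<phi> (x + h *\<^sub>R ?e j) + \<phi> x) / h\<^sup>2) (pd j (pd i \<phi>) x) < e"
      unfolding eventually_at_right_field using d(1) by (intro exI[of _ "d / 2"]) auto
  qed
  \<comment> \<open>The second difference is symmetric in \<open>i\<close> and \<open>j\<close>, so
    the same quotient has both mixed derivatives as its limit.\<close>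
  have "((\<lambda>h. (\<phi> (x + h *\<^sub>R ?e i + h *\<^sub>R ?e j) - \<phi> (x + h *\<^sub>R ?e i) - \<phi> (x + h *\<^sub>R ?e j) + \<phi> x) / h\<^sup>2)
      \<longlongrightarrow> pd i (pd j \<phi>) x) (at_right 0)"
    using lim[of j i] by (simp add: algebra_simps)
  with lim[of i j] show "pd i (pd j \<phi>) x = pd j (pd i \<phi>) x"
    by (intro tendsto_unique[OF trivial_limit_at_right_real])
qed

lemma funpow_pd_commute:
  assumes "smooth \<phi>"
  shows "(pd j ^^ n) (pd i \<phi>) = pd i ((pd j ^^ n) \<phi>) \<and> smooth ((pd j ^^ n) \<phi>)"
  using assms by (induction n) (auto simp: pd_commute[of _ j i] smooth_pd)

lemma smooth_mpd: "smooth \<phi> \<Longrightarrow> smooth (mpd a b \<phi>)"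
  unfolding mpd_def using funpow_pd_commute by blast

lemma mpd_pd: "smooth \<phi> \<Longrightarrow> mpd a b (pd i \<phi>) = pd i (mpd a b \<phi>)"
  unfolding mpd_def using funpow_pd_commute by metis

lemma mpd_0 [simp]: "mpd 0 0 \<phi> = \<phi>"
  by (simp add: mpd_def)

lemma mpd_Suc_left: "mpd (Suc a) b \<phi> = pd 1 (mpd a b \<phi>)"
  by (simp add: mpd_def)

lemma mpd_Suc_right: "smooth \<phi> \<Longrightarrow> mpd a (Suc b) \<phi> = pd 2 (mpd a b \<phi>)"
  using mpd_pd[of \<phi> a b 2] funpow_pd_commute[of \<phi> b 2 2] by (simp add: mpd_def)

lemma mpd_induct:
  assumes "smooth \<phi>" "P \<phi>" "\<And>\<psi> i. smooth \<psi> \<Longrightarrow> P \<psi> \<Longrightarrow> P (pd i \<psi>)"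
  shows "P (mpd a b \<phi>)"
proof (induction a)
  case 0
  show ?case using assms(1)
    by (induction b) (simp_all add: assms mpd_Suc_right smooth_mpd)
next
  case (Suc a)
  then show ?case by (simp add: mpd_Suc_left assms smooth_mpd)
qed

text \<open>For relations between two functions, such as one being a shift or a multiple of the
  other: a rule for a single \<open>pd\<close> then lifts to all mixed derivatives.\<close>

lemma mpd_induct2:
  assumes "smooth \<phi>" "smooth \<phi>'" "P \<phi> \<phi>'"
    "\<And>\<psi> \<psi>' i. smooth \<psi> \<Longrightarrow> smooth \<psi>' \<Longrightarrow> P \<psi> \<psi>' \<Longrightarrow> P (pd i \<psi>) (pd i \<psi>')"
  shows "P (mpd a b \<phi>) (mpd a b \<phi>')"
proof (induction a)
  case 0
  show ?case using assms(1,2)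
    by (induction b) (simp_all add: assms mpd_Suc_right smooth_mpd)
next
  case (Suc a)
  then show ?case by (simp add: mpd_Suc_left assms smooth_mpd)
qed

section \<open>Periodic functions and the torus\<close>

lemma lattice_shift_simps [simp]:
  "lattice_shift 0 = 0" "lattice_shift (k + l) = lattice_shift k + lattice_shift l"
  "lattice_shift (- k) = - lattice_shift k" "lattice_shift (k - l) = lattice_shift k - lattice_shift l"
  by (simp_all add: lattice_shift_def vec_eq_iff algebra_simps)

lemma lattice_shift_nth: "lattice_shift k $ i = 2 * pi * of_int (k $ i)"
  by (simp add: lattice_shift_def)

lemma periodicD: "periodic f \<Longrightarrow> f (x + lattice_shift k) = f x"
  by (simp add: periodic_def)

lemma mem_torus_box: "x \<in> torus_box \<longleftrightarrow> (\<forall>i. - pi \<le> x $ i \<and> x $ i \<le> pi)"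
  by (simp add: torus_box_def mem_box_cart)

text \<open>A true fundamental domain, with exactly one lattice translate of every point. It differs
  from \<open>torus_box\<close> by a null set.\<close>

definition half_open_box :: "(real^2) set" where
  "half_open_box = {x. \<forall>i. - pi \<le> x $ i \<and> x $ i < pi}"

lemma half_open_box_subset: "half_open_box \<subseteq> torus_box"
  by (auto simp: half_open_box_def mem_torus_box less_imp_le)

lemma half_open_box_ex1: "\<exists>!k. x + lattice_shift k \<in> half_open_box"
proof -
  have ex1: "\<exists>!m::int. - pi \<le> t + 2 * pi * of_int m \<and> t + 2 * pi * of_int m < pi" for t :: real
  proof -
    have "(- pi \<le> t + 2 * pi * of_int m \<and> t + 2 * pi * of_int m < pi) \<longleftrightarrow>
        (of_int (- m) \<le> (t + pi) / (2 * pi) \<and> (t + pi) / (2 * pi) < of_int (- m) + 1)" for m :: int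
    proof -
      define q where "q = (t + pi) / (2 * pi)"
      have e: "t + 2 * pi * of_int m = (2 * pi) * (q + of_int m) - pi"
        by (simp add: q_def field_simps)
      have "- pi \<le> t + 2 * pi * of_int m \<longleftrightarrow> 0 \<le> q + of_int m"
        unfolding e using zero_le_mult_iff[of "2 * pi" "q + of_int m"] pi_gt_zero by auto
      moreover have "t + 2 * pi * of_int m < pi \<longleftrightarrow> q + of_int m < 1"
        unfolding e using mult_less_cancel_left_pos[of "2 * pi" "q + of_int m" 1] pi_gt_zero by auto
      ultimately show ?thesis unfolding q_def[symmetric] by auto
    qed
    then have "(- pi \<le> t + 2 * pi * of_int m \<and> t + 2 * pi * of_int m < pi) \<longleftrightarrow>
        \<lfloor>(t + pi) / (2 * pi)\<rfloor> = - m" for m :: int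
      by (simp only: floor_eq_iff)
    then have eq: "(- pi \<le> t + 2 * pi * of_int m \<and> t + 2 * pi * of_int m < pi) \<longleftrightarrow>
        \<lfloor>(t + pi) / (2 * pi)\<rfloor> = - m" for m :: int .
    show ?thesis
      unfolding eq by (rule ex1I[of _ "- \<lfloor>(t + pi) / (2 * pi)\<rfloor>"]) simp_all
  qed
  define m where "m i = (THE m::int. - pi \<le> x $ i + 2 * pi * of_int m \<and> x $ i + 2 * pi * of_int m < pi)" for i
  have m: "- pi \<le> x $ i + 2 * pi * of_int (m i) \<and> x $ i + 2 * pi * of_int (m i) < pi" for i
    unfolding m_def by (rule theI'[OF ex1])
  have m_unique: "m i = n" if "- pi \<le> x $ i + 2 * pi * of_int n \<and> x $ i + 2 * pi * of_int n < pi" for i n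
    unfolding m_def by (rule the1_equality[OF ex1 that])
  show ?thesis
  proof
    show "x + lattice_shift (\<chi> i. m i) \<in> half_open_box"
      using m by (simp add: half_open_box_def lattice_shift_nth)
  next
    fix k assume "x + lattice_shift k \<in> half_open_box"
    then have "m i = k $ i" for i
      by (intro m_unique) (simp add: half_open_box_def lattice_shift_nth)
    then show "k = (\<chi> i. m i)" by (simp add: vec_eq_iff)
  qed
qed

lemma ex_torus_box: obtains k where "x + lattice_shift k \<in> torus_box"
  using half_open_box_ex1[of x] half_open_box_subset by blast

lemma compact_torus_box [simp]: "compact torus_box"
  by (simp add: torus_box_def)

lemma periodic_bounded:
  fixes f :: "real^2 \<Rightarrow> real"
  assumes "continuous_on UNIV f" "periodic f"
  obtains B where "\<And>x. \<bar>f x\<bar> \<le> B" "B \<ge> 0"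
proof -
  have "compact (f ` torus_box)"
    using assms by (intro compact_continuous_image) (auto intro: continuous_on_subset)
  then have "bounded (f ` torus_box)" by (rule compact_imp_bounded)
  then obtain B where B: "\<forall>x\<in>torus_box. \<bar>f x\<bar> \<le> B"
    by (auto simp: bounded_iff)
  have "\<bar>f x\<bar> \<le> max B 0" for x
  proof -
    obtain k where "x + lattice_shift k \<in> torus_box" by (rule ex_torus_box)
    then have "\<bar>f (x + lattice_shift k)\<bar> \<le> B" using B by blast
    then show ?thesis by (simp add: periodicD[OF assms(2)])
  qed
  then show ?thesis using that[of "max B 0"] by simp
qed

lemma smooth_periodic_pd: "smooth f \<Longrightarrow> periodic f \<Longrightarrow> periodic (pd i f)"
proof -
  assume f: "smooth f" "periodic f"
  have "pd i f (x + lattice_shift k) = pd i f x" for x k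
  proof -
    have "(\<lambda>y. f (y + lattice_shift k)) = f" using f(2) by (simp add: periodic_def)
    then show ?thesis using fun_cong[OF pd_shift[OF f(1), of i "lattice_shift k"], of x] by simp
  qed
  then show ?thesis by (simp add: periodic_def)
qed

lemma test_functionsD: "\<phi> \<in> test_functions \<Longrightarrow> smooth \<phi>" "\<phi> \<in> test_functions \<Longrightarrow> periodic \<phi>"
  by (simp_all add: test_functions_def)

lemma test_functions_pd: "\<phi> \<in> test_functions \<Longrightarrow> pd i \<phi> \<in> test_functions"
  by (simp add: test_functions_def smooth_pd smooth_periodic_pd)

lemma test_functions_const [simp]: "(\<lambda>x. c) \<in> test_functions"
  by (simp add: test_functions_def periodic_def smooth_const)

lemma
  assumes "\<phi> \<in> test_functions" "\<psi> \<in> test_functions"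
  shows test_functions_add: "(\<lambda>x. \<phi> x + \<psi> x) \<in> test_functions"
    and test_functions_diff: "(\<lambda>x. \<phi> x - \<psi> x) \<in> test_functions"
    and test_functions_mult: "(\<lambda>x. \<phi> x * \<psi> x) \<in> test_functions"
  using assms by (simp_all add: test_functions_def smooth_add smooth_diff smooth_mult periodic_def)

lemma test_functions_cmult: "\<phi> \<in> test_functions \<Longrightarrow> (\<lambda>x. c * \<phi> x) \<in> test_functions"
  by (rule test_functions_mult[OF test_functions_const])

lemma test_functions_sum:
  "(\<And>k. k \<in> F \<Longrightarrow> f k \<in> test_functions) \<Longrightarrow> (\<lambda>x. \<Sum>k\<in>F. f k x) \<in> test_functions"
  by (induction F rule: infinite_finite_induct) (simp_all add: test_functions_add)

lemma test_functions_shift: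
  assumes "\<phi> \<in> test_functions" shows "(\<lambda>y. \<phi> (y + x)) \<in> test_functions"
proof -
  have "\<phi> (y + lattice_shift k + x) = \<phi> (y + x)" for y k
    using periodicD[OF test_functionsD(2)[OF assms], of "y + x" k] by (simp add: algebra_simps)
  then show ?thesis using assms by (simp add: test_functions_def smooth_shift periodic_def)
qed

lemma test_functions_reflect:
  assumes "\<phi> \<in> test_functions" shows "(\<lambda>y. \<phi> (x - y)) \<in> test_functions"
proof -
  have "\<phi> (x - (y + lattice_shift k)) = \<phi> (x - y)" for y k
    using periodicD[OF test_functionsD(2)[OF assms], of "x - y" "- k"] by (simp add: algebra_simps)
  then show ?thesis using assms by (simp add: test_functions_def smooth_reflect periodic_def)
qed

lemma test_functions_mpd: "\<phi> \<in> test_functions \<Longrightarrow> mpd a b \<phi> \<in> test_functions"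
  using mpd_induct[of \<phi> "\<lambda>\<phi>. \<phi> \<in> test_functions"] test_functions_pd test_functionsD by blast

lemma test_functions_bounded:
  assumes "\<phi> \<in> test_functions"
  obtains B where "\<And>x. \<bar>\<phi> x\<bar> \<le> B" "B \<ge> 0"
  by (rule periodic_bounded[OF smooth_continuous_on]) (use test_functionsD[OF assms] in auto)

lemma test_functions_continuous: "\<phi> \<in> test_functions \<Longrightarrow> continuous_on S \<phi>"
  using smooth_continuous_on test_functionsD by blast

lemma test_functions_borel: "\<phi> \<in> test_functions \<Longrightarrow> \<phi> \<in> borel_measurable borel"
  using smooth_borel test_functionsD by blast

subsection \<open>Periodization\<close>

text \<open>No regularity is asked for, so the class is stable under multiplication by arbitrary
  functions and contains the indicators of bounded sets.\<close>

definition bounded_support :: "(real^2 \<Rightarrow> real) \<Rightarrow> bool" where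
  "bounded_support g \<longleftrightarrow> (\<exists>R. \<forall>x. norm x \<ge> R \<longrightarrow> g x = 0)"

lemma bounded_supportE:
  assumes "bounded_support g"
  obtains R where "R > 0" "\<And>x. norm x \<ge> R \<Longrightarrow> g x = 0"
proof -
  obtain R where "\<And>x. norm x \<ge> R \<Longrightarrow> g x = 0" using assms by (auto simp: bounded_support_def)
  then show ?thesis using that[of "max R 1"] by auto
qed

definition index_box :: "nat \<Rightarrow> (int^2) set" where
  "index_box N = {k. \<forall>i. \<bar>k $ i\<bar> \<le> int N}"

lemma finite_index_box [simp]: "finite (index_box N)"
proof (rule finite_imageD)
  have "(\<lambda>k. (k $ 1, k $ 2)) ` index_box N \<subseteq> {- int N..int N} \<times> {- int N..int N}"
    unfolding index_box_def forall_2 by auto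
  then show "finite ((\<lambda>k. (k $ 1, k $ 2)) ` index_box N)"
    by (rule finite_subset) (intro finite_cartesian_product finite_atLeastAtMost_int)
  show "inj_on (\<lambda>k::int^2. (k $ 1, k $ 2)) (index_box N)"
    by (rule inj_onI) (simp add: vec_eq_iff forall_2)
qed

lemma outside_index_box:
  assumes "norm y \<le> D" "R + D \<le> real N" "k \<notin> index_box N"
  shows "norm (y + lattice_shift k) \<ge> R"
proof -
  obtain i where "\<not> \<bar>k $ i\<bar> \<le> int N" using assms(3) unfolding index_box_def by blast
  then have i: "\<bar>k $ i\<bar> \<ge> int N + 1" by linarith
  have "real N \<le> real_of_int \<bar>k $ i\<bar>" using i by linarith
  also have "\<dots> \<le> 2 * pi * real_of_int \<bar>k $ i\<bar>"
    using mult_right_mono[of 1 "2 * pi" "real_of_int \<bar>k $ i\<bar>"] pi_ge_two by simp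
  also have "\<dots> = \<bar>lattice_shift k $ i\<bar>" by (simp add: lattice_shift_nth abs_mult)
  also have "\<dots> \<le> norm (lattice_shift k)" by (rule component_le_norm_cart)
  also have "\<dots> \<le> norm (y + lattice_shift k) + norm y"
    using norm_triangle_ineq4[of "y + lattice_shift k" y] by simp
  finally show ?thesis using assms by linarith
qed

lemma periodize_eq_sum:
  assumes "finite F" "\<And>k. k \<notin> F \<Longrightarrow> g (y + lattice_shift k) = 0"
  shows "periodize g y = (\<Sum>k\<in>F. g (y + lattice_shift k))"
  unfolding periodize_def using assms
  by (subst infsum_cong_neutral[where T = F and g = "\<lambda>k. g (y + lattice_shift k)"]) auto

text \<open>One index set serves a whole ball of points, so near any point a periodization is a
  fixed finite sum of translates that can be differentiated and integrated termwise.\<close>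

lemma periodize_finite_sum:
  assumes "bounded_support g"
  obtains N where "\<And>y. norm y \<le> D \<Longrightarrow> periodize g y = (\<Sum>k\<in>index_box N. g (y + lattice_shift k))"
    "\<And>y k. norm y \<le> D \<Longrightarrow> k \<notin> index_box N \<Longrightarrow> g (y + lattice_shift k) = 0"
proof -
  obtain R where R: "\<And>x. norm x \<ge> R \<Longrightarrow> g x = 0" using bounded_supportE[OF assms] by blast
  obtain N where N: "R + D \<le> real N" using real_arch_simple by blast
  have z: "g (y + lattice_shift k) = 0" if "norm y \<le> D" "k \<notin> index_box N" for y k
    using outside_index_box[OF that(1) N that(2)] R by blast
  then show ?thesis using that[of N] periodize_eq_sum[of "index_box N" g] by auto
qed

lemma periodic_periodize: "periodic (periodize g)"
  unfolding periodic_def periodize_def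
proof (intro allI)
  fix x :: "real^2" and k :: "int^2"
  have "bij_betw (\<lambda>l. k + l) UNIV UNIV" by simp
  from infsum_reindex_bij_betw[OF this, of "\<lambda>l. g (x + lattice_shift l)"]
  show "(\<Sum>\<^sub>\<infinity>l. g (x + lattice_shift k + lattice_shift l)) = (\<Sum>\<^sub>\<infinity>l. g (x + lattice_shift l))"
    by (simp add: add.assoc)
qed

lemma has_derivative_local:
  assumes "smooth h" "\<And>y. y \<in> ball x 1 \<Longrightarrow> f y = h y"
  shows "f differentiable (at x)" "pd i f x = pd i h x"
proof -
  note D = smooth_has_derivative[OF assms(1), of x]
  have "(f has_derivative (\<lambda>k. k $ 1 * pd 1 h x + k $ 2 * pd 2 h x)) (at x)"
    by (rule has_derivative_transform_within_open[OF D, of "ball x 1"]) (use assms(2) in auto)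
  then show "f differentiable (at x)" "pd i f x = pd i h x"
    using pd_eqI[OF D, of i] by (auto simp: differentiable_def pd_eqI)
qed

lemma bounded_support_pd:
  assumes "smooth g" "bounded_support g"
  shows "bounded_support (pd i g)"
proof -
  obtain R where R: "\<And>x. norm x \<ge> R \<Longrightarrow> g x = 0" using bounded_supportE[OF assms(2)] by blast
  have "pd i g x = 0" if "norm x \<ge> R + 1" for x
  proof -
    have "g y = 0" if "y \<in> ball x 1" for y
      using R \<open>norm x \<ge> R + 1\<close> that norm_triangle_ineq2[of x y] by (force simp: dist_norm)
    then show ?thesis using has_derivative_local(2)[of "\<lambda>_. 0" x g i] by (simp add: smooth_const)
  qed
  then show ?thesis by (auto simp: bounded_support_def)
qed

lemma
  assumes "smooth g" "bounded_support g"
  shows periodize_differentiable: "periodize g differentiable (at x)"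
    and pd_periodize: "pd i (periodize g) = periodize (pd i g)"
proof -
  have *: "periodize g differentiable (at x) \<and> pd i (periodize g) x = periodize (pd i g) x" for x
  proof -
    obtain N where N: "\<And>y. norm y \<le> norm x + 1 \<Longrightarrow> periodize g y = (\<Sum>k\<in>index_box N. g (y + lattice_shift k))"
      "\<And>y k. norm y \<le> norm x + 1 \<Longrightarrow> k \<notin> index_box N \<Longrightarrow> g (y + lattice_shift k) = 0"
      using periodize_finite_sum[OF assms(2)] by metis
    have le: "norm y \<le> norm x + 1" if "y \<in> ball x 1" for y
      using that norm_triangle_ineq2[of y x] by (force simp: dist_norm norm_minus_commute)
    let ?h = "\<lambda>y. \<Sum>k\<in>index_box N. g (y + lattice_shift k)"
    have h: "smooth ?h" by (intro smooth_sum smooth_shift assms)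
    note loc = has_derivative_local[OF h, of x "periodize g"]
    \<comment> \<open>Outside the index set the translate vanishes on a whole ball about
      \<open>x\<close>, hence so does its derivative at \<open>x\<close>.\<close>
    have "pd i g (x + lattice_shift k) = 0" if "k \<notin> index_box N" for k
    proof -
      have "pd i (\<lambda>y. g (y + lattice_shift k)) x = pd i (\<lambda>_. 0) x"
        using N(2)[OF le that] by (intro has_derivative_local(2) smooth_const) auto
      then show ?thesis by (simp add: pd_shift assms)
    qed
    then have "periodize (pd i g) x = (\<Sum>k\<in>index_box N. pd i g (x + lattice_shift k))"
      by (intro periodize_eq_sum) auto
    also have "\<dots> = pd i ?h x" by (simp add: pd_sum smooth_shift pd_shift assms)
    finally show ?thesis using loc N(1) le by auto
  qed
  then show "periodize g differentiable (at x)" "pd i (periodize g) = periodize (pd i g)" by auto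
qed

lemma smooth_periodize:
  assumes "smooth g" "bounded_support g"
  shows "smooth (periodize g)"
proof (rule smooth_coinduct[where P = "\<lambda>f. \<exists>g. smooth g \<and> bounded_support g \<and> f = periodize g"])
  show "\<exists>h. smooth h \<and> bounded_support h \<and> periodize g = periodize h" using assms by blast
next
  fix f x assume "\<exists>g. smooth g \<and> bounded_support g \<and> f = periodize g"
  then show "f differentiable (at x)" using periodize_differentiable by blast
next
  fix f i assume "\<exists>g. smooth g \<and> bounded_support g \<and> f = periodize g"
  then show "\<exists>g. smooth g \<and> bounded_support g \<and> pd i f = periodize g"
    using pd_periodize smooth_pd bounded_support_pd by metis
qed

lemma periodize_test_function: "smooth g \<Longrightarrow> bounded_support g \<Longrightarrow> periodize g \<in> test_functions"
  by (simp add: test_functions_def smooth_periodize periodic_periodize)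

text \<open>A periodic factor takes the same value on all translates. Together with
  \<open>integral_periodize\<close> this turns torus integrals against periodized functions into
  integrals over the plane.\<close>

lemma periodize_mult:
  assumes "periodic f" "bounded_support g"
  shows "f x * periodize g x = periodize (\<lambda>y. f y * g y) x"
proof -
  obtain N where N: "\<And>y. norm y \<le> norm x \<Longrightarrow> periodize g y = (\<Sum>k\<in>index_box N. g (y + lattice_shift k))"
    "\<And>y k. norm y \<le> norm x \<Longrightarrow> k \<notin> index_box N \<Longrightarrow> g (y + lattice_shift k) = 0"
    using periodize_finite_sum[OF assms(2)] by metis
  have "periodize (\<lambda>y. f y * g y) x = (\<Sum>k\<in>index_box N. f (x + lattice_shift k) * g (x + lattice_shift k))"
    by (rule periodize_eq_sum) (auto simp: N)
  then show ?thesis by (simp add: N periodicD[OF assms(1)] sum_distrib_left)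
qed

lemma periodize_nonneg: "(\<And>x. 0 \<le> g x) \<Longrightarrow> 0 \<le> periodize g x"
  unfolding periodize_def by (intro infsum_nonneg) auto

lemma bounded_support_mult: "bounded_support g \<Longrightarrow> bounded_support (\<lambda>x. f x * g x)"
  by (auto simp: bounded_support_def)

lemma bounded_support_scale:
  assumes "bounded_support g" "c \<noteq> 0"
  shows "bounded_support (\<lambda>y. g (a + c *\<^sub>R y))"
proof -
  obtain R where R: "\<And>x. norm x \<ge> R \<Longrightarrow> g x = 0" using bounded_supportE[OF assms(1)] by blast
  have "g (a + c *\<^sub>R y) = 0" if "norm y \<ge> (R + norm a) / \<bar>c\<bar>" for y
  proof (rule R)
    have "R + norm a \<le> norm (c *\<^sub>R y)" using that assms(2) by (simp add: pos_divide_le_eq mult.commute)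
    also have "\<dots> \<le> norm (a + c *\<^sub>R y) + norm a"
      using norm_triangle_ineq4[of "a + c *\<^sub>R y" a] by simp
    finally show "R \<le> norm (a + c *\<^sub>R y)" by simp
  qed
  then show ?thesis by (auto simp: bounded_support_def)
qed

subsection \<open>Integration over the torus\<close>

text \<open>As a finite measure in its own right it makes Fubini and ordinary integral estimates
  available for the set integrals of the definitions.\<close>

definition tor :: "(real^2) measure" where
  "tor = restrict_space lborel torus_box"

lemma torus_box_sets [measurable]: "torus_box \<in> sets borel"
  by (simp add: torus_box_def)

lemma space_tor [simp]: "space tor = torus_box"
  by (simp add: tor_def space_restrict_space)

lemma emeasure_tor: "emeasure tor torus_box = ennreal (4 * pi\<^sup>2)"
proof -
  have "emeasure tor torus_box = emeasure lborel torus_box"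
    unfolding tor_def by (subst emeasure_restrict_space) (auto simp: torus_box_sets)
  also have "\<dots> = ennreal (measure lborel torus_box)"
    unfolding torus_box_def
    by (rule emeasure_eq_ennreal_measure) (metis emeasure_lborel_cbox_finite infinity_ennreal_def less_irrefl)
  also have "measure lborel torus_box = 4 * pi\<^sup>2"
    unfolding torus_box_def
    by (subst content_cbox_cart) (simp_all add: interval_ne_empty_cart UNIV_2 power2_eq_square)
  finally show ?thesis .
qed

interpretation tor: finite_measure tor
  by (rule finite_measureI) (simp add: emeasure_tor)

lemma measure_tor: "measure tor torus_box = 4 * pi\<^sup>2"
  by (simp add: measure_def emeasure_tor)

lemma set_integral_tor:
  fixes f :: "_ \<Rightarrow> _ :: {banach, second_countable_topology}"
  shows "(LINT x:torus_box|lborel. f x) = integral\<^sup>L tor f"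
  unfolding tor_def set_lebesgue_integral_def by (subst integral_restrict_space) (auto simp: torus_box_sets)

lemma set_integrable_tor:
  fixes f :: "_ \<Rightarrow> _ :: {banach, second_countable_topology}"
  shows "set_integrable lborel torus_box f \<longleftrightarrow> integrable tor f"
  unfolding tor_def set_integrable_def by (subst integrable_restrict_space) (auto simp: torus_box_sets)

lemma measurable_tor: "f \<in> borel_measurable borel \<Longrightarrow> f \<in> borel_measurable tor"
  by (simp add: tor_def measurable_restrict_space1)

lemma tor_integrable_continuous:
  fixes f :: "_ \<Rightarrow> _ :: {banach, second_countable_topology}"
  assumes "continuous_on UNIV f"
  shows "integrable tor f"
proof -
  have "compact (f ` torus_box)"
    using assms by (intro compact_continuous_image) (auto intro: continuous_on_subset)
  then have "bounded (f ` torus_box)" by (rule compact_imp_bounded)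
  then obtain B where B: "\<forall>x\<in>torus_box. norm (f x) \<le> B"
    by (auto simp: bounded_iff)
  show ?thesis
    by (rule tor.integrable_const_bound[of _ B])
      (auto simp: B measurable_tor borel_measurable_continuous_onI[OF assms])
qed

lemma tor_integrable_mult_bounded:
  assumes "integrable tor f" "g \<in> borel_measurable borel" "\<And>x. \<bar>g x\<bar> \<le> B"
  shows "integrable tor (\<lambda>x. f x * g x :: real)"
proof (rule Bochner_Integration.integrable_bound)
  show "integrable tor (\<lambda>x. B * f x)" using assms(1) by simp
  show "(\<lambda>x. f x * g x) \<in> borel_measurable tor"
    using assms(1) measurable_tor[OF assms(2)] by (intro borel_measurable_times) auto
  have "\<bar>f x * g x\<bar> \<le> \<bar>B * f x\<bar>" for x
    using mult_right_mono[OF assms(3)[of x], of "\<bar>f x\<bar>"] assms(3)[of x]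
    by (simp add: abs_mult mult.commute)
  then show "AE x in tor. norm (f x * g x) \<le> norm (B * f x)" by simp
qed

lemma AE_half_open_box: "AE x in lborel. indicator half_open_box x = (indicator torus_box x :: real)"
proof (rule AE_I')
  have "{x::real^2. x $ i = pi} \<in> null_sets lborel" for i :: 2
  proof -
    have "negligible {x::real^2. x \<bullet> axis i 1 = pi}"
      by (rule negligible_standard_hyperplane) (simp add: axis_in_Basis_iff)
    then have "{x::real^2. x $ i = pi} \<in> null_sets lebesgue"
      by (simp add: inner_axis negligible_iff_null_sets)
    moreover have "closed {x::real^2. x $ i = pi}"
      by (intro closed_Collect_eq continuous_intros)
    ultimately show ?thesis
      using null_sets_completion_iff[of "{x::real^2. x $ i = pi}" lborel] borel_closed by simp
  qed
  then show "{x::real^2. x $ 1 = pi} \<union> {x. x $ 2 = pi} \<in> null_sets lborel" by blast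
  show "{x \<in> space lborel. indicator half_open_box x \<noteq> (indicator torus_box x :: real)}
      \<subseteq> {x. x $ 1 = pi} \<union> {x. x $ 2 = pi}"
    by (auto simp: half_open_box_def mem_torus_box indicator_def forall_2 split: if_splits)
qed

lemma half_open_box_borel [measurable]: "half_open_box \<in> sets borel"
  unfolding half_open_box_def by measurable

lemma integral_tor_half_open:
  fixes f :: "real^2 \<Rightarrow> real"
  assumes "f \<in> borel_measurable borel"
  shows "integral\<^sup>L tor f = (LINT x|lborel. indicator half_open_box x * f x)"
proof -
  have "integral\<^sup>L tor f = (LINT x|lborel. indicator torus_box x * f x)"
    unfolding set_integral_tor[symmetric] set_lebesgue_integral_def by simp
  also have "\<dots> = (LINT x|lborel. indicator half_open_box x * f x)"
    using AE_half_open_box assms by (intro integral_cong_AE) auto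
  finally show ?thesis .
qed

lemma lborel_integral_affine:
  fixes f :: "real^2 \<Rightarrow> real"
  assumes "f \<in> borel_measurable borel" "c \<noteq> 0"
  shows "integral\<^sup>L lborel f = c\<^sup>2 * (LINT x|lborel. f (t + c *\<^sub>R x))"
proof -
  have "integral\<^sup>L lborel f = integral\<^sup>L (density (distr lborel borel (\<lambda>x. t + c *\<^sub>R x)) (\<lambda>_. \<bar>c\<bar>^2)) f"
    using lborel_affine[OF assms(2), of t] by simp
  also have "\<dots> = (\<integral>x. c\<^sup>2 * f x \<partial>(distr lborel borel (\<lambda>x. t + c *\<^sub>R x)))"
    using assms by (subst integral_density) auto
  also have "\<dots> = (LINT x|lborel. c\<^sup>2 * f (t + c *\<^sub>R x))"
    using assms by (subst integral_distr) auto
  finally show ?thesis by simp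
qed

lemma lborel_integrable_bounded_support:
  fixes g :: "real^2 \<Rightarrow> real"
  assumes "g \<in> borel_measurable borel" "bounded_support g" "\<And>x. \<bar>g x\<bar> \<le> B"
  shows "integrable lborel g"
proof -
  obtain R where R: "\<And>x. norm x \<ge> R \<Longrightarrow> g x = 0" using bounded_supportE[OF assms(2)] by blast
  show ?thesis
  proof (rule integrableI_bounded_set[of "cball 0 R" _ _ B])
    show "g \<in> borel_measurable lborel" using assms(1) by simp
    show "AE x in lborel. x \<in> cball 0 R \<longrightarrow> norm (g x) \<le> B" by (simp add: assms(3))
    show "AE x in lborel. x \<notin> cball 0 R \<longrightarrow> g x = 0" by (simp add: R)
  qed (use emeasure_bounded_finite[OF bounded_cball, of "0::real^2" R] in simp_all)
qed

lemma torus_box_norm_le: "norm y \<le> 2 * pi" if "y \<in> torus_box" for y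
proof -
  have "- pi \<le> y $ i \<and> y $ i \<le> pi" for i using that by (simp add: mem_torus_box)
  from this[of 1] this[of 2] have "\<bar>y $ 1\<bar> \<le> pi" "\<bar>y $ 2\<bar> \<le> pi" by linarith+
  then show ?thesis using norm_le_l1_cart[of y] by (simp add: sum_2)
qed

text \<open>Unfolding: the translates of the half-open box tile the plane, so the integral over the
  plane is a sum of integrals of translates of \<open>g\<close> over one box.\<close>

theorem integral_periodize:
  fixes g :: "real^2 \<Rightarrow> real"
  assumes g [measurable]: "g \<in> borel_measurable borel" and "bounded_support g" "\<And>x. \<bar>g x\<bar> \<le> B"
  shows "integral\<^sup>L tor (periodize g) = integral\<^sup>L lborel g"
proof -
  obtain N where N: "\<And>y. norm y \<le> 2 * pi \<Longrightarrow> periodize g y = (\<Sum>k\<in>index_box N. g (y + lattice_shift k))"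
    "\<And>y k. norm y \<le> 2 * pi \<Longrightarrow> k \<notin> index_box N \<Longrightarrow> g (y + lattice_shift k) = 0"
    using periodize_finite_sum[OF assms(2)] by metis
  let ?H = "indicator half_open_box :: real^2 \<Rightarrow> real"
  have int: "integrable lborel (\<lambda>y. ?H y * g (y + a))" for a
  proof (rule lborel_integrable_bounded_support)
    show "bounded_support (\<lambda>y. ?H y * g (y + a))"
      using bounded_support_mult[OF bounded_support_scale[OF assms(2), of 1 a], of ?H] by (simp add: add.commute)
    show "\<bar>?H y * g (y + a)\<bar> \<le> B" for y
      using assms(3)[of "y + a"] by (auto simp: indicator_def)
  qed auto
  have int': "integrable lborel (\<lambda>x. ?H (x - a) * g x)" for a
  proof (rule lborel_integrable_bounded_support)
    show "bounded_support (\<lambda>x. ?H (x - a) * g x)" by (rule bounded_support_mult[OF assms(2)])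
    show "\<bar>?H (x - a) * g x\<bar> \<le> B" for x
      using assms(3)[of x] by (auto simp: indicator_def)
  qed auto
  \<comment> \<open>Exactly one translate of the box contains \<open>x\<close>. If
    \<open>g x\<close> is not zero, its index lies in \<open>index_box N\<close>, because outside of
    it the translates of \<open>g\<close> vanish on the box.\<close>
  have one: "(\<Sum>k\<in>index_box N. ?H (x - lattice_shift k) * g x) = g x" for x
  proof (cases "g x = 0")
    case False
    obtain k where k: "x + lattice_shift k \<in> half_open_box"
      "\<And>l. x + lattice_shift l \<in> half_open_box \<Longrightarrow> l = k" using half_open_box_ex1[of x] by blast
    have mem: "- k \<in> index_box N"
    proof (rule ccontr)
      assume "- k \<notin> index_box N"
      moreover have "norm (x + lattice_shift k) \<le> 2 * pi" using k(1) half_open_box_subset torus_box_norm_le by blast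
      ultimately have "g (x + lattice_shift k + lattice_shift (- k)) = 0" using N(2) by blast
      then show False using False by simp
    qed
    have "?H (x - lattice_shift l) = (if l = - k then 1 else 0)" for l
      using k(1) k(2)[of "- l"] by (auto simp: indicator_def)
    then have "(\<Sum>l\<in>index_box N. ?H (x - lattice_shift l) * g x) = (\<Sum>l\<in>index_box N. if l = - k then g x else 0)"
      by (intro sum.cong) auto
    then show ?thesis using mem by simp
  qed simp
  have "integral\<^sup>L lborel g = (LINT x|lborel. (\<Sum>k\<in>index_box N. ?H (x - lattice_shift k) * g x))"
    by (simp add: one)
  also have "\<dots> = (\<Sum>k\<in>index_box N. LINT x|lborel. ?H (x - lattice_shift k) * g x)"
    by (rule Bochner_Integration.integral_sum) (rule int')
  also have "\<dots> = (\<Sum>k\<in>index_box N. LINT y|lborel. ?H y * g (y + lattice_shift k))"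
  proof (rule sum.cong[OF refl])
    fix k
    show "(LINT x|lborel. ?H (x - lattice_shift k) * g x) = (LINT y|lborel. ?H y * g (y + lattice_shift k))"
      using lborel_integral_affine[of "\<lambda>x. ?H (x - lattice_shift k) * g x" 1 "lattice_shift k"]
      by (simp add: add.commute)
  qed
  also have "\<dots> = (LINT y|lborel. (\<Sum>k\<in>index_box N. ?H y * g (y + lattice_shift k)))"
    by (rule Bochner_Integration.integral_sum[symmetric]) (rule int)
  also have "\<dots> = (LINT y|lborel. ?H y * (\<Sum>k\<in>index_box N. g (y + lattice_shift k)))"
    by (simp add: sum_distrib_left)
  also have "\<dots> = (\<integral>y. (\<Sum>k\<in>index_box N. g (y + lattice_shift k)) \<partial>tor)"
    by (rule integral_tor_half_open[symmetric]) measurable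
  also have "\<dots> = integral\<^sup>L tor (periodize g)"
    by (rule Bochner_Integration.integral_cong) (auto simp: N torus_box_norm_le)
  finally show ?thesis by simp
qed

text \<open>\<open>f\<close> is the periodization of its own restriction to a shifted fundamental
  domain; unfolding and a translation in the plane do the rest.\<close>

lemma integral_tor_shift:
  fixes f :: "real^2 \<Rightarrow> real"
  assumes f [measurable]: "f \<in> borel_measurable borel" and "periodic f" "\<And>x. \<bar>f x\<bar> \<le> B"
  shows "(\<integral>y. f (y + a) \<partial>tor) = integral\<^sup>L tor f"
proof -
  let ?H = "indicator half_open_box :: real^2 \<Rightarrow> real"
  let ?g = "\<lambda>x. f x * ?H (x - a)"
  have bH: "bounded_support ?H"
    unfolding bounded_support_def
  proof (intro exI allI impI)
    fix x :: "real^2" assume x: "norm x \<ge> 2 * pi + 1"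
    have "x \<notin> half_open_box" using x torus_box_norm_le[of x] half_open_box_subset by fastforce
    then show "?H x = 0" by simp
  qed
  have bs: "bounded_support (\<lambda>x. ?H (x - a))"
    using bounded_support_scale[OF bH, of 1 "- a"] by simp
  have "periodize ?g x = f x" for x
  proof -
    have "periodize ?g x = f x * periodize (\<lambda>x. ?H (x - a)) x"
      using periodize_mult[OF assms(2) bs] by simp
    also have "periodize (\<lambda>x. ?H (x - a)) x = 1"
    proof -
      have e: "x - a + lattice_shift l = x + lattice_shift l - a" for l by simp
      obtain k where k: "x + lattice_shift k - a \<in> half_open_box"
        "\<And>l. x + lattice_shift l - a \<in> half_open_box \<Longrightarrow> l = k"
        using half_open_box_ex1[of "x - a"] unfolding e by blast
      have "periodize (\<lambda>x. ?H (x - a)) x = (\<Sum>l\<in>{k}. ?H (x + lattice_shift l - a))"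
      proof (rule periodize_eq_sum)
        fix l assume "l \<notin> {k}"
        then have "x + lattice_shift l - a \<notin> half_open_box" using k(2) by blast
        then show "?H (x + lattice_shift l - a) = 0" by simp
      qed simp
      then show ?thesis using k(1) by simp
    qed
    finally show ?thesis by simp
  qed
  then have "periodize ?g = f" by blast
  then have "integral\<^sup>L tor f = integral\<^sup>L tor (periodize ?g)" by simp
  also have "\<dots> = integral\<^sup>L lborel ?g"
  proof (rule integral_periodize)
    show "\<bar>?g x\<bar> \<le> B" for x
      using assms(3)[of x] by (cases "x - a \<in> half_open_box") auto
  qed (use bounded_support_mult[OF bs, of f] in auto)
  also have "\<dots> = (LINT x|lborel. ?H x * f (x + a))"
    by (subst lborel_integral_affine[of ?g 1 a]) (simp_all add: add.commute[of a] mult.commute)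
  also have "\<dots> = (\<integral>y. f (y + a) \<partial>tor)"
    by (rule integral_tor_half_open[symmetric]) measurable
  finally show ?thesis by simp
qed

lemma integral_tor_reflect:
  fixes f :: "real^2 \<Rightarrow> real"
  assumes f [measurable]: "f \<in> borel_measurable borel" and "periodic f" "\<And>x. \<bar>f x\<bar> \<le> B"
  shows "(\<integral>y. f (a - y) \<partial>tor) = integral\<^sup>L tor f"
proof -
  have *: "integral\<^sup>L tor h = (LINT x|lborel. indicator torus_box x * h x)" for h :: "real^2 \<Rightarrow> real"
    unfolding set_integral_tor[symmetric] set_lebesgue_integral_def by simp
  have "(\<integral>y. f (a - y) \<partial>tor) = (LINT x|lborel. indicator torus_box (- x) * f (a + x))"
    unfolding * using lborel_integral_affine[of "\<lambda>x. indicator torus_box x * f (a - x)" "-1" 0] by simp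
  also have "\<dots> = (LINT x|lborel. indicator torus_box x * f (x + a))"
  proof -
    have "(- x \<in> torus_box) = (x \<in> torus_box)" for x
      unfolding mem_torus_box forall_2 by auto
    then show ?thesis by (simp add: indicator_def add.commute)
  qed
  also have "\<dots> = (\<integral>y. f (y + a) \<partial>tor)" by (simp add: *)
  finally show ?thesis using integral_tor_shift[OF assms] by simp
qed

section \<open>Distributions and convolution\<close>

lemma mpd_add:
  assumes "smooth f" "smooth g"
  shows "mpd a b (\<lambda>x. f x + g x) = (\<lambda>x. mpd a b f x + mpd a b g x)"
proof (induction a)
  case 0
  show ?case
    by (induction b) (simp_all add: mpd_Suc_right smooth_add pd_add smooth_mpd assms)
next
  case (Suc a)
  then show ?case by (simp add: mpd_Suc_left pd_add smooth_mpd assms)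
qed

lemma mpd_cmult:
  assumes "smooth f"
  shows "mpd a b (\<lambda>x. c * f x) = (\<lambda>x. c * mpd a b f x)"
proof -
  have "mpd a b (\<lambda>x. c * f x) = (\<lambda>x. c * mpd a b f x) \<and> smooth (mpd a b f)"
    by (rule mpd_induct2[where P = "\<lambda>f g. g = (\<lambda>x. c * f x) \<and> smooth f"])
      (simp_all add: assms smooth_cmult pd_cmult smooth_pd)
  then show ?thesis by blast
qed

lemma mpd_diff:
  assumes "smooth f" "smooth g"
  shows "mpd a b (\<lambda>x. f x - g x) = (\<lambda>x. mpd a b f x - mpd a b g x)"
  using mpd_add[OF assms(1) smooth_cmult[OF assms(2), of "-1"], of a b]
  unfolding mpd_cmult[OF assms(2)] by simp

lemma mpd_sum:
  assumes "\<And>k. k \<in> F \<Longrightarrow> smooth (f k)"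
  shows "mpd a b (\<lambda>x. \<Sum>k\<in>F. f k x) = (\<lambda>x. \<Sum>k\<in>F. mpd a b (f k) x)"
  using assms
proof (induction F rule: infinite_finite_induct)
  case (infinite A)
  then show ?case using mpd_cmult[OF smooth_const, of a b 0] by simp
next
  case empty
  show ?case using mpd_cmult[OF smooth_const, of a b 0] by simp
next
  case (insert k F)
  then show ?case by (simp add: mpd_add smooth_sum)
qed

lemma mpd_shift:
  assumes "smooth f"
  shows "mpd a b (\<lambda>y. f (y + x)) = (\<lambda>y. mpd a b f (y + x))"
proof -
  have "mpd a b (\<lambda>y. f (y + x)) = (\<lambda>y. mpd a b f (y + x)) \<and> smooth (mpd a b f)"
    by (rule mpd_induct2[where P = "\<lambda>f g. g = (\<lambda>y. f (y + x)) \<and> smooth f"])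
      (simp_all add: assms smooth_shift pd_shift smooth_pd)
  then show ?thesis by blast
qed

lemma mpd_reflect:
  assumes "smooth f"
  shows "\<bar>mpd a b (\<lambda>y. f (x - y)) y\<bar> = \<bar>mpd a b f (x - y)\<bar>"
proof -
  let ?P = "\<lambda>f g. smooth f \<and> (\<exists>s. \<bar>s\<bar> = 1 \<and> g = (\<lambda>y. s * f (x - y)))"
  have "?P (mpd a b f) (mpd a b (\<lambda>y. f (x - y)))"
  proof (rule mpd_induct2)
    show "?P f (\<lambda>y. f (x - y))" using assms by (auto intro!: exI[of _ 1])
  next
    fix \<psi> \<psi>' i assume "?P \<psi> \<psi>'"
    then obtain s where s: "smooth \<psi>" "\<bar>s\<bar> = 1" "\<psi>' = (\<lambda>y. s * \<psi> (x - y))" by blast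
    then have "pd i \<psi>' = (\<lambda>y. (- s) * pd i \<psi> (x - y))"
      by (simp add: pd_cmult smooth_reflect pd_reflect)
    then show "?P (pd i \<psi>) (pd i \<psi>')" using s smooth_pd by (intro conjI exI[of _ "- s"]) auto
  qed (simp_all add: assms smooth_reflect)
  then show ?thesis by (auto simp: abs_mult)
qed

section \<open>Lipschitz and Taylor bounds for test functions\<close>

lemma line_mean_value:
  assumes "smooth \<phi>"
  obtains s where "0 < s" "s < 1"
    "\<phi> (x + h) - \<phi> x = h $ 1 * pd 1 \<phi> (x + s *\<^sub>R h) + h $ 2 * pd 2 \<phi> (x + s *\<^sub>R h)"
proof -
  let ?D = "\<lambda>s. h $ 1 * pd 1 \<phi> (x + s *\<^sub>R h) + h $ 2 * pd 2 \<phi> (x + s *\<^sub>R h)"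
  have "((\<lambda>s. \<phi> (x + s *\<^sub>R h)) has_real_derivative ?D s) (at s)" for s
  proof -
    have g: "((\<lambda>s. x + s *\<^sub>R h) has_derivative (\<lambda>k. k *\<^sub>R h)) (at s)"
      by (auto intro!: derivative_eq_intros)
    have "(\<lambda>k. (k *\<^sub>R h) $ 1 * pd 1 \<phi> (x + s *\<^sub>R h) + (k *\<^sub>R h) $ 2 * pd 2 \<phi> (x + s *\<^sub>R h)) = (*) (?D s)"
      by (simp add: fun_eq_iff algebra_simps)
    then show ?thesis
      using has_derivative_compose[OF g smooth_has_derivative[OF assms]]
      by (simp add: has_field_derivative_def)
  qed
  from MVT2[OF zero_less_one this] show ?thesis using that by auto
qed

lemma smooth_lipschitz:
  assumes "smooth \<phi>" "\<And>x. \<bar>pd 1 \<phi> x\<bar> \<le> B" "\<And>x. \<bar>pd 2 \<phi> x\<bar> \<le> B"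
  shows "\<bar>\<phi> (x + h) - \<phi> x\<bar> \<le> 2 * B * norm h"
proof -
  obtain s where s: "\<phi> (x + h) - \<phi> x = h $ 1 * pd 1 \<phi> (x + s *\<^sub>R h) + h $ 2 * pd 2 \<phi> (x + s *\<^sub>R h)"
    using line_mean_value[OF assms(1)] by blast
  have "\<bar>h $ i * pd i \<phi> (x + s *\<^sub>R h)\<bar> \<le> norm h * B" if "\<And>x. \<bar>pd i \<phi> x\<bar> \<le> B" for i
    unfolding abs_mult by (intro mult_mono component_le_norm_cart that) auto
  from this[of 1, OF assms(2)] this[of 2, OF assms(3)] show ?thesis
    unfolding s by (simp add: algebra_simps)
qed

lemma test_function_lipschitz:
  assumes "\<phi> \<in> test_functions"
  obtains B where "\<And>x h. \<bar>\<phi> (x + h) - \<phi> x\<bar> \<le> B * norm h" "B \<ge> 0"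
proof -
  obtain B1 where B1: "\<And>x. \<bar>pd 1 \<phi> x\<bar> \<le> B1" "B1 \<ge> 0"
    using test_functions_bounded[OF test_functions_pd[OF assms]] by blast
  obtain B2 where B2: "\<And>x. \<bar>pd 2 \<phi> x\<bar> \<le> B2" "B2 \<ge> 0"
    using test_functions_bounded[OF test_functions_pd[OF assms]] by blast
  have "\<bar>\<phi> (x + h) - \<phi> x\<bar> \<le> 2 * max B1 B2 * norm h" for x h
    by (rule smooth_lipschitz) (use B1 B2 assms test_functionsD in \<open>auto intro: max.coboundedI1 max.coboundedI2\<close>)
  then show ?thesis using that[of "2 * max B1 B2"] B1 B2 by auto
qed

lemma test_function_taylor:
  assumes "\<phi> \<in> test_functions"
  obtains B where "\<And>x h. \<bar>\<phi> (x + h) - \<phi> x - h $ 1 * pd 1 \<phi> x - h $ 2 * pd 2 \<phi> x\<bar> \<le> B * (norm h)\<^sup>2" "B \<ge> 0"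
proof -
  obtain B1 where B1: "\<And>x h. \<bar>pd 1 \<phi> (x + h) - pd 1 \<phi> x\<bar> \<le> B1 * norm h" "B1 \<ge> 0"
    using test_function_lipschitz[OF test_functions_pd[OF assms]] by blast
  obtain B2 where B2: "\<And>x h. \<bar>pd 2 \<phi> (x + h) - pd 2 \<phi> x\<bar> \<le> B2 * norm h" "B2 \<ge> 0"
    using test_function_lipschitz[OF test_functions_pd[OF assms]] by blast
  have "\<bar>\<phi> (x + h) - \<phi> x - h $ 1 * pd 1 \<phi> x - h $ 2 * pd 2 \<phi> x\<bar> \<le> (B1 + B2) * (norm h)\<^sup>2" for x h
  proof -
    obtain s where s: "0 < s" "s < 1" "\<phi> (x + h) - \<phi> x = h $ 1 * pd 1 \<phi> (x + s *\<^sub>R h) + h $ 2 * pd 2 \<phi> (x + s *\<^sub>R h)"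
      using line_mean_value[OF test_functionsD(1)[OF assms]] by blast
    have step: "\<bar>h $ i * (pd i \<phi> (x + s *\<^sub>R h) - pd i \<phi> x)\<bar> \<le> norm h * (C * norm h)"
      if "\<And>x h. \<bar>pd i \<phi> (x + h) - pd i \<phi> x\<bar> \<le> C * norm h" "C \<ge> 0" for i C
    proof -
      have "\<bar>pd i \<phi> (x + s *\<^sub>R h) - pd i \<phi> x\<bar> \<le> C * norm (s *\<^sub>R h)" by (rule that(1))
      also have "\<dots> \<le> C * norm h"
        using s that(2) by (intro mult_left_mono) (auto intro: mult_left_le_one_le)
      finally show ?thesis
        unfolding abs_mult by (intro mult_mono component_le_norm_cart) auto
    qed
    have "\<phi> (x + h) - \<phi> x - h $ 1 * pd 1 \<phi> x - h $ 2 * pd 2 \<phi> x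
      = h $ 1 * (pd 1 \<phi> (x + s *\<^sub>R h) - pd 1 \<phi> x) + h $ 2 * (pd 2 \<phi> (x + s *\<^sub>R h) - pd 2 \<phi> x)"
      using s(3) by (simp add: algebra_simps)
    then show ?thesis
      using step[of 1, OF B1] step[of 2, OF B2] by (simp add: power2_eq_square algebra_simps)
  qed
  then show ?thesis using that[of "B1 + B2"] B1 B2 by auto
qed

lemma has_derivative_quadratic:
  fixes f :: "real^2 \<Rightarrow> real"
  assumes "bounded_linear D" "\<And>h. \<bar>f (x + h) - f x - D h\<bar> \<le> C * (norm h)\<^sup>2"
  shows "(f has_derivative D) (at x)"
  unfolding has_derivative_at
proof
  show "(\<lambda>h. norm (f (x + h) - f x - D h) / norm h) \<midarrow>0\<rightarrow> 0"
  proof (rule Lim_null_comparison)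
    have "norm (norm (f (x + h) - f x - D h) / norm h) \<le> \<bar>C\<bar> * norm h" for h
    proof (cases "h = 0")
      case False
      have "\<bar>f (x + h) - f x - D h\<bar> \<le> \<bar>C\<bar> * (norm h)\<^sup>2"
        by (rule order_trans[OF assms(2)]) (intro mult_right_mono, auto)
      then show ?thesis using False by (simp add: pos_divide_le_eq power2_eq_square mult.assoc)
    qed simp
    then show "\<forall>\<^sub>F h in at 0. norm (norm (f (x + h) - f x - D h) / norm h) \<le> \<bar>C\<bar> * norm h" by simp
    have "((\<lambda>h::real^2. \<bar>C\<bar> * norm h) \<longlongrightarrow> \<bar>C\<bar> * norm (0::real^2)) (at 0)" by (intro tendsto_intros)
    then show "((\<lambda>h::real^2. \<bar>C\<bar> * norm h) \<longlongrightarrow> 0) (at 0)" by simp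
  qed
qed (fact assms(1))

text \<open>Distributions of finite order, with the seminorm replaced by a common bound
  \<open>B\<close> on finitely many derivatives. Estimates can then be inserted without handling
  suprema.\<close>

definition real_dist :: "((real^2 \<Rightarrow> real) \<Rightarrow> real) \<Rightarrow> bool" where
  "real_dist w \<longleftrightarrow>
    (\<forall>\<phi>\<in>test_functions. \<forall>\<psi>\<in>test_functions. \<forall>c. w (\<lambda>x. c * \<phi> x + \<psi> x) = c * w \<phi> + w \<psi>) \<and>
    (\<exists>C N. C \<ge> 0 \<and> (\<forall>\<phi>\<in>test_functions. \<forall>B. (\<forall>a\<le>N. \<forall>b\<le>N. \<forall>x. \<bar>mpd a b \<phi> x\<bar> \<le> B) \<longrightarrow> \<bar>w \<phi>\<bar> \<le> C * B))"

lemma real_dist_linear: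
  "real_dist w \<Longrightarrow> \<phi> \<in> test_functions \<Longrightarrow> \<psi> \<in> test_functions \<Longrightarrow> w (\<lambda>x. c * \<phi> x + \<psi> x) = c * w \<phi> + w \<psi>"
  unfolding real_dist_def by blast

lemma real_dist_boundE:
  assumes "real_dist w"
  obtains C N where "C \<ge> 0"
    "\<And>\<phi> B. \<phi> \<in> test_functions \<Longrightarrow> (\<And>a b x. a \<le> N \<Longrightarrow> b \<le> N \<Longrightarrow> \<bar>mpd a b \<phi> x\<bar> \<le> B) \<Longrightarrow> \<bar>w \<phi>\<bar> \<le> C * B"
proof -
  obtain C N where CN: "C \<ge> 0"
    "\<And>\<phi> B. \<phi> \<in> test_functions \<Longrightarrow> \<forall>a\<le>N. \<forall>b\<le>N. \<forall>x. \<bar>mpd a b \<phi> x\<bar> \<le> B \<Longrightarrow> \<bar>w \<phi>\<bar> \<le> C * B"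
    using assms unfolding real_dist_def by blast
  show ?thesis by (rule that[OF CN(1), of N]) (rule CN(2); simp)
qed

lemma
  assumes "real_dist w" "\<phi> \<in> test_functions"
  shows real_dist_add: "\<psi> \<in> test_functions \<Longrightarrow> w (\<lambda>x. \<phi> x + \<psi> x) = w \<phi> + w \<psi>"
    and real_dist_diff: "\<psi> \<in> test_functions \<Longrightarrow> w (\<lambda>x. \<phi> x - \<psi> x) = w \<phi> - w \<psi>"
    and real_dist_zero: "w (\<lambda>x. 0) = 0"
    and real_dist_cmult: "w (\<lambda>x. c * \<phi> x) = c * w \<phi>"
    and real_dist_uminus: "w (\<lambda>x. - \<phi> x) = - w \<phi>"
proof -
  show add: "w (\<lambda>x. \<phi> x + \<psi> x) = w \<phi> + w \<psi>" if "\<psi> \<in> test_functions" for \<psi>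
    using real_dist_linear[OF assms that, of 1] by simp
  show zero: "w (\<lambda>x. 0) = 0"
    using real_dist_linear[OF assms assms(2), of "-1"] by simp
  show "w (\<lambda>x. c * \<phi> x) = c * w \<phi>" for c
    using real_dist_linear[OF assms, of "\<lambda>x. 0" c] zero by simp
  show "w (\<lambda>x. - \<phi> x) = - w \<phi>"
    using real_dist_linear[OF assms, of "\<lambda>x. 0" "-1"] zero by simp
  show "w (\<lambda>x. \<phi> x - \<psi> x) = w \<phi> - w \<psi>" if "\<psi> \<in> test_functions"
    using real_dist_linear[OF assms(1) that assms(2), of "-1"] by (simp add: add.commute)
qed

lemma real_dist_sum:
  assumes "real_dist w" "\<And>k. k \<in> F \<Longrightarrow> f k \<in> test_functions"
  shows "w (\<lambda>x. \<Sum>k\<in>F. c k * f k x) = (\<Sum>k\<in>F. c k * w (f k))"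
  using assms(2)
proof (induction F rule: infinite_finite_induct)
  case (insert k F)
  have "(\<lambda>x. \<Sum>k\<in>F. c k * f k x) \<in> test_functions"
    by (rule test_functions_sum) (use insert.prems in \<open>auto intro: test_functions_cmult\<close>)
  with insert show ?case by (simp add: real_dist_linear[OF assms(1)])
qed (use real_dist_zero[OF assms(1) test_functions_const] in auto)

text \<open>A common bound on the derivatives makes every supremum in \<open>is_dist\<close> finite
  and at most that bound; the constant counts the summands.\<close>

lemma is_dist_real_dist:
  assumes "is_dist u"
  shows "real_dist (\<lambda>\<phi>. Re (u \<phi>))" "real_dist (\<lambda>\<phi>. Im (u \<phi>))"
proof -
  obtain C N where CN: "\<And>\<phi>. \<phi> \<in> test_functions \<Longrightarrow> norm (u \<phi>) \<le> C * (\<Sum>a\<le>N. \<Sum>b\<le>N - a. SUP x. \<bar>mpd a b \<phi> x\<bar>)"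
    using assms unfolding is_dist_def by blast
  have lin: "u (\<lambda>x. c * \<phi> x + \<psi> x) = of_real c * u \<phi> + u \<psi>" if "\<phi> \<in> test_functions" "\<psi> \<in> test_functions" for c \<phi> \<psi>
    using assms that unfolding is_dist_def by blast
  let ?C = "\<bar>C\<bar> * (\<Sum>a\<le>N. \<Sum>b\<le>N - a. 1)"
  have bound: "norm (u \<phi>) \<le> ?C * B"
    if \<phi>: "\<phi> \<in> test_functions" and B: "\<forall>a\<le>N. \<forall>b\<le>N. \<forall>x. \<bar>mpd a b \<phi> x\<bar> \<le> B" for \<phi> B
  proof -
    have le: "(SUP x. \<bar>mpd a b \<phi> x\<bar>) \<le> B" and ge: "0 \<le> (SUP x. \<bar>mpd a b \<phi> x\<bar>)" if "a \<le> N" "b \<le> N - a" for a b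
    proof -
      have *: "\<bar>mpd a b \<phi> x\<bar> \<le> B" for x using that B by (meson diff_le_self le_trans)
      then show "(SUP x. \<bar>mpd a b \<phi> x\<bar>) \<le> B" by (intro cSUP_least) auto
      have "bdd_above (range (\<lambda>x. \<bar>mpd a b \<phi> x\<bar>))" using * by (auto intro!: bdd_aboveI2)
      then show "0 \<le> (SUP x. \<bar>mpd a b \<phi> x\<bar>)" by (rule cSUP_upper2[of _ _ 0]) auto
    qed
    have "(\<Sum>a\<le>N. \<Sum>b\<le>N - a. SUP x. \<bar>mpd a b \<phi> x\<bar>) \<le> (\<Sum>a\<le>N. \<Sum>b\<le>N - a. B)"
      by (intro sum_mono le) auto
    moreover have "0 \<le> (\<Sum>a\<le>N. \<Sum>b\<le>N - a. SUP x. \<bar>mpd a b \<phi> x\<bar>)"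
      by (intro sum_nonneg ge) auto
    ultimately have "\<bar>C\<bar> * (\<Sum>a\<le>N. \<Sum>b\<le>N - a. SUP x. \<bar>mpd a b \<phi> x\<bar>) \<le> \<bar>C\<bar> * (\<Sum>a\<le>N. \<Sum>b\<le>N - a. B)"
      "C * (\<Sum>a\<le>N. \<Sum>b\<le>N - a. SUP x. \<bar>mpd a b \<phi> x\<bar>) \<le> \<bar>C\<bar> * (\<Sum>a\<le>N. \<Sum>b\<le>N - a. SUP x. \<bar>mpd a b \<phi> x\<bar>)"
      by (auto intro: mult_left_mono mult_right_mono)
    with CN[OF \<phi>] have "norm (u \<phi>) \<le> \<bar>C\<bar> * (\<Sum>a\<le>N. \<Sum>b\<le>N - a. B)" by linarith
    then show ?thesis by (simp add: sum_distrib_right sum_distrib_left mult.assoc)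
  qed
  have C: "?C \<ge> 0" by (intro mult_nonneg_nonneg sum_nonneg) auto
  show "real_dist (\<lambda>\<phi>. Re (u \<phi>))"
    unfolding real_dist_def using lin bound C order_trans[OF abs_Re_le_cmod]
    by (intro conjI exI[of _ ?C] exI[of _ N]) auto
  show "real_dist (\<lambda>\<phi>. Im (u \<phi>))"
    unfolding real_dist_def using lin bound C order_trans[OF abs_Im_le_cmod]
    by (intro conjI exI[of _ ?C] exI[of _ N]) auto
qed

lemma real_dist_add_dist:
  assumes "real_dist u" "real_dist v"
  shows "real_dist (\<lambda>\<phi>. u \<phi> + c * v \<phi>)"
proof -
  obtain C N where C: "C \<ge> 0" "\<And>\<phi> B. \<phi> \<in> test_functions \<Longrightarrow> (\<And>a b x. a \<le> N \<Longrightarrow> b \<le> N \<Longrightarrow> \<bar>mpd a b \<phi> x\<bar> \<le> B) \<Longrightarrow> \<bar>u \<phi>\<bar> \<le> C * B"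
    using real_dist_boundE[OF assms(1)] by blast
  obtain C' N' where C': "C' \<ge> 0" "\<And>\<phi> B. \<phi> \<in> test_functions \<Longrightarrow> (\<And>a b x. a \<le> N' \<Longrightarrow> b \<le> N' \<Longrightarrow> \<bar>mpd a b \<phi> x\<bar> \<le> B) \<Longrightarrow> \<bar>v \<phi>\<bar> \<le> C' * B"
    using real_dist_boundE[OF assms(2)] by blast
  have "\<bar>u \<phi> + c * v \<phi>\<bar> \<le> (C + \<bar>c\<bar> * C') * B"
    if "\<phi> \<in> test_functions" "\<forall>a\<le>max N N'. \<forall>b\<le>max N N'. \<forall>x. \<bar>mpd a b \<phi> x\<bar> \<le> B" for \<phi> B
  proof -
    have "\<bar>u \<phi>\<bar> \<le> C * B" "\<bar>v \<phi>\<bar> \<le> C' * B"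
      by (intro C C' that(1); use that(2) in \<open>simp add: le_max_iff_disj\<close>)+
    then have "\<bar>u \<phi>\<bar> + \<bar>c\<bar> * \<bar>v \<phi>\<bar> \<le> C * B + \<bar>c\<bar> * (C' * B)"
      by (intro add_mono mult_left_mono) auto
    then show ?thesis using abs_triangle_ineq[of "u \<phi>" "c * v \<phi>"] by (simp add: abs_mult algebra_simps)
  qed
  moreover have "C + \<bar>c\<bar> * C' \<ge> 0" using C C' by simp
  ultimately show ?thesis
    unfolding real_dist_def using assms[THEN real_dist_linear]
    by (intro conjI exI[of _ "C + \<bar>c\<bar> * C'"] exI[of _ "max N N'"]) (auto simp: algebra_simps)
qed

section \<open>Pairing and convolution on the torus\<close>

definition pairing :: "(real^2 \<Rightarrow> real) \<Rightarrow> (real^2 \<Rightarrow> real) \<Rightarrow> real" where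
  "pairing f \<phi> = (\<integral>x. f x * \<phi> x \<partial>tor)"

lemma integrable_pairing:
  assumes "integrable tor f" "\<phi> \<in> test_functions"
  shows "integrable tor (\<lambda>x. f x * \<phi> x)"
  by (rule test_functions_bounded[OF assms(2)])
    (rule tor_integrable_mult_bounded[OF assms(1) test_functions_borel[OF assms(2)]])

lemma integrable_test_function: "\<phi> \<in> test_functions \<Longrightarrow> integrable tor \<phi>"
  by (rule tor_integrable_continuous[OF test_functions_continuous])

lemma pairing_bound:
  assumes "integrable tor f" "\<phi> \<in> borel_measurable borel" "\<And>x. \<bar>\<phi> x\<bar> \<le> B"
  shows "\<bar>pairing f \<phi>\<bar> \<le> (\<integral>x. \<bar>f x\<bar> \<partial>tor) * B"
proof -
  have "\<bar>pairing f \<phi>\<bar> \<le> (\<integral>x. \<bar>f x * \<phi> x\<bar> \<partial>tor)" unfolding pairing_def by (rule integral_abs_bound)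
  also have "\<dots> \<le> (\<integral>x. \<bar>f x\<bar> * B \<partial>tor)"
  proof (rule integral_mono)
    show "integrable tor (\<lambda>x. \<bar>f x * \<phi> x\<bar>)"
      by (intro integrable_abs tor_integrable_mult_bounded[OF assms])
    show "integrable tor (\<lambda>x. \<bar>f x\<bar> * B)" using assms(1) by simp
    show "\<bar>f x * \<phi> x\<bar> \<le> \<bar>f x\<bar> * B" for x
      unfolding abs_mult by (intro mult_left_mono assms(3)) simp
  qed
  finally show ?thesis by simp
qed

lemma real_dist_pairing:
  assumes "integrable tor f"
  shows "real_dist (pairing f)"
  unfolding real_dist_def
proof (intro conjI exI[of _ "\<integral>x. \<bar>f x\<bar> \<partial>tor"] exI[of _ 0] ballI allI impI)
  fix \<phi> \<psi> c assume t: "\<phi> \<in> test_functions" "\<psi> \<in> test_functions"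
  have "pairing f (\<lambda>x. c * \<phi> x + \<psi> x) = (\<integral>x. c * (f x * \<phi> x) + f x * \<psi> x \<partial>tor)"
    by (simp add: pairing_def algebra_simps)
  also have "\<dots> = c * pairing f \<phi> + pairing f \<psi>"
    unfolding pairing_def using integrable_pairing[OF assms] t by (subst Bochner_Integration.integral_add) auto
  finally show "pairing f (\<lambda>x. c * \<phi> x + \<psi> x) = c * pairing f \<phi> + pairing f \<psi>" .
next
  fix \<phi> B assume "\<phi> \<in> test_functions" "\<forall>a\<le>0. \<forall>b\<le>0. \<forall>x. \<bar>mpd a b \<phi> x\<bar> \<le> B"
  then show "\<bar>pairing f \<phi>\<bar> \<le> (\<integral>x. \<bar>f x\<bar> \<partial>tor) * B"
    by (intro pairing_bound[OF assms]) (auto simp: test_functions_borel)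
qed simp

definition cv :: "((real^2 \<Rightarrow> real) \<Rightarrow> real) \<Rightarrow> (real^2 \<Rightarrow> real) \<Rightarrow> real^2 \<Rightarrow> real" where
  "cv w \<phi> x = w (\<lambda>y. \<phi> (x - y))"

text \<open>The derivatives of \<open>\<phi>\<close> up to the order of \<open>w\<close> have Taylor
  remainders that are quadratic in \<open>h\<close>, uniformly in the base point. Applying
  \<open>w\<close> to the remainder identifies the derivative of the convolution.\<close>

lemma
  assumes w: "real_dist w" and \<phi>: "\<phi> \<in> test_functions"
  shows cv_differentiable: "cv w \<phi> differentiable (at x)"
    and pd_cv: "pd i (cv w \<phi>) = cv w (pd i \<phi>)"
proof -
  obtain C N where CN: "C \<ge> 0"
    "\<And>\<phi> B. \<phi> \<in> test_functions \<Longrightarrow> (\<And>a b x. a \<le> N \<Longrightarrow> b \<le> N \<Longrightarrow> \<bar>mpd a b \<phi> x\<bar> \<le> B) \<Longrightarrow> \<bar>w \<phi>\<bar> \<le> C * B"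
    using real_dist_boundE[OF w] by blast
  have "\<exists>B. \<forall>x h. \<bar>mpd a b \<phi> (x + h) - mpd a b \<phi> x - h $ 1 * pd 1 (mpd a b \<phi>) x - h $ 2 * pd 2 (mpd a b \<phi>) x\<bar> \<le> B * (norm h)\<^sup>2" for a b
    using test_function_taylor[OF test_functions_mpd[OF \<phi>, of a b]] by blast
  then obtain B where B: "\<And>a b x h. \<bar>mpd a b \<phi> (x + h) - mpd a b \<phi> x - h $ 1 * pd 1 (mpd a b \<phi>) x - h $ 2 * pd 2 (mpd a b \<phi>) x\<bar> \<le> B a b * (norm h)\<^sup>2"
    by (metis (no_types))
  define M where "M = (\<Sum>a\<le>N. \<Sum>b\<le>N. \<bar>B a b\<bar>)"
  have M: "B a b \<le> M" if "a \<le> N" "b \<le> N" for a b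
  proof -
    have "\<bar>B a b\<bar> \<le> (\<Sum>b\<le>N. \<bar>B a b\<bar>)" using that by (intro member_le_sum) auto
    also have "\<dots> \<le> M" unfolding M_def using that by (intro member_le_sum[of a "{..N}" "\<lambda>a. \<Sum>b\<le>N. \<bar>B a b\<bar>"]) (auto intro: sum_nonneg)
    finally show ?thesis by simp
  qed
  note tf = \<phi> test_functions_pd[OF \<phi>]
  have main: "\<bar>cv w \<phi> (x + h) - cv w \<phi> x - (h $ 1 * cv w (pd 1 \<phi>) x + h $ 2 * cv w (pd 2 \<phi>) x)\<bar> \<le> C * M * (norm h)\<^sup>2" for x h
  proof -
    define \<theta> where "\<theta> z = \<phi> (z + h) - \<phi> z - h $ 1 * pd 1 \<phi> z - h $ 2 * pd 2 \<phi> z" for z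
    have \<theta>: "\<theta> \<in> test_functions"
      unfolding \<theta>_def[abs_def] by (intro test_functions_diff test_functions_cmult test_functions_shift tf)
    have m: "mpd a b \<theta> = (\<lambda>z. mpd a b \<phi> (z + h) - mpd a b \<phi> z - h $ 1 * pd 1 (mpd a b \<phi>) z - h $ 2 * pd 2 (mpd a b \<phi>) z)" for a b
      unfolding \<theta>_def[abs_def]
      by (simp add: mpd_diff mpd_cmult mpd_shift mpd_pd smooth_diff smooth_cmult smooth_shift smooth_pd tf test_functionsD)
    have "w (\<lambda>y. \<theta> (x - y)) = cv w \<phi> (x + h) - cv w \<phi> x - h $ 1 * cv w (pd 1 \<phi>) x - h $ 2 * cv w (pd 2 \<phi>) x"
    proof -
      have "(\<lambda>y. \<theta> (x - y)) = (\<lambda>y. \<phi> (x + h - y) - \<phi> (x - y) - h $ 1 * pd 1 \<phi> (x - y) - h $ 2 * pd 2 \<phi> (x - y))"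
        by (simp add: \<theta>_def algebra_simps)
      then show ?thesis
        unfolding cv_def
        by (simp add: real_dist_diff[OF w] real_dist_cmult[OF w] test_functions_diff test_functions_cmult test_functions_reflect tf)
    qed
    moreover have "\<bar>w (\<lambda>y. \<theta> (x - y))\<bar> \<le> C * (M * (norm h)\<^sup>2)"
    proof (rule CN(2)[OF test_functions_reflect[OF \<theta>]])
      fix a b y assume ab: "a \<le> N" "b \<le> N"
      have "\<bar>mpd a b (\<lambda>y. \<theta> (x - y)) y\<bar> \<le> B a b * (norm h)\<^sup>2"
        unfolding mpd_reflect[OF test_functionsD(1)[OF \<theta>]] m by (rule B)
      also have "\<dots> \<le> M * (norm h)\<^sup>2" using M[OF ab] by (intro mult_right_mono) auto
      finally show "\<bar>mpd a b (\<lambda>y. \<theta> (x - y)) y\<bar> \<le> M * (norm h)\<^sup>2" .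
    qed
    ultimately show ?thesis by (simp add: mult.assoc algebra_simps)
  qed
  have D: "(cv w \<phi> has_derivative (\<lambda>h. h $ 1 * cv w (pd 1 \<phi>) x + h $ 2 * cv w (pd 2 \<phi>) x)) (at x)" for x
    by (rule has_derivative_quadratic[OF _ main])
      (intro bounded_linear_add bounded_linear_mult_left[THEN bounded_linear_compose] bounded_linear_vec_nth)
  then show "cv w \<phi> differentiable (at x)" by (auto simp: differentiable_def)
  show "pd i (cv w \<phi>) = cv w (pd i \<phi>)"
    using exhaust_2[of i] has_derivative_pdI[OF D] by auto
qed

lemma cv_test_function:
  assumes w: "real_dist w" and \<phi>: "\<phi> \<in> test_functions"
  shows "cv w \<phi> \<in> test_functions"
proof -
  have "smooth (cv w \<phi>)"
  proof (rule smooth_coinduct[where P = "\<lambda>f. \<exists>\<phi>\<in>test_functions. f = cv w \<phi>"])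
    show "\<exists>\<psi>\<in>test_functions. cv w \<phi> = cv w \<psi>" using \<phi> by blast
  next
    fix f x assume "\<exists>\<phi>\<in>test_functions. f = cv w \<phi>"
    then show "f differentiable (at x)" using cv_differentiable[OF w] by blast
  next
    fix f i assume "\<exists>\<phi>\<in>test_functions. f = cv w \<phi>"
    then show "\<exists>\<phi>\<in>test_functions. pd i f = cv w \<phi>" using pd_cv[OF w] test_functions_pd by metis
  qed
  moreover have "periodic (cv w \<phi>)"
    unfolding periodic_def cv_def
  proof (intro allI)
    fix x k
    have "(\<lambda>y. \<phi> (x + lattice_shift k - y)) = (\<lambda>y. \<phi> (x - y))"
    proof
      fix y show "\<phi> (x + lattice_shift k - y) = \<phi> (x - y)"
        using periodicD[OF test_functionsD(2)[OF \<phi>], of "x - y" k] by (simp add: algebra_simps)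
    qed
    then show "w (\<lambda>y. \<phi> (x + lattice_shift k - y)) = w (\<lambda>y. \<phi> (x - y))" by simp
  qed
  ultimately show ?thesis by (simp add: test_functions_def)
qed

lemma mpd_cv:
  assumes w: "real_dist w" and \<phi>: "\<phi> \<in> test_functions"
  shows "mpd a b (cv w \<phi>) = cv w (mpd a b \<phi>)"
proof -
  have "mpd a b \<phi> \<in> test_functions \<and> mpd a b (cv w \<phi>) = cv w (mpd a b \<phi>)"
    by (rule mpd_induct2[where P = "\<lambda>f g. f \<in> test_functions \<and> g = cv w f"])
      (simp_all add: \<phi> test_functionsD cv_test_function[OF w] test_functions_pd pd_cv[OF w])
  then show ?thesis by blast
qed

text \<open>The integrable factor is treated as a distribution, so smoothness and the derivative
  rules are inherited from \<open>cv\<close>; only the second factor has to be smooth.\<close>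

definition tconv :: "(real^2 \<Rightarrow> real) \<Rightarrow> (real^2 \<Rightarrow> real) \<Rightarrow> real^2 \<Rightarrow> real" where
  "tconv f \<psi> = cv (pairing f) \<psi>"

lemma tconv_eq: "tconv f \<psi> x = (\<integral>y. f y * \<psi> (x - y) \<partial>tor)"
  by (simp add: tconv_def cv_def pairing_def)

lemma
  assumes "integrable tor f" "\<psi> \<in> test_functions"
  shows tconv_test_function: "tconv f \<psi> \<in> test_functions"
    and pd_tconv: "pd i (tconv f \<psi>) = tconv f (pd i \<psi>)"
    and mpd_tconv: "mpd a b (tconv f \<psi>) = tconv f (mpd a b \<psi>)"
  unfolding tconv_def using assms cv_test_function pd_cv mpd_cv real_dist_pairing by blast+

lemma tconv_bound:
  assumes "integrable tor f" "\<psi> \<in> test_functions" "\<And>x. \<bar>\<psi> x\<bar> \<le> B"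
  shows "\<bar>tconv f \<psi> x\<bar> \<le> (\<integral>x. \<bar>f x\<bar> \<partial>tor) * B"
  unfolding tconv_def cv_def
  by (intro pairing_bound assms) (simp add: test_functions_borel test_functions_reflect assms)

text \<open>Rounding to a grid of mesh \<open>1 / m\<close>. Replacing \<open>y\<close> by its grid
  point turns a convolution integral into a finite combination of translates.\<close>

definition grid_point :: "nat \<Rightarrow> real^2 \<Rightarrow> real^2" where
  "grid_point m y = (\<chi> i. of_int \<lfloor>real m * y $ i\<rfloor> / real m)"

lemma grid_point_dist:
  assumes "m > 0"
  shows "norm (y - grid_point m y) \<le> 2 / real m"
proof -
  have "\<bar>(y - grid_point m y) $ i\<bar> \<le> 1 / real m" for i
  proof -
    have "\<bar>real m * y $ i - of_int \<lfloor>real m * y $ i\<rfloor>\<bar> \<le> 1" by linarith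
    then have "\<bar>real m * y $ i - of_int \<lfloor>real m * y $ i\<rfloor>\<bar> / real m \<le> 1 / real m"
      by (intro divide_right_mono) auto
    moreover have "\<bar>(y - grid_point m y) $ i\<bar> = \<bar>real m * y $ i - of_int \<lfloor>real m * y $ i\<rfloor>\<bar> / real m"
    proof -
      have "(y - grid_point m y) $ i = (real m * y $ i - of_int \<lfloor>real m * y $ i\<rfloor>) / real m"
        using assms by (simp add: grid_point_def diff_divide_distrib)
      then show ?thesis by (simp add: abs_divide)
    qed
    ultimately show ?thesis by simp
  qed
  from this[of 1] this[of 2] have "\<bar>(y - grid_point m y) $ 1\<bar> + \<bar>(y - grid_point m y) $ 2\<bar> \<le> 2 / real m"
    by linarith
  then show ?thesis using norm_le_l1_cart[of "y - grid_point m y"] by (simp add: sum_2)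
qed

lemma finite_grid_point: "finite (grid_point m ` torus_box)"
proof (rule finite_subset)
  show "grid_point m ` torus_box \<subseteq> (\<lambda>k. \<chi> i. of_int (k $ i) / real m) ` index_box (4 * m)"
  proof (rule image_subsetI)
    fix y assume y: "y \<in> torus_box"
    let ?k = "\<chi> i. \<lfloor>real m * y $ i\<rfloor> :: int^2"
    have "\<bar>\<lfloor>real m * y $ i\<rfloor>\<bar> \<le> int (4 * m)" for i
    proof -
      have b: "- 4 \<le> y $ i" "y $ i \<le> 4"
      proof -
        have "- pi \<le> y $ i \<and> y $ i \<le> pi" using y by (simp add: mem_torus_box)
        then show "- 4 \<le> y $ i" "y $ i \<le> 4" using pi_less_4 by linarith+
      qed
      have "real m * y $ i \<le> real m * 4" "real m * (- 4) \<le> real m * y $ i"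
        by (intro mult_left_mono b; simp)+
      then show ?thesis by linarith
    qed
    then have "?k \<in> index_box (4 * m)" by (simp add: index_box_def)
    moreover have "grid_point m y = (\<chi> i. of_int (?k $ i) / real m)"
      by (simp add: grid_point_def)
    ultimately show "grid_point m y \<in> (\<lambda>k. \<chi> i. of_int (k $ i) / real m) ` index_box (4 * m)"
      by blast
  qed
qed simp

lemma integral_grid_point:
  fixes f G :: "real^2 \<Rightarrow> real"
  assumes "integrable tor f"
  shows "(\<integral>y. f y * G (grid_point m y) \<partial>tor) =
    (\<Sum>p\<in>grid_point m ` torus_box. (\<integral>y. f y * indicator {y. grid_point m y = p} y \<partial>tor) * G p)"
proof -
  let ?P = "grid_point m ` torus_box"
  have meas: "{y. grid_point m y = p} \<in> sets borel" for p
    unfolding grid_point_def vec_eq_iff forall_2 by simp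
  have int: "integrable tor (\<lambda>y. f y * indicator {y. grid_point m y = p} y)" for p
    by (rule tor_integrable_mult_bounded[OF assms borel_measurable_indicator[OF meas], where B = 1]) simp
  have "(\<integral>y. f y * G (grid_point m y) \<partial>tor) =
    (\<integral>y. (\<Sum>p\<in>?P. f y * indicator {y. grid_point m y = p} y * G p) \<partial>tor)"
  proof (rule Bochner_Integration.integral_cong[OF refl])
    fix y assume "y \<in> space tor"
    then have mem: "grid_point m y \<in> ?P" by simp
    have "(\<Sum>p\<in>?P. f y * indicator {y. grid_point m y = p} y * G p)
      = (\<Sum>p\<in>?P. if p = grid_point m y then f y * G (grid_point m y) else 0)"
      by (intro sum.cong) auto
    then show "f y * G (grid_point m y) = (\<Sum>p\<in>?P. f y * indicator {y. grid_point m y = p} y * G p)"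
      using mem finite_grid_point by simp
  qed
  also have "\<dots> = (\<Sum>p\<in>?P. \<integral>y. f y * indicator {y. grid_point m y = p} y * G p \<partial>tor)"
    by (rule Bochner_Integration.integral_sum) (rule integrable_mult_left[OF int])
  finally show ?thesis by simp
qed

lemma integral_grid_point_error:
  assumes f: "integrable tor f" and \<psi>: "\<psi> \<in> test_functions"
    and L: "\<And>x h. \<bar>\<psi> (x + h) - \<psi> x\<bar> \<le> L * norm h" "L \<ge> 0" and m: "m > 0"
  shows "\<bar>(\<Sum>p\<in>grid_point m ` torus_box. (\<integral>y. f y * indicator {y. grid_point m y = p} y \<partial>tor) * \<psi> (x - p))
      - tconv f \<psi> x\<bar> \<le> (\<integral>y. \<bar>f y\<bar> \<partial>tor) * (L * (2 / real m))"
proof -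
  have [measurable]: "(\<lambda>x::real^2. x $ i) \<in> borel_measurable borel" for i
    by (intro borel_measurable_continuous_onI continuous_intros)
  have g [measurable]: "grid_point m \<in> borel_measurable borel"
    unfolding grid_point_def
    by (subst borel_measurable_euclidean_space) (auto simp: Basis_vec_def inner_axis; measurable)
  obtain B where B: "\<And>x. \<bar>\<psi> x\<bar> \<le> B" using test_functions_bounded[OF \<psi>] by blast
  have [measurable]: "\<psi> \<in> borel_measurable borel" by (rule test_functions_borel[OF \<psi>])
  let ?d = "\<lambda>y. \<psi> (x - grid_point m y) - \<psi> (x - y)"
  have d: "\<bar>?d y\<bar> \<le> L * (2 / real m)" for y
  proof -
    have "\<bar>?d y\<bar> \<le> L * norm (y - grid_point m y)"
      using L(1)[of "x - y" "y - grid_point m y"] by simp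
    also have "\<dots> \<le> L * (2 / real m)" using grid_point_dist[OF m] L(2) by (rule mult_left_mono)
    finally show ?thesis .
  qed
  have int: "integrable tor (\<lambda>y. f y * \<psi> (x - grid_point m y))" "integrable tor (\<lambda>y. f y * \<psi> (x - y))"
    by (rule tor_integrable_mult_bounded[OF f _ B]; measurable)+
  have "(\<Sum>p\<in>grid_point m ` torus_box. (\<integral>y. f y * indicator {y. grid_point m y = p} y \<partial>tor) * \<psi> (x - p))
      - tconv f \<psi> x = (\<integral>y. f y * \<psi> (x - grid_point m y) \<partial>tor) - (\<integral>y. f y * \<psi> (x - y) \<partial>tor)"
    unfolding tconv_eq by (subst integral_grid_point[OF f]) simp
  also have "\<dots> = pairing f ?d"
    unfolding pairing_def by (subst Bochner_Integration.integral_diff[symmetric]) (simp_all add: int right_diff_distrib)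
  finally have eq: "(\<Sum>p\<in>grid_point m ` torus_box. (\<integral>y. f y * indicator {y. grid_point m y = p} y \<partial>tor) * \<psi> (x - p))
      - tconv f \<psi> x = pairing f ?d" .
  have "?d \<in> borel_measurable borel" by measurable
  from pairing_bound[OF f this d] show ?thesis unfolding eq .
qed

text \<open>A distribution commutes with finite sums, not a priori with integrals, so the inner
  integral is replaced by Riemann sums over a grid. The derivatives of \<open>\<psi>\<close> up to
  the order of \<open>w\<close> are Lipschitz, hence these sums converge in the seminorm that
  controls \<open>w\<close>, with an error of order \<open>1 / m\<close>.\<close>

theorem cv_tconv:
  assumes w: "real_dist w" and f: "integrable tor f" and \<psi>: "\<psi> \<in> test_functions"
  shows "cv w (tconv f \<psi>) = tconv f (cv w \<psi>)"
proof
  fix x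
  obtain C N where CN: "C \<ge> 0"
    "\<And>\<phi> B. \<phi> \<in> test_functions \<Longrightarrow> (\<And>a b x. a \<le> N \<Longrightarrow> b \<le> N \<Longrightarrow> \<bar>mpd a b \<phi> x\<bar> \<le> B) \<Longrightarrow> \<bar>w \<phi>\<bar> \<le> C * B"
    using real_dist_boundE[OF w] by blast
  define L where "L a b = (SOME L. L \<ge> 0 \<and> (\<forall>x h. \<bar>mpd a b \<psi> (x + h) - mpd a b \<psi> x\<bar> \<le> L * norm h))" for a b
  have "L a b \<ge> 0 \<and> (\<forall>x h. \<bar>mpd a b \<psi> (x + h) - mpd a b \<psi> x\<bar> \<le> L a b * norm h)" for a b
    unfolding L_def
    by (rule someI_ex, rule test_function_lipschitz[OF test_functions_mpd[OF \<psi>, of a b]]) blast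
  then have L: "\<And>a b. L a b \<ge> 0" "\<And>a b x h. \<bar>mpd a b \<psi> (x + h) - mpd a b \<psi> x\<bar> \<le> L a b * norm h"
    by blast+
  define M where "M = (\<Sum>a\<le>N. \<Sum>b\<le>N. L a b)"
  have M: "L a b \<le> M" if "a \<le> N" "b \<le> N" for a b
  proof -
    have "L a b \<le> (\<Sum>b\<le>N. L a b)" using that L by (intro member_le_sum) auto
    also have "\<dots> \<le> M"
      unfolding M_def using that L by (intro member_le_sum[of a "{..N}" "\<lambda>a. \<Sum>b\<le>N. L a b"]) (auto intro: sum_nonneg)
    finally show ?thesis .
  qed
  obtain L' where L': "\<And>x h. \<bar>cv w \<psi> (x + h) - cv w \<psi> x\<bar> \<le> L' * norm h" "L' \<ge> 0"
    using test_function_lipschitz[OF cv_test_function[OF w \<psi>]] by blast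
  define I where "I = (\<integral>y. \<bar>f y\<bar> \<partial>tor)"
  have I: "I \<ge> 0" by (simp add: I_def)
  have bound: "\<bar>cv w (tconv f \<psi>) x - tconv f (cv w \<psi>) x\<bar> \<le> (C * (I * M) + I * L') * 2 * inverse (real (Suc n))" for n
  proof -
    define m where "m = Suc n"
    define P where "P = grid_point m ` torus_box"
    define c where "c p = (\<integral>y. f y * indicator {y. grid_point m y = p} y \<partial>tor)" for p
    define \<theta> where "\<theta> u = (\<Sum>p\<in>P. c p * \<psi> (u - p)) - tconv f \<psi> u" for u
    have shift: "(\<lambda>u. \<psi> (u - p)) \<in> test_functions" for p
      using test_functions_shift[OF \<psi>, of "- p"] by simp
    have \<theta>: "\<theta> \<in> test_functions"
      unfolding \<theta>_def[abs_def]
      by (intro test_functions_diff test_functions_sum test_functions_cmult shift tconv_test_function f \<psi>)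
    have m_theta: "mpd a b \<theta> = (\<lambda>u. (\<Sum>p\<in>P. c p * mpd a b \<psi> (u - p)) - tconv f (mpd a b \<psi>) u)" for a b
    proof -
      have "mpd a b (\<lambda>u. \<psi> (u - p)) = (\<lambda>u. mpd a b \<psi> (u - p))" for p
        using mpd_shift[OF test_functionsD(1)[OF \<psi>], of a b "- p"] by simp
      then show ?thesis
        unfolding \<theta>_def[abs_def] using test_functionsD(1)[OF shift] test_functionsD(1)[OF tconv_test_function[OF f \<psi>]]
        by (simp add: mpd_diff mpd_sum mpd_cmult smooth_sum smooth_cmult mpd_tconv f \<psi>)
    qed
    have m: "m > 0" by (simp add: m_def)
    have "\<bar>w (\<lambda>z. \<theta> (x - z))\<bar> \<le> C * (I * (M * (2 / real m)))"
    proof (rule CN(2)[OF test_functions_reflect[OF \<theta>]])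
      fix a b y assume ab: "a \<le> N" "b \<le> N"
      have "\<bar>mpd a b (\<lambda>y. \<theta> (x - y)) y\<bar> \<le> I * (L a b * (2 / real m))"
        unfolding mpd_reflect[OF test_functionsD(1)[OF \<theta>]] m_theta P_def c_def I_def
        by (rule integral_grid_point_error[OF f test_functions_mpd[OF \<psi>] L(2) L(1) m])
      also have "\<dots> \<le> I * (M * (2 / real m))"
        using M[OF ab] I by (intro mult_left_mono mult_right_mono) auto
      finally show "\<bar>mpd a b (\<lambda>y. \<theta> (x - y)) y\<bar> \<le> I * (M * (2 / real m))" .
    qed
    moreover have "w (\<lambda>z. \<theta> (x - z)) = (\<Sum>p\<in>P. c p * cv w \<psi> (x - p)) - cv w (tconv f \<psi>) x"
    proof -
      have e: "x - z - p = x - p - z" for z p :: "real^2" by simp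
      have t: "(\<lambda>z. \<psi> (x - p - z)) \<in> test_functions" for p by (rule test_functions_reflect[OF \<psi>])
      have "w (\<lambda>z. \<theta> (x - z)) = w (\<lambda>z. (\<Sum>p\<in>P. c p * \<psi> (x - p - z)) - tconv f \<psi> (x - z))"
        by (simp add: \<theta>_def e)
      also have "\<dots> = w (\<lambda>z. (\<Sum>p\<in>P. c p * \<psi> (x - p - z))) - w (\<lambda>z. tconv f \<psi> (x - z))"
        by (intro real_dist_diff[OF w] test_functions_sum test_functions_cmult t test_functions_reflect
            tconv_test_function f \<psi>)
      also have "w (\<lambda>z. (\<Sum>p\<in>P. c p * \<psi> (x - p - z))) = (\<Sum>p\<in>P. c p * cv w \<psi> (x - p))"
        unfolding cv_def by (rule real_dist_sum[OF w t])
      finally show ?thesis by (simp add: cv_def)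
    qed
    moreover have "\<bar>(\<Sum>p\<in>P. c p * cv w \<psi> (x - p)) - tconv f (cv w \<psi>) x\<bar> \<le> I * (L' * (2 / real m))"
      unfolding P_def c_def I_def
      by (rule integral_grid_point_error[OF f cv_test_function[OF w \<psi>] L' m])
    ultimately have "\<bar>cv w (tconv f \<psi>) x - tconv f (cv w \<psi>) x\<bar> \<le> C * (I * (M * (2 / real m))) + I * (L' * (2 / real m))"
      by linarith
    also have "\<dots> = (C * (I * M) + I * L') * 2 * inverse (real (Suc n))"
      by (simp add: m_def[symmetric] divide_inverse algebra_simps)
    finally show ?thesis .
  qed
  have "(\<lambda>n. (C * (I * M) + I * L') * 2 * inverse (real (Suc n))) \<longlonglongrightarrow> (C * (I * M) + I * L') * 2 * 0"
    by (intro tendsto_intros LIMSEQ_inverse_real_of_nat)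
  then have "\<bar>cv w (tconv f \<psi>) x - tconv f (cv w \<psi>) x\<bar> \<le> 0"
    using bound by (intro LIMSEQ_le_const[of _ 0]) auto
  then show "cv w (tconv f \<psi>) x = tconv f (cv w \<psi>) x" by simp
qed

lemma tconv_tconv:
  assumes "integrable tor f" "integrable tor g" "\<psi> \<in> test_functions"
  shows "tconv g (tconv f \<psi>) = tconv f (tconv g \<psi>)"
  using cv_tconv[OF real_dist_pairing[OF assms(2)] assms(1,3)] by (simp add: tconv_def)

lemma integral_test_reflect:
  assumes "f \<in> test_functions"
  shows "(\<integral>y. f (a - y) \<partial>tor) = integral\<^sup>L tor f"
  by (rule test_functions_bounded[OF assms])
    (rule integral_tor_reflect[OF test_functions_borel[OF assms] test_functionsD(2)[OF assms]])

lemma tconv_commute: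
  assumes "f \<in> test_functions" "g \<in> test_functions"
  shows "tconv f g = tconv g f"
proof
  fix x
  have "tconv f g x = (\<integral>y. f (x - y) * g (x - (x - y)) \<partial>tor)"
    unfolding tconv_eq
    by (rule integral_test_reflect[symmetric, where f = "\<lambda>y. f y * g (x - y)"])
      (intro test_functions_mult test_functions_reflect assms)
  then show "tconv f g x = tconv g f x" by (simp add: tconv_eq mult.commute)
qed

text \<open>Both sides are a triple convolution at 0, read in two orders. The pairing of a mollified
  distribution thus becomes an average, with weight \<open>\<rho>\<close>, of its values on
  translates of \<open>\<phi>\<close>.\<close>

lemma pairing_cv:
  assumes w: "real_dist w" and \<rho>: "\<rho> \<in> test_functions" and \<phi>: "\<phi> \<in> test_functions"
  shows "pairing (cv w \<rho>) \<phi> = pairing \<rho> (\<lambda>y. w (\<lambda>z. \<phi> (z + y)))"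
proof -
  let ?\<phi> = "\<lambda>y. \<phi> (0 - y)"
  have \<phi>': "?\<phi> \<in> test_functions" by (rule test_functions_reflect[OF \<phi>])
  note t = cv_test_function[OF w \<rho>]
  have "pairing (cv w \<rho>) \<phi> = (\<integral>y. cv w \<rho> (0 - y) * \<phi> (0 - y) \<partial>tor)"
    unfolding pairing_def by (rule integral_test_reflect[symmetric]) (intro test_functions_mult t \<phi>)
  also have "\<dots> = tconv ?\<phi> (cv w \<rho>) 0"
    by (simp add: tconv_eq mult.commute)
  also have "\<dots> = cv w (tconv ?\<phi> \<rho>) 0"
    by (simp only: cv_tconv[OF w integrable_test_function[OF \<phi>'] \<rho>])
  also have "\<dots> = tconv \<rho> (cv w ?\<phi>) 0"
    by (simp only: tconv_commute[OF \<phi>' \<rho>] cv_tconv[OF w integrable_test_function[OF \<rho>] \<phi>'])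
  also have "\<dots> = pairing \<rho> (\<lambda>y. w (\<lambda>z. \<phi> (z + y)))"
    by (simp add: tconv_eq pairing_def cv_def add.commute)
  finally show ?thesis .
qed

text \<open>Convolution with the constant 1 sends a function to its integral, which is a constant,
  and it commutes with derivatives.\<close>

lemma integral_pd:
  assumes "f \<in> test_functions"
  shows "integral\<^sup>L tor (pd i f) = 0"
proof -
  have c: "tconv (\<lambda>_. 1) g = (\<lambda>_. integral\<^sup>L tor g)" if "g \<in> test_functions" for g
    by (rule ext) (simp add: tconv_eq integral_test_reflect[OF that])
  have "integral\<^sup>L tor (pd i f) = tconv (\<lambda>_. 1) (pd i f) 0"
    by (simp add: c test_functions_pd[OF assms])
  also have "\<dots> = pd i (tconv (\<lambda>_. 1) f) 0"
    using pd_tconv[OF _ assms, of "\<lambda>_. 1" i] by (simp add: integrable_test_function)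
  also have "\<dots> = 0" by (simp add: c[OF assms])
  finally show ?thesis .
qed

lemma integral_pd_mult:
  assumes "f \<in> test_functions" "g \<in> test_functions"
  shows "pairing (pd i f) g = - pairing f (pd i g)"
proof -
  note sm = test_functionsD(1)[OF assms(1)] test_functionsD(1)[OF assms(2)]
  have "0 = (\<integral>x. pd i f x * g x + f x * pd i g x \<partial>tor)"
    using integral_pd[OF test_functions_mult[OF assms], of i] by (simp add: pd_mult sm)
  also have "\<dots> = pairing (pd i f) g + pairing f (pd i g)"
    unfolding pairing_def
    by (intro Bochner_Integration.integral_add integrable_test_function test_functions_mult test_functions_pd assms)
  finally show ?thesis by simp
qed

section \<open>A multiscale decomposition of the Green function\<close>

lemma vec_nth_differentiable_pd:
  shows "(\<lambda>x::real^2. x $ i) differentiable (at x)" "pd j (\<lambda>x. x $ i) = (\<lambda>x. if i = j then 1 else 0)"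
proof -
  have D: "((\<lambda>x::real^2. x $ i) has_derivative (\<lambda>h. h $ i)) (at x)" for x
    by (intro bounded_linear_imp_has_derivative bounded_linear_vec_nth)
  then show "(\<lambda>x::real^2. x $ i) differentiable (at x)" by (auto simp: differentiable_def)
  show "pd j (\<lambda>x. x $ i) = (\<lambda>x. if i = j then 1 else 0)"
    by (rule ext) (subst pd_eqI[OF D], simp add: axis_def)
qed

lemma smooth_vec_nth: "smooth (\<lambda>x. x $ i)"
  by (rule smooth_coinduct[where P = "\<lambda>f. f = (\<lambda>x. x $ i) \<or> (\<exists>c. f = (\<lambda>x. c))"])
    (auto simp: vec_nth_differentiable_pd)

text \<open>Differentiating \<open>G n (x \<bullet> x)\<close> gives \<open>2 * x $ i\<close> times
  \<open>G (Suc n) (x \<bullet> x)\<close>, so sums of such functions with smooth coefficients form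
  a class closed under \<open>pd\<close>.\<close>

inductive radial_algebra :: "(nat \<Rightarrow> real \<Rightarrow> real) \<Rightarrow> (real^2 \<Rightarrow> real) \<Rightarrow> bool" for G where
  base: "smooth m \<Longrightarrow> radial_algebra G (\<lambda>x. m x * G n (x \<bullet> x))"
| add: "radial_algebra G \<phi> \<Longrightarrow> radial_algebra G \<psi> \<Longrightarrow> radial_algebra G (\<lambda>x. \<phi> x + \<psi> x)"

text \<open>A radial function is handled together with all its derivatives as a function of the squared norm;
  these only need to exist on a neighbourhood of the nonnegative half-line.\<close>

lemma
  assumes G: "\<And>n s. s > - d \<Longrightarrow> (G n has_real_derivative G (Suc n) s) (at s)" and d: "d > 0"
  shows radial_differentiable: "(\<lambda>x::real^2. G n (x \<bullet> x)) differentiable (at x)"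
    and pd_radial: "pd i (\<lambda>x::real^2. G n (x \<bullet> x)) = (\<lambda>x. 2 * x $ i * G (Suc n) (x \<bullet> x))"
    and smooth_radial: "smooth (\<lambda>x::real^2. G n (x \<bullet> x))"
proof -
  have D: "((\<lambda>x::real^2. G n (x \<bullet> x)) has_derivative (\<lambda>h. (2 * (x \<bullet> h)) * G (Suc n) (x \<bullet> x))) (at x)" for x n
  proof -
    have sq: "((\<lambda>x::real^2. x \<bullet> x) has_derivative (\<lambda>h. 2 * (x \<bullet> h))) (at x)"
      by (auto intro!: derivative_eq_intros simp: inner_commute)
    have "- d < x \<bullet> x" using d inner_ge_zero[of x] by linarith
    then have "(G n has_derivative (\<lambda>h. h * G (Suc n) (x \<bullet> x))) (at (x \<bullet> x))"
      using G by (simp add: has_field_derivative_def mult_commute_abs)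
    from has_derivative_compose[OF sq this] show ?thesis .
  qed
  have diff: "(\<lambda>x::real^2. G n (x \<bullet> x)) differentiable (at x)" for n x
    using D by (auto simp: differentiable_def)
  then show "(\<lambda>x::real^2. G n (x \<bullet> x)) differentiable (at x)" .
  have pdG: "pd i (\<lambda>x::real^2. G n (x \<bullet> x)) = (\<lambda>x. 2 * x $ i * G (Suc n) (x \<bullet> x))" for i n
    by (rule ext) (subst pd_eqI[OF D], simp add: inner_axis)
  then show "pd i (\<lambda>x::real^2. G n (x \<bullet> x)) = (\<lambda>x. 2 * x $ i * G (Suc n) (x \<bullet> x))" .
  have dbase: "(\<lambda>x. m x * G n (x \<bullet> x)) differentiable (at x)" if "smooth m" for m n x
    by (intro differentiable_mult diff smooth_differentiable that)
  have dalg: "\<phi> differentiable (at x)" if "radial_algebra G \<phi>" for \<phi> x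
    using that by (induction rule: radial_algebra.induct) (simp_all add: dbase differentiable_add)
  have palg: "radial_algebra G (pd i \<phi>)" if "radial_algebra G \<phi>" for \<phi> i
    using that
  proof (induction rule: radial_algebra.induct)
    case (base m n)
    have "pd i (\<lambda>x. m x * G n (x \<bullet> x)) = (\<lambda>x. pd i m x * G n (x \<bullet> x) + (m x * (2 * x $ i)) * G (Suc n) (x \<bullet> x))"
      by (rule ext) (subst pd_mult_at, simp_all add: diff base smooth_differentiable pdG)
    then show ?case
      using base by (simp only:) (intro radial_algebra.intros smooth_pd smooth_mult smooth_cmult smooth_vec_nth)
  next
    case (add \<phi> \<psi>)
    have "pd i (\<lambda>x. \<phi> x + \<psi> x) = (\<lambda>x. pd i \<phi> x + pd i \<psi> x)"
      by (rule ext) (rule pd_add_at; rule dalg; fact)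
    then show ?case using add by (simp add: radial_algebra.add)
  qed
  have "radial_algebra G (\<lambda>x. 1 * G n (x \<bullet> x))" by (rule radial_algebra.base) simp
  then show "smooth (\<lambda>x::real^2. G n (x \<bullet> x))"
    by (intro smooth_coinduct[where P = "radial_algebra G"]) (simp_all add: dalg palg)
qed

section \<open>Bump functions\<close>

lemma
  assumes "\<phi> \<in> bump_functions"
  shows bump_smooth: "smooth \<phi>" and bump_eq_0: "norm x \<ge> 1 \<Longrightarrow> \<phi> x = 0"
    and bump_bounded_support: "bounded_support \<phi>"
proof -
  show "smooth \<phi>" using assms by (simp add: bump_functions_def)
  show z: "\<phi> x = 0" if "norm x \<ge> 1" for x
  proof (rule ccontr)
    assume "\<phi> x \<noteq> 0"
    then have "x \<in> closure {x. \<phi> x \<noteq> 0}" by (intro closure_subset[THEN subsetD]) simp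
    then have "x \<in> ball 0 1" using assms by (auto simp: bump_functions_def)
    then show False using that by simp
  qed
  then show "bounded_support \<phi>" unfolding bounded_support_def by blast
qed

lemma bump_bounded:
  assumes "\<phi> \<in> bump_functions"
  obtains B where "\<And>x. \<bar>\<phi> x\<bar> \<le> B" "B \<ge> 0"
proof -
  have "compact (\<phi> ` cball 0 1)"
    using smooth_continuous_on[OF bump_smooth[OF assms]] by (intro compact_continuous_image) auto
  then have "bounded (\<phi> ` cball 0 1)" by (rule compact_imp_bounded)
  then obtain B where B: "\<forall>x\<in>cball 0 1. \<bar>\<phi> x\<bar> \<le> B" by (auto simp: bounded_iff)
  have "\<bar>\<phi> x\<bar> \<le> max B 0" for x
    using B bump_eq_0[OF assms, of x] by (cases "norm x \<le> 1") (auto simp: max.coboundedI1)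
  then show ?thesis using that[of "max B 0"] by simp
qed

lemma bump_functionsI:
  assumes "smooth \<phi>" "\<And>x. norm x \<ge> c \<Longrightarrow> \<phi> x = 0" "c < 1"
  shows "\<phi> \<in> bump_functions"
proof -
  have "{x. \<phi> x \<noteq> 0} \<subseteq> cball 0 c" using assms(2) by (auto simp: not_le) (meson le_cases)
  then have "closure {x. \<phi> x \<noteq> 0} \<subseteq> cball 0 c" by (rule closure_minimal) simp
  also have "\<dots> \<subseteq> ball 0 1" using assms(3) by auto
  finally show ?thesis using assms(1) by (simp add: bump_functions_def)
qed

lemma bump_pd:
  assumes "\<phi> \<in> bump_functions"
  shows "pd i \<phi> \<in> bump_functions"
proof -
  define S where "S = closure {x. \<phi> x \<noteq> 0}"
  have op: "open (- S)" unfolding S_def by (rule open_Compl[OF closed_closure])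
  have "{x. \<phi> x \<noteq> 0} \<subseteq> S" unfolding S_def by (rule closure_subset)
  then have z: "0 = \<phi> y" if "y \<in> - S" for y using that by auto
  have "pd i \<phi> x = 0" if "x \<in> - S" for x
    by (rule pd_eqI[OF has_derivative_transform_within_open[OF has_derivative_const op that z]])
  then have "{x. pd i \<phi> x \<noteq> 0} \<subseteq> S" by auto
  then have "closure {x. pd i \<phi> x \<noteq> 0} \<subseteq> S" by (rule closure_minimal) (simp add: S_def)
  also have "S \<subseteq> ball 0 1" using assms by (simp add: bump_functions_def S_def)
  finally show ?thesis using assms by (simp add: bump_functions_def smooth_pd)
qed

lemma bump_mult:
  assumes "smooth f" "\<phi> \<in> bump_functions"
  shows "(\<lambda>x. f x * \<phi> x) \<in> bump_functions"
proof -
  have "closure {x. f x * \<phi> x \<noteq> 0} \<subseteq> closure {x. \<phi> x \<noteq> 0}" by (rule closure_mono) auto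
  also have "\<dots> \<subseteq> ball 0 1" using assms by (simp add: bump_functions_def)
  finally show ?thesis using assms by (simp add: bump_functions_def smooth_mult)
qed

lemma bump_cmult: "\<phi> \<in> bump_functions \<Longrightarrow> (\<lambda>x. c * \<phi> x) \<in> bump_functions"
  by (rule bump_mult[OF smooth_const])

lemma bump_reflect:
  assumes "\<phi> \<in> bump_functions"
  shows "(\<lambda>x. \<phi> (- x)) \<in> bump_functions"
proof -
  let ?S = "uminus ` closure {x. \<phi> x \<noteq> 0}"
  have "{x. \<phi> (- x) \<noteq> 0} \<subseteq> ?S"
  proof
    fix x assume "x \<in> {x. \<phi> (- x) \<noteq> 0}"
    then have "- x \<in> closure {x. \<phi> x \<noteq> 0}" by (intro closure_subset[THEN subsetD]) simp
    then have "- (- x) \<in> ?S" by (rule imageI)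
    then show "x \<in> ?S" by simp
  qed
  then have "closure {x. \<phi> (- x) \<noteq> 0} \<subseteq> ?S" by (rule closure_minimal) (rule closed_negations, simp)
  also have "?S \<subseteq> ball 0 1" using assms by (auto simp: bump_functions_def)
  finally show ?thesis
    using assms smooth_affine[of \<phi> 0 "-1"] by (simp add: bump_functions_def)
qed

lemma bump_integrable: "\<phi> \<in> bump_functions \<Longrightarrow> integrable lborel \<phi>"
  by (rule bump_bounded) (auto intro: lborel_integrable_bounded_support smooth_borel bump_smooth bump_bounded_support)

lemma integral_lborel_pos:
  fixes g :: "real^2 \<Rightarrow> real"
  assumes "continuous_on UNIV g" "integrable lborel g" "\<And>x. g x \<ge> 0" "g a > 0"
  shows "integral\<^sup>L lborel g > 0"
proof -
  have "isCont g a" using assms(1) by (simp add: continuous_on_eq_continuous_at)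
  then obtain e where e: "e > 0" "\<And>y. dist y a < e \<Longrightarrow> dist (g y) (g a) < g a / 2"
    using assms(4) unfolding continuous_at_eps_delta by (meson half_gt_zero)
  have le: "g a / 2 * indicator (ball a e) y \<le> g y" for y
    using e(2)[of y] assms(3)[of y] by (auto simp: indicator_def dist_real_def dist_commute abs_if split: if_splits)
  have int: "integrable lborel (\<lambda>y. g a / 2 * indicator (ball a e) y)"
    using emeasure_bounded_finite[OF bounded_ball, of a e] by (intro integrable_mult_right integrable_real_indicator) auto
  have "0 < g a / 2 * measure lborel (ball a e)" using assms(4) content_ball_pos[OF e(1), of a] by simp
  also have "\<dots> = (LINT y|lborel. g a / 2 * indicator (ball a e) y)" by simp
  also have "\<dots> \<le> integral\<^sup>L lborel g" by (rule integral_mono[OF int assms(2) le])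
  finally show ?thesis .
qed

text \<open>\<open>\<kappa>\<close> will be what the averaged Green function gains when the
  averaging scale is halved. It is built as a radial function in order to control its support. In
  the variable s = \<open>x \<bullet> x\<close> the Laplacian of k(s) is 4 (s k')'. Hence it
  suffices that s k'(s) = (h(4 s) - h(s)) / 2 with h' = -p: the Laplacian is then 2 p(s) - 8 p(4 s),
  which is \<open>r x - 4 * r (2 *\<^sub>R x)\<close> for r(x) = 2 p(s).\<close>

theorem ex_green_kernel:
  assumes "mollifier \<rho>"
  obtains \<kappa> r where "\<kappa> \<in> bump_functions" "r \<in> bump_functions" "integral\<^sup>L lborel r = 1"
    "\<And>x. pd 1 (pd 1 \<kappa>) x + pd 2 (pd 2 \<kappa>) x = r x - 4 * r (2 *\<^sub>R x)"
proof -
  have \<rho>: "\<rho> \<in> bump_functions" "\<And>x. 0 \<le> \<rho> x" "integral\<^sup>L lborel \<rho> = 1"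
    using assms by (auto simp: mollifier_def)
  obtain x0 where x0: "\<rho> x0 > 0"
  proof (rule ccontr)
    assume "\<not> thesis"
    then have "\<not> \<rho> x > 0" for x using that by blast
    then have "\<rho> = (\<lambda>_. 0)" using \<rho>(2) by (intro ext) (meson antisym not_le)
    then show False using \<rho>(3) by simp
  qed
  then have nx0: "norm x0 < 1" using bump_eq_0[OF \<rho>(1), of x0] by (metis less_irrefl not_le)
  \<comment> \<open>The mollifier provides a smooth profile that is positive at the origin of the
    new coordinates. Since 8 * (1/4) = 2 exceeds \<open>1 + norm x0\<close>, the profile along the
    first axis vanishes from 1/4 on, which in the radial variable means
    \<open>norm x \<ge> 1/2\<close>.\<close>
  define q where "q x = \<rho> (x0 + 8 *\<^sub>R x)" for x
  have q: "smooth q" unfolding q_def[abs_def] by (rule smooth_affine[OF bump_smooth[OF \<rho>(1)]])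
  define p where "p n s = (pd 1 ^^ n) q (s *\<^sub>R axis 1 1)" for n s
  have p_deriv: "(p n has_real_derivative p (Suc n) s) (at s)" for n s
    using smooth_line_derivative[of "(pd 1 ^^ n) q" 0 1 s] funpow_pd_commute[OF q, of n 1 1]
    by (simp add: p_def[abs_def])
  have p_cont: "continuous_on S (p n)" for n S
    using p_deriv by (meson DERIV_continuous continuous_at_imp_continuous_on)
  have p_nonneg: "p 0 s \<ge> 0" for s by (simp add: p_def q_def \<rho>)
  have p_pos: "p 0 0 > 0" by (simp add: p_def q_def x0)
  have p_zero: "p 0 s = 0" if "s \<ge> 1/4" for s
  proof -
    have "8 * \<bar>s\<bar> - norm x0 \<le> norm (x0 + (8 * s) *\<^sub>R (axis 1 1 :: real^2))"
      using norm_triangle_ineq4[of "x0 + (8 * s) *\<^sub>R axis 1 1" x0] by (simp add: norm_axis_1 abs_mult)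
    then have "1 \<le> norm (x0 + (8 * s) *\<^sub>R (axis 1 1 :: real^2))" using that nx0 by linarith
    then show ?thesis by (simp add: p_def q_def bump_eq_0[OF \<rho>(1)])
  qed
  \<comment> \<open>\<open>h 0\<close> is the integral of the profile from \<open>s\<close> to 1/4.
    The lower limit -2 makes it differentiable at all \<open>t * s\<close> with
    \<open>s > -1/4\<close> and \<open>1 \<le> t \<le> 4\<close>.\<close>
  define h where "h n s = (case n of 0 \<Rightarrow> integral {-2..1/4} (p 0) - integral {-2..s} (p 0) | Suc m \<Rightarrow> - p m s)" for n s
  have h_deriv: "(h n has_real_derivative h (Suc n) s) (at s)" if "s > -2" for n s
  proof (cases n)
    case 0
    have "((\<lambda>s. integral {-2..s} (p 0)) has_real_derivative p 0 s) (at s within {-2..s+1})"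
      by (rule integral_has_real_derivative) (use that p_cont in auto)
    moreover have "at s within {-2..s+1} = at s" by (rule at_within_interior) (use that in auto)
    ultimately show ?thesis
      using 0 by (auto simp: h_def[abs_def] intro!: derivative_eq_intros)
  next
    case (Suc m)
    then show ?thesis using p_deriv by (auto simp: h_def[abs_def] intro!: derivative_eq_intros)
  qed
  have h_cont: "continuous_on {-2<..} (h n)" for n
    by (rule continuous_at_imp_continuous_on) (use h_deriv DERIV_continuous in blast)
  have h_zero: "h 0 s = 0" if "s \<ge> 1/4" for s
  proof -
    have "integral {-2..1/4} (p 0) + integral {1/4..s} (p 0) = integral {-2..s} (p 0)"
      by (rule Henstock_Kurzweil_Integration.integral_combine) (use that p_cont in \<open>auto intro: integrable_continuous_real\<close>)
    moreover have "integral {1/4..s} (p 0) = integral {1/4..s} (\<lambda>_. 0)"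
      by (rule Henstock_Kurzweil_Integration.integral_cong) (simp add: p_zero)
    ultimately show ?thesis by (simp add: h_def)
  qed
  \<comment> \<open>Averaging \<open>h 0\<close> over the dilations between 1 and 4 with weight dt /
    (2 t) solves s k' = (h(4 s) - h(s)) / 2 and does not enlarge the support. The factor
    \<open>t ^ n\<close> comes from differentiating under the integral.\<close>
  define k where "k n s = integral (cbox 1 4) (\<lambda>t. h n (t * s) * (t ^ n / (2 * t)))" for n s
  have ts: "t * s > -2" if "s > -1/4" "t \<in> {1..4}" for t s :: real
  proof -
    have "t * (- 1/4) \<le> t * s" using that by (intro mult_left_mono) auto
    then show ?thesis using that by auto
  qed
  have k_deriv: "(k n has_real_derivative k (Suc n) s) (at s)" if s: "s > -1/4" for n s
  proof -
    let ?U = "{-1/4<..} :: real set"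
    have "(\<lambda>x. snd x * fst x) ` (?U \<times> cbox 1 4) \<subseteq> {-2<..}"
    proof (intro image_subsetI)
      fix x :: "real \<times> real" assume "x \<in> ?U \<times> cbox 1 4"
      then have "fst x > -1/4" "snd x \<in> {1..4}" by (auto simp: mem_Times_iff)
      from ts[OF this] show "snd x * fst x \<in> {-2<..}" by simp
    qed
    then have hc: "continuous_on (?U \<times> cbox 1 4) (\<lambda>x. h m (snd x * fst x))" for m
      by (intro continuous_on_compose2[OF h_cont[of m]] continuous_on_mult continuous_on_fst continuous_on_snd
          continuous_on_id)
    have cont: "continuous_on (?U \<times> cbox 1 4) (\<lambda>(s, t). h m (t * s) * (t ^ j / (2 * t)))" for m j
      unfolding split_def
      by (intro continuous_on_mult hc continuous_on_divide continuous_on_power continuous_on_const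
          continuous_on_snd continuous_on_id) auto
    have "(k n has_real_derivative integral (cbox 1 4) (\<lambda>t. h (Suc n) (t * s) * (t ^ Suc n / (2 * t)))) (at s within ?U)"
      unfolding k_def[abs_def]
    proof (rule leibniz_rule_field_derivative)
      fix x t :: real assume "x \<in> ?U" "t \<in> cbox 1 4"
      then have "t * x > -2" using ts by auto
      then have "((\<lambda>x. h n (t * x)) has_real_derivative h (Suc n) (t * x) * t) (at x)"
        using h_deriv by (intro DERIV_chain2) (auto intro!: derivative_eq_intros)
      then have "((\<lambda>x. h n (t * x) * (t ^ n / (2 * t))) has_real_derivative h (Suc n) (t * x) * t * (t ^ n / (2 * t))) (at x)"
        by (rule DERIV_cmult_right)
      then show "((\<lambda>x. h n (t * x) * (t ^ n / (2 * t))) has_real_derivative h (Suc n) (t * x) * (t ^ Suc n / (2 * t))) (at x within ?U)"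
        by - (rule has_field_derivative_at_within, cases "t = 0", simp_all add: mult.assoc)
    next
      fix x assume "x \<in> ?U"
      then have "(\<lambda>t. t * x) ` cbox 1 4 \<subseteq> {-2<..}" using ts[of x] by auto
      then have "continuous_on (cbox 1 4) (\<lambda>t. h n (t * x))"
        by (intro continuous_on_compose2[OF h_cont[of n]] continuous_on_mult continuous_on_const continuous_on_id)
      then have "continuous_on (cbox 1 4) (\<lambda>t. h n (t * x) * (t ^ n / (2 * t)))"
        by (intro continuous_on_mult continuous_on_divide continuous_on_power continuous_on_const
          continuous_on_id) auto
      then show "(\<lambda>t. h n (t * x) * (t ^ n / (2 * t))) integrable_on cbox 1 4"
        by (rule integrable_continuous)
    next
      show "continuous_on (?U \<times> cbox 1 4) (\<lambda>(s, t). h (Suc n) (t * s) * (t ^ Suc n / (2 * t)))"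
        by (rule cont)
    qed (use s in auto)
    moreover have "at s within ?U = at s" by (rule at_within_open) (use s in auto)
    ultimately show ?thesis by (simp add: k_def)
  qed
  have k_zero: "k 0 s = 0" if "s \<ge> 1/4" for s
  proof -
    have "h 0 (t * s) = 0" if "t \<in> {1..4}" for t
      using mult_mono[of 1 t "1/4" s] \<open>s \<ge> 1/4\<close> that by (intro h_zero) auto
    then have "k 0 s = integral (cbox 1 (4::real)) (\<lambda>_. 0)"
      unfolding k_def by (intro Henstock_Kurzweil_Integration.integral_cong) simp
    then show ?thesis by simp
  qed
  have k_eq: "s * k 1 s = (h 0 (4 * s) - h 0 s) / 2" if s: "s > -1/4" for s
  proof -
    have "((\<lambda>t. h 1 (t * s) * s / 2) has_integral (h 0 (4 * s) / 2 - h 0 (1 * s) / 2)) {1..4}"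
    proof (rule fundamental_theorem_of_calculus)
      fix t :: real assume "t \<in> {1..4}"
      then have "t * s > -2" using ts s by auto
      then have "((\<lambda>t. h 0 (t * s)) has_real_derivative h 1 (t * s) * s) (at t)"
        using h_deriv[of "t * s" 0] by (intro DERIV_chain2) (auto intro!: derivative_eq_intros)
      then show "((\<lambda>t. h 0 (t * s) / 2) has_vector_derivative h 1 (t * s) * s / 2) (at t within {1..4})"
        by - (rule has_vector_derivative_at_within, simp add: DERIV_cdivide flip: has_real_derivative_iff_has_vector_derivative)
    qed simp
    then have "integral {1..4} (\<lambda>t. h 1 (t * s) * s / 2) = (h 0 (4 * s) - h 0 s) / 2"
      using integral_unique by (auto simp only: diff_divide_distrib mult_1)
    moreover have "integral {1..4} (\<lambda>t. h 1 (t * s) * s / 2) = integral {1..4} (\<lambda>t. s * (h 1 (t * s) * (t ^ 1 / (2 * t))))"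
      by (rule Henstock_Kurzweil_Integration.integral_cong) simp
    ultimately show ?thesis by (simp add: k_def)
  qed
  have k_laplace: "k 1 s + s * k 2 s = (4 * h 1 (4 * s) - h 1 s) / 2" if s: "s \<ge> 0" for s
  proof (rule DERIV_unique)
    show "((\<lambda>s. s * k 1 s) has_real_derivative k 1 s + s * k 2 s) (at s)"
      using k_deriv[of s 1] s by (auto intro!: derivative_eq_intros simp: numeral_2_eq_2)
    have "((\<lambda>s. h 0 (4 * s)) has_real_derivative h 1 (4 * s) * 4) (at s)"
      using h_deriv[of "4 * s" 0] s by (intro DERIV_chain2) (auto intro!: derivative_eq_intros)
    then have "((\<lambda>s. (h 0 (4 * s) - h 0 s) / 2) has_real_derivative (4 * h 1 (4 * s) - h 1 s) / 2) (at s)"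
      using h_deriv[of s 0] s by (auto intro!: derivative_eq_intros)
    then show "((\<lambda>s. s * k 1 s) has_real_derivative (4 * h 1 (4 * s) - h 1 s) / 2) (at s)"
      by (rule has_field_derivative_transform_within_open[of _ _ _ "{-1/4<..}"]) (use k_eq s in auto)
  qed
  define \<kappa> where "\<kappa> x = k 0 (x \<bullet> x)" for x :: "real^2"
  define r where "r x = 2 * p 0 (x \<bullet> x)" for x :: "real^2"
  have quarter: "x \<bullet> x \<ge> 1/4" if "norm x \<ge> 1/2" for x :: "real^2"
    using power_mono[OF that, of 2] by (simp add: power2_norm_eq_inner power_divide)
  have quarter0: "0 < (1/4::real)" by simp
  note radial = pd_radial[of "1/4" k, OF k_deriv quarter0] smooth_radial[of "1/4" k, OF k_deriv quarter0]
  have \<kappa>: "\<kappa> \<in> bump_functions"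
    unfolding \<kappa>_def[abs_def]
    by (rule bump_functionsI[of _ "1/2"]) (use radial(2) k_zero quarter in auto)
  have "smooth (\<lambda>x. p 0 (x \<bullet> x))" by (rule smooth_radial[of 1 p]) (use p_deriv in auto)
  then have r: "r \<in> bump_functions"
    unfolding r_def[abs_def] by (intro bump_functionsI[of _ "1/2"] smooth_cmult) (use p_zero quarter in auto)
  have laplace: "pd 1 (pd 1 \<kappa>) x + pd 2 (pd 2 \<kappa>) x = r x - 4 * r (2 *\<^sub>R x)" for x
  proof -
    have "pd i (pd i \<kappa>) x = 2 * k 1 (x \<bullet> x) + 4 * (x $ i)\<^sup>2 * k 2 (x \<bullet> x)" for i
    proof -
      have "pd i \<kappa> = (\<lambda>x. (2 * x $ i) * k 1 (x \<bullet> x))"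
        unfolding \<kappa>_def[abs_def] using radial(1)[where i = i and n = 0] by simp
      moreover have "pd i (\<lambda>x. (2 * x $ i) * k 1 (x \<bullet> x)) x = 2 * k 1 (x \<bullet> x) + 2 * x $ i * (2 * x $ i * k 2 (x \<bullet> x))"
        using radial(1)[where i = i and n = 1] radial(2)[where n = 1]
        by (subst pd_mult) (simp_all add: smooth_cmult pd_cmult smooth_vec_nth vec_nth_differentiable_pd numeral_2_eq_2)
      ultimately show ?thesis by (simp add: power2_eq_square)
    qed
    then have "pd 1 (pd 1 \<kappa>) x + pd 2 (pd 2 \<kappa>) x = 4 * (k 1 (x \<bullet> x) + (x \<bullet> x) * k 2 (x \<bullet> x))"
      by (simp add: inner_vec_def sum_2 power2_eq_square algebra_simps)
    also have "\<dots> = 2 * (4 * h 1 (4 * (x \<bullet> x)) - h 1 (x \<bullet> x))" by (subst k_laplace) auto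
    also have "\<dots> = r x - 4 * r (2 *\<^sub>R x)" by (simp add: h_def r_def)
    finally show ?thesis .
  qed
  define J where "J = integral\<^sup>L lborel r"
  have J: "J > 0"
    unfolding J_def
    by (rule integral_lborel_pos[OF smooth_continuous_on[OF bump_smooth[OF r]] bump_integrable[OF r], of 0])
      (simp_all add: r_def p_nonneg p_pos)
  show ?thesis
  proof (rule that)
    show "(\<lambda>x. inverse J * \<kappa> x) \<in> bump_functions" "(\<lambda>x. inverse J * r x) \<in> bump_functions"
      by (intro bump_cmult \<kappa> r)+
    show "(LINT x|lborel. inverse J * r x) = 1" using J by (simp add: J_def)
    show "pd 1 (pd 1 (\<lambda>x. inverse J * \<kappa> x)) x + pd 2 (pd 2 (\<lambda>x. inverse J * \<kappa> x)) x
        = inverse J * r x - 4 * (inverse J * r (2 *\<^sub>R x))" for x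
      using laplace[of x] bump_smooth[OF \<kappa>] by (simp add: pd_cmult smooth_pd flip: distrib_left) (simp add: algebra_simps)
  qed
qed

subsection \<open>Rescaled test functions\<close>

lemma rescale_inner:
  assumes "\<phi> \<in> bump_functions" "l > 0"
  shows "smooth (\<lambda>y. \<phi> ((y - x) /\<^sub>R l) / l\<^sup>2)" "bounded_support (\<lambda>y. \<phi> ((y - x) /\<^sub>R l) / l\<^sup>2)"
    "pd i (\<lambda>y. \<phi> ((y - x) /\<^sub>R l) / l\<^sup>2) = (\<lambda>y. inverse l * (pd i \<phi> ((y - x) /\<^sub>R l) / l\<^sup>2))"
proof -
  let ?g = "\<lambda>y. \<phi> (- (inverse l *\<^sub>R x) + inverse l *\<^sub>R y)"
  have eq: "(\<lambda>y. \<psi> ((y - x) /\<^sub>R l) / l\<^sup>2) = (\<lambda>y. (1 / l\<^sup>2) * \<psi> (- (inverse l *\<^sub>R x) + inverse l *\<^sub>R y))" for \<psi> :: "real^2 \<Rightarrow> real"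
    by (simp add: scaleR_right_diff_distrib)
  have g: "smooth ?g" by (rule smooth_affine[OF bump_smooth[OF assms(1)]])
  show "smooth (\<lambda>y. \<phi> ((y - x) /\<^sub>R l) / l\<^sup>2)" unfolding eq by (rule smooth_cmult[OF g])
  show "bounded_support (\<lambda>y. \<phi> ((y - x) /\<^sub>R l) / l\<^sup>2)"
    unfolding eq using assms by (intro bounded_support_mult bounded_support_scale bump_bounded_support) auto
  show "pd i (\<lambda>y. \<phi> ((y - x) /\<^sub>R l) / l\<^sup>2) = (\<lambda>y. inverse l * (pd i \<phi> ((y - x) /\<^sub>R l) / l\<^sup>2))"
    unfolding eq[of \<phi>] pd_cmult[OF g] pd_affine[OF bump_smooth[OF assms(1)]]
    by (simp add: scaleR_right_diff_distrib)
qed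

lemma rescale_test_function: "\<phi> \<in> bump_functions \<Longrightarrow> l > 0 \<Longrightarrow> rescale \<phi> l x \<in> test_functions"
  unfolding rescale_def by (intro periodize_test_function rescale_inner)

lemma periodize_cmult: "periodize (\<lambda>y. c * g y) y = c * periodize g y"
  unfolding periodize_def by (rule infsum_cmult_right')

lemma periodize_add:
  assumes "bounded_support f" "bounded_support g"
  shows "periodize (\<lambda>y. f y + g y) x = periodize f x + periodize g x"
proof -
  obtain N where N: "\<And>y. norm y \<le> norm x \<Longrightarrow> periodize f y = (\<Sum>k\<in>index_box N. f (y + lattice_shift k))"
    "\<And>y k. norm y \<le> norm x \<Longrightarrow> k \<notin> index_box N \<Longrightarrow> f (y + lattice_shift k) = 0"
    using periodize_finite_sum[OF assms(1)] by metis
  obtain M where M: "\<And>y. norm y \<le> norm x \<Longrightarrow> periodize g y = (\<Sum>k\<in>index_box M. g (y + lattice_shift k))"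
    "\<And>y k. norm y \<le> norm x \<Longrightarrow> k \<notin> index_box M \<Longrightarrow> g (y + lattice_shift k) = 0"
    using periodize_finite_sum[OF assms(2)] by metis
  let ?F = "index_box N \<union> index_box M"
  have "periodize f x = (\<Sum>k\<in>?F. f (x + lattice_shift k))"
    "periodize g x = (\<Sum>k\<in>?F. g (x + lattice_shift k))"
    "periodize (\<lambda>y. f y + g y) x = (\<Sum>k\<in>?F. f (x + lattice_shift k) + g (x + lattice_shift k))"
    by (intro periodize_eq_sum; simp add: N(2) M(2))+
  then show ?thesis by (simp add: sum.distrib)
qed

lemma rescale_cmult: "rescale (\<lambda>z. c * \<phi> z) l x = (\<lambda>y. c * rescale \<phi> l x y)"
  unfolding rescale_def by (rule ext) (simp flip: periodize_cmult)

lemma rescale_add: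
  assumes "\<phi> \<in> bump_functions" "\<psi> \<in> bump_functions" "l > 0"
  shows "rescale (\<lambda>z. \<phi> z + \<psi> z) l x = (\<lambda>y. rescale \<phi> l x y + rescale \<psi> l x y)"
  unfolding rescale_def
  by (rule ext) (simp add: add_divide_distrib flip: periodize_add[OF rescale_inner(2)[OF assms(1,3)] rescale_inner(2)[OF assms(2,3)]])

lemma pd_rescale:
  assumes "\<phi> \<in> bump_functions" "l > 0"
  shows "pd i (rescale \<phi> l x) = (\<lambda>y. inverse l * rescale (pd i \<phi>) l x y)"
  unfolding rescale_def pd_periodize[OF rescale_inner(1,2)[OF assms]] rescale_inner(3)[OF assms]
  by (rule ext) (rule periodize_cmult)

lemma rescale_shift: "rescale \<phi> l x (z + y) = rescale \<phi> l (x - y) z"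
  unfolding rescale_def periodize_def by (simp add: algebra_simps)

lemma rescale_reflect: "rescale \<phi> l 0 (x - y) = rescale (\<lambda>z. \<phi> (- z)) l x y"
proof -
  have "bij_betw uminus (UNIV :: (int^2) set) UNIV" by (rule bij_uminus)
  from infsum_reindex_bij_betw[OF this, of "\<lambda>k. \<phi> ((x - y + lattice_shift k) /\<^sub>R l) / l\<^sup>2"]
  have "(\<Sum>\<^sub>\<infinity>k. \<phi> ((x - y + lattice_shift k) /\<^sub>R l) / l\<^sup>2) = (\<Sum>\<^sub>\<infinity>k. \<phi> ((x - y - lattice_shift k) /\<^sub>R l) / l\<^sup>2)"
    by simp
  moreover have "x - y - lattice_shift k = - (y + lattice_shift k - x)" for k by simp
  ultimately show ?thesis unfolding rescale_def periodize_def by (simp only: diff_zero scaleR_minus_right)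
qed

lemma rescale_half: "rescale (\<lambda>z. 4 * \<phi> (2 *\<^sub>R z)) l x = rescale \<phi> (l / 2) x"
proof -
  have "4 * \<phi> (2 *\<^sub>R ((y - x) /\<^sub>R l)) / l\<^sup>2 = \<phi> ((y - x) /\<^sub>R (l / 2)) / (l / 2)\<^sup>2" for y
    by (simp add: power_divide inverse_eq_divide)
  then show ?thesis unfolding rescale_def by simp
qed

lemma integral_rescale_mult:
  assumes \<phi>: "\<phi> \<in> bump_functions" and l: "l > 0"
    and f: "f \<in> borel_measurable borel" "periodic f" "\<And>x. \<bar>f x\<bar> \<le> B"
  shows "(\<integral>y. f y * rescale \<phi> l x y \<partial>tor) = (LINT z|lborel. f (x + l *\<^sub>R z) * \<phi> z)"
proof -
  let ?g = "\<lambda>y. \<phi> ((y - x) /\<^sub>R l) / l\<^sup>2"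
  note g = rescale_inner(1,2)[OF \<phi> l, of x]
  obtain C where C: "\<And>x. \<bar>\<phi> x\<bar> \<le> C" "C \<ge> 0" using bump_bounded[OF \<phi>] by blast
  have [measurable]: "f \<in> borel_measurable borel" "?g \<in> borel_measurable borel"
    by (rule f, rule smooth_borel[OF g(1)])
  have "(\<integral>y. f y * rescale \<phi> l x y \<partial>tor) = integral\<^sup>L tor (periodize (\<lambda>y. f y * ?g y))"
    unfolding rescale_def periodize_mult[OF f(2) g(2)] ..
  also have "\<dots> = (LINT y|lborel. f y * ?g y)"
  proof (rule integral_periodize)
    show "bounded_support (\<lambda>y. f y * ?g y)" by (rule bounded_support_mult[OF g(2)])
    show "\<bar>f y * ?g y\<bar> \<le> B * (C / l\<^sup>2)" for y
    proof -
      have "\<bar>?g y\<bar> \<le> C / l\<^sup>2" by (simp add: divide_right_mono C)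
      then show ?thesis unfolding abs_mult using f(3)[of y] by (intro mult_mono) auto
    qed
  qed measurable
  also have "\<dots> = l\<^sup>2 * (LINT z|lborel. f (x + l *\<^sub>R z) * ?g (x + l *\<^sub>R z))"
  proof (rule lborel_integral_affine)
    show "(\<lambda>y. f y * ?g y) \<in> borel_measurable borel" by measurable
  qed (use l in simp)
  also have "\<dots> = (LINT z|lborel. f (x + l *\<^sub>R z) * \<phi> z)"
  proof -
    have "(LINT z|lborel. f (x + l *\<^sub>R z) * ?g (x + l *\<^sub>R z)) = (LINT z|lborel. f (x + l *\<^sub>R z) * \<phi> z) / l\<^sup>2"
      using l by simp
    then show ?thesis using l by simp
  qed
  finally show ?thesis .
qed

lemma integral_rescale:
  assumes "\<phi> \<in> bump_functions" "l > 0"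
  shows "integral\<^sup>L tor (rescale \<phi> l x) = integral\<^sup>L lborel \<phi>"
  using integral_rescale_mult[OF assms, of "\<lambda>_. 1" 1 x] by (simp add: periodic_def)

text \<open>Periodization may superpose translates of opposite sign, so only an inequality holds.
  Testing against the sign of the periodized function reduces it to
  \<open>integral_rescale_mult\<close>.\<close>

lemma integral_abs_rescale_le:
  assumes "\<phi> \<in> bump_functions" "l > 0"
  shows "(\<integral>y. \<bar>rescale \<phi> l x y\<bar> \<partial>tor) \<le> (LINT z|lborel. \<bar>\<phi> z\<bar>)"
proof -
  let ?f = "\<lambda>y. sgn (rescale \<phi> l x y)"
  note t = rescale_test_function[OF assms, of x]
  have "(\<integral>y. \<bar>rescale \<phi> l x y\<bar> \<partial>tor) = (\<integral>y. ?f y * rescale \<phi> l x y \<partial>tor)"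
    by (simp add: mult_sgn_abs abs_sgn mult.commute)
  also have "\<dots> = (LINT z|lborel. ?f (x + l *\<^sub>R z) * \<phi> z)"
  proof (rule integral_rescale_mult[OF assms])
    show "?f \<in> borel_measurable borel"
      using test_functions_borel[OF t] by simp
    show "periodic ?f" using test_functionsD(2)[OF t] by (simp add: periodic_def)
    show "\<bar>?f y\<bar> \<le> 1" for y by (simp add: abs_sgn_eq)
  qed
  also have "\<dots> \<le> (LINT z|lborel. \<bar>\<phi> z\<bar>)"
  proof (rule integral_mono_AE')
    show "integrable lborel (\<lambda>z. \<bar>\<phi> z\<bar>)" using bump_integrable[OF assms(1)] by simp
    have "?f (x + l *\<^sub>R z) * \<phi> z \<le> \<bar>\<phi> z\<bar>" for z
      by (auto simp: sgn_if)
    then show "AE z in lborel. ?f (x + l *\<^sub>R z) * \<phi> z \<le> \<bar>\<phi> z\<bar>" by simp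
  qed simp
  finally show ?thesis .
qed

lemma foldr_pd_bump: "\<phi> \<in> bump_functions \<Longrightarrow> foldr pd is \<phi> \<in> bump_functions"
  by (induction "is") (auto intro: bump_pd)

lemma foldr_pd_rescale:
  assumes "\<phi> \<in> bump_functions" "l > 0"
  shows "foldr pd is (rescale \<phi> l x) = (\<lambda>y. inverse l ^ length is * rescale (foldr pd is \<phi>) l x y)"
proof (induction "is")
  case (Cons i "is")
  note b = foldr_pd_bump[OF assms(1), of "is"]
  show ?case
    using test_functionsD(1)[OF rescale_test_function[OF b assms(2)]]
    by (simp add: Cons pd_cmult pd_rescale[OF b assms(2)] mult_ac)
qed simp

text \<open>Membership in a multiple of \<open>test_ball 2\<close>, but for derivatives in any
  order, so that the product rule applies directly.\<close>

definition C2_bounded :: "(real^2 \<Rightarrow> real) \<Rightarrow> real \<Rightarrow> bool" where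
  "C2_bounded \<phi> M \<longleftrightarrow> (\<forall>x. \<bar>\<phi> x\<bar> \<le> M \<and> (\<forall>i. \<bar>pd i \<phi> x\<bar> \<le> M) \<and> (\<forall>i j. \<bar>pd i (pd j \<phi>) x\<bar> \<le> M))"

lemma C2_bounded_mpd:
  assumes "C2_bounded \<phi> M" "a + b \<le> 2"
  shows "\<bar>mpd a b \<phi> x\<bar> \<le> M"
proof -
  have "(a = 0 \<and> b = 0) \<or> (a = 1 \<and> b = 0) \<or> (a = 0 \<and> b = 1) \<or> (a = 2 \<and> b = 0) \<or> (a = 1 \<and> b = 1) \<or> (a = 0 \<and> b = 2)"
    using assms(2) by arith
  then show ?thesis using assms(1) by (auto simp: C2_bounded_def mpd_def numeral_2_eq_2)
qed

lemma ex_C2_bounded: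
  assumes "\<exists>B. \<forall>x. \<bar>\<phi> x\<bar> \<le> B" "\<And>i. \<exists>B. \<forall>x. \<bar>pd i \<phi> x\<bar> \<le> B"
    "\<And>i j. \<exists>B. \<forall>x. \<bar>pd i (pd j \<phi>) x\<bar> \<le> B"
  obtains M where "C2_bounded \<phi> M" "M > 0"
proof -
  obtain B0 where B0: "\<And>x. \<bar>\<phi> x\<bar> \<le> B0" using assms(1) by blast
  obtain B1 where B1: "\<And>i x. \<bar>pd i \<phi> x\<bar> \<le> B1 i" using assms(2) by metis
  obtain B2 where B2: "\<And>i j x. \<bar>pd i (pd j \<phi>) x\<bar> \<le> B2 i j" using assms(3) by metis
  define M where "M = 1 + B0 + (B1 1 + B1 2) + (B2 1 1 + B2 1 2 + B2 2 1 + B2 2 2)"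
  have nn: "0 \<le> B0" "0 \<le> B1 i" "0 \<le> B2 i j" for i j
    using order_trans[OF abs_ge_zero B0] order_trans[OF abs_ge_zero B1] order_trans[OF abs_ge_zero B2] by blast+
  have 1: "B1 i \<le> B1 1 + B1 2" for i
    using exhaust_2[of i] nn(2)[of 1] nn(2)[of 2] by auto
  have 2: "B2 i j \<le> B2 1 1 + B2 1 2 + B2 2 1 + B2 2 2" for i j
    using exhaust_2[of i] exhaust_2[of j] nn(3)[of 1 1] nn(3)[of 1 2] nn(3)[of 2 1] nn(3)[of 2 2] by auto
  note pos = nn(1) nn(2)[of 1] nn(2)[of 2] nn(3)[of 1 1] nn(3)[of 1 2] nn(3)[of 2 1] nn(3)[of 2 2]
  have "\<bar>\<phi> x\<bar> \<le> M" "\<bar>pd i \<phi> x\<bar> \<le> M" "\<bar>pd i (pd j \<phi>) x\<bar> \<le> M" for x i j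
    using B0[of x] B1[of i x] B2[of i j x] 1[of i] 2[of i j] pos unfolding M_def by linarith+
  then have "C2_bounded \<phi> M" unfolding C2_bounded_def by blast
  moreover have "M > 0" unfolding M_def using pos by linarith
  ultimately show ?thesis by (rule that)
qed

lemma bump_C2_bounded:
  assumes "\<phi> \<in> bump_functions"
  obtains M where "C2_bounded \<phi> M" "M > 0"
proof (rule ex_C2_bounded)
  have *: "\<exists>B. \<forall>x. \<bar>\<psi> x\<bar> \<le> B" if "\<psi> \<in> bump_functions" for \<psi>
    using bump_bounded[OF that] by blast
  show "\<exists>B. \<forall>x. \<bar>\<phi> x\<bar> \<le> B" "\<exists>B. \<forall>x. \<bar>pd i \<phi> x\<bar> \<le> B" "\<exists>B. \<forall>x. \<bar>pd i (pd j \<phi>) x\<bar> \<le> B" for i j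
    by (intro * bump_pd assms)+
qed

lemma test_function_C2_bounded:
  assumes "\<phi> \<in> test_functions"
  obtains M where "C2_bounded \<phi> M" "M > 0"
proof (rule ex_C2_bounded)
  have *: "\<exists>B. \<forall>x. \<bar>\<psi> x\<bar> \<le> B" if "\<psi> \<in> test_functions" for \<psi>
    using test_functions_bounded[OF that] by blast
  show "\<exists>B. \<forall>x. \<bar>\<phi> x\<bar> \<le> B" "\<exists>B. \<forall>x. \<bar>pd i \<phi> x\<bar> \<le> B" "\<exists>B. \<forall>x. \<bar>pd i (pd j \<phi>) x\<bar> \<le> B" for i j
    by (intro * test_functions_pd assms)+
qed

text \<open>For 0 < \<alpha> < 1 this says that the norm of index - 1 - \<alpha> is at most
  \<open>A\<close>, without extended reals (\<open>real_norm_neg_le_iff\<close>). The order 2 of the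
  test functions is the floor of 2 + \<alpha>.\<close>

definition neg_bound :: "real \<Rightarrow> ((real^2 \<Rightarrow> real) \<Rightarrow> real) \<Rightarrow> real \<Rightarrow> bool" where
  "neg_bound \<alpha> w A \<longleftrightarrow> (\<forall>x l \<phi>. 0 < l \<longrightarrow> l \<le> 1 \<longrightarrow> \<phi> \<in> test_ball 2 \<longrightarrow> \<bar>w (rescale \<phi> l x)\<bar> \<le> A * l powr (- 1 - \<alpha>))"

lemma neg_boundD:
  assumes "neg_bound \<alpha> w A" "real_dist w" "\<phi> \<in> bump_functions" "C2_bounded \<phi> M" "M > 0" "0 < l" "l \<le> 1"
  shows "\<bar>w (rescale \<phi> l x)\<bar> \<le> M * A * l powr (- 1 - \<alpha>)"
proof -
  have s: "smooth \<phi>" by (rule bump_smooth[OF assms(3)])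
  have "\<bar>inverse M * mpd a b \<phi> x\<bar> \<le> 1" if "a + b \<le> 2" for a b x
    using C2_bounded_mpd[OF assms(4) that, of x] assms(5) by (simp add: abs_mult inverse_eq_divide pos_divide_le_eq)
  then have "(\<lambda>z. inverse M * \<phi> z) \<in> test_ball 2"
    unfolding test_ball_def by (simp add: bump_cmult[OF assms(3)] mpd_cmult[OF s])
  then have "\<bar>w (rescale (\<lambda>z. inverse M * \<phi> z) l x)\<bar> \<le> A * l powr (- 1 - \<alpha>)"
    using assms(1,6,7) unfolding neg_bound_def by blast
  moreover have "w (rescale (\<lambda>z. inverse M * \<phi> z) l x) = inverse M * w (rescale \<phi> l x)"
    unfolding rescale_cmult by (rule real_dist_cmult[OF assms(2) rescale_test_function[OF assms(3,6)]])
  ultimately have "inverse M * \<bar>w (rescale \<phi> l x)\<bar> \<le> A * l powr (- 1 - \<alpha>)"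
    using assms(5) by (simp only: abs_mult abs_of_pos positive_imp_inverse_positive)
  then have "M * (inverse M * \<bar>w (rescale \<phi> l x)\<bar>) \<le> M * (A * l powr (- 1 - \<alpha>))"
    using assms(5) by (intro mult_left_mono) auto
  then show ?thesis using assms(5) by (simp add: mult.assoc[symmetric])
qed

lemma neg_bound_cv_rescale:
  assumes "\<phi> \<in> bump_functions"
  obtains M where "M > 0" "\<And>\<alpha> w A l x. neg_bound \<alpha> w A \<Longrightarrow> real_dist w \<Longrightarrow> 0 < l \<Longrightarrow> l \<le> 1 \<Longrightarrow>
    \<bar>cv w (rescale \<phi> l 0) x\<bar> \<le> M * A * l powr (- 1 - \<alpha>)"
proof -
  obtain M where M: "C2_bounded (\<lambda>z. \<phi> (- z)) M" "M > 0" by (rule bump_C2_bounded[OF bump_reflect[OF assms]])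
  show ?thesis
  proof (rule that[OF M(2)])
    fix \<alpha> A l :: real and w x assume a: "neg_bound \<alpha> w A" "real_dist w" "0 < l" "l \<le> 1"
    show "\<bar>cv w (rescale \<phi> l 0) x\<bar> \<le> M * A * l powr (- 1 - \<alpha>)"
      unfolding cv_def rescale_reflect by (rule neg_boundD[OF a(1,2) bump_reflect[OF assms] M a(3,4)])
  qed
qed

lemma
  assumes "integrable tor f" "\<phi> \<in> test_functions"
  shows tconv_cmult: "tconv f (\<lambda>x. c * \<phi> x) = (\<lambda>x. c * tconv f \<phi> x)"
    and tconv_add: "\<psi> \<in> test_functions \<Longrightarrow> tconv f (\<lambda>x. \<phi> x + \<psi> x) = (\<lambda>x. tconv f \<phi> x + tconv f \<psi> x)"
    and tconv_diff: "\<psi> \<in> test_functions \<Longrightarrow> tconv f (\<lambda>x. \<phi> x - \<psi> x) = (\<lambda>x. tconv f \<phi> x - tconv f \<psi> x)"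
proof -
  note w = real_dist_pairing[OF assms(1)] test_functions_reflect[OF assms(2)]
  show "tconv f (\<lambda>x. c * \<phi> x) = (\<lambda>x. c * tconv f \<phi> x)"
    unfolding tconv_def cv_def by (rule ext) (rule real_dist_cmult[OF w])
  assume \<psi>: "\<psi> \<in> test_functions"
  show "tconv f (\<lambda>x. \<phi> x + \<psi> x) = (\<lambda>x. tconv f \<phi> x + tconv f \<psi> x)"
    unfolding tconv_def cv_def by (rule ext) (rule real_dist_add[OF w test_functions_reflect[OF \<psi>]])
  show "tconv f (\<lambda>x. \<phi> x - \<psi> x) = (\<lambda>x. tconv f \<phi> x - tconv f \<psi> x)"
    unfolding tconv_def cv_def by (rule ext) (rule real_dist_diff[OF w test_functions_reflect[OF \<psi>]])
qed

lemma pd_pd_reflect: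
  assumes "smooth f"
  shows "pd i (pd j (\<lambda>y. f (x - y))) = (\<lambda>y. pd i (pd j f) (x - y))"
  by (simp only: pd_reflect[OF assms] pd_reflect[OF smooth_pd[OF assms]] minus_minus
      pd_uminus[OF smooth_reflect[OF smooth_pd[OF assms]]])

lemma fun_dist_of_real: "fun_dist (\<lambda>x. complex_of_real (f x)) \<phi> = of_real (pairing f \<phi>)"
  unfolding fun_dist_def set_integral_tor pairing_def by (simp flip: of_real_mult)

lemma zero_test_ball: "(\<lambda>_. 0) \<in> test_ball n"
  by (simp add: test_ball_def bump_functions_def smooth_const mpd_cmult[OF smooth_const, of _ _ 0 0, simplified])

lemma neg_bound_nonneg:
  assumes "neg_bound \<alpha> w A" "real_dist w"
  shows "A \<ge> 0"
proof -
  have "\<bar>w (rescale (\<lambda>_. 0) 1 0)\<bar> \<le> A * 1 powr (- 1 - \<alpha>)"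
    using assms(1) zero_test_ball unfolding neg_bound_def by (meson order_refl zero_less_one)
  moreover have "rescale (\<lambda>_. 0) 1 0 = (\<lambda>_. 0)" by (simp add: rescale_def periodize_def fun_eq_iff)
  ultimately show ?thesis by (simp add: real_dist_zero[OF assms(2) test_functions_const])
qed

lemma C2_bounded_reflect:
  assumes "C2_bounded f M" "smooth f"
  shows "C2_bounded (\<lambda>y. f (x - y)) M"
proof -
  have "\<bar>pd i (pd j (\<lambda>y. f (x - y))) z\<bar> \<le> M" for i j z
    unfolding pd_pd_reflect[OF assms(2)] using assms(1) by (simp add: C2_bounded_def)
  moreover have "\<bar>pd i (\<lambda>y. f (x - y)) z\<bar> \<le> M" "\<bar>f (x - z)\<bar> \<le> M" for i z
    unfolding pd_reflect[OF assms(2)] using assms(1) by (simp_all add: C2_bounded_def)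
  ultimately show ?thesis unfolding C2_bounded_def by blast
qed

lemma C2_bounded_mult:
  assumes f: "C2_bounded f M" "smooth f" and g: "C2_bounded g N" "smooth g"
  shows "C2_bounded (\<lambda>x. f x * g x) (4 * (M * N))"
proof -
  have b: "\<bar>a * b\<bar> \<le> M * N" if "\<bar>a\<bar> \<le> M" "\<bar>b\<bar> \<le> N" for a b
    unfolding abs_mult using that by (intro mult_mono) auto
  have fb: "\<bar>f x\<bar> \<le> M" "\<bar>pd i f x\<bar> \<le> M" "\<bar>pd i (pd j f) x\<bar> \<le> M" for x i j
    using f(1) unfolding C2_bounded_def by blast+
  have gb: "\<bar>g x\<bar> \<le> N" "\<bar>pd i g x\<bar> \<le> N" "\<bar>pd i (pd j g) x\<bar> \<le> N" for x i j
    using g(1) unfolding C2_bounded_def by blast+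
  have nn: "M * N \<ge> 0" using b[OF fb(1)[of 0] gb(1)[of 0]] by linarith
  show ?thesis
    unfolding C2_bounded_def
  proof (intro allI conjI)
    fix x i j
    show "\<bar>f x * g x\<bar> \<le> 4 * (M * N)" using b[OF fb(1)[of x] gb(1)[of x]] nn by linarith
    show "\<bar>pd i (\<lambda>x. f x * g x) x\<bar> \<le> 4 * (M * N)"
      using b[OF fb(2)[of i x] gb(1)[of x]] b[OF fb(1)[of x] gb(2)[of i x]] nn
      unfolding pd_mult[OF f(2) g(2)] by linarith
    have "pd i (pd j (\<lambda>x. f x * g x)) x =
      pd i (pd j f) x * g x + pd j f x * pd i g x + (pd i f x * pd j g x + f x * pd i (pd j g) x)"
      by (simp add: pd_mult pd_add f g smooth_pd smooth_mult)
    then show "\<bar>pd i (pd j (\<lambda>x. f x * g x)) x\<bar> \<le> 4 * (M * N)"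
      using b[OF fb(3)[of i j x] gb(1)[of x]] b[OF fb(2)[of j x] gb(2)[of i x]]
        b[OF fb(2)[of i x] gb(2)[of j x]] b[OF fb(1)[of x] gb(3)[of i j x]] by linarith
  qed
qed

text \<open>Fubini's theorem for convolutions, obtained by convolving with the constant 1 and
  exchanging the convolutions.\<close>

lemma integral_tconv:
  assumes "p \<in> test_functions" "\<eta> \<in> test_functions"
  shows "integral\<^sup>L tor (tconv p \<eta>) = integral\<^sup>L tor p * integral\<^sup>L tor \<eta>"
proof -
  have c: "tconv (\<lambda>_. 1) g = (\<lambda>_. integral\<^sup>L tor g)" if "g \<in> test_functions" for g
    by (rule ext) (simp add: tconv_eq integral_test_reflect[OF that])
  have i: "integrable tor (\<lambda>_. 1::real)" by (simp add: integrable_test_function)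
  have "integral\<^sup>L tor (tconv p \<eta>) = tconv (\<lambda>_. 1) (tconv p \<eta>) 0"
    by (simp add: c tconv_test_function integrable_test_function assms)
  also have "\<dots> = tconv p (tconv (\<lambda>_. 1) \<eta>) 0"
    by (simp only: tconv_tconv[OF integrable_test_function[OF assms(1)] i assms(2)])
  also have "\<dots> = integral\<^sup>L tor p * integral\<^sup>L tor \<eta>"
    by (simp add: c assms(2)) (simp add: tconv_eq)
  finally show ?thesis .
qed

lemma abs_integral_tor_le:
  assumes "\<And>x. \<bar>f x\<bar> \<le> B" "f \<in> borel_measurable borel"
  shows "\<bar>integral\<^sup>L tor f\<bar> \<le> 4 * pi\<^sup>2 * B"
  using pairing_bound[of "\<lambda>_. 1" f B] assms by (simp add: pairing_def integrable_test_function measure_tor)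

text \<open>Smearing with a mollifier expresses the pairing with an arbitrary smooth periodic function as an
  average of pairings with test functions supported in unit balls.\<close>

lemma tconv_smooth_bound:
  assumes \<rho>: "mollifier \<rho>" and \<phi>: "\<phi> \<in> test_functions"
  obtains C where "C > 0"
    "\<And>\<alpha> f A x. f \<in> test_functions \<Longrightarrow> neg_bound \<alpha> (pairing f) A \<Longrightarrow> \<bar>tconv f \<phi> x\<bar> \<le> C * A"
proof -
  have \<rho>b: "\<rho> \<in> bump_functions" "integral\<^sup>L lborel \<rho> = 1" using \<rho> by (auto simp: mollifier_def)
  let ?\<rho> = "\<lambda>z. \<rho> (- z)"
  let ?\<eta> = "rescale \<rho> 1 0"
  have \<rho>r: "?\<rho> \<in> bump_functions" by (rule bump_reflect[OF \<rho>b(1)])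
  obtain M where M: "C2_bounded \<phi> M" "M > 0" by (rule test_function_C2_bounded[OF \<phi>])
  obtain N where N: "C2_bounded ?\<rho> N" "N > 0" by (rule bump_C2_bounded[OF \<rho>r])
  have \<eta>: "?\<eta> \<in> test_functions" by (rule rescale_test_function[OF \<rho>b(1)]) simp
  have bound: "\<bar>tconv f \<phi> x\<bar> \<le> (4 * pi\<^sup>2 * (4 * (M * N))) * A"
    if f: "f \<in> test_functions" and A: "neg_bound \<alpha> (pairing f) A" for \<alpha> f A x
  proof -
    define p where "p y = f y * \<phi> (x - y)" for y
    have p: "p \<in> test_functions"
      unfolding p_def[abs_def] by (intro test_functions_mult test_functions_reflect f \<phi>)
    have z: "\<bar>tconv p ?\<eta> z\<bar> \<le> 4 * (M * N) * A" for z
    proof -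
      \<comment> \<open>The part of \<open>\<phi>\<close> seen through the mollifier centred at
        \<open>z\<close>, recentred at 0. Its derivatives are bounded uniformly in \<open>x\<close>
        and \<open>z\<close>, so one constant serves all windows.\<close>
      define \<theta> where "\<theta> \<zeta> = \<phi> (x - z - \<zeta>) * \<rho> (- \<zeta>)" for \<zeta>
      have \<theta>: "\<theta> \<in> bump_functions" "C2_bounded \<theta> (4 * (M * N))"
        unfolding \<theta>_def[abs_def]
        using test_functionsD(1)[OF \<phi>] bump_smooth[OF \<rho>r]
        by (auto intro!: bump_mult \<rho>r C2_bounded_mult smooth_reflect C2_bounded_reflect M N)
      have "\<phi> (x - y) * ?\<eta> (z - y) = rescale \<theta> 1 z y" for y
      proof -
        have bs: "bounded_support (\<lambda>y. ?\<rho> ((y - z) /\<^sub>R 1) / 1\<^sup>2)" by (rule rescale_inner(2)[OF \<rho>r]) simp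
        have "\<phi> (x - y) * ?\<eta> (z - y) = \<phi> (x - y) * periodize (\<lambda>y. ?\<rho> ((y - z) /\<^sub>R 1) / 1\<^sup>2) y"
          unfolding rescale_reflect unfolding rescale_def ..
        also have "\<dots> = periodize (\<lambda>y. \<phi> (x - y) * (?\<rho> ((y - z) /\<^sub>R 1) / 1\<^sup>2)) y"
          by (rule periodize_mult[OF test_functionsD(2)[OF test_functions_reflect[OF \<phi>]] bs])
        also have "\<dots> = rescale \<theta> 1 z y"
          unfolding rescale_def \<theta>_def by simp
        finally show ?thesis .
      qed
      then have "tconv p ?\<eta> z = pairing f (rescale \<theta> 1 z)"
        by (simp add: tconv_eq pairing_def p_def mult.assoc)
      moreover have "\<bar>pairing f (rescale \<theta> 1 z)\<bar> \<le> 4 * (M * N) * A * 1 powr (- 1 - \<alpha>)"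
        by (rule neg_boundD[OF A real_dist_pairing[OF integrable_test_function[OF f]] \<theta>])
          (use M N in auto)
      ultimately show ?thesis by simp
    qed
    \<comment> \<open>\<open>?\<eta>\<close> has integral one, so smearing \<open>p\<close> with it
      does not change the integral.\<close>
    have "tconv f \<phi> x = integral\<^sup>L tor p * integral\<^sup>L tor ?\<eta>"
      using integral_rescale[OF \<rho>b(1), of 1 0] \<rho>b(2) by (simp add: tconv_eq p_def[abs_def])
    also have "\<dots> = integral\<^sup>L tor (tconv p ?\<eta>)" by (rule integral_tconv[OF p \<eta>, symmetric])
    finally show ?thesis
      using abs_integral_tor_le[OF z test_functions_borel[OF tconv_test_function[OF integrable_test_function[OF p] \<eta>]]]
      by (simp add: mult_ac)
  qed
  show ?thesis by (rule that[OF _ bound]) (use M N in auto)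
qed

text \<open>Bundles \<open>K\<close> with the kernel and the profile of
  \<open>ex_green_kernel\<close>. The letter \<open>\<kappa>\<close> denotes this kernel here; in
  the final statement it is an exponent.\<close>

locale green_kernel =
  fixes K \<kappa> r :: "real^2 \<Rightarrow> real"
  assumes green: "green_function K"
    and \<kappa>: "\<kappa> \<in> bump_functions" and r: "r \<in> bump_functions" and integral_r: "integral\<^sup>L lborel r = 1"
    and laplace: "\<And>x. pd 1 (pd 1 \<kappa>) x + pd 2 (pd 2 \<kappa>) x = r x - 4 * r (2 *\<^sub>R x)"
begin

lemma K_integrable: "integrable tor K"
  using green by (simp add: green_function_def set_integrable_tor)

lemma green_identity:
  assumes "\<psi> \<in> test_functions"
  shows "tconv K (\<lambda>x. pd 1 (pd 1 \<psi>) x + pd 2 (pd 2 \<psi>) x) x = integral\<^sup>L tor \<psi> / (4 * pi\<^sup>2) - \<psi> x"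
proof -
  let ?\<phi> = "\<lambda>y. \<psi> (x - y)"
  have t: "?\<phi> \<in> test_functions" by (rule test_functions_reflect[OF assms])
  have s: "smooth \<psi>" using test_functionsD assms by blast
  have pp: "pd i (pd i ?\<phi>) = (\<lambda>y. pd i (pd i \<psi>) (x - y))" for i
    by (rule pd_pd_reflect[OF s])
  have "- dist_laplace (fun_dist (\<lambda>x. complex_of_real (K x))) ?\<phi>
      = of_real (?\<phi> 0) - fun_dist (\<lambda>x. 1 / (4 * of_real pi ^ 2)) ?\<phi>"
    using green t unfolding green_function_def by blast
  also have "fun_dist (\<lambda>x. 1 / (4 * complex_of_real pi ^ 2)) ?\<phi> = of_real (pairing (\<lambda>x. 1 / (4 * pi ^ 2)) ?\<phi>)"
    using fun_dist_of_real[of "\<lambda>x. 1 / (4 * pi ^ 2)" ?\<phi>] by simp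
  also have "dist_laplace (fun_dist (\<lambda>x. complex_of_real (K x))) ?\<phi>
      = of_real (pairing K (pd 1 (pd 1 ?\<phi>)) + pairing K (pd 2 (pd 2 ?\<phi>)))"
    by (simp add: dist_laplace_def dist_pd_def fun_dist_of_real)
  finally have "- (pairing K (pd 1 (pd 1 ?\<phi>)) + pairing K (pd 2 (pd 2 ?\<phi>)))
      = ?\<phi> 0 - pairing (\<lambda>x. 1 / (4 * pi ^ 2)) ?\<phi>"
    by (simp only: of_real_eq_iff flip: of_real_minus of_real_diff)
  moreover have "pairing (\<lambda>x. 1 / (4 * pi ^ 2)) ?\<phi> = integral\<^sup>L tor \<psi> / (4 * pi\<^sup>2)"
    by (simp add: pairing_def integral_test_reflect[OF assms])
  moreover have "tconv K (\<lambda>x. pd 1 (pd 1 \<psi>) x + pd 2 (pd 2 \<psi>) x) x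
      = pairing K (pd 1 (pd 1 ?\<phi>)) + pairing K (pd 2 (pd 2 ?\<phi>))"
    by (simp add: tconv_add K_integrable test_functions_pd assms) (simp add: tconv_eq pairing_def pp)
  ultimately show ?thesis by simp
qed

definition r_scale :: "nat \<Rightarrow> real^2 \<Rightarrow> real" where
  "r_scale n = rescale r ((1/2) ^ n) 0"

text \<open>The factor cancels the normalization of \<open>rescale\<close>: the kernels keep their
  size and only shrink in support, like the dyadic pieces of a logarithm.\<close>

definition \<kappa>_scale :: "nat \<Rightarrow> real^2 \<Rightarrow> real" where
  "\<kappa>_scale n = (\<lambda>y. ((1/2) ^ n)\<^sup>2 * rescale \<kappa> ((1/2) ^ n) 0 y)"

text \<open>The Green function averaged at scale 2^-n. Up to constants these are the partial sums of
  the kernels, by \<open>K_scale_Suc\<close>.\<close>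

definition K_scale :: "nat \<Rightarrow> real^2 \<Rightarrow> real" where
  "K_scale n = tconv K (r_scale n)"

lemma r_scale_test: "r_scale n \<in> test_functions"
  unfolding r_scale_def by (rule rescale_test_function[OF r]) simp

lemma \<kappa>_scale_test: "\<kappa>_scale n \<in> test_functions"
  unfolding \<kappa>_scale_def by (intro test_functions_cmult rescale_test_function[OF \<kappa>]) simp

lemma K_scale_test: "K_scale n \<in> test_functions"
  unfolding K_scale_def by (rule tconv_test_function[OF K_integrable r_scale_test])

lemma laplace_\<kappa>_scale:
  "pd 1 (pd 1 (\<kappa>_scale n)) x + pd 2 (pd 2 (\<kappa>_scale n)) x = r_scale n x - r_scale (Suc n) x"
proof -
  define l :: real where "l = (1/2) ^ n"
  have l: "l > 0" by (simp add: l_def)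
  have pp: "pd i (pd i (\<kappa>_scale n)) = rescale (pd i (pd i \<kappa>)) l 0" for i
  proof -
    have "pd i (pd i (\<kappa>_scale n)) = (\<lambda>y. l\<^sup>2 * foldr pd [i, i] (rescale \<kappa> l 0) y)"
      unfolding \<kappa>_scale_def l_def[symmetric]
      using test_functionsD(1)[OF rescale_test_function[OF \<kappa> l]] by (simp add: pd_cmult smooth_pd)
    then show ?thesis
      unfolding foldr_pd_rescale[OF \<kappa> l] using l by (simp add: power2_eq_square field_simps)
  qed
  have r2: "(\<lambda>z. 4 * r (2 *\<^sub>R z)) \<in> bump_functions"
  proof (rule bump_functionsI[of _ "1/2"])
    show "smooth (\<lambda>z. 4 * r (2 *\<^sub>R z))"
      using smooth_affine[OF bump_smooth[OF r], of 0 2] by (intro smooth_cmult) simp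
    show "4 * r (2 *\<^sub>R x) = 0" if "1/2 \<le> norm x" for x
      using that by (simp add: bump_eq_0[OF r])
  qed simp
  have pb: "pd i (pd i \<kappa>) \<in> bump_functions" for i by (intro bump_pd \<kappa>)
  have "rescale (\<lambda>z. pd 1 (pd 1 \<kappa>) z + pd 2 (pd 2 \<kappa>) z) l 0 x = rescale (\<lambda>z. r z + (-1) * (4 * r (2 *\<^sub>R z))) l 0 x"
    by (simp add: laplace)
  also have "\<dots> = rescale r l 0 x + rescale (\<lambda>z. (-1) * (4 * r (2 *\<^sub>R z))) l 0 x"
    by (simp only: rescale_add[OF r bump_cmult[OF r2] l])
  also have "\<dots> = rescale r l 0 x - rescale r (l / 2) 0 x"
    unfolding rescale_cmult[of "-1"] rescale_half by simp
  finally show ?thesis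
    unfolding pp r_scale_def l_def[symmetric] rescale_add[OF pb pb l] by (simp add: l_def)
qed

text \<open>Convolving \<open>K\<close> with the Laplacian of a kernel returns minus that kernel, up
  to its mean. This constant disappears from all derivatives, and only derivatives of
  \<open>K_scale\<close> enter the estimates.\<close>

lemma K_scale_Suc:
  "K_scale (Suc n) x = K_scale n x + \<kappa>_scale n x - integral\<^sup>L tor (\<kappa>_scale n) / (4 * pi\<^sup>2)"
proof -
  have "K_scale n x - K_scale (Suc n) x = tconv K (\<lambda>x. r_scale n x - r_scale (Suc n) x) x"
    unfolding K_scale_def by (simp add: tconv_diff[OF K_integrable r_scale_test r_scale_test])
  also have "\<dots> = integral\<^sup>L tor (\<kappa>_scale n) / (4 * pi\<^sup>2) - \<kappa>_scale n x"
    using green_identity[OF \<kappa>_scale_test, of n x] by (simp add: laplace_\<kappa>_scale)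
  finally show ?thesis by simp
qed

lemma pd_K_scale_Suc:
  "pd i (K_scale (Suc n)) = (\<lambda>x. pd i (K_scale n) x + pd i (\<kappa>_scale n) x)"
proof -
  have "K_scale (Suc n) = (\<lambda>x. (K_scale n x + \<kappa>_scale n x) - integral\<^sup>L tor (\<kappa>_scale n) / (4 * pi\<^sup>2))"
    by (rule ext) (simp add: K_scale_Suc)
  then show ?thesis
    using test_functionsD(1)[OF K_scale_test, of n] test_functionsD(1)[OF \<kappa>_scale_test, of n]
    by (simp add: pd_diff pd_add smooth_add smooth_const)
qed

text \<open>The kernel has size of order one on a set of area of order 4^-n, and each derivative
  costs 2^n.\<close>

lemma foldr_pd_\<kappa>_scale_L1:
  "(\<integral>y. \<bar>foldr pd is (\<kappa>_scale n) y\<bar> \<partial>tor) \<le> (LINT z|lborel. \<bar>foldr pd is \<kappa> z\<bar>) * (2 ^ n) ^ length is / 4 ^ n"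
proof -
  define l :: real where "l = (1/2) ^ n"
  have l: "l > 0" by (simp add: l_def)
  have "foldr pd is (\<lambda>y. l\<^sup>2 * f y) = (\<lambda>y. l\<^sup>2 * foldr pd is f y)" if "smooth f" for f
  proof -
    have "smooth (foldr pd is f) \<and> foldr pd is (\<lambda>y. l\<^sup>2 * f y) = (\<lambda>y. l\<^sup>2 * foldr pd is f y)"
      by (induction "is") (auto simp: that smooth_pd pd_cmult)
    then show ?thesis ..
  qed
  from this[OF test_functionsD(1)[OF rescale_test_function[OF \<kappa> l]]]
  have "(\<integral>y. \<bar>foldr pd is (\<kappa>_scale n) y\<bar> \<partial>tor)
      = l\<^sup>2 * inverse l ^ length is * (\<integral>y. \<bar>rescale (foldr pd is \<kappa>) l 0 y\<bar> \<partial>tor)"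
    unfolding \<kappa>_scale_def l_def[symmetric] foldr_pd_rescale[OF \<kappa> l]
    using l by (simp add: abs_mult mult.assoc)
  also have "\<dots> \<le> l\<^sup>2 * inverse l ^ length is * (LINT z|lborel. \<bar>foldr pd is \<kappa> z\<bar>)"
    using l by (intro mult_left_mono integral_abs_rescale_le foldr_pd_bump \<kappa>) auto
  also have "l\<^sup>2 = 1 / 4 ^ n"
    unfolding l_def power_mult[symmetric] by (simp add: mult.commute[of n] power_mult power_one_over)
  also have "inverse l = 2 ^ n" by (simp add: l_def power_one_over)
  finally show ?thesis by (simp add: mult_ac)
qed

end

section \<open>The Jacobian estimate\<close>

definition jac :: "(real^2 \<Rightarrow> real) \<Rightarrow> (real^2 \<Rightarrow> real) \<Rightarrow> real^2 \<Rightarrow> real" where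
  "jac u v x = pd 1 u x * pd 2 v x - pd 2 u x * pd 1 v x"

lemma jac_test_function: "u \<in> test_functions \<Longrightarrow> v \<in> test_functions \<Longrightarrow> jac u v \<in> test_functions"
  unfolding jac_def[abs_def] by (intro test_functions_diff test_functions_mult test_functions_pd)

lemma jac_bound:
  assumes "\<And>i. \<bar>pd i u x\<bar> \<le> U" "\<And>i. \<bar>pd i v x\<bar> \<le> V"
  shows "\<bar>jac u v x\<bar> \<le> 2 * (U * V)"
proof -
  have "\<bar>pd i u x * pd j v x\<bar> \<le> U * V" for i j
    unfolding abs_mult using assms[of 1] by (intro mult_mono assms) auto
  from this[of 1 2] this[of 2 1] show ?thesis unfolding jac_def by linarith
qed

text \<open>The two integrands differ by a divergence, since the mixed second derivatives of
  \<open>v\<close> cancel. The derivatives can therefore be shifted cyclically from one factor to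
  another.\<close>

lemma pairing_jac_cyclic:
  assumes "\<phi> \<in> test_functions" "u \<in> test_functions" "v \<in> test_functions"
  shows "pairing \<phi> (jac u v) = pairing u (jac v \<phi>)"
proof -
  note s = assms[THEN test_functionsD(1)]
  have i: "integrable tor (\<lambda>x. \<phi> x * jac u v x)" "integrable tor (\<lambda>x. u x * jac v \<phi> x)"
    by (intro integrable_test_function test_functions_mult jac_test_function assms)+
  have t: "(\<lambda>x. \<phi> x * u x * pd i v x) \<in> test_functions" for i
    by (intro test_functions_mult test_functions_pd assms)
  have d: "pd j (\<lambda>x. \<phi> x * u x * pd i v x) =
      (\<lambda>x. (pd j \<phi> x * u x + \<phi> x * pd j u x) * pd i v x + \<phi> x * u x * pd j (pd i v) x)" for i j
    by (simp add: pd_mult smooth_mult smooth_pd s)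
  have "pairing \<phi> (jac u v) - pairing u (jac v \<phi>) = (\<integral>x. \<phi> x * jac u v x - u x * jac v \<phi> x \<partial>tor)"
    unfolding pairing_def by (rule Bochner_Integration.integral_diff[OF i, symmetric])
  also have "\<dots> = (\<integral>x. pd 1 (\<lambda>x. \<phi> x * u x * pd 2 v x) x - pd 2 (\<lambda>x. \<phi> x * u x * pd 1 v x) x \<partial>tor)"
    unfolding d jac_def pd_commute[OF s(3), of 1 2] by (simp add: algebra_simps)
  also have "\<dots> = 0"
    by (subst Bochner_Integration.integral_diff)
      (simp_all only: integral_pd t integrable_test_function test_functions_pd diff_self)
  finally show ?thesis by simp
qed

definition L1 :: "(real^2 \<Rightarrow> real) \<Rightarrow> real" where
  "L1 f = (\<integral>x. \<bar>f x\<bar> \<partial>tor)"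

lemma L1_nonneg: "L1 f \<ge> 0"
  by (simp add: L1_def)

lemma L1_add:
  assumes "f \<in> test_functions" "g \<in> test_functions"
  shows "L1 (\<lambda>x. f x + g x) \<le> L1 f + L1 g"
proof -
  have "L1 (\<lambda>x. f x + g x) \<le> (\<integral>x. \<bar>f x\<bar> + \<bar>g x\<bar> \<partial>tor)"
    unfolding L1_def
    by (intro integral_mono Bochner_Integration.integrable_add integrable_abs integrable_test_function assms abs_triangle_ineq)
  also have "\<dots> = L1 f + L1 g"
    unfolding L1_def
    by (intro Bochner_Integration.integral_add integrable_abs integrable_test_function assms)
  finally show ?thesis .
qed

lemma L1_pd_reflect:
  assumes "k \<in> test_functions"
  shows "L1 (pd i (\<lambda>y. k (x - y))) = L1 (pd i k)"
proof -
  have t: "pd i k \<in> test_functions" by (rule test_functions_pd[OF assms])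
  obtain B where B: "\<And>x. \<bar>pd i k x\<bar> \<le> B" using test_functions_bounded[OF t] by blast
  have "(\<integral>y. \<bar>pd i k (x - y)\<bar> \<partial>tor) = (\<integral>y. \<bar>pd i k y\<bar> \<partial>tor)"
    by (rule integral_tor_reflect[where f = "\<lambda>y. \<bar>pd i k y\<bar>" and B = B])
      (use test_functions_borel[OF t] test_functionsD(2)[OF t] B in \<open>auto simp: periodic_def\<close>)
  then show ?thesis by (simp add: L1_def pd_reflect test_functionsD(1)[OF assms])
qed

text \<open>By the cyclic identity the derivative that falls on \<open>d\<close> is moved to
  \<open>k\<close>. Only the size of \<open>d\<close> enters, so a \<open>d\<close> built from a
  small kernel gives a small term even though its gradient is large.\<close>

lemma tconv_jac_bound:
  assumes "k \<in> test_functions" "d \<in> test_functions" "v \<in> test_functions"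
    and d: "\<And>x. \<bar>d x\<bar> \<le> \<delta>" and V: "\<And>i x. \<bar>pd i v x\<bar> \<le> V" and b: "\<And>i. L1 (pd i k) \<le> b"
  shows "\<bar>tconv k (jac d v) x\<bar> \<le> 2 * b * (\<delta> * V)"
proof -
  let ?\<phi> = "\<lambda>y. k (x - y)"
  have \<phi>: "?\<phi> \<in> test_functions" by (rule test_functions_reflect[OF assms(1)])
  have "tconv k (jac d v) x = pairing ?\<phi> (jac d v)"
    unfolding tconv_commute[OF assms(1) jac_test_function[OF assms(2,3)]]
    by (simp add: tconv_eq pairing_def mult.commute)
  also have "\<dots> = pairing d (jac v ?\<phi>)" by (rule pairing_jac_cyclic[OF \<phi> assms(2,3)])
  finally have eq: "tconv k (jac d v) x = pairing d (jac v ?\<phi>)" .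
  have nn: "\<delta> \<ge> 0" "V \<ge> 0" using d[of 0] V[of 1 0] by linarith+
  note t = test_functions_pd[OF \<phi>] jac_test_function[OF assms(3) \<phi>]
  have "\<bar>pairing d (jac v ?\<phi>)\<bar> \<le> (\<integral>y. \<bar>d y * jac v ?\<phi> y\<bar> \<partial>tor)" unfolding pairing_def by (rule integral_abs_bound)
  also have "\<dots> \<le> (\<integral>y. \<delta> * V * (\<bar>pd 2 ?\<phi> y\<bar> + \<bar>pd 1 ?\<phi> y\<bar>) \<partial>tor)"
  proof (rule integral_mono)
    show "integrable tor (\<lambda>y. \<bar>d y * jac v ?\<phi> y\<bar>)"
      by (intro integrable_abs integrable_test_function test_functions_mult assms t)
    show "integrable tor (\<lambda>y. \<delta> * V * (\<bar>pd 2 ?\<phi> y\<bar> + \<bar>pd 1 ?\<phi> y\<bar>))"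
      by (intro integrable_mult_right Bochner_Integration.integrable_add integrable_abs integrable_test_function t)
    fix y
    have "\<bar>jac v ?\<phi> y\<bar> \<le> \<bar>pd 1 v y\<bar> * \<bar>pd 2 ?\<phi> y\<bar> + \<bar>pd 2 v y\<bar> * \<bar>pd 1 ?\<phi> y\<bar>"
      unfolding jac_def by (simp add: abs_mult[symmetric])
    also have "\<dots> \<le> V * \<bar>pd 2 ?\<phi> y\<bar> + V * \<bar>pd 1 ?\<phi> y\<bar>"
      by (intro add_mono mult_right_mono V) auto
    finally have "\<bar>jac v ?\<phi> y\<bar> \<le> V * (\<bar>pd 2 ?\<phi> y\<bar> + \<bar>pd 1 ?\<phi> y\<bar>)" by (simp add: distrib_left)
    then show "\<bar>d y * jac v ?\<phi> y\<bar> \<le> \<delta> * V * (\<bar>pd 2 ?\<phi> y\<bar> + \<bar>pd 1 ?\<phi> y\<bar>)"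
      unfolding abs_mult mult.assoc using d nn by (intro mult_mono) auto
  qed
  also have "\<dots> = \<delta> * V * (L1 (pd 2 ?\<phi>) + L1 (pd 1 ?\<phi>))"
    unfolding L1_def
    by (simp only: integral_mult_right_zero,
        subst Bochner_Integration.integral_add) (simp_all only: integrable_abs integrable_test_function t)
  also have "\<dots> \<le> \<delta> * V * (b + b)"
    unfolding L1_pd_reflect[OF assms(1)] using nn by (intro mult_left_mono add_mono b) auto
  finally show ?thesis unfolding eq by (simp add: mult_ac)
qed

text \<open>One step of the telescoping. The change of the trilinear expression splits into three
  terms, one for each factor that changes. The change of the outer kernel is measured in
  \<open>L1\<close> and bounded directly; the changes of \<open>u\<close> and \<open>v\<close> are
  small only without derivatives and go through \<open>tconv_jac_bound\<close>.\<close>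

lemma jac_step:
  assumes t: "k \<in> test_functions" "\<delta>k \<in> test_functions" "u \<in> test_functions" "u' \<in> test_functions" "d \<in> test_functions"
      "v \<in> test_functions" "v' \<in> test_functions" "e \<in> test_functions"
    and du: "\<And>i x. pd i u' x = pd i u x + pd i d x" and dv: "\<And>i x. pd i v' x = pd i v x + pd i e x"
    and U: "\<And>i x. \<bar>pd i u x\<bar> \<le> U" "\<And>i x. \<bar>pd i u' x\<bar> \<le> U"
    and V: "\<And>i x. \<bar>pd i v' x\<bar> \<le> V"
    and d: "\<And>x. \<bar>d x\<bar> \<le> du" and e: "\<And>x. \<bar>e x\<bar> \<le> dv"
    and a: "L1 \<delta>k \<le> a" and b: "\<And>i. L1 (pd i k) \<le> b"
  shows "\<bar>tconv (\<lambda>x. k x + \<delta>k x) (jac u' v') x - tconv k (jac u v) x\<bar> \<le> a * (2 * (U * V)) + 2 * b * (du * V + dv * U)"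
proof -
  note j = jac_test_function[OF t(4,7)] jac_test_function[OF t(5,7)] jac_test_function[OF t(3,8)] jac_test_function[OF t(3,6)]
    jac_test_function[OF t(8,3)]
  note ik = integrable_test_function[OF t(1)]
  have "tconv (\<lambda>x. k x + \<delta>k x) (jac u' v') x = tconv k (jac u' v') x + tconv \<delta>k (jac u' v') x"
    unfolding tconv_commute[OF test_functions_add[OF t(1,2)] j(1)] tconv_commute[OF t(1) j(1)] tconv_commute[OF t(2) j(1)]
    by (simp add: tconv_add integrable_test_function j t)
  \<comment> \<open>The change of \<open>v\<close> is written with the Jacobian reversed, so that
    the small function \<open>e\<close> stands in the first slot, as \<open>tconv_jac_bound\<close>
    expects.\<close>
  moreover have "jac u' v' = (\<lambda>x. jac u v x + (jac d v' x - jac e u x))"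
    by (rule ext) (simp add: jac_def du dv algebra_simps)
  then have "tconv k (jac u' v') x = tconv k (jac u v) x + (tconv k (jac d v') x - tconv k (jac e u) x)"
    by (simp add: tconv_add[OF ik j(4) test_functions_diff[OF j(2,5)]] tconv_diff[OF ik j(2,5)])
  moreover have "\<bar>tconv \<delta>k (jac u' v') x\<bar> \<le> a * (2 * (U * V))"
  proof -
    have nn: "0 \<le> 2 * (U * V)" using jac_bound[OF U(2)[of _ 0] V[of _ 0]] by (rule order_trans[OF abs_ge_zero])
    have "\<bar>tconv \<delta>k (jac u' v') x\<bar> \<le> L1 \<delta>k * (2 * (U * V))"
      unfolding L1_def by (rule tconv_bound[OF integrable_test_function[OF t(2)] j(1) jac_bound[OF U(2) V]])
    also have "\<dots> \<le> a * (2 * (U * V))" using nn by (rule mult_right_mono[OF a])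
    finally show ?thesis .
  qed
  moreover have "\<bar>tconv k (jac d v') x\<bar> \<le> 2 * b * (du * V)" by (rule tconv_jac_bound[OF t(1,5,7) d V b])
  moreover have "\<bar>tconv k (jac e u) x\<bar> \<le> 2 * b * (dv * U)" by (rule tconv_jac_bound[OF t(1,8,3) e U(1) b])
  ultimately show ?thesis by (simp add: distrib_left)
qed

text \<open>The smaller of two bounds is at most any weighted geometric mean of them.\<close>

lemma powr_interpolation:
  fixes d X p s \<theta> :: real
  assumes "\<bar>d\<bar> \<le> X * p" "\<bar>d\<bar> \<le> X * s" "X \<ge> 0" "p > 0" "s > 0" "0 < \<theta>" "\<theta> < 1"
  shows "\<bar>d\<bar> \<le> X * (p powr \<theta> * s powr (1 - \<theta>))"
proof -
  have "min p s > 0" using assms(4,5) by simp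
  then have "min p s = min p s powr \<theta> * min p s powr (1 - \<theta>)" by (simp flip: powr_add)
  also have "\<dots> \<le> p powr \<theta> * s powr (1 - \<theta>)"
    using assms(4-7) by (intro mult_mono powr_mono2) auto
  finally have "X * min p s \<le> X * (p powr \<theta> * s powr (1 - \<theta>))" using assms(3) by (rule mult_left_mono)
  moreover have "\<bar>d\<bar> \<le> X * min p s" using assms(1,2) by (simp add: min_def)
  ultimately show ?thesis by linarith
qed

context green_kernel
begin

lemma pd_tconv_K_scale_Suc:
  assumes "f \<in> test_functions"
  shows "pd i (tconv f (K_scale (Suc n))) x = pd i (tconv f (K_scale n)) x + pd i (tconv f (\<kappa>_scale n)) x"
  by (simp add: pd_tconv integrable_test_function assms K_scale_test \<kappa>_scale_test pd_K_scale_Suc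
      tconv_add test_functions_pd)

lemma half_power_powr: "((1/2::real) ^ n) powr (- 1 - \<alpha>) = 2 ^ n * (2 powr \<alpha>) ^ n"
proof -
  have "((1/2::real) ^ n) powr (- 1 - \<alpha>) = (2 powr (- real n)) powr (- 1 - \<alpha>)"
    by (simp add: powr_minus powr_realpow power_one_over inverse_eq_divide)
  also have "\<dots> = 2 powr (real n * (1 + \<alpha>))" by (simp add: powr_powr algebra_simps)
  also have "\<dots> = 2 ^ n * (2 powr \<alpha>) ^ n"
    by (simp add: powr_add distrib_left powr_realpow powr_power mult.commute)
  finally show ?thesis .
qed

text \<open>The weight 4^-n of the kernel meets the growth l^(-1-\<alpha>) of \<open>f\<close> at l
  = 2^-n, which leaves (2^\<alpha> / 2)^n. One derivative costs 2^n.\<close>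

lemma tconv_\<kappa>_scale_bound:
  obtains C where "C > 0"
    "\<And>\<alpha> f A n x. f \<in> test_functions \<Longrightarrow> neg_bound \<alpha> (pairing f) A \<Longrightarrow>
      \<bar>tconv f (\<kappa>_scale n) x\<bar> \<le> C * A * (2 powr \<alpha> / 2) ^ n"
    "\<And>\<alpha> f A n x i. f \<in> test_functions \<Longrightarrow> neg_bound \<alpha> (pairing f) A \<Longrightarrow>
      \<bar>pd i (tconv f (\<kappa>_scale n)) x\<bar> \<le> C * A * (2 powr \<alpha>) ^ n"
proof -
  obtain M where M: "M > 0" "\<And>\<alpha> w A l x. neg_bound \<alpha> w A \<Longrightarrow> real_dist w \<Longrightarrow> 0 < l \<Longrightarrow> l \<le> 1 \<Longrightarrow>
    \<bar>cv w (rescale \<kappa> l 0) x\<bar> \<le> M * A * l powr (- 1 - \<alpha>)"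
    using neg_bound_cv_rescale[OF \<kappa>] by blast
  obtain M1 where M1: "M1 > 0" "\<And>\<alpha> w A l x. neg_bound \<alpha> w A \<Longrightarrow> real_dist w \<Longrightarrow> 0 < l \<Longrightarrow> l \<le> 1 \<Longrightarrow>
    \<bar>cv w (rescale (pd 1 \<kappa>) l 0) x\<bar> \<le> M1 * A * l powr (- 1 - \<alpha>)"
    using neg_bound_cv_rescale[OF bump_pd[OF \<kappa>]] by blast
  obtain M2 where M2: "M2 > 0" "\<And>\<alpha> w A l x. neg_bound \<alpha> w A \<Longrightarrow> real_dist w \<Longrightarrow> 0 < l \<Longrightarrow> l \<le> 1 \<Longrightarrow>
    \<bar>cv w (rescale (pd 2 \<kappa>) l 0) x\<bar> \<le> M2 * A * l powr (- 1 - \<alpha>)"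
    using neg_bound_cv_rescale[OF bump_pd[OF \<kappa>]] by blast
  define C where "C = M + M1 + M2"
  have le: "M \<le> C" "M1 \<le> C" "M2 \<le> C" unfolding C_def using M(1) M1(1) M2(1) by linarith+
  show ?thesis
  proof (rule that[of C])
    show "C > 0" unfolding C_def using M(1) M1(1) M2(1) by linarith
  next
    fix \<alpha> A :: real and f n x assume f: "f \<in> test_functions" and A: "neg_bound \<alpha> (pairing f) A"
    define l :: real where "l = (1/2) ^ n"
    have l: "0 < l" "l \<le> 1" by (simp_all add: l_def power_le_one)
    note w = real_dist_pairing[OF integrable_test_function[OF f]]
    have A0: "A \<ge> 0" by (rule neg_bound_nonneg[OF A w])
    have lp: "l powr (- 1 - \<alpha>) = 2 ^ n * (2 powr \<alpha>) ^ n" unfolding l_def by (rule half_power_powr)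
    have t: "rescale \<phi> l 0 \<in> test_functions" if "\<phi> \<in> bump_functions" for \<phi>
      by (rule rescale_test_function[OF that l(1)])
    have eq: "tconv f (\<kappa>_scale n) = (\<lambda>x. l\<^sup>2 * tconv f (rescale \<kappa> l 0) x)"
      unfolding \<kappa>_scale_def l_def[symmetric] by (rule tconv_cmult[OF integrable_test_function[OF f] t[OF \<kappa>]])
    have b: "\<bar>tconv f (rescale \<kappa> l 0) x\<bar> \<le> C * A * l powr (- 1 - \<alpha>)"
      using M(2)[OF A w l, of x] le(1) A0 unfolding tconv_def
      by (elim order_trans) (intro mult_right_mono, auto)
    have "\<bar>tconv f (\<kappa>_scale n) x\<bar> \<le> l\<^sup>2 * (C * A * l powr (- 1 - \<alpha>))"
      unfolding eq abs_mult using b by (simp add: mult_left_mono)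
    also have "\<dots> = C * A * (2 powr \<alpha> / 2) ^ n"
      unfolding lp unfolding l_def by (simp add: power_divide power2_eq_square)
    finally show "\<bar>tconv f (\<kappa>_scale n) x\<bar> \<le> C * A * (2 powr \<alpha> / 2) ^ n" .
    fix i
    have b: "\<bar>tconv f (rescale (pd i \<kappa>) l 0) x\<bar> \<le> C * A * l powr (- 1 - \<alpha>)"
    proof (cases "i = 1")
      case True
      then show ?thesis
        using M1(2)[OF A w l, of x] le(2) A0 unfolding tconv_def True
        by (elim order_trans) (intro mult_right_mono, auto)
    next
      case False
      then have i: "i = 2" using exhaust_2[of i] by auto
      then show ?thesis
        using M2(2)[OF A w l, of x] le(3) A0 unfolding tconv_def i
        by (elim order_trans) (intro mult_right_mono, auto)
    qed
    have "pd i (tconv f (\<kappa>_scale n)) x = l\<^sup>2 * (inverse l * tconv f (rescale (pd i \<kappa>) l 0) x)"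
    proof -
      note f' = integrable_test_function[OF f]
      have "pd i (tconv f (\<kappa>_scale n)) = tconv f (\<lambda>y. l\<^sup>2 * (inverse l * rescale (pd i \<kappa>) l 0 y))"
        unfolding pd_tconv[OF f' \<kappa>_scale_test] unfolding \<kappa>_scale_def l_def[symmetric]
        unfolding pd_cmult[OF test_functionsD(1)[OF t[OF \<kappa>]]] pd_rescale[OF \<kappa> l(1)] ..
      then show ?thesis
        by (simp only: tconv_cmult[OF f' test_functions_cmult[OF t[OF bump_pd[OF \<kappa>]]]] tconv_cmult[OF f' t[OF bump_pd[OF \<kappa>]]])
    qed
    then have "\<bar>pd i (tconv f (\<kappa>_scale n)) x\<bar> = l * \<bar>tconv f (rescale (pd i \<kappa>) l 0) x\<bar>"
      using l by (simp add: abs_mult power2_eq_square)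
    also have "\<dots> \<le> l * (C * A * l powr (- 1 - \<alpha>))" using b l by (intro mult_left_mono) auto
    also have "\<dots> = C * A * (2 powr \<alpha>) ^ n" unfolding lp unfolding l_def by (simp add: power_one_over)
    finally show "\<bar>pd i (tconv f (\<kappa>_scale n)) x\<bar> \<le> C * A * (2 powr \<alpha>) ^ n" .
  qed
qed

text \<open>At scale 0 this is a convolution with a smooth function, covered by
  \<open>tconv_smooth_bound\<close>. The kernels up to scale \<open>n\<close> then add a geometric
  series with ratio above one, dominated by its last term.\<close>

lemma pd_tconv_K_scale_bound:
  assumes \<alpha>: "\<alpha> > 0" and \<rho>: "mollifier \<rho>"
  obtains C where "C > 0"
    "\<And>f A n x i. f \<in> test_functions \<Longrightarrow> neg_bound \<alpha> (pairing f) A \<Longrightarrow>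
      \<bar>pd i (tconv f (K_scale n)) x\<bar> \<le> C * A * (2 powr \<alpha>) ^ n"
proof -
  define q where "q = 2 powr \<alpha>"
  have q: "q > 1" unfolding q_def using \<alpha> by (simp add: gr_one_powr)
  obtain M where M: "M > 0" "\<And>f A n x i. f \<in> test_functions \<Longrightarrow> neg_bound \<alpha> (pairing f) A \<Longrightarrow>
      \<bar>pd i (tconv f (\<kappa>_scale n)) x\<bar> \<le> M * A * q ^ n"
    unfolding q_def using tconv_\<kappa>_scale_bound by metis
  obtain C1 where C1: "C1 > 0" "\<And>f A x. f \<in> test_functions \<Longrightarrow> neg_bound \<alpha> (pairing f) A \<Longrightarrow> \<bar>tconv f (pd 1 (K_scale 0)) x\<bar> \<le> C1 * A"
    using tconv_smooth_bound[OF \<rho> test_functions_pd[OF K_scale_test]] by metis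
  obtain C2 where C2: "C2 > 0" "\<And>f A x. f \<in> test_functions \<Longrightarrow> neg_bound \<alpha> (pairing f) A \<Longrightarrow> \<bar>tconv f (pd 2 (K_scale 0)) x\<bar> \<le> C2 * A"
    using tconv_smooth_bound[OF \<rho> test_functions_pd[OF K_scale_test]] by metis
  \<comment> \<open>The last summand gives \<open>M \<le> C * (q - 1)\<close>, which makes C q^n + M
    q^n at most C q^(n+1) in the induction.\<close>
  define C where "C = C1 + C2 + M / (q - 1)"
  have Mq: "0 < M / (q - 1)" using M(1) q by simp
  have C: "C1 \<le> C" "C2 \<le> C" "M \<le> C * (q - 1)" "C > 0"
  proof -
    show "C1 \<le> C" "C2 \<le> C" "C > 0" unfolding C_def using C1(1) C2(1) Mq by linarith+
    have "M = M / (q - 1) * (q - 1)" using q by simp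
    also have "\<dots> \<le> C * (q - 1)" unfolding C_def using C1(1) C2(1) q by (intro mult_right_mono) auto
    finally show "M \<le> C * (q - 1)" .
  qed
  have "\<bar>pd i (tconv f (K_scale n)) x\<bar> \<le> C * A * q ^ n"
    if f: "f \<in> test_functions" and A: "neg_bound \<alpha> (pairing f) A" for f A n x i
  proof (induction n)
    case 0
    have A0: "A \<ge> 0" by (rule neg_bound_nonneg[OF A real_dist_pairing[OF integrable_test_function[OF f]]])
    have "\<bar>tconv f (pd i (K_scale 0)) x\<bar> \<le> C * A"
      using exhaust_2[of i] order_trans[OF C1(2)[OF f A] mult_right_mono[OF C(1) A0]]
        order_trans[OF C2(2)[OF f A] mult_right_mono[OF C(2) A0]] by auto
    then show ?case by (simp add: pd_tconv integrable_test_function f K_scale_test)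
  next
    case (Suc n)
    have A0: "A \<ge> 0" by (rule neg_bound_nonneg[OF A real_dist_pairing[OF integrable_test_function[OF f]]])
    have "\<bar>pd i (tconv f (K_scale (Suc n))) x\<bar> \<le> C * A * q ^ n + M * A * q ^ n"
      unfolding pd_tconv_K_scale_Suc[OF f] using Suc M(2)[OF f A, of i n x] by linarith
    also have "\<dots> \<le> C * A * q ^ n + (C * (q - 1)) * A * q ^ n"
      using C(3) A0 q by (intro add_left_mono mult_right_mono) auto
    also have "\<dots> = C * A * q ^ Suc n" by (simp add: algebra_simps)
    finally show ?case .
  qed
  then show ?thesis using that C(4) unfolding q_def by blast
qed

end

section \<open>From bounds at each scale to a Hoelder bound\<close>

lemma powr_quarter_facts:
  assumes "0 < \<alpha>" "4 * \<alpha> < 1"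
  shows "1 < 2 powr \<alpha>" "(2 powr \<alpha>) ^ 4 \<le> (2::real)"
    "((1/2::real) ^ n) powr (4 * \<alpha>) = 1 / ((2 powr \<alpha>) ^ 4) ^ n"
proof -
  show "1 < 2 powr \<alpha>" using assms by (simp add: gr_one_powr)
  have 4: "(2 powr \<alpha>) ^ 4 = (2::real) powr (4 * \<alpha>)" by (simp add: powr_power mult.commute)
  have "(2::real) powr (4 * \<alpha>) \<le> 2 powr 1" using assms by (intro powr_mono) auto
  then show "(2 powr \<alpha>) ^ 4 \<le> (2::real)" unfolding 4 by simp
  have "((1/2::real) ^ n) powr (4 * \<alpha>) = (2 powr (- real n)) powr (4 * \<alpha>)"
    by (simp add: powr_minus powr_realpow power_one_over inverse_eq_divide)
  also have "\<dots> = inverse (2 powr (4 * \<alpha> * real n))" by (simp add: powr_powr powr_minus[symmetric] mult_ac)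
  also have "2 powr (4 * \<alpha> * real n) = ((2 powr \<alpha>) ^ 4) ^ n" unfolding 4 by (simp add: powr_power mult_ac)
  finally show "((1/2::real) ^ n) powr (4 * \<alpha>) = 1 / ((2 powr \<alpha>) ^ 4) ^ n" by (simp add: inverse_eq_divide)
qed

text \<open>Interpolating between size and gradient with weights 4 \<alpha> and 1 - 4 \<alpha>
  bounds an increment between two points by 2 X q^(3n) 2^(-4 \<alpha> n) times
  \<open>norm h powr (1 - 4 * \<alpha>)\<close>. As 2^(4 \<alpha>) = q^4, the rate is q^-n and the
  sum over scales converges. The bounds are uniform in \<open>n\<close>, so they pass to the
  pointwise limit.\<close>

lemma holder_of_multiscale:
  assumes \<alpha>: "0 < \<alpha>" "4 * \<alpha> < 1" and q: "q = 2 powr \<alpha>"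
    and F: "\<And>n. F n \<in> test_functions" and X: "X \<ge> 0"
    and F0: "\<And>x. \<bar>F 0 x\<bar> \<le> X" "\<And>i x. \<bar>pd i (F 0) x\<bar> \<le> X"
    and D: "\<And>n x. \<bar>F (Suc n) x - F n x\<bar> \<le> X * (q ^ 3 / 2) ^ n"
    and pdD: "\<And>n i x. \<bar>pd i (F (Suc n)) x - pd i (F n) x\<bar> \<le> X * (q ^ 3) ^ n"
    and lim: "\<And>x. (\<lambda>n. F n x) \<longlonglongrightarrow> G x"
  shows "\<bar>G x\<bar> \<le> 2 * (1 + 1 / (1 - 1 / q)) * X"
    and "\<bar>G (x + h) - G x\<bar> \<le> 2 * (1 + 1 / (1 - 1 / q)) * X * norm h powr (1 - 4 * \<alpha>)"
proof -
  note qf = powr_quarter_facts[OF \<alpha>, folded q]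
  have q0: "0 < q" "0 < 1 / q" "1 / q < 1" using qf(1) by auto
  have geo: "(\<Sum>m<n. (1 / q) ^ m) \<le> 1 / (1 - 1 / q)" for n
  proof -
    have "(\<Sum>m<n. (1 / q) ^ m) \<le> suminf (\<lambda>m. (1 / q) ^ m)"
      using q0 by (intro sum_le_suminf summable_geometric) auto
    then show ?thesis using q0 by (simp add: suminf_geometric)
  qed
  have q3: "(q ^ 3 / 2) ^ n \<le> (1 / q) ^ n" for n
  proof (rule power_mono)
    have "q ^ 3 / 2 * q \<le> 1" using qf(2) by (simp add: power3_eq_cube power4_eq_xxxx)
    then show "q ^ 3 / 2 \<le> 1 / q" using q0(1) by (simp add: pos_le_divide_eq)
  qed (use q0 in simp)
  have tel: "F n y = F 0 y + (\<Sum>m<n. F (Suc m) y - F m y)" for n y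
    by (induction n) auto
  have "\<bar>F n x\<bar> \<le> 2 * (1 + 1 / (1 - 1 / q)) * X" for n x
  proof -
    have "\<bar>\<Sum>m<n. F (Suc m) x - F m x\<bar> \<le> (\<Sum>m<n. X * (1 / q) ^ m)"
      using mult_left_mono[OF q3 X] by (intro sum_abs[THEN order_trans] sum_mono order_trans[OF D])
    also have "\<dots> \<le> X * (1 / (1 - 1 / q))"
      unfolding sum_distrib_left[symmetric] by (rule mult_left_mono[OF geo X])
    finally have "\<bar>F n x\<bar> \<le> X + X * (1 / (1 - 1 / q))" using F0(1)[of x] tel[of n x] by linarith
    \<comment> \<open>The factor 2 stems from comparing two points in the Hoelder bound; it is put
      in here so that both conclusions share one constant.\<close>
    also have "\<dots> \<le> 2 * (X + X * (1 / (1 - 1 / q)))"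
    proof -
      have "0 \<le> X * (1 / (1 - 1 / q))" using X q0 by (intro mult_nonneg_nonneg divide_nonneg_pos) auto
      then have "0 \<le> X + X * (1 / (1 - 1 / q))" using X by (intro add_nonneg_nonneg)
      then show ?thesis by (simp only: mult_2 le_add_same_cancel1)
    qed
    finally show ?thesis by (simp add: algebra_simps)
  qed
  moreover have "(\<lambda>n. \<bar>F n x\<bar>) \<longlonglongrightarrow> \<bar>G x\<bar>" by (intro tendsto_rabs lim)
  ultimately show "\<bar>G x\<bar> \<le> 2 * (1 + 1 / (1 - 1 / q)) * X"
    by (intro LIMSEQ_le_const2) auto
  show "\<bar>G (x + h) - G x\<bar> \<le> 2 * (1 + 1 / (1 - 1 / q)) * X * norm h powr (1 - 4 * \<alpha>)"
  proof (cases "h = 0")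
    case False
    define s where "s = norm h"
    have s: "s > 0" using False by (simp add: s_def)
    have d0: "\<bar>F 0 (x + h) - F 0 x\<bar> \<le> 2 * X * s powr (1 - 4 * \<alpha>)"
    proof -
      have "\<bar>F 0 (x + h) - F 0 x\<bar> \<le> 2 * X * s"
        unfolding s_def by (rule smooth_lipschitz[OF test_functionsD(1)[OF F] F0(2) F0(2)])
      moreover have "\<bar>F 0 (x + h) - F 0 x\<bar> \<le> 2 * X * 1"
        using F0(1)[of x] F0(1)[of "x + h"] by linarith
      ultimately have "\<bar>F 0 (x + h) - F 0 x\<bar> \<le> 2 * X * (1 powr (4 * \<alpha>) * s powr (1 - 4 * \<alpha>))"
        using X s \<alpha> by (intro powr_interpolation) auto
      then show ?thesis by simp
    qed
    have dm: "\<bar>(F (Suc m) (x + h) - F m (x + h)) - (F (Suc m) x - F m x)\<bar> \<le> 2 * X * (1 / q) ^ m * s powr (1 - 4 * \<alpha>)" for m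
    proof -
      let ?D = "\<lambda>y. F (Suc m) y - F m y"
      have sm: "smooth ?D" by (intro smooth_diff test_functionsD(1) F)
      have pD: "\<bar>pd i ?D y\<bar> \<le> X * (q ^ 3) ^ m" for i y
        using pdD by (simp add: pd_diff test_functionsD(1)[OF F])
      have "\<bar>?D (x + h) - ?D x\<bar> \<le> 2 * (X * (q ^ 3) ^ m) * s"
        unfolding s_def by (rule smooth_lipschitz[OF sm pD pD])
      moreover have "\<bar>?D (x + h) - ?D x\<bar> \<le> 2 * (X * (q ^ 3) ^ m) * (1 / 2) ^ m"
        using D[of m x] D[of m "x + h"] by (simp add: power_divide)
      ultimately have "\<bar>?D (x + h) - ?D x\<bar> \<le> 2 * (X * (q ^ 3) ^ m) * (((1 / 2) ^ m) powr (4 * \<alpha>) * s powr (1 - 4 * \<alpha>))"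
        using X s \<alpha> q0 by (intro powr_interpolation) auto
      also have "\<dots> = 2 * X * ((q ^ 3) ^ m / (q ^ 4) ^ m) * s powr (1 - 4 * \<alpha>)"
        unfolding qf(3) by simp
      also have "(q ^ 3) ^ m / (q ^ 4) ^ m = (1 / q) ^ m"
        unfolding power_divide[symmetric] using q0(1) by (simp add: power3_eq_cube power4_eq_xxxx)
      finally show ?thesis .
    qed
    have "\<bar>F n (x + h) - F n x\<bar> \<le> 2 * (1 + 1 / (1 - 1 / q)) * X * s powr (1 - 4 * \<alpha>)" for n
    proof -
      have "F n (x + h) - F n x = (F 0 (x + h) - F 0 x) + (\<Sum>m<n. (F (Suc m) (x + h) - F m (x + h)) - (F (Suc m) x - F m x))"
        unfolding tel[of n x] tel[of n "x + h"] sum_subtractf by simp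
      moreover have "\<bar>\<Sum>m<n. (F (Suc m) (x + h) - F m (x + h)) - (F (Suc m) x - F m x)\<bar>
          \<le> (\<Sum>m<n. 2 * X * (1 / q) ^ m * s powr (1 - 4 * \<alpha>))"
        by (intro sum_abs[THEN order_trans] sum_mono dm)
      moreover have "(\<Sum>m<n. 2 * X * (1 / q) ^ m * s powr (1 - 4 * \<alpha>)) = 2 * X * s powr (1 - 4 * \<alpha>) * (\<Sum>m<n. (1 / q) ^ m)"
        by (subst sum_distrib_left, rule sum.cong) (simp_all add: mult_ac)
      moreover have "\<dots> \<le> 2 * X * s powr (1 - 4 * \<alpha>) * (1 / (1 - 1 / q))"
        using X by (intro mult_left_mono[OF geo]) auto
      ultimately have "\<bar>F n (x + h) - F n x\<bar> \<le> 2 * X * s powr (1 - 4 * \<alpha>) + 2 * X * s powr (1 - 4 * \<alpha>) * (1 / (1 - 1 / q))"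
        using d0 by linarith
      then show ?thesis by (simp add: algebra_simps)
    qed
    moreover have "(\<lambda>n. \<bar>F n (x + h) - F n x\<bar>) \<longlonglongrightarrow> \<bar>G (x + h) - G x\<bar>" by (intro tendsto_intros lim)
    ultimately show ?thesis unfolding s_def[symmetric] by (intro LIMSEQ_le_const2) auto
  qed simp
qed

context green_kernel
begin

lemma foldr_pd_test: "f \<in> test_functions \<Longrightarrow> foldr pd is f \<in> test_functions"
  by (induction "is") (auto intro: test_functions_pd)

lemma foldr_pd_K_scale_Suc:
  assumes "is \<noteq> []"
  shows "foldr pd is (K_scale (Suc n)) = (\<lambda>x. foldr pd is (K_scale n) x + foldr pd is (\<kappa>_scale n) x)"
  using assms
proof (induction "is")
  case (Cons i "is")
  show ?case
  proof (cases "is = []")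
    case True
    then show ?thesis by (simp add: pd_K_scale_Suc)
  next
    case False
    with Cons show ?thesis
      by (simp add: pd_add test_functionsD(1) foldr_pd_test K_scale_test \<kappa>_scale_test)
  qed
qed simp

text \<open>The second derivatives of the kernels have \<open>L1\<close> norm of order one at every
  scale, so for \<open>K_scale n\<close> these bounds add up to one that is linear in
  \<open>n\<close>. This logarithmic divergence is absorbed into q^n. Third derivatives are
  dominated by the last scale.\<close>

lemma kernel_L1_bounds:
  assumes q: "q > 1"
  obtains C where "C > 0"
    "\<And>i n. L1 (foldr pd [i] (\<kappa>_scale n)) \<le> C * (1/2) ^ n" "\<And>i j n. L1 (foldr pd [j, i] (\<kappa>_scale n)) \<le> C"
    "\<And>i j n. L1 (foldr pd [j, i] (K_scale n)) \<le> C * q ^ n" "\<And>i j m n. L1 (foldr pd [m, j, i] (K_scale n)) \<le> C * 2 ^ n"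
    "\<And>i. L1 (foldr pd [i] (K_scale 0)) \<le> C"
proof -
  define S where "S = {is :: 2 list. length is \<le> 3}"
  have S: "finite S" unfolding S_def using finite_lists_length_le[of "UNIV :: 2 set" 3] by simp
  define c where "c is = (LINT z|lborel. \<bar>foldr pd is \<kappa> z\<bar>)" for "is"
  define M where "M = (\<Sum>is\<in>S. c is + L1 (foldr pd is (K_scale 0)))"
  have c: "c is \<ge> 0" for "is" by (simp add: c_def)
  have M: "c is \<le> M" "L1 (foldr pd is (K_scale 0)) \<le> M" if "length is \<le> 3" for "is"
  proof -
    have "c is + L1 (foldr pd is (K_scale 0)) \<le> M"
      unfolding M_def using that S c L1_nonneg by (intro member_le_sum[of "is" S "\<lambda>is. c is + L1 (foldr pd is (K_scale 0))"]) (auto simp: S_def)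
    then show "c is \<le> M" "L1 (foldr pd is (K_scale 0)) \<le> M" using c[of "is"] L1_nonneg[of "foldr pd is (K_scale 0)"] by linarith+
  qed
  have M0: "M \<ge> 0" using M(1)[of "[]"] c[of "[]"] by simp
  have k: "L1 (foldr pd is (\<kappa>_scale n)) \<le> M * ((2 ^ n) ^ length is / 4 ^ n)" if "length is \<le> 3" for "is" n
  proof -
    have "L1 (foldr pd is (\<kappa>_scale n)) \<le> c is * ((2 ^ n) ^ length is / 4 ^ n)"
      using foldr_pd_\<kappa>_scale_L1[of "is" n] by (simp add: L1_def c_def)
    also have "\<dots> \<le> M * ((2 ^ n) ^ length is / 4 ^ n)" by (intro mult_right_mono M that) simp
    finally show ?thesis .
  qed
  have four: "(4::real) ^ n = 2 ^ n * 2 ^ n" for n by (simp flip: power_mult_distrib)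
  have k1: "L1 (foldr pd [i] (\<kappa>_scale n)) \<le> M * (1/2) ^ n" for i n
    using k[of "[i]" n] by (simp add: four power_divide)
  have k2: "L1 (foldr pd [j, i] (\<kappa>_scale n)) \<le> M" for i j n
    using k[of "[j, i]" n] by (simp add: four power2_eq_square)
  have k3: "L1 (foldr pd [m, j, i] (\<kappa>_scale n)) \<le> M * 2 ^ n" for i j m n
    using k[of "[m, j, i]" n] by (simp add: four power3_eq_cube)
  define C where "C = 1 + M + M / (q - 1)"
  have Mq: "0 \<le> M / (q - 1)" using M0 q by simp
  have C: "M \<le> C" "C > 0" unfolding C_def using M0 Mq by linarith+
  have Cq: "M \<le> C * (q - 1)"
  proof -
    have "M = M / (q - 1) * (q - 1)" using q by simp
    also have "\<dots> \<le> C * (q - 1)" unfolding C_def using M0 q by (intro mult_right_mono) auto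
    finally show ?thesis .
  qed
  have step: "L1 (foldr pd is (K_scale (Suc n))) \<le> L1 (foldr pd is (K_scale n)) + L1 (foldr pd is (\<kappa>_scale n))" if "is \<noteq> []" for "is" n
    unfolding foldr_pd_K_scale_Suc[OF that] by (intro L1_add foldr_pd_test K_scale_test \<kappa>_scale_test)
  have K2: "L1 (foldr pd [j, i] (K_scale n)) \<le> C * q ^ n" for i j n
  proof (induction n)
    case 0
    then show ?case using M(2)[of "[j, i]"] C(1) by simp
  next
    case (Suc n)
    have "M * 1 \<le> C * (q - 1) * q ^ n" using Cq q C by (intro mult_mono) auto
    then show ?case using step[of "[j, i]" n] Suc k2[of j i n] by (simp add: algebra_simps)
  qed
  have K3: "L1 (foldr pd [m, j, i] (K_scale n)) \<le> C * 2 ^ n" for i j m n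
  proof (induction n)
    case 0
    then show ?case using M(2)[of "[m, j, i]"] C(1) by simp
  next
    case (Suc n)
    have "M * 2 ^ n \<le> C * 2 ^ n" using C by (intro mult_right_mono) auto
    then have "L1 (foldr pd [m, j, i] (K_scale (Suc n))) \<le> C * 2 ^ n + C * 2 ^ n"
      using step[OF list.simps(3), of m "[j, i]" n] Suc k3[of m j i n] by linarith
    also have "\<dots> = C * 2 ^ Suc n" by simp
    finally show ?case .
  qed
  show ?thesis
  proof (rule that[OF C(2) _ _ K2 K3])
    have "M * (1/2) ^ n \<le> C * (1/2) ^ n" for n using C by (intro mult_right_mono) auto
    then show "L1 (foldr pd [i] (\<kappa>_scale n)) \<le> C * (1/2) ^ n" for i n using k1[of i n] by (rule order_trans[rotated])
    show "L1 (foldr pd [j, i] (\<kappa>_scale n)) \<le> C" for i j n using k2 C(1) by (rule order_trans)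
    show "L1 (foldr pd [i] (K_scale 0)) \<le> C" for i using M(2)[of "[i]"] C(1) by simp
  qed
qed

text \<open>All three copies of the Green function are cut off at the same scale. The word
  \<open>is\<close> sits on the outer kernel, but as derivatives pass through convolutions it
  differentiates the whole function (\<open>pd_jac_scale\<close>).\<close>

definition jac_scale :: "2 list \<Rightarrow> (real^2 \<Rightarrow> real) \<Rightarrow> (real^2 \<Rightarrow> real) \<Rightarrow> nat \<Rightarrow> real^2 \<Rightarrow> real" where
  "jac_scale is f g n = tconv (foldr pd is (K_scale n)) (jac (tconv f (K_scale n)) (tconv g (K_scale n)))"

lemma jac_scale_test: "f \<in> test_functions \<Longrightarrow> g \<in> test_functions \<Longrightarrow> jac_scale is f g n \<in> test_functions"
  unfolding jac_scale_def
  by (intro tconv_test_function integrable_test_function foldr_pd_test jac_test_function K_scale_test)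

lemma pd_jac_scale:
  assumes "f \<in> test_functions" "g \<in> test_functions"
  shows "pd j (jac_scale is f g n) = jac_scale (j # is) f g n"
proof -
  have t: "jac (tconv f (K_scale n)) (tconv g (K_scale n)) \<in> test_functions"
    by (intro tconv_test_function integrable_test_function jac_test_function K_scale_test assms)
  note k = foldr_pd_test[OF K_scale_test]
  show ?thesis
    unfolding jac_scale_def tconv_commute[OF k t]
    by (simp add: pd_tconv[OF integrable_test_function[OF t] k])
qed

lemma jac_scale_bounds:
  assumes \<alpha>: "\<alpha> > 0" and \<rho>: "mollifier \<rho>" and q: "q = 2 powr \<alpha>"
  obtains E where "E > 0"
    "\<And>f g A B. f \<in> test_functions \<Longrightarrow> g \<in> test_functions \<Longrightarrow> neg_bound \<alpha> (pairing f) A \<Longrightarrow> neg_bound \<alpha> (pairing g) B \<Longrightarrow>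
      (\<forall>i x. \<bar>jac_scale [i] f g 0 x\<bar> \<le> E * A * B) \<and> (\<forall>i j x. \<bar>jac_scale [j, i] f g 0 x\<bar> \<le> E * A * B) \<and>
      (\<forall>i n x. \<bar>jac_scale [i] f g (Suc n) x - jac_scale [i] f g n x\<bar> \<le> E * A * B * (q ^ 3 / 2) ^ n) \<and>
      (\<forall>i j n x. \<bar>jac_scale [j, i] f g (Suc n) x - jac_scale [j, i] f g n x\<bar> \<le> E * A * B * (q ^ 3) ^ n)"
proof -
  have q1: "q > 1" unfolding q using \<alpha> by (simp add: gr_one_powr)
  obtain C1 where C1: "C1 > 0" "\<And>f A n x i. f \<in> test_functions \<Longrightarrow> neg_bound \<alpha> (pairing f) A \<Longrightarrow>
      \<bar>pd i (tconv f (K_scale n)) x\<bar> \<le> C1 * A * q ^ n"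
    unfolding q using pd_tconv_K_scale_bound[OF \<alpha> \<rho>] by metis
  obtain C2 where C2: "C2 > 0" "\<And>f A n x. f \<in> test_functions \<Longrightarrow> neg_bound \<alpha> (pairing f) A \<Longrightarrow>
      \<bar>tconv f (\<kappa>_scale n) x\<bar> \<le> C2 * A * (q / 2) ^ n"
    unfolding q using tconv_\<kappa>_scale_bound by metis
  obtain C3 where C3: "C3 > 0"
    "\<And>i n. L1 (foldr pd [i] (\<kappa>_scale n)) \<le> C3 * (1/2) ^ n" "\<And>i j n. L1 (foldr pd [j, i] (\<kappa>_scale n)) \<le> C3"
    "\<And>i j n. L1 (foldr pd [j, i] (K_scale n)) \<le> C3 * q ^ n" "\<And>i j m n. L1 (foldr pd [m, j, i] (K_scale n)) \<le> C3 * 2 ^ n"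
    "\<And>i. L1 (foldr pd [i] (K_scale 0)) \<le> C3"
    using kernel_L1_bounds[OF q1] by metis
  \<comment> \<open>First summand: the new part of the outer kernel against two gradients at scale n
    + 1, hence q^2. Second summand: the two changes of the inner factors, each with a factor 2 and
    one gradient at scale n + 1.\<close>
  define E where "E = C3 * (2 * (C1\<^sup>2 * q\<^sup>2)) + 4 * C3 * (C2 * C1 * q)"
  have E: "E > 0" unfolding E_def using C1(1) C2(1) C3(1) q1 by (intro add_pos_pos mult_pos_pos zero_less_power) auto
  have main: "(\<forall>i x. \<bar>jac_scale [i] f g 0 x\<bar> \<le> E * A * B) \<and> (\<forall>i j x. \<bar>jac_scale [j, i] f g 0 x\<bar> \<le> E * A * B) \<and>
      (\<forall>i n x. \<bar>jac_scale [i] f g (Suc n) x - jac_scale [i] f g n x\<bar> \<le> E * A * B * (q ^ 3 / 2) ^ n) \<and>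
      (\<forall>i j n x. \<bar>jac_scale [j, i] f g (Suc n) x - jac_scale [j, i] f g n x\<bar> \<le> E * A * B * (q ^ 3) ^ n)"
    if f: "f \<in> test_functions" and g: "g \<in> test_functions" and A: "neg_bound \<alpha> (pairing f) A" and B: "neg_bound \<alpha> (pairing g) B"
    for f g A B
  proof -
    have A0: "A \<ge> 0" by (rule neg_bound_nonneg[OF A real_dist_pairing[OF integrable_test_function[OF f]]])
    have B0: "B \<ge> 0" by (rule neg_bound_nonneg[OF B real_dist_pairing[OF integrable_test_function[OF g]]])
    note AB0 = mult_nonneg_nonneg[OF A0 B0]
    note tK = tconv_test_function[OF integrable_test_function[OF f] K_scale_test] tconv_test_function[OF integrable_test_function[OF g] K_scale_test]
    note t\<kappa> = tconv_test_function[OF integrable_test_function[OF f] \<kappa>_scale_test] tconv_test_function[OF integrable_test_function[OF g] \<kappa>_scale_test]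
    have zero: "\<bar>jac_scale is f g 0 x\<bar> \<le> E * A * B" if "L1 (foldr pd is (K_scale 0)) \<le> C3" for "is" x
    proof -
      have "\<bar>jac_scale is f g 0 x\<bar> \<le> L1 (foldr pd is (K_scale 0)) * (2 * ((C1 * A) * (C1 * B)))"
        unfolding jac_scale_def L1_def
        by (rule tconv_bound[OF integrable_test_function[OF foldr_pd_test[OF K_scale_test]] jac_test_function[OF tK] jac_bound])
          (use C1(2)[OF f A, of _ 0] C1(2)[OF g B, of _ 0] in auto)
      also have "\<dots> \<le> C3 * (2 * ((C1 * A) * (C1 * B)))"
        using that A0 B0 C1(1) by (intro mult_right_mono) auto
      also have "\<dots> = C3 * (2 * (C1\<^sup>2 * 1\<^sup>2)) * (A * B)" by (simp add: power2_eq_square)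
      also have "\<dots> \<le> E * (A * B)"
      proof (rule mult_right_mono[OF _ AB0])
        have "C3 * (2 * (C1\<^sup>2 * 1\<^sup>2)) \<le> C3 * (2 * (C1\<^sup>2 * q\<^sup>2))"
          using C3(1) q1 by (intro mult_left_mono power_mono) auto
        moreover have "0 \<le> 4 * C3 * (C2 * C1 * q)" using C1(1) C2(1) C3(1) q1 by simp
        ultimately show "C3 * (2 * (C1\<^sup>2 * 1\<^sup>2)) \<le> E" unfolding E_def by linarith
      qed
      finally show ?thesis by (simp add: mult.assoc)
    qed
    \<comment> \<open>\<open>a\<close> and \<open>b\<close> record how the \<open>L1\<close> norms
      of the new outer kernel and of the gradient of the old one depend on the scale; the two
      conditions on \<open>Q\<close> compare the resulting rates.\<close>
    have step: "\<bar>jac_scale is f g (Suc n) x - jac_scale is f g n x\<bar> \<le> E * A * B * Q"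
      if "is \<noteq> []" and a: "L1 (foldr pd is (\<kappa>_scale n)) \<le> C3 * a" and b: "\<And>i. L1 (pd i (foldr pd is (K_scale n))) \<le> C3 * b"
        and Q: "a * q ^ n * q ^ n \<le> Q" "b * (q / 2) ^ n * q ^ n \<le> Q" for "is" n x a b Q
    proof -
      let ?U = "C1 * A * q * q ^ n" and ?V = "C1 * B * q * q ^ n"
      have grow: "C1 * A * q ^ n \<le> C1 * A * q * q ^ n" if "A \<ge> 0" for A :: real
      proof -
        have "C1 * A * q ^ n * 1 \<le> C1 * A * q ^ n * q" using that C1(1) q1 by (intro mult_left_mono) auto
        then show ?thesis by (simp add: mult_ac)
      qed
      have "\<bar>tconv (\<lambda>x. foldr pd is (K_scale n) x + foldr pd is (\<kappa>_scale n) x) (jac (tconv f (K_scale (Suc n))) (tconv g (K_scale (Suc n)))) x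
          - tconv (foldr pd is (K_scale n)) (jac (tconv f (K_scale n)) (tconv g (K_scale n))) x\<bar>
          \<le> C3 * a * (2 * (?U * ?V)) + 2 * (C3 * b) * (C2 * A * (q / 2) ^ n * ?V + C2 * B * (q / 2) ^ n * ?U)"
      proof (rule jac_step[OF foldr_pd_test[OF K_scale_test] foldr_pd_test[OF \<kappa>_scale_test] tK(1) tK(1) t\<kappa>(1) tK(2) tK(2) t\<kappa>(2)])
        fix i x
        show "pd i (tconv f (K_scale (Suc n))) x = pd i (tconv f (K_scale n)) x + pd i (tconv f (\<kappa>_scale n)) x"
          "pd i (tconv g (K_scale (Suc n))) x = pd i (tconv g (K_scale n)) x + pd i (tconv g (\<kappa>_scale n)) x"
          by (rule pd_tconv_K_scale_Suc, fact)+
        show "\<bar>pd i (tconv f (K_scale n)) x\<bar> \<le> ?U" using C1(2)[OF f A] grow[OF A0] by (rule order_trans)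
        show "\<bar>pd i (tconv f (K_scale (Suc n))) x\<bar> \<le> ?U" using C1(2)[OF f A, of i "Suc n" x] by (simp add: mult_ac)
        show "\<bar>pd i (tconv g (K_scale (Suc n))) x\<bar> \<le> ?V" using C1(2)[OF g B, of i "Suc n" x] by (simp add: mult_ac)
      qed (use C2(2)[OF f A] C2(2)[OF g B] a b in auto)
      also have "\<dots> = C3 * (2 * (C1\<^sup>2 * q\<^sup>2)) * (A * B) * (a * q ^ n * q ^ n)
          + 4 * C3 * (C2 * C1 * q) * (A * B) * (b * (q / 2) ^ n * q ^ n)"
        by (simp add: power2_eq_square algebra_simps)
      also have "\<dots> \<le> C3 * (2 * (C1\<^sup>2 * q\<^sup>2)) * (A * B) * Q + 4 * C3 * (C2 * C1 * q) * (A * B) * Q"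
        using AB0 C1(1) C2(1) C3(1) q1 by (intro add_mono mult_left_mono Q) auto
      also have "\<dots> = E * A * B * Q" by (simp add: E_def algebra_simps)
      finally show ?thesis unfolding jac_scale_def foldr_pd_K_scale_Suc[OF that(1)] .
    qed
    have pw: "q ^ n * q ^ n \<le> (q ^ 3) ^ n" for n
    proof -
      have "(q\<^sup>2) ^ n \<le> (q ^ 3) ^ n" using q1 by (intro power_mono power_increasing) auto
      then show ?thesis by (simp add: power2_eq_square power_mult_distrib)
    qed
    \<comment> \<open>The rates are 2^-n q^(2n) for the outer kernel and q^n (q/2)^n q^n for the
      inner ones, the first q^n being the growth of the second derivatives of
      \<open>K_scale n\<close>. With one more derivative they become q^(2n) and 2^n (q/2)^n
      q^n.\<close>
    have "\<bar>jac_scale [i] f g (Suc n) x - jac_scale [i] f g n x\<bar> \<le> E * A * B * (q ^ 3 / 2) ^ n" for i n x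
    proof (rule step[where a = "(1/2) ^ n" and b = "q ^ n"])
      show "(1 / 2) ^ n * q ^ n * q ^ n \<le> (q ^ 3 / 2) ^ n"
        using pw[of n] by (simp add: power_divide divide_right_mono)
      show "q ^ n * (q / 2) ^ n * q ^ n \<le> (q ^ 3 / 2) ^ n"
        by (simp add: power_divide power_mult_distrib power3_eq_cube)
    qed (use C3 in auto)
    moreover have "\<bar>jac_scale [j, i] f g (Suc n) x - jac_scale [j, i] f g n x\<bar> \<le> E * A * B * (q ^ 3) ^ n" for i j n x
    proof (rule step[where a = 1 and b = "2 ^ n"])
      show "1 * q ^ n * q ^ n \<le> (q ^ 3) ^ n" "2 ^ n * (q / 2) ^ n * q ^ n \<le> (q ^ 3) ^ n"
        using pw[of n] by (simp_all add: power_divide)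
    qed (use C3 in auto)
    moreover have "\<bar>jac_scale [i] f g 0 x\<bar> \<le> E * A * B" "\<bar>jac_scale [j, i] f g 0 x\<bar> \<le> E * A * B" for i j x
      using C3(6)[of i] C3(4)[of j i 0] by (auto intro!: zero)
    ultimately show ?thesis by blast
  qed
  show ?thesis by (rule that[OF E main])
qed

end

section \<open>Removing the cutoff for smooth data\<close>

lemma tconv_rescale_error:
  assumes r: "r \<in> bump_functions" and integral_r: "integral\<^sup>L lborel r = 1" and l: "l > 0"
    and a: "a \<in> test_functions" and L: "\<And>x h. \<bar>a (x + h) - a x\<bar> \<le> L * norm h" "L \<ge> 0"
  shows "\<bar>tconv (rescale r l 0) a x - a x\<bar> \<le> L * l * (LINT z|lborel. \<bar>r z\<bar>)"
proof -
  note ar = test_functions_reflect[OF a]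
  obtain B where B: "\<And>x. \<bar>a x\<bar> \<le> B" using test_functions_bounded[OF a] by blast
  have "tconv (rescale r l 0) a x = (\<integral>y. a (x - y) * rescale r l 0 y \<partial>tor)"
    by (simp add: tconv_eq mult.commute)
  also have "\<dots> = (LINT z|lborel. a (x - (0 + l *\<^sub>R z)) * r z)"
    by (rule integral_rescale_mult[OF r l test_functions_borel[OF ar] test_functionsD(2)[OF ar], where B = B]) (rule B)
  finally have 1: "tconv (rescale r l 0) a x = (LINT z|lborel. a (x - l *\<^sub>R z) * r z)" by simp
  have ri: "integrable lborel r" by (rule bump_integrable[OF r])
  have [measurable]: "a \<in> borel_measurable borel" "r \<in> borel_measurable borel"
    using test_functions_borel[OF a] smooth_borel[OF bump_smooth[OF r]] by auto
  have i1: "integrable lborel (\<lambda>z. a (x - l *\<^sub>R z) * r z)"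
  proof (rule Bochner_Integration.integrable_bound)
    show "integrable lborel (\<lambda>z. B * r z)" using ri by simp
    have "\<bar>a (x - l *\<^sub>R z) * r z\<bar> \<le> \<bar>B * r z\<bar>" for z
      unfolding abs_mult using B[of "x - l *\<^sub>R z"] by (intro mult_right_mono) auto
    then show "AE z in lborel. norm (a (x - l *\<^sub>R z) * r z) \<le> norm (B * r z)" by simp
  qed measurable
  have i2: "integrable lborel (\<lambda>z. a x * r z)" using ri by simp
  have "\<bar>tconv (rescale r l 0) a x - a x\<bar> = \<bar>LINT z|lborel. a (x - l *\<^sub>R z) * r z - a x * r z\<bar>"
    using 1 Bochner_Integration.integral_diff[OF i1 i2] by (simp add: integral_r)
  also have "\<dots> \<le> (LINT z|lborel. \<bar>a (x - l *\<^sub>R z) * r z - a x * r z\<bar>)" by (rule integral_abs_bound)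
  also have "\<dots> \<le> (LINT z|lborel. L * l * \<bar>r z\<bar>)"
  proof (rule integral_mono)
    show "integrable lborel (\<lambda>z. \<bar>a (x - l *\<^sub>R z) * r z - a x * r z\<bar>)"
      by (intro integrable_abs Bochner_Integration.integrable_diff i1 i2)
    show "integrable lborel (\<lambda>z. L * l * \<bar>r z\<bar>)" using ri by simp
    fix z
    show "\<bar>a (x - l *\<^sub>R z) * r z - a x * r z\<bar> \<le> L * l * \<bar>r z\<bar>"
    proof (cases "norm z \<ge> 1")
      case False
      have "\<bar>a (x + - (l *\<^sub>R z)) - a x\<bar> \<le> L * norm (- (l *\<^sub>R z))" by (rule L)
      also have "\<dots> \<le> L * l" using False l L(2) by (simp add: mult_left_le mult_left_mono)
      finally have "\<bar>a (x - l *\<^sub>R z) - a x\<bar> * \<bar>r z\<bar> \<le> L * l * \<bar>r z\<bar>" by (intro mult_right_mono) auto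
      then show ?thesis by (simp add: abs_mult[symmetric] left_diff_distrib)
    qed (simp add: bump_eq_0[OF r])
  qed
  finally show ?thesis by simp
qed

context green_kernel
begin

lemma L1_r_scale: "L1 (r_scale n) \<le> (LINT z|lborel. \<bar>r z\<bar>)"
  unfolding L1_def r_scale_def by (rule integral_abs_rescale_le[OF r]) simp

lemma tconv_r_scale_error:
  assumes a: "a \<in> test_functions" and L: "\<And>x h. \<bar>a (x + h) - a x\<bar> \<le> L * norm h" "L \<ge> 0"
  shows "\<bar>tconv (r_scale n) a x - a x\<bar> \<le> L * (1/2) ^ n * (LINT z|lborel. \<bar>r z\<bar>)"
  unfolding r_scale_def by (rule tconv_rescale_error[OF r integral_r _ a L]) simp

lemma uniform_limit_tconv_r_scale:
  assumes an: "\<And>n. a n \<in> test_functions" and a: "b \<in> test_functions"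
    and lim: "uniform_limit UNIV a b sequentially"
  shows "uniform_limit UNIV (\<lambda>n. tconv K (tconv (r_scale n) (a n))) (tconv K b) sequentially"
proof (rule uniform_limitI)
  fix e :: real assume e: "e > 0"
  obtain L where L: "\<And>x h. \<bar>b (x + h) - b x\<bar> \<le> L * norm h" "L \<ge> 0"
    using test_function_lipschitz[OF a] by blast
  define I where "I = (LINT z|lborel. \<bar>r z\<bar>)"
  define k where "k = L1 K + 1"
  have pos: "I \<ge> 0" "k > 0" using L1_nonneg[of K] by (simp_all add: I_def k_def)
  have "(\<lambda>n. L * (1/2) ^ n * I) \<longlonglongrightarrow> L * 0 * I"
    by (intro tendsto_intros LIMSEQ_power_zero) simp
  then have "\<forall>\<^sub>F n in sequentially. L * (1/2) ^ n * I < e / (2 * k)"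
    using e pos by (intro order_tendstoD) auto
  moreover have "\<forall>\<^sub>F n in sequentially. \<forall>x\<in>UNIV. dist (a n x) (b x) < e / (2 * k * (I + 1))"
    using e pos by (intro uniform_limitD[OF lim]) (auto intro!: divide_pos_pos mult_pos_pos)
  ultimately show "\<forall>\<^sub>F n in sequentially. \<forall>x\<in>UNIV. dist (tconv K (tconv (r_scale n) (a n)) x) (tconv K b x) < e"
  proof eventually_elim
    case (elim n)
    note ri = integrable_test_function[OF r_scale_test]
    have t: "(\<lambda>x. tconv (r_scale n) (a n) x - b x) \<in> test_functions"
      by (intro test_functions_diff tconv_test_function ri an a)
    have d: "(\<lambda>x. a n x - b x) \<in> test_functions" by (intro test_functions_diff an a)
    have small: "\<bar>tconv (r_scale n) (a n) x - b x\<bar> \<le> e / k" for x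
    proof -
      have "\<bar>tconv (r_scale n) (\<lambda>x. a n x - b x) x\<bar> \<le> L1 (r_scale n) * (e / (2 * k * (I + 1)))"
        unfolding L1_def using elim(2) by (intro tconv_bound ri d) (auto simp: dist_real_def less_imp_le)
      also have "\<dots> \<le> (I + 1) * (e / (2 * k * (I + 1)))"
        using L1_r_scale[of n] e pos by (intro mult_right_mono) (auto simp: I_def)
      also have "\<dots> = e / (2 * k)" using pos by simp
      finally have "\<bar>tconv (r_scale n) (a n) x - tconv (r_scale n) b x\<bar> \<le> e / (2 * k)"
        by (simp add: tconv_diff[OF ri an a])
      moreover have "\<bar>tconv (r_scale n) b x - b x\<bar> \<le> e / (2 * k)"
        using tconv_r_scale_error[OF a L, of n x] elim(1) by (simp add: I_def)
      moreover have "e / (2 * k) + e / (2 * k) = e / k" by (simp add: field_simps)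
      ultimately show ?thesis by linarith
    qed
    show ?case
    proof
      fix x
      have "\<bar>tconv K (\<lambda>x. tconv (r_scale n) (a n) x - b x) x\<bar> \<le> L1 K * (e / k)"
        unfolding L1_def by (rule tconv_bound[OF K_integrable t small])
      also have "\<dots> < k * (e / k)" using e pos by (intro mult_strict_right_mono) (auto simp: k_def)
      also have "\<dots> = e" using pos by simp
      finally show "dist (tconv K (tconv (r_scale n) (a n)) x) (tconv K b x) < e"
        by (simp add: tconv_diff[OF K_integrable tconv_test_function[OF ri an] a] dist_real_def)
    qed
  qed
qed

lemma foldr_pd_tconv:
  assumes "integrable tor f" "\<psi> \<in> test_functions"
  shows "foldr pd is (tconv f \<psi>) = tconv f (foldr pd is \<psi>)"
  by (induction "is") (simp_all add: pd_tconv assms foldr_pd_test)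

lemma uniform_limit_tconv_K_scale:
  assumes f: "f \<in> test_functions"
  shows "uniform_limit UNIV (\<lambda>n. foldr pd is (tconv f (K_scale n))) (foldr pd is (tconv K f)) sequentially"
proof -
  note fi = integrable_test_function[OF f] and ri = integrable_test_function[OF r_scale_test]
  have "foldr pd is (tconv f (K_scale n)) = tconv K (tconv (r_scale n) (foldr pd is f))" for n
  proof -
    have "tconv f (K_scale n) = tconv K (tconv (r_scale n) f)"
      unfolding K_scale_def tconv_tconv[OF K_integrable fi r_scale_test] tconv_commute[OF f r_scale_test] ..
    then show ?thesis
      by (simp add: foldr_pd_tconv K_integrable tconv_test_function ri f)
  qed
  moreover have "foldr pd is (tconv K f) = tconv K (foldr pd is f)"
    by (rule foldr_pd_tconv[OF K_integrable f])
  moreover have "uniform_limit UNIV (\<lambda>n. tconv K (tconv (r_scale n) (foldr pd is f))) (tconv K (foldr pd is f)) sequentially"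
    by (rule uniform_limit_tconv_r_scale[of "\<lambda>_. foldr pd is f"])
      (rule foldr_pd_test[OF f], rule foldr_pd_test[OF f], rule uniform_limit_const)
  ultimately show ?thesis by simp
qed

lemma pd_jac:
  assumes "u \<in> test_functions" "v \<in> test_functions"
  shows "pd i (jac u v) = (\<lambda>x. pd i (pd 1 u) x * pd 2 v x + pd 1 u x * pd i (pd 2 v) x
      - (pd i (pd 2 u) x * pd 1 v x + pd 2 u x * pd i (pd 1 v) x))"
  unfolding jac_def[abs_def] using assms[THEN test_functionsD(1)]
  by (simp add: pd_diff pd_mult smooth_pd smooth_mult)

text \<open>The outer average is moved onto the Jacobian, so that \<open>K\<close> itself is the
  outer kernel throughout. The first derivatives of the Jacobian involve second derivatives of the
  potentials, and for smooth data these converge uniformly.\<close>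

lemma jac_scale_tendsto:
  assumes f: "f \<in> test_functions" and g: "g \<in> test_functions"
  shows "(\<lambda>n. jac_scale [i] f g n x) \<longlonglongrightarrow> pd i (tconv K (jac (tconv K f) (tconv K g))) x"
proof -
  note fi = integrable_test_function[OF f] and gi = integrable_test_function[OF g]
    and ri = integrable_test_function[OF r_scale_test]
  define J where "J n = jac (tconv f (K_scale n)) (tconv g (K_scale n))" for n
  define J' where "J' = jac (tconv K f) (tconv K g)"
  note tn = tconv_test_function[OF fi K_scale_test] tconv_test_function[OF gi K_scale_test]
  note t = tconv_test_function[OF K_integrable f] tconv_test_function[OF K_integrable g]
  have J: "J n \<in> test_functions" for n unfolding J_def by (rule jac_test_function[OF tn])
  have J': "J' \<in> test_functions" unfolding J'_def by (rule jac_test_function[OF t])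
  have eq: "jac_scale [i] f g n = tconv K (tconv (r_scale n) (pd i (J n)))" for n
  proof -
    note Ji = integrable_test_function[OF J]
    have "jac_scale [i] f g n = tconv (J n) (pd i (tconv K (r_scale n)))"
      unfolding jac_scale_def J_def[symmetric]
      using tconv_commute[OF test_functions_pd[OF K_scale_test] J, of i n n] by (simp add: K_scale_def)
    also have "\<dots> = tconv K (tconv (J n) (pd i (r_scale n)))"
      unfolding pd_tconv[OF K_integrable r_scale_test]
      by (rule tconv_tconv[OF K_integrable Ji test_functions_pd[OF r_scale_test]])
    also have "tconv (J n) (pd i (r_scale n)) = tconv (r_scale n) (pd i (J n))"
      unfolding pd_tconv[OF Ji r_scale_test, symmetric] tconv_commute[OF J r_scale_test] pd_tconv[OF ri J] ..
    finally show ?thesis .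
  qed
  have bdd: "bounded (a ` UNIV)" if a: "a \<in> test_functions" for a
  proof -
    obtain B where "\<And>x. \<bar>a x\<bar> \<le> B" using test_functions_bounded[OF a] by blast
    then show ?thesis by (intro boundedI[of _ B]) auto
  qed
  have 1: "uniform_limit UNIV (\<lambda>n. pd j (tconv f (K_scale n))) (pd j (tconv K f)) sequentially"
    "uniform_limit UNIV (\<lambda>n. pd j (tconv g (K_scale n))) (pd j (tconv K g)) sequentially" for j
    using uniform_limit_tconv_K_scale[OF f, of "[j]"] uniform_limit_tconv_K_scale[OF g, of "[j]"] by simp_all
  have 2: "uniform_limit UNIV (\<lambda>n. pd i (pd j (tconv f (K_scale n)))) (pd i (pd j (tconv K f))) sequentially"
    "uniform_limit UNIV (\<lambda>n. pd i (pd j (tconv g (K_scale n)))) (pd i (pd j (tconv K g))) sequentially" for j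
    using uniform_limit_tconv_K_scale[OF f, of "[i, j]"] uniform_limit_tconv_K_scale[OF g, of "[i, j]"] by simp_all
  have "uniform_limit UNIV (\<lambda>n. pd i (J n)) (pd i J') sequentially"
    unfolding J_def J'_def pd_jac[OF tn] pd_jac[OF t]
    by (intro uniform_limit_minus uniform_limit_add uniform_lim_mult 1 2 bdd test_functions_pd t)
  from uniform_limit_tconv_r_scale[OF test_functions_pd[OF J] test_functions_pd[OF J'] this]
  have "uniform_limit UNIV (\<lambda>n. jac_scale [i] f g n) (tconv K (pd i J')) sequentially" by (simp add: eq)
  then have "(\<lambda>n. jac_scale [i] f g n x) \<longlonglongrightarrow> tconv K (pd i J') x"
    by (rule tendsto_uniform_limitI) simp
  then show ?thesis by (simp add: pd_tconv[OF K_integrable J'] flip: J'_def)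
qed

text \<open>The data are smooth, but the constant sees them only through their negative norms; this
  is what lets the bound survive the passage to white noise.\<close>

theorem jacobian_estimate:
  assumes \<alpha>: "0 < \<alpha>" "4 * \<alpha> < 1" and \<rho>: "mollifier \<rho>"
  obtains C where "C > 0"
    "\<And>f g A B i x. f \<in> test_functions \<Longrightarrow> g \<in> test_functions \<Longrightarrow> neg_bound \<alpha> (pairing f) A \<Longrightarrow> neg_bound \<alpha> (pairing g) B \<Longrightarrow>
      \<bar>pd i (tconv K (jac (tconv K f) (tconv K g))) x\<bar> \<le> C * (A * B)"
    "\<And>f g A B i x h. f \<in> test_functions \<Longrightarrow> g \<in> test_functions \<Longrightarrow> neg_bound \<alpha> (pairing f) A \<Longrightarrow> neg_bound \<alpha> (pairing g) B \<Longrightarrow>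
      \<bar>pd i (tconv K (jac (tconv K f) (tconv K g))) (x + h) - pd i (tconv K (jac (tconv K f) (tconv K g))) x\<bar>
        \<le> C * (A * B) * norm h powr (1 - 4 * \<alpha>)"
proof -
  define q where "q = 2 powr \<alpha>"
  have q: "q > 1" unfolding q_def using \<alpha> by (simp add: gr_one_powr)
  obtain E where E: "E > 0"
    "\<And>f g A B. f \<in> test_functions \<Longrightarrow> g \<in> test_functions \<Longrightarrow> neg_bound \<alpha> (pairing f) A \<Longrightarrow> neg_bound \<alpha> (pairing g) B \<Longrightarrow>
      (\<forall>i x. \<bar>jac_scale [i] f g 0 x\<bar> \<le> E * A * B) \<and> (\<forall>i j x. \<bar>jac_scale [j, i] f g 0 x\<bar> \<le> E * A * B) \<and>
      (\<forall>i n x. \<bar>jac_scale [i] f g (Suc n) x - jac_scale [i] f g n x\<bar> \<le> E * A * B * (q ^ 3 / 2) ^ n) \<and>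
      (\<forall>i j n x. \<bar>jac_scale [j, i] f g (Suc n) x - jac_scale [j, i] f g n x\<bar> \<le> E * A * B * (q ^ 3) ^ n)"
    using jac_scale_bounds[OF \<alpha>(1) \<rho> q_def] by blast
  define C where "C = 2 * (1 + 1 / (1 - 1 / q)) * E"
  have C: "C > 0" unfolding C_def using E(1) q by (intro mult_pos_pos add_pos_pos divide_pos_pos) auto
  have main: "\<bar>pd i (tconv K (jac (tconv K f) (tconv K g))) x\<bar> \<le> C * (A * B)"
    "\<bar>pd i (tconv K (jac (tconv K f) (tconv K g))) (x + h) - pd i (tconv K (jac (tconv K f) (tconv K g))) x\<bar>
        \<le> C * (A * B) * norm h powr (1 - 4 * \<alpha>)"
    if f: "f \<in> test_functions" and g: "g \<in> test_functions" and A: "neg_bound \<alpha> (pairing f) A" and B: "neg_bound \<alpha> (pairing g) B"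
    for f g A B i x h
  proof -
    have X: "E * A * B \<ge> 0"
      using neg_bound_nonneg[OF A real_dist_pairing[OF integrable_test_function[OF f]]]
        neg_bound_nonneg[OF B real_dist_pairing[OF integrable_test_function[OF g]]] E(1) by simp
    note b = E(2)[OF f g A B]
    have H: "\<bar>pd i (tconv K (jac (tconv K f) (tconv K g))) x\<bar> \<le> 2 * (1 + 1 / (1 - 1 / q)) * (E * A * B)"
      "\<bar>pd i (tconv K (jac (tconv K f) (tconv K g))) (x + h) - pd i (tconv K (jac (tconv K f) (tconv K g))) x\<bar>
        \<le> 2 * (1 + 1 / (1 - 1 / q)) * (E * A * B) * norm h powr (1 - 4 * \<alpha>)"
    proof -
      have 1: "\<bar>jac_scale [i] f g 0 x\<bar> \<le> E * A * B" for x using b by blast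
      have 2: "\<bar>pd j (jac_scale [i] f g 0) x\<bar> \<le> E * A * B" for j x
        unfolding pd_jac_scale[OF f g] using b by blast
      have 3: "\<bar>jac_scale [i] f g (Suc n) x - jac_scale [i] f g n x\<bar> \<le> E * A * B * (q ^ 3 / 2) ^ n" for n x
        using b by blast
      have 4: "\<bar>pd j (jac_scale [i] f g (Suc n)) x - pd j (jac_scale [i] f g n) x\<bar> \<le> E * A * B * (q ^ 3) ^ n" for n j x
        unfolding pd_jac_scale[OF f g] using b by blast
      note h = holder_of_multiscale[OF \<alpha> q_def, of "jac_scale [i] f g", OF jac_scale_test[OF f g] X 1 2 3 4 jac_scale_tendsto[OF f g]]
      show "\<bar>pd i (tconv K (jac (tconv K f) (tconv K g))) x\<bar> \<le> 2 * (1 + 1 / (1 - 1 / q)) * (E * A * B)"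
        by (rule h(1))
      show "\<bar>pd i (tconv K (jac (tconv K f) (tconv K g))) (x + h) - pd i (tconv K (jac (tconv K f) (tconv K g))) x\<bar>
        \<le> 2 * (1 + 1 / (1 - 1 / q)) * (E * A * B) * norm h powr (1 - 4 * \<alpha>)"
        by (rule h(2))
    qed
    have e: "2 * (1 + 1 / (1 - 1 / q)) * (E * A * B) = C * (A * B)" by (simp add: C_def)
    show "\<bar>pd i (tconv K (jac (tconv K f) (tconv K g))) x\<bar> \<le> C * (A * B)"
      "\<bar>pd i (tconv K (jac (tconv K f) (tconv K g))) (x + h) - pd i (tconv K (jac (tconv K f) (tconv K g))) x\<bar>
        \<le> C * (A * B) * norm h powr (1 - 4 * \<alpha>)"
      using H unfolding e .
  qed
  show ?thesis by (rule that[OF C main])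
qed

end

section \<open>Distribution norms\<close>

lemma test_ball_bump: "\<phi> \<in> test_ball n \<Longrightarrow> \<phi> \<in> bump_functions"
  by (simp add: test_ball_def)

lemma test_ball_abs_le: "\<phi> \<in> test_ball n \<Longrightarrow> \<bar>\<phi> x\<bar> \<le> 1"
  unfolding test_ball_def using mpd_0[of \<phi>] by (metis (mono_tags, lifting) add_0 le0 mem_Collect_eq)

text \<open>The unit ball lies in a square of area 4.\<close>

lemma test_ball_integral_le:
  assumes "\<phi> \<in> test_ball n"
  shows "(LINT z|lborel. \<bar>\<phi> z\<bar>) \<le> 4"
proof -
  let ?S = "cbox (\<chi> i. - 1) (\<chi> i. 1) :: (real^2) set"
  have le: "\<bar>\<phi> z\<bar> \<le> indicator ?S z" for z
  proof (cases "norm z < 1")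
    case True
    then have "\<bar>z $ i\<bar> < 1" for i using component_le_norm_cart[of z i] by linarith
    then have "z \<in> ?S" by (auto simp: mem_box_cart) (smt (verit))+
    then show ?thesis using test_ball_abs_le[OF assms] by simp
  next
    case False
    then have "\<phi> z = 0" by (intro bump_eq_0[OF test_ball_bump[OF assms]]) simp
    then show ?thesis by simp
  qed
  have "(LINT z|lborel. \<bar>\<phi> z\<bar>) \<le> (LINT z|lborel. indicator ?S z)"
  proof (rule integral_mono[OF _ _ le])
    show "integrable lborel (\<lambda>z. \<bar>\<phi> z\<bar>)" by (intro integrable_abs bump_integrable test_ball_bump[OF assms])
    show "integrable lborel (indicator ?S :: _ \<Rightarrow> real)"
      using emeasure_lborel_cbox_finite by (intro integrable_real_indicator) auto
  qed
  also have "\<dots> = measure lborel ?S" by simp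
  also have "\<dots> = 4"
    by (subst content_cbox_cart) (simp_all add: interval_ne_empty_cart UNIV_2)
  finally show ?thesis .
qed

text \<open>Both suprema of the positive norm are bounded by one real constant. Written as
  inequalities for single test functions, the bound is preserved by weak limits.\<close>

definition pos_bound :: "real \<Rightarrow> ((real^2 \<Rightarrow> real) \<Rightarrow> real) \<Rightarrow> real \<Rightarrow> bool" where
  "pos_bound \<nu> w H \<longleftrightarrow> (\<forall>x. \<forall>\<psi>\<in>test_ball 0. \<bar>w (rescale \<psi> 1 x)\<bar> \<le> H) \<and>
    (\<forall>x l. \<forall>\<phi>\<in>test_ball0 \<nu>. 0 < l \<longrightarrow> l \<le> 1 \<longrightarrow> \<bar>w (rescale \<phi> l x)\<bar> \<le> H * l powr \<nu>)"

lemma test_ball0_test_ball: "\<phi> \<in> test_ball0 \<nu> \<Longrightarrow> \<phi> \<in> test_ball 0"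
  by (simp add: test_ball0_def)

text \<open>A function in \<open>test_ball0\<close> has mean zero, so \<open>F x\<close> may be
  subtracted and only the oscillation of \<open>F\<close> at scale \<open>l\<close> counts. The
  factor 4 bounds the integral of the test function.\<close>

lemma pos_bound_pairing:
  assumes F: "F \<in> test_functions" and \<nu>: "0 < \<nu>" and H: "\<And>x. \<bar>F x\<bar> \<le> H" "\<And>x h. \<bar>F (x + h) - F x\<bar> \<le> H * norm h powr \<nu>"
  shows "pos_bound \<nu> (pairing F) (4 * H)"
proof -
  have H0: "H \<ge> 0" using H(1)[of 0] by linarith
  have [measurable]: "F \<in> borel_measurable borel" by (rule test_functions_borel[OF F])
  have eq: "pairing F (rescale \<phi> l x) = (LINT z|lborel. F (x + l *\<^sub>R z) * \<phi> z)" if "\<phi> \<in> test_ball 0" "l > 0" for \<phi> l x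
    unfolding pairing_def
    by (rule integral_rescale_mult[OF test_ball_bump[OF that(1)] that(2) test_functions_borel[OF F] test_functionsD(2)[OF F] H(1)])
  have int: "integrable lborel (\<lambda>z. (F (x + l *\<^sub>R z) - c) * \<phi> z)" if "\<phi> \<in> test_ball 0" for \<phi> l x c
  proof (rule lborel_integrable_bounded_support)
    note b = test_ball_bump[OF that]
    have [measurable]: "\<phi> \<in> borel_measurable borel" by (rule smooth_borel[OF bump_smooth[OF b]])
    show "(\<lambda>z. (F (x + l *\<^sub>R z) - c) * \<phi> z) \<in> borel_measurable borel" by measurable
    show "bounded_support (\<lambda>z. (F (x + l *\<^sub>R z) - c) * \<phi> z)"
      by (rule bounded_support_mult[OF bump_bounded_support[OF b]])
    show "\<bar>(F (x + l *\<^sub>R z) - c) * \<phi> z\<bar> \<le> (H + \<bar>c\<bar>) * 1" for z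
    proof -
      have "\<bar>F (x + l *\<^sub>R z) - c\<bar> \<le> H + \<bar>c\<bar>" using H(1)[of "x + l *\<^sub>R z"] by linarith
      then show ?thesis unfolding abs_mult using test_ball_abs_le[OF that] H0 by (intro mult_mono) auto
    qed
  qed
  have bound: "\<bar>LINT z|lborel. (F (x + l *\<^sub>R z) - c) * \<phi> z\<bar> \<le> 4 * X"
    if \<phi>: "\<phi> \<in> test_ball 0" and X: "\<And>z. norm z < 1 \<Longrightarrow> \<bar>F (x + l *\<^sub>R z) - c\<bar> \<le> X" and X0: "X \<ge> 0" for \<phi> l x c X
  proof -
    have "\<bar>LINT z|lborel. (F (x + l *\<^sub>R z) - c) * \<phi> z\<bar> \<le> (LINT z|lborel. \<bar>(F (x + l *\<^sub>R z) - c) * \<phi> z\<bar>)"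
      by (rule integral_abs_bound)
    also have "\<dots> \<le> (LINT z|lborel. X * \<bar>\<phi> z\<bar>)"
    proof (rule integral_mono)
      show "integrable lborel (\<lambda>z. \<bar>(F (x + l *\<^sub>R z) - c) * \<phi> z\<bar>)" by (intro integrable_abs int \<phi>)
      show "integrable lborel (\<lambda>z. X * \<bar>\<phi> z\<bar>)"
        by (intro integrable_mult_right integrable_abs bump_integrable test_ball_bump[OF \<phi>])
      show "\<bar>(F (x + l *\<^sub>R z) - c) * \<phi> z\<bar> \<le> X * \<bar>\<phi> z\<bar>" for z
      proof (cases "norm z < 1")
        case True
        then show ?thesis unfolding abs_mult by (intro mult_right_mono X) auto
      next
        case False
        then have "\<phi> z = 0" by (intro bump_eq_0[OF test_ball_bump[OF \<phi>]]) simp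
        then show ?thesis by simp
      qed
    qed
    also have "\<dots> \<le> X * 4" using test_ball_integral_le[OF \<phi>] X0 by (simp add: mult_left_mono)
    finally show ?thesis by simp
  qed
  show ?thesis
    unfolding pos_bound_def
  proof (intro conjI allI ballI impI)
    fix x \<psi> assume \<psi>: "\<psi> \<in> test_ball 0"
    show "\<bar>pairing F (rescale \<psi> 1 x)\<bar> \<le> 4 * H"
      unfolding eq[OF \<psi> zero_less_one] using bound[OF \<psi>, of x 1 0 H] H(1) H0 by simp
  next
    fix x \<phi> and l :: real assume \<phi>0: "\<phi> \<in> test_ball0 \<nu>" and l: "0 < l" "l \<le> 1"
    note \<phi> = test_ball0_test_ball[OF \<phi>0]
    have "\<forall>a b. real (a + b) \<le> \<nu> \<longrightarrow> (LINT z|lborel. \<phi> z * ((z $ 1) ^ a * (z $ 2) ^ b)) = 0"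
      using \<phi>0 by (simp add: test_ball0_def)
    from this[rule_format, of 0 0] have z: "integral\<^sup>L lborel \<phi> = 0" using \<nu> by simp
    have "pairing F (rescale \<phi> l x) = (LINT z|lborel. F (x + l *\<^sub>R z) * \<phi> z) - F x * integral\<^sup>L lborel \<phi>"
      by (simp add: eq[OF \<phi> l(1)] z)
    also have "\<dots> = (LINT z|lborel. (F (x + l *\<^sub>R z) - F x) * \<phi> z)"
      using Bochner_Integration.integral_diff[OF int[OF \<phi>, of x l 0] integrable_mult_right[OF bump_integrable[OF test_ball_bump[OF \<phi>]], of "F x"]]
      by (simp add: left_diff_distrib)
    also have "\<bar>\<dots>\<bar> \<le> 4 * (H * l powr \<nu>)"
    proof (rule bound[OF \<phi>])
      fix z :: "real^2" assume "norm z < 1"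
      then have "norm (l *\<^sub>R z) \<le> l" using l by (simp add: mult_left_le)
      then have "norm (l *\<^sub>R z) powr \<nu> \<le> l powr \<nu>" using \<nu> by (intro powr_mono2) auto
      then have "H * norm (l *\<^sub>R z) powr \<nu> \<le> H * l powr \<nu>" using H0 by (rule mult_left_mono)
      with H(2)[of x "l *\<^sub>R z"] show "\<bar>F (x + l *\<^sub>R z) - F x\<bar> \<le> H * l powr \<nu>" by (rule order_trans)
    qed (use H0 in simp)
    finally show "\<bar>pairing F (rescale \<phi> l x)\<bar> \<le> 4 * H * l powr \<nu>" by simp
  qed
qed

lemma pos_bound_limit:
  assumes "\<forall>\<^sub>F d in F. pos_bound \<nu> (w d) (H d)" "F \<noteq> bot" "(H \<longlongrightarrow> H0) F"
    and "\<And>\<phi>. \<phi> \<in> test_functions \<Longrightarrow> ((\<lambda>d. w d \<phi>) \<longlongrightarrow> w0 \<phi>) F"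
  shows "pos_bound \<nu> w0 H0"
  unfolding pos_bound_def
proof (intro conjI allI ballI impI)
  fix x \<psi> assume \<psi>: "\<psi> \<in> test_ball 0"
  have "((\<lambda>d. \<bar>w d (rescale \<psi> 1 x)\<bar>) \<longlongrightarrow> \<bar>w0 (rescale \<psi> 1 x)\<bar>) F"
    by (intro tendsto_rabs assms(4) rescale_test_function test_ball_bump[OF \<psi>]) simp
  moreover have "\<forall>\<^sub>F d in F. \<bar>w d (rescale \<psi> 1 x)\<bar> \<le> H d"
    using assms(1) by eventually_elim (use \<psi> in \<open>auto simp: pos_bound_def\<close>)
  ultimately show "\<bar>w0 (rescale \<psi> 1 x)\<bar> \<le> H0" using assms(2,3) by (intro tendsto_le)
next
  fix x \<phi> and l :: real assume \<phi>: "\<phi> \<in> test_ball0 \<nu>" and l: "0 < l" "l \<le> 1"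
  have "((\<lambda>d. \<bar>w d (rescale \<phi> l x)\<bar>) \<longlongrightarrow> \<bar>w0 (rescale \<phi> l x)\<bar>) F"
    by (intro tendsto_rabs assms(4) rescale_test_function test_ball_bump[OF test_ball0_test_ball[OF \<phi>]] l)
  moreover have "((\<lambda>d. H d * l powr \<nu>) \<longlongrightarrow> H0 * l powr \<nu>) F" by (intro tendsto_intros assms(3))
  moreover have "\<forall>\<^sub>F d in F. \<bar>w d (rescale \<phi> l x)\<bar> \<le> H d * l powr \<nu>"
    using assms(1) by eventually_elim (use \<phi> l in \<open>auto simp: pos_bound_def\<close>)
  ultimately show "\<bar>w0 (rescale \<phi> l x)\<bar> \<le> H0 * l powr \<nu>" using assms(2) by (intro tendsto_le)
qed

lemma real_norm_pos_le:
  assumes "pos_bound \<nu> w H" "0 < \<nu>"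
  shows "real_norm \<nu> w \<le> ennreal (2 * H)"
proof -
  have b: "\<bar>w (rescale \<psi> 1 x)\<bar> \<le> H" if "\<psi> \<in> test_ball 0" for \<psi> x
    using assms(1) that by (simp add: pos_bound_def)
  have H0: "H \<ge> 0" using b[OF zero_test_ball, of 0] by linarith
  have "(SUP x. SUP \<psi>\<in>test_ball 0. ennreal \<bar>w (rescale \<psi> 1 x)\<bar>) \<le> ennreal H"
    by (intro SUP_least ennreal_leI b)
  moreover have "(SUP x. SUP l\<in>{0<..1}. SUP \<phi>\<in>test_ball0 \<nu>. ennreal (l powr (- \<nu>) * \<bar>w (rescale \<phi> l x)\<bar>)) \<le> ennreal H"
  proof (intro SUP_least ennreal_leI)
    fix x \<phi> and l :: real assume \<phi>: "\<phi> \<in> test_ball0 \<nu>" and l: "l \<in> {0<..1}"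
    have "\<bar>w (rescale \<phi> l x)\<bar> \<le> H * l powr \<nu>" using assms(1) \<phi> l by (auto simp: pos_bound_def)
    then have "l powr (- \<nu>) * \<bar>w (rescale \<phi> l x)\<bar> \<le> l powr (- \<nu>) * (H * l powr \<nu>)" by (rule mult_left_mono) simp
    also have "\<dots> = H * (l powr (- \<nu>) * l powr \<nu>)" by simp
    also have "l powr (- \<nu>) * l powr \<nu> = 1" using l by (simp flip: powr_add)
    finally show "l powr (- \<nu>) * \<bar>w (rescale \<phi> l x)\<bar> \<le> H" by simp
  qed
  ultimately have "real_norm \<nu> w \<le> ennreal H + ennreal H"
    unfolding real_norm_def using assms(2) by (simp add: add_mono)
  then show ?thesis using H0 by (simp flip: ennreal_plus)
qed

lemma real_norm_neg_eq:
  assumes "0 < \<alpha>" "\<alpha> < 1"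
  shows "real_norm (- 1 - \<alpha>) w = (SUP x. SUP l\<in>{0<..1}. SUP \<phi>\<in>test_ball 2. ennreal (l powr (1 + \<alpha>) * \<bar>w (rescale \<phi> l x)\<bar>))"
proof -
  have "\<lfloor>- (- 1 - \<alpha>) + 1\<rfloor> = 2" using assms by (intro floor_unique) auto
  then show ?thesis unfolding real_norm_def using assms by (simp add: add.commute)
qed

lemma real_norm_neg_le_iff:
  assumes \<alpha>: "0 < \<alpha>" "\<alpha> < 1" and A: "A \<ge> 0"
  shows "real_norm (- 1 - \<alpha>) w \<le> ennreal A \<longleftrightarrow> neg_bound \<alpha> w A"
proof -
  have iff: "ennreal (l powr (1 + \<alpha>) * \<bar>y\<bar>) \<le> ennreal A \<longleftrightarrow> \<bar>y\<bar> \<le> A * l powr (- 1 - \<alpha>)" if "0 < l" for l y :: real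
  proof -
    have e: "l powr (- 1 - \<alpha>) = 1 / l powr (1 + \<alpha>)" using powr_minus_divide[of l "1 + \<alpha>"] by simp
    have "0 < l powr (1 + \<alpha>)" using that by simp
    then have "l powr (1 + \<alpha>) * \<bar>y\<bar> \<le> A \<longleftrightarrow> \<bar>y\<bar> \<le> A * l powr (- 1 - \<alpha>)"
      unfolding e by (simp add: pos_le_divide_eq mult.commute)
    then show ?thesis using A by (simp add: ennreal_le_iff)
  qed
  show ?thesis
    unfolding real_norm_neg_eq[OF \<alpha>] neg_bound_def SUP_le_iff using iff by auto
qed

lemma esqrt_power2: "esqrt (a\<^sup>2) = a"
proof (cases a rule: ennreal_cases)
  case (real r)
  then show ?thesis by (simp add: esqrt_def ennreal_power)
qed (simp add: esqrt_def power2_eq_square ennreal_top_mult)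

lemma esqrt_mono:
  assumes "a \<le> b"
  shows "esqrt a \<le> esqrt b"
proof (cases "b = \<top>")
  case False
  then have "a < \<top>" "b < \<top>" using assms by (auto simp: less_top[symmetric] top_unique)
  moreover have "enn2real a \<le> enn2real b" using assms \<open>b < \<top>\<close> by (rule enn2real_mono)
  ultimately show ?thesis by (auto simp: esqrt_def intro!: ennreal_leI)
qed (simp add: esqrt_def)

lemma esqrt_le: "a \<le> b\<^sup>2 \<Longrightarrow> esqrt a \<le> b"
  using esqrt_mono[of a "b\<^sup>2"] by (simp add: esqrt_power2)

lemma esqrt_square: "(esqrt a)\<^sup>2 = a"
proof (cases a rule: ennreal_cases)
  case (real r)
  then show ?thesis by (simp add: esqrt_def ennreal_power)
qed (simp add: esqrt_def power2_eq_square ennreal_top_mult)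

lemma dist_norm_pos_le:
  assumes "pos_bound \<nu> (\<lambda>\<phi>. Re (f \<phi>)) H" "pos_bound \<nu> (\<lambda>\<phi>. Im (f \<phi>)) H" "0 < \<nu>"
  shows "dist_norm \<nu> f \<le> ennreal (4 * H)"
proof -
  have H0: "H \<ge> 0" using assms(1) zero_test_ball[of 0] unfolding pos_bound_def by (meson abs_ge_zero order_trans)
  let ?a = "real_norm \<nu> (\<lambda>\<phi>. Re (f \<phi>))" and ?b = "real_norm \<nu> (\<lambda>\<phi>. Im (f \<phi>))"
  have "?a \<le> ennreal (2 * H)" "?b \<le> ennreal (2 * H)" by (intro real_norm_pos_le assms)+
  then have "?a\<^sup>2 + ?b\<^sup>2 \<le> (ennreal (2 * H))\<^sup>2 + (ennreal (2 * H))\<^sup>2" by (intro add_mono power_mono) auto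
  also have "\<dots> = ennreal ((2 * H)\<^sup>2 + (2 * H)\<^sup>2)" using H0 by (subst ennreal_plus) (simp_all add: ennreal_power)
  also have "\<dots> \<le> ennreal ((4 * H)\<^sup>2)" by (intro ennreal_leI) (simp add: power2_eq_square)
  also have "\<dots> = (ennreal (4 * H))\<^sup>2" using H0 by (simp add: ennreal_power)
  finally show ?thesis unfolding dist_norm_def by (rule esqrt_le)
qed

lemma real_norm_zero:
  assumes "0 < \<alpha>" "\<alpha> < 1" "\<And>\<phi>. \<phi> \<in> test_functions \<Longrightarrow> w \<phi> = 0"
  shows "real_norm (- 1 - \<alpha>) w = 0"
proof -
  have "neg_bound \<alpha> w 0"
    unfolding neg_bound_def using assms(3) rescale_test_function test_ball_bump by simp
  then show ?thesis using real_norm_neg_le_iff[of \<alpha> 0 w] assms by simp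
qed

lemma dist_norm_real:
  assumes "0 < \<alpha>" "\<alpha> < 1" "\<And>\<phi>. \<phi> \<in> test_functions \<Longrightarrow> Im (f \<phi>) = 0"
  shows "dist_norm (- 1 - \<alpha>) f = real_norm (- 1 - \<alpha>) (\<lambda>\<phi>. Re (f \<phi>))"
  unfolding dist_norm_def using real_norm_zero[OF assms] by (simp add: esqrt_power2)

section \<open>Mollification\<close>

text \<open>By \<open>pairing_cv\<close>, mollification averages the values on translated test
  functions with a probability weight, and the bound is translation invariant. It holds for every
  positive \<open>e\<close>, which is why the field without mollification can stand on the right of
  the first estimate.\<close>

lemma neg_bound_mollify:
  assumes w: "real_dist w" and \<rho>: "mollifier \<rho>" and e: "e > 0" and A: "neg_bound \<alpha> w A"
  shows "neg_bound \<alpha> (pairing (cv w (rescale \<rho> e 0))) A"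
  unfolding neg_bound_def
proof (intro allI impI)
  fix x l \<phi> assume l: "0 < l" "l \<le> (1::real)" and \<phi>: "\<phi> \<in> test_ball 2"
  have \<rho>b: "\<rho> \<in> bump_functions" "\<And>x. 0 \<le> \<rho> x" "integral\<^sup>L lborel \<rho> = 1" using \<rho> by (auto simp: mollifier_def)
  let ?\<rho> = "rescale \<rho> e 0" and ?X = "A * l powr (- 1 - \<alpha>)"
  have t: "?\<rho> \<in> test_functions" by (rule rescale_test_function[OF \<rho>b(1) e])
  have nn: "0 \<le> ?\<rho> y" for y unfolding rescale_def using \<rho>b(2) by (intro periodize_nonneg) simp
  have tr: "rescale \<phi> l x \<in> test_functions" for x by (rule rescale_test_function[OF test_ball_bump[OF \<phi>] l(1)])
  have le: "\<bar>w (rescale \<phi> l (x - y))\<bar> \<le> ?X" for y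
    using A \<phi> l unfolding neg_bound_def by blast
  have "pairing (cv w ?\<rho>) (rescale \<phi> l x) = pairing ?\<rho> (\<lambda>y. w (rescale \<phi> l (x - y)))"
    unfolding pairing_cv[OF w t tr] rescale_shift ..
  also have "\<bar>\<dots>\<bar> \<le> (\<integral>y. \<bar>?\<rho> y\<bar> \<partial>tor) * ?X"
  proof (rule pairing_bound[OF integrable_test_function[OF t] _ le])
    \<comment> \<open>Measurability: as a function of the translation this is a reflected
      convolution of \<open>w\<close>, hence smooth.\<close>
    have "(\<lambda>y. w (rescale \<phi> l (x - y))) = (\<lambda>y. cv w (\<lambda>z. rescale \<phi> l x (0 - z)) (0 - y))"
    proof
      fix y
      have "rescale \<phi> l (x - y) = (\<lambda>z. rescale \<phi> l x (0 - (0 - y - z)))"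
        by (rule ext) (simp add: rescale_shift[symmetric] add.commute)
      then show "w (rescale \<phi> l (x - y)) = cv w (\<lambda>z. rescale \<phi> l x (0 - z)) (0 - y)"
        by (simp only: cv_def)
    qed
    then show "(\<lambda>y. w (rescale \<phi> l (x - y))) \<in> borel_measurable borel"
      by (simp only: test_functions_borel[OF test_functions_reflect[OF cv_test_function[OF w test_functions_reflect[OF tr]]]])
  qed
  also have "(\<integral>y. \<bar>?\<rho> y\<bar> \<partial>tor) = 1"
    using integral_rescale[OF \<rho>b(1) e, of 0] \<rho>b(3) nn by simp
  finally show "\<bar>pairing (cv w ?\<rho>) (rescale \<phi> l x)\<bar> \<le> ?X" by simp
qed

lemma neg_bound_add:
  assumes "neg_bound \<alpha> u A" "neg_bound \<alpha> v B"
    and "\<And>\<phi>. \<phi> \<in> test_functions \<Longrightarrow> \<bar>w \<phi>\<bar> \<le> \<bar>u \<phi>\<bar> + \<bar>v \<phi>\<bar>"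
  shows "neg_bound \<alpha> w (A + B)"
  unfolding neg_bound_def
proof (intro allI impI)
  fix x l \<phi> assume l: "0 < l" "l \<le> (1::real)" and \<phi>: "\<phi> \<in> test_ball 2"
  have "\<bar>u (rescale \<phi> l x)\<bar> \<le> A * l powr (- 1 - \<alpha>)" "\<bar>v (rescale \<phi> l x)\<bar> \<le> B * l powr (- 1 - \<alpha>)"
    using assms(1,2) l \<phi> unfolding neg_bound_def by blast+
  with assms(3)[OF rescale_test_function[OF test_ball_bump[OF \<phi>] l(1)], of x]
  show "\<bar>w (rescale \<phi> l x)\<bar> \<le> (A + B) * l powr (- 1 - \<alpha>)" by (simp add: distrib_right)
qed

section \<open>The deterministic bound\<close>

lemma is_dist_zero: "is_dist u \<Longrightarrow> u (\<lambda>_. 0) = 0"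
  using real_dist_zero[OF is_dist_real_dist(1) test_functions_const] real_dist_zero[OF is_dist_real_dist(2) test_functions_const]
  by (simp add: complex_eq_iff)

lemma mollify_real:
  assumes w: "is_dist w" "\<And>\<phi>. \<phi> \<in> test_functions \<Longrightarrow> Im (w \<phi>) = 0" and \<rho>: "\<rho> \<in> bump_functions" and e: "e > 0"
  shows "mollify \<rho> e w = (\<lambda>x. of_real (cv (\<lambda>\<phi>. Re (w \<phi>)) (rescale \<rho> e 0) x))"
proof
  fix x
  have "mollify \<rho> e w x = w (\<lambda>y. rescale \<rho> e 0 (x - y))"
    by (simp add: mollify_def conv_def rescale_def is_dist_zero[OF w(1)])
  then show "mollify \<rho> e w x = of_real (cv (\<lambda>\<phi>. Re (w \<phi>)) (rescale \<rho> e 0) x)"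
    using w(2)[OF test_functions_reflect[OF rescale_test_function[OF \<rho> e]]] by (simp add: cv_def complex_eq_iff)
qed

lemma fun_dist_Re_Im:
  assumes "p \<in> test_functions" "q \<in> test_functions" "\<phi> \<in> test_functions"
  shows "fun_dist (\<lambda>x. of_real (p x) + \<i> * of_real (q x)) \<phi> = of_real (pairing p \<phi>) + \<i> * of_real (pairing q \<phi>)"
proof -
  have i: "integrable tor (\<lambda>x. complex_of_real (f x * \<phi> x))" if "f \<in> test_functions" for f
    by (intro integrable_of_real integrable_test_function test_functions_mult that assms)
  have "fun_dist (\<lambda>x. of_real (p x) + \<i> * of_real (q x)) \<phi>
      = (\<integral>x. of_real (p x * \<phi> x) + \<i> * of_real (q x * \<phi> x) \<partial>tor)"
    unfolding fun_dist_def set_integral_tor by (simp add: distrib_right mult.assoc)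
  also have "\<dots> = (\<integral>x. of_real (p x * \<phi> x) \<partial>tor) + (\<integral>x. \<i> * of_real (q x * \<phi> x) \<partial>tor)"
    by (intro Bochner_Integration.integral_add integrable_mult_right i assms)
  also have "\<dots> = of_real (pairing p \<phi>) + \<i> * of_real (pairing q \<phi>)"
    unfolding pairing_def by (simp only: integral_mult_right_zero integral_complex_of_real)
  finally show ?thesis .
qed

lemma pos_bound_abs_mono:
  assumes "pos_bound \<nu> w H" "\<And>\<phi>. \<phi> \<in> test_functions \<Longrightarrow> \<bar>w' \<phi>\<bar> \<le> \<bar>w \<phi>\<bar>"
  shows "pos_bound \<nu> w' H"
  unfolding pos_bound_def
proof (intro conjI allI ballI impI)
  fix x \<psi> assume \<psi>: "\<psi> \<in> test_ball 0"
  show "\<bar>w' (rescale \<psi> 1 x)\<bar> \<le> H"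
    using assms(1) \<psi> by (intro order_trans[OF assms(2)[OF rescale_test_function[OF test_ball_bump[OF \<psi>]]]]) (auto simp: pos_bound_def)
next
  fix x \<phi> and l :: real assume \<phi>: "\<phi> \<in> test_ball0 \<nu>" and l: "0 < l" "l \<le> 1"
  show "\<bar>w' (rescale \<phi> l x)\<bar> \<le> H * l powr \<nu>"
    using assms(1) \<phi> l
    by (intro order_trans[OF assms(2)[OF rescale_test_function[OF test_ball_bump[OF test_ball0_test_ball[OF \<phi>]] l(1)]]]) (auto simp: pos_bound_def)
qed

lemma vec_norm_le:
  assumes "\<And>k. dist_norm \<nu> (f k) \<le> ennreal (h k)" "\<And>k. h k \<ge> 0"
  shows "vec_norm \<nu> f \<le> ennreal (\<Sum>k\<in>UNIV. h k)"
  unfolding vec_norm_def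
proof (rule esqrt_le)
  have "(\<Sum>k\<in>UNIV. (dist_norm \<nu> (f k))\<^sup>2) \<le> (\<Sum>k\<in>UNIV. (ennreal (h k))\<^sup>2)"
    by (intro sum_mono power_mono assms) auto
  also have "\<dots> = ennreal (\<Sum>k\<in>UNIV. (h k)\<^sup>2)" by (simp add: ennreal_power assms sum_ennreal)
  also have "\<dots> \<le> ennreal ((\<Sum>k\<in>UNIV. h k)\<^sup>2)"
  proof (rule ennreal_leI)
    have "(\<Sum>k\<in>UNIV. (h k)\<^sup>2) \<le> (\<Sum>k\<in>UNIV. h k * (\<Sum>k\<in>UNIV. h k))"
      unfolding power2_eq_square using assms(2) by (intro sum_mono mult_left_mono member_le_sum) auto
    then show "(\<Sum>k\<in>UNIV. (h k)\<^sup>2) \<le> (\<Sum>k\<in>UNIV. h k)\<^sup>2" by (simp add: power2_eq_square sum_distrib_right)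
  qed
  also have "\<dots> = (ennreal (\<Sum>k\<in>UNIV. h k))\<^sup>2" by (simp add: ennreal_power assms sum_nonneg)
  finally show "(\<Sum>k\<in>UNIV. (dist_norm \<nu> (f k))\<^sup>2) \<le> (ennreal (\<Sum>k\<in>UNIV. h k))\<^sup>2" .
qed

text \<open>The arithmetic-geometric mean inequality after a cyclic relabelling. It turns the
  products of two different components into the square of \<open>vec_norm\<close>.\<close>

lemma sum_cyclic_mult_le:
  fixes A :: "3 \<Rightarrow> real"
  shows "(\<Sum>k\<in>UNIV. A (k + 1) * A (k + 2)) \<le> (\<Sum>k\<in>UNIV. (A k)\<^sup>2)"
proof -
  have shift: "(\<Sum>k\<in>UNIV. (A (k + c))\<^sup>2) = (\<Sum>k\<in>UNIV. (A k)\<^sup>2)" for c :: 3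
  proof (rule sum.reindex_bij_betw)
    show "bij_betw (\<lambda>k. k + c) UNIV UNIV"
      by (rule bij_betw_byWitness[where f' = "\<lambda>k. k - c"]) auto
  qed
  have "(\<Sum>k\<in>UNIV. A (k + 1) * A (k + 2)) \<le> (\<Sum>k\<in>UNIV. ((A (k + 1))\<^sup>2 + (A (k + 2))\<^sup>2) / 2)"
  proof (rule sum_mono)
    fix k
    show "A (k + 1) * A (k + 2) \<le> ((A (k + 1))\<^sup>2 + (A (k + 2))\<^sup>2) / 2"
      using sum_squares_bound[of "A (k + 1)" "A (k + 2)"] by simp
  qed
  also have "\<dots> = (\<Sum>k\<in>UNIV. (A k)\<^sup>2)"
    by (simp add: sum_divide_distrib[symmetric] sum.distrib shift)
  finally show ?thesis .
qed

context green_kernel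
begin

text \<open>Up to the factor 16 this is the real part (\<open>i = 2\<close>) or the imaginary part
  (\<open>i = 1\<close>) of a component of the mollified field, by
  \<open>zeta_eps_eq\<close>.\<close>

definition jac_grad :: "2 \<Rightarrow> (real^2 \<Rightarrow> real) \<Rightarrow> (real^2 \<Rightarrow> real) \<Rightarrow> real^2 \<Rightarrow> real" where
  "jac_grad i f g = pd i (tconv K (jac (tconv K f) (tconv K g)))"

lemma jac_grad_test: "f \<in> test_functions \<Longrightarrow> g \<in> test_functions \<Longrightarrow> jac_grad i f g \<in> test_functions"
  unfolding jac_grad_def
  by (intro test_functions_pd tconv_test_function[OF K_integrable] jac_test_function)

lemma jac_grad_diff:
  assumes t: "f \<in> test_functions" "g \<in> test_functions" "f' \<in> test_functions" "g' \<in> test_functions"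
  shows "jac_grad i f g x - jac_grad i f' g' x = jac_grad i (\<lambda>y. f y - f' y) g x + jac_grad i f' (\<lambda>y. g y - g' y) x"
proof -
  note T = tconv_test_function[OF K_integrable]
  note d = test_functions_diff[OF t(1,3)] test_functions_diff[OF t(2,4)]
  note j = jac_test_function[OF T[OF t(1)] T[OF t(2)]] jac_test_function[OF T[OF t(3)] T[OF t(4)]]
    jac_test_function[OF T[OF d(1)] T[OF t(2)]] jac_test_function[OF T[OF t(3)] T[OF d(2)]]
  have "(\<lambda>x. jac (tconv K f) (tconv K g) x - jac (tconv K f') (tconv K g') x)
      = (\<lambda>x. jac (tconv K (\<lambda>y. f y - f' y)) (tconv K g) x + jac (tconv K f') (tconv K (\<lambda>y. g y - g' y)) x)"
    unfolding tconv_diff[OF K_integrable t(1,3)] tconv_diff[OF K_integrable t(2,4)] jac_def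
    by (simp add: pd_diff test_functionsD(1)[OF T] t algebra_simps)
  then have "tconv K (pd i (\<lambda>x. jac (tconv K f) (tconv K g) x - jac (tconv K f') (tconv K g') x))
      = tconv K (pd i (\<lambda>x. jac (tconv K (\<lambda>y. f y - f' y)) (tconv K g) x + jac (tconv K f') (tconv K (\<lambda>y. g y - g' y)) x))"
    by simp
  then show ?thesis
    unfolding jac_grad_def pd_tconv[OF K_integrable j(1)] pd_tconv[OF K_integrable j(2)] pd_tconv[OF K_integrable j(3)] pd_tconv[OF K_integrable j(4)]
    unfolding pd_diff[OF test_functionsD(1)[OF j(1)] test_functionsD(1)[OF j(2)]] pd_add[OF test_functionsD(1)[OF j(3)] test_functionsD(1)[OF j(4)]]
    unfolding tconv_diff[OF K_integrable test_functions_pd[OF j(1)] test_functions_pd[OF j(2)]]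
      tconv_add[OF K_integrable test_functions_pd[OF j(3)] test_functions_pd[OF j(4)]]
    by (rule fun_cong)
qed

lemma G_dist_eq: "G_dist K \<phi> = - of_real (pairing K (pd 1 \<phi>)) + \<i> * of_real (pairing K (pd 2 \<phi>))"
  by (simp add: G_dist_def dist_dz_def dist_pd_def fun_dist_of_real)

lemma conv_G:
  assumes "f \<in> test_functions"
  shows "conv (G_dist K) (\<lambda>x. of_real (f x)) x = of_real (pd 1 (tconv K f) x) - \<i> * of_real (pd 2 (tconv K f) x)"
    and "conv (G_dist K) (\<lambda>x. \<i> * of_real (f x)) x = \<i> * conv (G_dist K) (\<lambda>x. of_real (f x)) x"
proof -
  have z: "G_dist K (\<lambda>_. 0) = 0" by (simp add: G_dist_eq pairing_def)
  have p: "pairing K (pd i (\<lambda>y. f (x - y))) = - pd i (tconv K f) x" for i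
    unfolding pd_tconv[OF K_integrable assms] pd_reflect[OF test_functionsD(1)[OF assms]]
    by (simp add: tconv_eq pairing_def)
  show "conv (G_dist K) (\<lambda>x. of_real (f x)) x = of_real (pd 1 (tconv K f) x) - \<i> * of_real (pd 2 (tconv K f) x)"
    by (simp add: conv_def z) (simp add: G_dist_eq p)
  show "conv (G_dist K) (\<lambda>x. \<i> * of_real (f x)) x = \<i> * conv (G_dist K) (\<lambda>x. of_real (f x)) x"
    by (simp add: conv_def z)
qed

text \<open>A component of \<open>xi_eps\<close> times the conjugate of another, minus the conjugate
  of this product, is 8 i times the Jacobian J of the two potentials. Convolving 8 i J with
  \<open>G_dist K\<close> and doubling gives 16 i (d1 - i d2) (K * J) = 16 (d2 + i d1) (K * J),
  where d1 and d2 are the partial derivatives.\<close>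

lemma zeta_eps_eq:
  assumes w: "\<And>j. mollify \<rho> e (w j) = (\<lambda>x. of_real (f j x))" and f: "\<And>j. f j \<in> test_functions" and \<phi>: "\<phi> \<in> test_functions"
  shows "zeta_eps K \<rho> w e j = fun_dist (\<lambda>x. of_real (16 * jac_grad 2 (f (j + 1)) (f (j + 2)) x) + \<i> * of_real (16 * jac_grad 1 (f (j + 1)) (f (j + 2)) x))"
proof -
  define u where "u j = tconv K (f j)" for j
  have J: "jac (u (j + 1)) (u (j + 2)) \<in> test_functions" for j
    unfolding u_def by (intro jac_test_function tconv_test_function[OF K_integrable] f)
  have xi: "xi_eps K \<rho> w e y $ k = 2 * \<i> * (of_real (pd 1 (u k) y) - \<i> * of_real (pd 2 (u k) y))" for y k
    by (simp add: xi_eps_def w conv_G[OF f] u_def)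
  have cr: "ccross (xi_eps K \<rho> w e y) (vcnj (xi_eps K \<rho> w e y)) $ j = \<i> * of_real (8 * jac (u (j + 1)) (u (j + 2)) y)" for y
    unfolding ccross_def vcnj_def by (simp add: xi jac_def complex_eq_iff algebra_simps)
  have "2 * conv (G_dist K) (\<lambda>y. ccross (xi_eps K \<rho> w e y) (vcnj (xi_eps K \<rho> w e y)) $ j) x
      = of_real (16 * jac_grad 2 (f (j + 1)) (f (j + 2)) x) + \<i> * of_real (16 * jac_grad 1 (f (j + 1)) (f (j + 2)) x)" for x
    unfolding cr conv_G[OF test_functions_cmult[OF J]] tconv_cmult[OF K_integrable J]
      pd_cmult[OF test_functionsD(1)[OF tconv_test_function[OF K_integrable J]]]
    by (simp add: jac_grad_def u_def complex_eq_iff)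
  then show ?thesis unfolding zeta_eps_def by simp
qed

lemma jac_grad_pos_bound:
  assumes \<alpha>: "0 < \<alpha>" "4 * \<alpha> < 1" and \<rho>: "mollifier \<rho>"
  obtains C where "C > 0"
    "\<And>f g A B i. f \<in> test_functions \<Longrightarrow> g \<in> test_functions \<Longrightarrow> neg_bound \<alpha> (pairing f) A \<Longrightarrow> neg_bound \<alpha> (pairing g) B \<Longrightarrow>
      pos_bound (1 - 4 * \<alpha>) (pairing (\<lambda>x. 16 * jac_grad i f g x)) (C * (A * B))"
    "\<And>f g f' g' A A' B B' D E i. f \<in> test_functions \<Longrightarrow> g \<in> test_functions \<Longrightarrow> f' \<in> test_functions \<Longrightarrow> g' \<in> test_functions \<Longrightarrow>
      neg_bound \<alpha> (pairing (\<lambda>x. f x - f' x)) D \<Longrightarrow> neg_bound \<alpha> (pairing g) B \<Longrightarrow>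
      neg_bound \<alpha> (pairing f') A \<Longrightarrow> neg_bound \<alpha> (pairing (\<lambda>x. g x - g' x)) E \<Longrightarrow>
      pos_bound (1 - 4 * \<alpha>) (pairing (\<lambda>x. 16 * jac_grad i f g x - 16 * jac_grad i f' g' x)) (C * (D * B + E * A))"
proof -
  obtain C where C: "C > 0"
    "\<And>f g A B i x. f \<in> test_functions \<Longrightarrow> g \<in> test_functions \<Longrightarrow> neg_bound \<alpha> (pairing f) A \<Longrightarrow> neg_bound \<alpha> (pairing g) B \<Longrightarrow>
      \<bar>jac_grad i f g x\<bar> \<le> C * (A * B)"
    "\<And>f g A B i x h. f \<in> test_functions \<Longrightarrow> g \<in> test_functions \<Longrightarrow> neg_bound \<alpha> (pairing f) A \<Longrightarrow> neg_bound \<alpha> (pairing g) B \<Longrightarrow>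
      \<bar>jac_grad i f g (x + h) - jac_grad i f g x\<bar> \<le> C * (A * B) * norm h powr (1 - 4 * \<alpha>)"
    unfolding jac_grad_def using jacobian_estimate[OF \<alpha> \<rho>] by blast
  show ?thesis
  \<comment> \<open>The factor 64 is the 16 of \<open>zeta_eps_eq\<close> times the 4 of
    \<open>pos_bound_pairing\<close>.\<close>
  proof (rule that[of "64 * C"])
    show "64 * C > 0" using C(1) by simp
  next
    fix f g A B i assume a: "f \<in> test_functions" "g \<in> test_functions" "neg_bound \<alpha> (pairing f) A" "neg_bound \<alpha> (pairing g) B"
    have "pos_bound (1 - 4 * \<alpha>) (pairing (\<lambda>x. 16 * jac_grad i f g x)) (4 * (16 * (C * (A * B))))"
    proof (rule pos_bound_pairing)
      show "\<bar>16 * jac_grad i f g (x + h) - 16 * jac_grad i f g x\<bar> \<le> 16 * (C * (A * B)) * norm h powr (1 - 4 * \<alpha>)" for x h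
        using C(3)[OF a, of i x h] by linarith
    qed (use \<alpha> C(2)[OF a] in \<open>auto intro: test_functions_cmult jac_grad_test a simp: abs_mult\<close>)
    then show "pos_bound (1 - 4 * \<alpha>) (pairing (\<lambda>x. 16 * jac_grad i f g x)) (64 * C * (A * B))" by (simp add: mult_ac)
  next
    fix f g f' g' A B D E i
    assume t: "f \<in> test_functions" "g \<in> test_functions" "f' \<in> test_functions" "g' \<in> test_functions"
      and D: "neg_bound \<alpha> (pairing (\<lambda>x. f x - f' x)) D" and B: "neg_bound \<alpha> (pairing g) B"
      and A: "neg_bound \<alpha> (pairing f') A" and E: "neg_bound \<alpha> (pairing (\<lambda>x. g x - g' x)) E"
    note a = test_functions_diff[OF t(1,3)] t(2) D B and b = t(3) test_functions_diff[OF t(2,4)] A E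
    let ?F = "\<lambda>x. 16 * jac_grad i f g x - 16 * jac_grad i f' g' x"
    let ?X = "C * (D * B) + C * (A * E)"
    define p where "p = jac_grad i (\<lambda>y. f y - f' y) g"
    define q where "q = jac_grad i f' (\<lambda>y. g y - g' y)"
    have eq: "?F x = 16 * (p x + q x)" for x
      unfolding p_def q_def jac_grad_diff[OF t, symmetric] by (simp add: right_diff_distrib)
    note p = C(2,3)[OF a, of i, folded p_def] and q = C(2,3)[OF b, of i, folded q_def]
    have "pos_bound (1 - 4 * \<alpha>) (pairing ?F) (4 * (16 * ?X))"
    proof (rule pos_bound_pairing)
      show "?F \<in> test_functions" by (intro test_functions_diff test_functions_cmult jac_grad_test t)
      show "\<bar>?F x\<bar> \<le> 16 * ?X" for x
      proof -
        have "\<bar>p x + q x\<bar> \<le> C * (D * B) + C * (A * E)"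
          by (rule order_trans[OF abs_triangle_ineq add_mono[OF p(1) q(1)]])
        then show ?thesis unfolding eq abs_mult by simp
      qed
      show "\<bar>?F (x + h) - ?F x\<bar> \<le> 16 * ?X * norm h powr (1 - 4 * \<alpha>)" for x h
      proof -
        have "\<bar>?F (x + h) - ?F x\<bar> \<le> 16 * (C * (D * B) * norm h powr (1 - 4 * \<alpha>) + C * (A * E) * norm h powr (1 - 4 * \<alpha>))"
        proof -
          have "\<bar>(p (x + h) - p x) + (q (x + h) - q x)\<bar>
              \<le> C * (D * B) * norm h powr (1 - 4 * \<alpha>) + C * (A * E) * norm h powr (1 - 4 * \<alpha>)"
            by (rule order_trans[OF abs_triangle_ineq add_mono[OF p(2) q(2)]])
          moreover have "?F (x + h) - ?F x = 16 * ((p (x + h) - p x) + (q (x + h) - q x))"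
            unfolding eq by (simp add: algebra_simps)
          ultimately show ?thesis by (simp only: abs_mult) simp
        qed
        then show ?thesis by (simp add: algebra_simps)
      qed
    qed (use \<alpha> in simp)
    then show "pos_bound (1 - 4 * \<alpha>) (pairing ?F) (64 * C * (D * B + E * A))" by (simp add: algebra_simps)
  qed
qed

end

text \<open>Once any finite bound is known, the norm is a real number and itself the least
  admissible bound, so the estimates that follow can be carried out in the reals.\<close>

lemma ennreal_neg_bound:
  assumes \<alpha>: "0 < \<alpha>" "\<alpha> < 1" and im: "\<And>\<phi>. \<phi> \<in> test_functions \<Longrightarrow> Im (f \<phi>) = 0"
    and A: "neg_bound \<alpha> (\<lambda>\<phi>. Re (f \<phi>)) A" "A \<ge> 0"
  obtains N where "N \<ge> 0" "N \<le> A" "dist_norm (- 1 - \<alpha>) f = ennreal N" "neg_bound \<alpha> (\<lambda>\<phi>. Re (f \<phi>)) N"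
proof -
  define N where "N = enn2real (real_norm (- 1 - \<alpha>) (\<lambda>\<phi>. Re (f \<phi>)))"
  have le: "real_norm (- 1 - \<alpha>) (\<lambda>\<phi>. Re (f \<phi>)) \<le> ennreal A"
    using A real_norm_neg_le_iff[OF \<alpha>] by blast
  then have N: "real_norm (- 1 - \<alpha>) (\<lambda>\<phi>. Re (f \<phi>)) = ennreal N"
    unfolding N_def by (intro ennreal_enn2real[symmetric]) (auto simp: less_top[symmetric] top_unique)
  have N0: "N \<ge> 0" by (simp add: N_def)
  show ?thesis
  proof (rule that[OF N0])
    show "N \<le> A" using le A(2) N0 unfolding N by (simp add: ennreal_le_iff)
    show "dist_norm (- 1 - \<alpha>) f = ennreal N" using dist_norm_real[OF \<alpha> im] N by simp
    show "neg_bound \<alpha> (\<lambda>\<phi>. Re (f \<phi>)) N"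
      using real_norm_neg_le_iff[OF \<alpha> N0, of "\<lambda>\<phi>. Re (f \<phi>)"] N by simp
  qed
qed

lemma neg_bound_cong:
  assumes "\<And>\<phi>. \<phi> \<in> test_functions \<Longrightarrow> \<bar>u \<phi>\<bar> = \<bar>v \<phi>\<bar>"
  shows "neg_bound \<alpha> u A \<longleftrightarrow> neg_bound \<alpha> v A"
  unfolding neg_bound_def using assms rescale_test_function test_ball_bump by simp

context green_kernel
begin

text \<open>The pathwise statement, with \<open>w\<close> a realization of the noise. Chance enters
  only through the assumptions on \<open>w\<close> and \<open>z\<close>; in particular the
  mollifications converge to \<open>w\<close> in the negative norm. The constant is chosen before
  \<open>w\<close> and \<open>z\<close>.\<close>

theorem zeta_bounds:
  assumes \<alpha>: "0 < \<alpha>" "4 * \<alpha> < 1" and \<rho>: "mollifier \<rho>"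
  obtains C where "C > 0"
    "\<And>w z. (\<And>j. is_dist (w j)) \<Longrightarrow> (\<And>j \<phi>. \<phi> \<in> test_functions \<Longrightarrow> Im (w j \<phi>) = 0) \<Longrightarrow>
      (\<And>j. \<exists>A. neg_bound \<alpha> (\<lambda>\<phi>. Re (w j \<phi>)) A) \<Longrightarrow>
      (\<And>j \<eta>. \<eta> > 0 \<Longrightarrow> \<forall>\<^sub>F e in at_right 0.
        neg_bound \<alpha> (\<lambda>\<phi>. pairing (cv (\<lambda>\<phi>. Re (w j \<phi>)) (rescale \<rho> e 0)) \<phi> - Re (w j \<phi>)) \<eta>) \<Longrightarrow>
      (\<And>j. dist_tendsto (\<lambda>e. zeta_eps K \<rho> w e j) (z j) (at_right 0)) \<Longrightarrow>
      z \<in> E_space (1 - 4 * \<alpha>) \<and>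
      (\<forall>e\<ge>0. \<forall>j.
       vec_norm (1 - 4 * \<alpha>) (zeta_ext K \<rho> w z e)
         \<le> ennreal C * (vec_norm (- 1 - \<alpha>) w)\<^sup>2 \<and>
       dist_norm (1 - 4 * \<alpha>) (\<lambda>\<phi>. zeta_ext K \<rho> w z e j \<phi> - z j \<phi>)
         \<le> ennreal C *
           (dist_norm (- 1 - \<alpha>) (\<lambda>\<phi>. W_eps \<rho> w e (j + 1) \<phi> - w (j + 1) \<phi>)
              * dist_norm (- 1 - \<alpha>) (w (j + 2))
            + dist_norm (- 1 - \<alpha>) (\<lambda>\<phi>. W_eps \<rho> w e (j + 2) \<phi> - w (j + 2) \<phi>)
              * dist_norm (- 1 - \<alpha>) (w (j + 1))))"
proof -
  have \<alpha>1: "\<alpha> < 1" using \<alpha> by linarith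
  have \<nu>: "0 < 1 - 4 * \<alpha>" using \<alpha> by linarith
  have \<rho>b: "\<rho> \<in> bump_functions" using \<rho> by (simp add: mollifier_def)
  obtain C where C: "C > 0"
    "\<And>f g A B i. f \<in> test_functions \<Longrightarrow> g \<in> test_functions \<Longrightarrow> neg_bound \<alpha> (pairing f) A \<Longrightarrow> neg_bound \<alpha> (pairing g) B \<Longrightarrow>
      pos_bound (1 - 4 * \<alpha>) (pairing (\<lambda>x. 16 * jac_grad i f g x)) (C * (A * B))"
    "\<And>f g f' g' A A' B B' D E i. f \<in> test_functions \<Longrightarrow> g \<in> test_functions \<Longrightarrow> f' \<in> test_functions \<Longrightarrow> g' \<in> test_functions \<Longrightarrow>
      neg_bound \<alpha> (pairing (\<lambda>x. f x - f' x)) D \<Longrightarrow> neg_bound \<alpha> (pairing g) B \<Longrightarrow>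
      neg_bound \<alpha> (pairing f') A \<Longrightarrow> neg_bound \<alpha> (pairing (\<lambda>x. g x - g' x)) E \<Longrightarrow>
      pos_bound (1 - 4 * \<alpha>) (pairing (\<lambda>x. 16 * jac_grad i f g x - 16 * jac_grad i f' g' x)) (C * (D * B + E * A))"
    using jac_grad_pos_bound[OF \<alpha> \<rho>] by blast
  show ?thesis
  proof (rule that[of "4 * C"])
    show "4 * C > 0" using C(1) by simp
  next
    fix w z
    assume w: "\<And>j. is_dist (w j)" and im: "\<And>j \<phi>. \<phi> \<in> test_functions \<Longrightarrow> Im (w j \<phi>) = 0"
      and bdd: "\<And>j. \<exists>A. neg_bound \<alpha> (\<lambda>\<phi>. Re (w j \<phi>)) A"
      and conv0: "\<And>j \<eta>. \<eta> > 0 \<Longrightarrow> \<forall>\<^sub>F e in at_right 0.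
        neg_bound \<alpha> (\<lambda>\<phi>. pairing (cv (\<lambda>\<phi>. Re (w j \<phi>)) (rescale \<rho> e 0)) \<phi> - Re (w j \<phi>)) \<eta>"
      and z: "\<And>j. dist_tendsto (\<lambda>e. zeta_eps K \<rho> w e j) (z j) (at_right 0)"
    define wr where "wr j = (\<lambda>\<phi>. Re (w j \<phi>))" for j
    have wr: "real_dist (wr j)" for j unfolding wr_def by (rule is_dist_real_dist(1)[OF w])
    define f where "f j e = cv (wr j) (rescale \<rho> e 0)" for j e
    have f: "f j e \<in> test_functions" if "e > 0" for j e
      unfolding f_def by (rule cv_test_function[OF wr rescale_test_function[OF \<rho>b that]])
    have mol: "mollify \<rho> e (w j) = (\<lambda>x. of_real (f j e x))" if "e > 0" for e j
      unfolding f_def wr_def by (rule mollify_real[OF w im \<rho>b that])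
    have "\<exists>A. A \<ge> 0 \<and> dist_norm (- 1 - \<alpha>) (w j) = ennreal A \<and> neg_bound \<alpha> (wr j) A" for j
    proof -
      obtain A where A: "neg_bound \<alpha> (\<lambda>\<phi>. Re (w j \<phi>)) A" using bdd by blast
      have "A \<ge> 0" by (rule neg_bound_nonneg[OF A wr[unfolded wr_def]])
      from ennreal_neg_bound[OF \<alpha>(1) \<alpha>1 im A this] obtain N where
        "N \<ge> 0" "dist_norm (- 1 - \<alpha>) (w j) = ennreal N" "neg_bound \<alpha> (\<lambda>\<phi>. Re (w j \<phi>)) N" by blast
      then show ?thesis unfolding wr_def by blast
    qed
    then have "\<forall>j. \<exists>A. A \<ge> 0 \<and> dist_norm (- 1 - \<alpha>) (w j) = ennreal A \<and> neg_bound \<alpha> (wr j) A" by blast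
    then obtain A where "\<forall>j. A j \<ge> 0 \<and> dist_norm (- 1 - \<alpha>) (w j) = ennreal (A j) \<and> neg_bound \<alpha> (wr j) (A j)"
      unfolding choice_iff by blast
    then have A: "\<And>j. A j \<ge> 0" "\<And>j. dist_norm (- 1 - \<alpha>) (w j) = ennreal (A j)" "\<And>j. neg_bound \<alpha> (wr j) (A j)"
      by blast+
    have fA: "neg_bound \<alpha> (pairing (f j e)) (A j)" if "e > 0" for j e
      unfolding f_def by (rule neg_bound_mollify[OF wr \<rho> that A(3)])
    have imW: "Im (W_eps \<rho> w e j \<phi> - w j \<phi>) = 0" "Re (W_eps \<rho> w e j \<phi> - w j \<phi>) = pairing (f j e) \<phi> - wr j \<phi>"
      if "e > 0" "\<phi> \<in> test_functions" for e j \<phi>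
      using that im[OF that(2)] by (simp_all add: W_eps_def mol fun_dist_of_real wr_def)
    have cong: "neg_bound \<alpha> (\<lambda>\<phi>. Re (W_eps \<rho> w e j \<phi> - w j \<phi>)) X \<longleftrightarrow> neg_bound \<alpha> (\<lambda>\<phi>. pairing (f j e) \<phi> - wr j \<phi>) X"
      if "e > 0" for e j X
      by (rule neg_bound_cong) (simp only: imW(2)[OF that])
    \<comment> \<open>\<open>D\<close> is the distance from the mollified component to
      \<open>w\<close> in the negative norm. The minimality clause lets \<open>conv0\<close> be read
      as convergence of these distances to 0.\<close>
    define isD where "isD j e D \<longleftrightarrow> D \<ge> 0 \<and> dist_norm (- 1 - \<alpha>) (\<lambda>\<phi>. W_eps \<rho> w e j \<phi> - w j \<phi>) = ennreal D \<and>
        neg_bound \<alpha> (\<lambda>\<phi>. pairing (f j e) \<phi> - wr j \<phi>) D \<and>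
        (\<forall>X. X \<ge> 0 \<longrightarrow> neg_bound \<alpha> (\<lambda>\<phi>. pairing (f j e) \<phi> - wr j \<phi>) X \<longrightarrow> D \<le> X)" for j e D
    have "\<exists>D. e > 0 \<longrightarrow> isD j e D" for j e
    proof (cases "e > 0")
      case True
      have "neg_bound \<alpha> (\<lambda>\<phi>. pairing (f j e) \<phi> - wr j \<phi>) (A j + A j)"
        by (rule neg_bound_add[OF fA[OF True] A(3)]) (rule abs_triangle_ineq4)
      then have nb: "neg_bound \<alpha> (\<lambda>\<phi>. Re (W_eps \<rho> w e j \<phi> - w j \<phi>)) (A j + A j)" by (simp only: cong[OF True])
      obtain D where D: "D \<ge> 0" "dist_norm (- 1 - \<alpha>) (\<lambda>\<phi>. W_eps \<rho> w e j \<phi> - w j \<phi>) = ennreal D"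
        "neg_bound \<alpha> (\<lambda>\<phi>. Re (W_eps \<rho> w e j \<phi> - w j \<phi>)) D"
        using ennreal_neg_bound[OF \<alpha>(1) \<alpha>1 imW(1)[OF True] nb add_nonneg_nonneg[OF A(1) A(1)]] by blast
      have "D \<le> X" if X: "X \<ge> 0" "neg_bound \<alpha> (\<lambda>\<phi>. pairing (f j e) \<phi> - wr j \<phi>) X" for X
      proof -
        have nbX: "neg_bound \<alpha> (\<lambda>\<phi>. Re (W_eps \<rho> w e j \<phi> - w j \<phi>)) X" using X(2) by (simp only: cong[OF True])
        obtain N where "N \<le> X" "dist_norm (- 1 - \<alpha>) (\<lambda>\<phi>. W_eps \<rho> w e j \<phi> - w j \<phi>) = ennreal N" "N \<ge> 0"
          using ennreal_neg_bound[OF \<alpha>(1) \<alpha>1 imW(1)[OF True] nbX X(1)] by blast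
        then show ?thesis using D(1,2) by simp
      qed
      moreover have "neg_bound \<alpha> (\<lambda>\<phi>. pairing (f j e) \<phi> - wr j \<phi>) D" using D(3) by (simp only: cong[OF True])
      ultimately show ?thesis using D(1,2) unfolding isD_def by blast
    qed simp
    then have "\<forall>j e. \<exists>D. e > 0 \<longrightarrow> isD j e D" by blast
    then obtain D where "\<forall>j e. e > 0 \<longrightarrow> isD j e (D j e)" unfolding choice_iff by blast
    then have D: "\<And>j e. e > 0 \<Longrightarrow> D j e \<ge> 0"
      "\<And>j e. e > 0 \<Longrightarrow> dist_norm (- 1 - \<alpha>) (\<lambda>\<phi>. W_eps \<rho> w e j \<phi> - w j \<phi>) = ennreal (D j e)"
      "\<And>j e. e > 0 \<Longrightarrow> neg_bound \<alpha> (\<lambda>\<phi>. pairing (f j e) \<phi> - wr j \<phi>) (D j e)"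
      "\<And>j e X. e > 0 \<Longrightarrow> X \<ge> 0 \<Longrightarrow> neg_bound \<alpha> (\<lambda>\<phi>. pairing (f j e) \<phi> - wr j \<phi>) X \<Longrightarrow> D j e \<le> X"
      unfolding isD_def by blast+
    have pos: "\<forall>\<^sub>F e in at_right 0. (0::real) < e" by (rule eventually_at_right_less)
    have D0: "(D j \<longlongrightarrow> 0) (at_right 0)" for j
    proof (rule order_tendstoI)
      fix a :: real assume a: "a < 0"
      show "\<forall>\<^sub>F e in at_right 0. a < D j e"
        by (rule eventually_mono[OF pos]) (rule less_le_trans[OF a D(1)])
    next
      fix a :: real assume a: "0 < a"
      have "\<forall>\<^sub>F e in at_right 0. neg_bound \<alpha> (\<lambda>\<phi>. pairing (f j e) \<phi> - wr j \<phi>) (a / 2)"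
        unfolding f_def wr_def by (rule conv0) (use a in simp)
      with pos show "\<forall>\<^sub>F e in at_right 0. D j e < a"
      proof eventually_elim
        case (elim e)
        then have "D j e \<le> a / 2" using a by (intro D(4)) auto
        then show ?case using a by linarith
      qed
    qed
    define T where "T i j e = (\<lambda>x. 16 * jac_grad i (f (j + 1) e) (f (j + 2) e) x)" for i and j :: 3 and e
    have T: "T i j e \<in> test_functions" if "e > 0" for i j e
      unfolding T_def by (intro test_functions_cmult jac_grad_test f that)
    have zeta: "zeta_eps K \<rho> w e j \<phi> = of_real (pairing (T 2 j e) \<phi>) + \<i> * of_real (pairing (T 1 j e) \<phi>)"
      "zeta_eps K \<rho> w e j = fun_dist (\<lambda>x. of_real (T 2 j e x) + \<i> * of_real (T 1 j e x))"
      if "e > 0" "\<phi> \<in> test_functions" for e j \<phi>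
    proof -
      show "zeta_eps K \<rho> w e j = fun_dist (\<lambda>x. of_real (T 2 j e x) + \<i> * of_real (T 1 j e x))"
        unfolding T_def by (rule zeta_eps_eq[OF mol[OF that(1)] f[OF that(1)] that(2)])
      then show "zeta_eps K \<rho> w e j \<phi> = of_real (pairing (T 2 j e) \<phi>) + \<i> * of_real (pairing (T 1 j e) \<phi>)"
        by (simp only: fun_dist_Re_Im[OF T[OF that(1)] T[OF that(1)] that(2)])
    qed
    define Z where "Z i j \<phi> = (if i = (2::2) then Re (z j \<phi>) else Im (z j \<phi>))" for i j \<phi>
    have Zlim: "((\<lambda>d. pairing (T i j d) \<phi>) \<longlongrightarrow> Z i j \<phi>) (at_right 0)" if \<phi>: "\<phi> \<in> test_functions" for i j \<phi>
    proof -
      have lim: "((\<lambda>d. zeta_eps K \<rho> w d j \<phi>) \<longlongrightarrow> z j \<phi>) (at_right 0)" using z[of j] \<phi> unfolding dist_tendsto_def by blast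
      show ?thesis
      proof (cases "i = 2")
        case True
        have "((\<lambda>d. Re (zeta_eps K \<rho> w d j \<phi>)) \<longlongrightarrow> Z i j \<phi>) (at_right 0)"
          unfolding Z_def using True tendsto_Re[OF lim] by simp
        then show ?thesis
          by (rule Lim_transform_eventually) (rule eventually_mono[OF pos], simp add: zeta(1)[OF _ \<phi>] True)
      next
        case False
        then have i: "i = 1" using exhaust_2[of i] by auto
        have "((\<lambda>d. Im (zeta_eps K \<rho> w d j \<phi>)) \<longlongrightarrow> Z i j \<phi>) (at_right 0)"
          unfolding Z_def using False tendsto_Im[OF lim] by simp
        then show ?thesis
          by (rule Lim_transform_eventually) (rule eventually_mono[OF pos], simp add: zeta(1)[OF _ \<phi>] i)
      qed
    qed
    have ab: "pos_bound (1 - 4 * \<alpha>) (pairing (T i j e)) (C * (A (j + 1) * A (j + 2)))" if "e > 0" for i j e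
      unfolding T_def by (intro C(2) f fA that)
    have Zb: "pos_bound (1 - 4 * \<alpha>) (Z i j) (C * (A (j + 1) * A (j + 2)))" for i j
      by (rule pos_bound_limit[OF _ trivial_limit_at_right_real tendsto_const Zlim])
        (rule eventually_mono[OF pos], rule ab)
    \<comment> \<open>The fields at two positive scales \<open>e\<close> and \<open>d\<close> are
      compared first, where all products are products of smooth functions; then \<open>d\<close>
      tends to 0 on each test function.\<close>
    have diff: "pos_bound (1 - 4 * \<alpha>) (\<lambda>\<phi>. pairing (T i j e) \<phi> - Z i j \<phi>)
        (C * (D (j + 1) e * A (j + 2) + D (j + 2) e * A (j + 1)))" if e: "e > 0" for i j e
    proof (rule pos_bound_limit[OF _ trivial_limit_at_right_real])
      show "((\<lambda>d. C * ((D (j + 1) e + D (j + 1) d) * A (j + 2) + (D (j + 2) e + D (j + 2) d) * A (j + 1)))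
          \<longlongrightarrow> C * (D (j + 1) e * A (j + 2) + D (j + 2) e * A (j + 1))) (at_right 0)"
        using D0 by (auto intro!: tendsto_eq_intros)
      show "((\<lambda>d. pairing (T i j e) \<phi> - pairing (T i j d) \<phi>) \<longlongrightarrow> pairing (T i j e) \<phi> - Z i j \<phi>) (at_right 0)"
        if "\<phi> \<in> test_functions" for \<phi>
        by (intro tendsto_intros Zlim that)
      show "\<forall>\<^sub>F d in at_right 0. pos_bound (1 - 4 * \<alpha>) (\<lambda>\<phi>. pairing (T i j e) \<phi> - pairing (T i j d) \<phi>)
          (C * ((D (j + 1) e + D (j + 1) d) * A (j + 2) + (D (j + 2) e + D (j + 2) d) * A (j + 1)))"
        using pos
      proof eventually_elim
        fix d :: real assume d: "0 < d"
        have sub: "pairing (\<lambda>x. p x - q x) \<phi> = pairing p \<phi> - pairing q \<phi>"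
          if "p \<in> test_functions" "q \<in> test_functions" "\<phi> \<in> test_functions" for p q \<phi>
          unfolding pairing_def using that
          by (subst Bochner_Integration.integral_diff[symmetric])
            (auto simp: left_diff_distrib intro!: integrable_test_function test_functions_mult)
        have nb: "neg_bound \<alpha> (pairing (\<lambda>x. f k e x - f k d x)) (D k e + D k d)" for k
        proof (rule neg_bound_add[OF D(3)[OF e] D(3)[OF d]])
          fix \<phi> assume \<phi>: "\<phi> \<in> test_functions"
          show "\<bar>pairing (\<lambda>x. f k e x - f k d x) \<phi>\<bar> \<le> \<bar>pairing (f k e) \<phi> - wr k \<phi>\<bar> + \<bar>pairing (f k d) \<phi> - wr k \<phi>\<bar>"
            unfolding sub[OF f[OF e] f[OF d] \<phi>] by linarith
        qed
        have "pos_bound (1 - 4 * \<alpha>) (pairing (\<lambda>x. T i j e x - T i j d x))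
          (C * ((D (j + 1) e + D (j + 1) d) * A (j + 2) + (D (j + 2) e + D (j + 2) d) * A (j + 1)))"
          unfolding T_def by (intro C(3) f fA nb e d)
        then show "pos_bound (1 - 4 * \<alpha>) (\<lambda>\<phi>. pairing (T i j e) \<phi> - pairing (T i j d) \<phi>)
          (C * ((D (j + 1) e + D (j + 1) d) * A (j + 2) + (D (j + 2) e + D (j + 2) d) * A (j + 1)))"
          by (rule pos_bound_abs_mono) (simp add: sub T e d)
      qed
    qed
    define X where "X j e = 4 * C * (D (j + 1) e * A (j + 2) + D (j + 2) e * A (j + 1))" for j e
    have X0: "((\<lambda>e. X j e) \<longlongrightarrow> 0) (at_right 0)" for j
      unfolding X_def using D0 by (auto intro!: tendsto_eq_intros)
    have diff_norm: "dist_norm (1 - 4 * \<alpha>) h \<le> ennreal (X j e)"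
      if e: "e > 0" and h: "\<And>\<phi>. \<phi> \<in> test_functions \<Longrightarrow> h \<phi> = zeta_eps K \<rho> w e j \<phi> - z j \<phi> \<or> h \<phi> = z j \<phi> - zeta_eps K \<rho> w e j \<phi>"
      for e j h
    proof -
      have "dist_norm (1 - 4 * \<alpha>) h \<le> ennreal (4 * (C * (D (j + 1) e * A (j + 2) + D (j + 2) e * A (j + 1))))"
      proof (rule dist_norm_pos_le[OF _ _ \<nu>])
        show "pos_bound (1 - 4 * \<alpha>) (\<lambda>\<phi>. Re (h \<phi>)) (C * (D (j + 1) e * A (j + 2) + D (j + 2) e * A (j + 1)))"
        proof (rule pos_bound_abs_mono[OF diff[OF e, of 2]])
          fix \<phi> assume \<phi>: "\<phi> \<in> test_functions"
          show "\<bar>Re (h \<phi>)\<bar> \<le> \<bar>pairing (T 2 j e) \<phi> - Z 2 j \<phi>\<bar>"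
            using h[OF \<phi>] by (auto simp: zeta(1)[OF e \<phi>] Z_def)
        qed
        show "pos_bound (1 - 4 * \<alpha>) (\<lambda>\<phi>. Im (h \<phi>)) (C * (D (j + 1) e * A (j + 2) + D (j + 2) e * A (j + 1)))"
        proof (rule pos_bound_abs_mono[OF diff[OF e, of 1]])
          fix \<phi> assume \<phi>: "\<phi> \<in> test_functions"
          show "\<bar>Im (h \<phi>)\<bar> \<le> \<bar>pairing (T 1 j e) \<phi> - Z 1 j \<phi>\<bar>"
            using h[OF \<phi>] by (auto simp: zeta(1)[OF e \<phi>] Z_def)
        qed
      qed
      then show ?thesis by (simp add: X_def mult.assoc)
    qed
    have norm_z: "dist_norm (1 - 4 * \<alpha>) (zeta_ext K \<rho> w z e j) \<le> ennreal (4 * (C * (A (j + 1) * A (j + 2))))"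
      if e: "e \<ge> 0" for e j
    proof (rule dist_norm_pos_le[OF _ _ \<nu>])
      show "pos_bound (1 - 4 * \<alpha>) (\<lambda>\<phi>. Re (zeta_ext K \<rho> w z e j \<phi>)) (C * (A (j + 1) * A (j + 2)))"
      proof (cases "e = 0")
        case True
        show ?thesis by (rule pos_bound_abs_mono[OF Zb[of 2]]) (simp add: True zeta_ext_def Z_def)
      next
        case False
        then have e': "e > 0" using e by simp
        show ?thesis by (rule pos_bound_abs_mono[OF ab[OF e', of 2]]) (simp add: False zeta_ext_def zeta(1)[OF e'])
      qed
      show "pos_bound (1 - 4 * \<alpha>) (\<lambda>\<phi>. Im (zeta_ext K \<rho> w z e j \<phi>)) (C * (A (j + 1) * A (j + 2)))"
      proof (cases "e = 0")
        case True
        show ?thesis by (rule pos_bound_abs_mono[OF Zb[of 1]]) (simp add: True zeta_ext_def Z_def)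
      next
        case False
        then have e': "e > 0" using e by simp
        show ?thesis by (rule pos_bound_abs_mono[OF ab[OF e', of 1]]) (simp add: False zeta_ext_def zeta(1)[OF e'])
      qed
    qed
    have "z j \<in> little_space (1 - 4 * \<alpha>)" for j
      unfolding little_space_def
    proof (intro CollectI conjI allI impI)
      show "is_dist (z j)" using z[of j] by (simp add: dist_tendsto_def)
      show "dist_norm (1 - 4 * \<alpha>) (z j) < \<infinity>"
        using norm_z[of 0 j] by (simp add: zeta_ext_def) (metis ennreal_less_top infinity_ennreal_def le_less_trans)
      fix e' :: ennreal assume e': "0 < e'"
      have "((\<lambda>e. ennreal (X j e)) \<longlongrightarrow> ennreal 0) (at_right 0)" by (intro tendsto_ennrealI X0)
      then have "\<forall>\<^sub>F e in at_right 0. ennreal (X j e) < e'" using e' by (intro order_tendstoD(2)) auto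
      with pos have "\<forall>\<^sub>F e in at_right 0. 0 < e \<and> ennreal (X j e) < e'" by eventually_elim simp
      then obtain e where e: "0 < e" "ennreal (X j e) < e'"
        using eventually_happens'[OF trivial_limit_at_right_real] by blast
      \<comment> \<open>The mollified field is smooth and serves as the approximation that the
        closure in \<open>little_space\<close> demands.\<close>
      let ?g = "\<lambda>x. of_real (T 2 j e x) + \<i> * of_real (T 1 j e x)"
      have "?g \<in> smooth_torus" using T[OF e(1)] by (simp add: smooth_torus_def)
      moreover have "dist_norm (1 - 4 * \<alpha>) (\<lambda>\<phi>. z j \<phi> - fun_dist ?g \<phi>) < e'"
        by (rule le_less_trans[OF diff_norm[OF e(1)] e(2)]) (simp add: zeta(2)[OF e(1) test_functions_const])
      ultimately show "\<exists>g\<in>smooth_torus. dist_norm (1 - 4 * \<alpha>) (\<lambda>\<phi>. z j \<phi> - fun_dist g \<phi>) < e'" by blast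
    qed
    then have "z \<in> E_space (1 - 4 * \<alpha>)" by (simp add: E_space_def)
    moreover have "vec_norm (1 - 4 * \<alpha>) (zeta_ext K \<rho> w z e) \<le> ennreal (4 * C) * (vec_norm (- 1 - \<alpha>) w)\<^sup>2" if e: "e \<ge> 0" for e
    proof -
      have "vec_norm (1 - 4 * \<alpha>) (zeta_ext K \<rho> w z e) \<le> ennreal (\<Sum>j\<in>UNIV. 4 * (C * (A (j + 1) * A (j + 2))))"
        by (rule vec_norm_le[OF norm_z[OF e]]) (use C(1) A(1) in simp)
      also have "(\<Sum>j\<in>UNIV. 4 * (C * (A (j + 1) * A (j + 2)))) = 4 * C * (\<Sum>j\<in>UNIV. A (j + 1) * A (j + 2))"
        by (simp add: sum_distrib_left mult.assoc)
      also have "ennreal \<dots> \<le> ennreal (4 * C * (\<Sum>j\<in>UNIV. (A j)\<^sup>2))"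
        using C(1) by (intro ennreal_leI mult_left_mono sum_cyclic_mult_le) auto
      also have "\<dots> = ennreal (4 * C) * (vec_norm (- 1 - \<alpha>) w)\<^sup>2"
        unfolding vec_norm_def esqrt_square A(2) using C(1) A(1)
        by (simp add: ennreal_mult sum_nonneg ennreal_power)
      finally show ?thesis .
    qed
    moreover have "dist_norm (1 - 4 * \<alpha>) (\<lambda>\<phi>. zeta_ext K \<rho> w z e j \<phi> - z j \<phi>)
         \<le> ennreal (4 * C) *
           (dist_norm (- 1 - \<alpha>) (\<lambda>\<phi>. W_eps \<rho> w e (j + 1) \<phi> - w (j + 1) \<phi>)
              * dist_norm (- 1 - \<alpha>) (w (j + 2))
            + dist_norm (- 1 - \<alpha>) (\<lambda>\<phi>. W_eps \<rho> w e (j + 2) \<phi> - w (j + 2) \<phi>)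
              * dist_norm (- 1 - \<alpha>) (w (j + 1)))" if e: "e \<ge> 0" for e j
    proof (cases "e = 0")
      case True
      have "pos_bound (1 - 4 * \<alpha>) (\<lambda>_. 0) 0" by (simp add: pos_bound_def)
      then have "dist_norm (1 - 4 * \<alpha>) (\<lambda>\<phi>. zeta_ext K \<rho> w z e j \<phi> - z j \<phi>) \<le> ennreal (4 * 0)"
        by (intro dist_norm_pos_le \<nu>) (simp_all add: True zeta_ext_def)
      then show ?thesis by simp
    next
      case False
      then have e': "e > 0" using e by simp
      have "dist_norm (1 - 4 * \<alpha>) (\<lambda>\<phi>. zeta_ext K \<rho> w z e j \<phi> - z j \<phi>) \<le> ennreal (X j e)"
        by (rule diff_norm[OF e']) (simp add: False zeta_ext_def)
      also have "\<dots> = ennreal (4 * C) * (ennreal (D (j + 1) e) * ennreal (A (j + 2)) + ennreal (D (j + 2) e) * ennreal (A (j + 1)))"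
        unfolding X_def using C(1) A(1) D(1)[OF e'] by (simp add: ennreal_mult ennreal_plus)
      finally show ?thesis by (simp only: D(2)[OF e'] A(2))
    qed
    ultimately show "z \<in> E_space (1 - 4 * \<alpha>) \<and>
      (\<forall>e\<ge>0. \<forall>j.
       vec_norm (1 - 4 * \<alpha>) (zeta_ext K \<rho> w z e)
         \<le> ennreal (4 * C) * (vec_norm (- 1 - \<alpha>) w)\<^sup>2 \<and>
       dist_norm (1 - 4 * \<alpha>) (\<lambda>\<phi>. zeta_ext K \<rho> w z e j \<phi> - z j \<phi>)
         \<le> ennreal (4 * C) *
           (dist_norm (- 1 - \<alpha>) (\<lambda>\<phi>. W_eps \<rho> w e (j + 1) \<phi> - w (j + 1) \<phi>)
              * dist_norm (- 1 - \<alpha>) (w (j + 2))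
            + dist_norm (- 1 - \<alpha>) (\<lambda>\<phi>. W_eps \<rho> w e (j + 2) \<phi> - w (j + 2) \<phi>)
              * dist_norm (- 1 - \<alpha>) (w (j + 1))))" by blast
  qed
qed

end

section \<open>Regularity from smooth approximations\<close>

lemma pairing_rescale_le:
  assumes "g \<in> test_functions" "\<And>x. \<bar>g x\<bar> \<le> S" "\<phi> \<in> test_ball n" "l > 0"
  shows "\<bar>pairing g (rescale \<phi> l x)\<bar> \<le> 4 * S"
proof -
  note b = test_ball_bump[OF assms(3)]
  have S: "S \<ge> 0" using assms(2)[of 0] by linarith
  have "\<bar>pairing g (rescale \<phi> l x)\<bar> = \<bar>pairing (rescale \<phi> l x) g\<bar>" by (simp add: pairing_def mult.commute)
  also have "\<dots> \<le> (\<integral>y. \<bar>rescale \<phi> l x y\<bar> \<partial>tor) * S"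
    by (rule pairing_bound[OF integrable_test_function[OF rescale_test_function[OF b assms(4)]] test_functions_borel[OF assms(1)] assms(2)])
  also have "\<dots> \<le> 4 * S"
    using integral_abs_rescale_le[OF b assms(4), of x] test_ball_integral_le[OF assms(3)] S by (intro mult_right_mono) linarith+
  finally show ?thesis .
qed

lemma neg_bound_pairing_sup:
  assumes "g \<in> test_functions" "\<And>x. \<bar>g x\<bar> \<le> S" "\<alpha> > 0"
  shows "neg_bound \<alpha> (pairing g) (4 * S)"
  unfolding neg_bound_def
proof (intro allI impI)
  fix x l \<phi> assume l: "0 < l" "l \<le> (1::real)" and \<phi>: "\<phi> \<in> test_ball 2"
  have S: "S \<ge> 0" using assms(2)[of 0] by linarith
  have "1 \<le> (1 / l) powr (1 + \<alpha>)" using l assms(3) by (intro ge_one_powr_ge_zero) auto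
  also have "(1 / l) powr (1 + \<alpha>) = l powr (- 1 - \<alpha>)"
    using l powr_minus[of l "1 + \<alpha>"] by (simp add: powr_divide inverse_eq_divide)
  finally have "4 * S * 1 \<le> 4 * S * l powr (- 1 - \<alpha>)" using S by (intro mult_left_mono) auto
  then show "\<bar>pairing g (rescale \<phi> l x)\<bar> \<le> 4 * S * l powr (- 1 - \<alpha>)"
    using pairing_rescale_le[OF assms(1,2) \<phi> l(1), of x] by linarith
qed

text \<open>The mollification error of \<open>w\<close> is that of \<open>w - g n\<close> plus that
  of \<open>g n\<close>. The former is at most \<open>2 * B n\<close> for all scales, since
  mollification does not increase the bound; the latter tends to 0 with the scale because
  \<open>g n\<close> is Lipschitz.\<close>

lemma mollified_converges:
  assumes w: "real_dist w" and \<rho>: "mollifier \<rho>" and \<alpha>: "\<alpha> > 0"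
    and g: "\<And>n. g n \<in> test_functions" and B: "\<And>n. neg_bound \<alpha> (\<lambda>\<phi>. w \<phi> - pairing (g n) \<phi>) (B n)" "B \<longlonglongrightarrow> 0"
  shows "\<exists>A. neg_bound \<alpha> w A"
    and "\<eta> > 0 \<Longrightarrow> \<forall>\<^sub>F e in at_right 0. neg_bound \<alpha> (\<lambda>\<phi>. pairing (cv w (rescale \<rho> e 0)) \<phi> - w \<phi>) \<eta>"
proof -
  have \<rho>b: "\<rho> \<in> bump_functions" "integral\<^sup>L lborel \<rho> = 1" using \<rho> by (auto simp: mollifier_def)
  obtain S where S: "\<And>x. \<bar>g 0 x\<bar> \<le> S" using test_functions_bounded[OF g] by blast
  have "neg_bound \<alpha> w (B 0 + 4 * S)"
    by (rule neg_bound_add[OF B(1) neg_bound_pairing_sup[OF g S \<alpha>]]) linarith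
  then show "\<exists>A. neg_bound \<alpha> w A" ..
  assume \<eta>: "\<eta> > 0"
  have "\<forall>\<^sub>F n in sequentially. B n < \<eta> / 4" using B(2) \<eta> by (intro order_tendstoD) auto
  then obtain n where n: "B n < \<eta> / 4" by (auto simp: eventually_sequentially)
  obtain L where L: "\<And>x h. \<bar>g n (x + h) - g n x\<bar> \<le> L * norm h" "L \<ge> 0"
    using test_function_lipschitz[OF g] by blast
  define I where "I = (LINT z|lborel. \<bar>\<rho> z\<bar>)"
  have I: "I \<ge> 0" by (simp add: I_def)
  define u where "u \<phi> = w \<phi> - pairing (g n) \<phi>" for \<phi>
  have u: "real_dist u"
    using real_dist_add_dist[OF w real_dist_pairing[OF integrable_test_function[OF g[of n]]], of "-1"] by (simp add: u_def[abs_def])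
  have main: "neg_bound \<alpha> (\<lambda>\<phi>. pairing (cv w (rescale \<rho> e 0)) \<phi> - w \<phi>) (B n + B n + 4 * (L * e * I))" if e: "e > 0" for e
  proof -
    let ?\<rho> = "rescale \<rho> e 0" and ?d = "\<lambda>x. tconv (g n) (rescale \<rho> e 0) x - g n x"
    have t: "?\<rho> \<in> test_functions" by (rule rescale_test_function[OF \<rho>b(1) e])
    note gi = integrable_test_function[OF g[of n]]
    have d: "?d \<in> test_functions" by (intro test_functions_diff tconv_test_function gi t g)
    have db: "\<bar>?d x\<bar> \<le> L * e * I" for x
      using tconv_rescale_error[OF \<rho>b e g[of n] L, of x] unfolding tconv_commute[OF g t] I_def .
    have ub: "neg_bound \<alpha> u (B n)" unfolding u_def[abs_def] by (rule B(1))
    have "neg_bound \<alpha> (\<lambda>\<phi>. pairing (cv u ?\<rho>) \<phi> - u \<phi>) (B n + B n)"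
      by (rule neg_bound_add[OF neg_bound_mollify[OF u \<rho> e ub] ub]) (rule abs_triangle_ineq4)
    then show ?thesis
    proof (rule neg_bound_add[OF _ neg_bound_pairing_sup[OF d db \<alpha>]])
      fix \<phi> assume \<phi>: "\<phi> \<in> test_functions"
      have i: "integrable tor (\<lambda>x. p x * \<phi> x)" if "p \<in> test_functions" for p
        by (intro integrable_test_function test_functions_mult that \<phi>)
      have sub: "pairing (\<lambda>x. p x - q x) \<phi> = pairing p \<phi> - pairing q \<phi>" if "p \<in> test_functions" "q \<in> test_functions" for p q
        unfolding pairing_def by (subst Bochner_Integration.integral_diff[OF i i, symmetric]) (simp_all add: that left_diff_distrib)
      have "cv u ?\<rho> = (\<lambda>x. cv w ?\<rho> x - tconv (g n) ?\<rho> x)"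
        by (simp add: cv_def u_def tconv_def fun_eq_iff)
      then have "pairing (cv u ?\<rho>) \<phi> = pairing (cv w ?\<rho>) \<phi> - pairing (tconv (g n) ?\<rho>) \<phi>"
        by (simp add: sub cv_test_function[OF w t] tconv_test_function[OF gi t])
      moreover have "pairing ?d \<phi> = pairing (tconv (g n) ?\<rho>) \<phi> - pairing (g n) \<phi>"
        by (rule sub[OF tconv_test_function[OF gi t] g])
      ultimately show "\<bar>pairing (cv w ?\<rho>) \<phi> - w \<phi>\<bar> \<le> \<bar>pairing (cv u ?\<rho>) \<phi> - u \<phi>\<bar> + \<bar>pairing ?d \<phi>\<bar>"
        unfolding u_def by linarith
    qed
  qed
  have "((\<lambda>e. 4 * (L * e * I)) \<longlongrightarrow> 4 * (L * 0 * I)) (at_right 0)" by (intro tendsto_intros)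
  then have "\<forall>\<^sub>F e in at_right 0. 4 * (L * e * I) < \<eta> / 4" using \<eta> by (intro order_tendstoD) auto
  moreover have "\<forall>\<^sub>F e in at_right 0. (0::real) < e" by (rule eventually_at_right_less)
  ultimately show "\<forall>\<^sub>F e in at_right 0. neg_bound \<alpha> (\<lambda>\<phi>. pairing (cv w (rescale \<rho> e 0)) \<phi> - w \<phi>) \<eta>"
  proof eventually_elim
    case (elim e)
    have le: "B n + B n + 4 * (L * e * I) \<le> \<eta>" using elim(1) n \<eta> by linarith
    show ?case
      unfolding neg_bound_def
    proof (intro allI impI)
      fix x l \<phi> assume l: "0 < l" "l \<le> (1::real)" and \<phi>: "\<phi> \<in> test_ball 2"
      have "\<bar>pairing (cv w (rescale \<rho> e 0)) (rescale \<phi> l x) - w (rescale \<phi> l x)\<bar> \<le> (B n + B n + 4 * (L * e * I)) * l powr (- 1 - \<alpha>)"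
        using main[OF elim(2)] l \<phi> unfolding neg_bound_def by blast
      also have "\<dots> \<le> \<eta> * l powr (- 1 - \<alpha>)" using le by (rule mult_right_mono) simp
      finally show "\<bar>pairing (cv w (rescale \<rho> e 0)) (rescale \<phi> l x) - w (rescale \<phi> l x)\<bar> \<le> \<eta> * l powr (- 1 - \<alpha>)" .
    qed
  qed
qed

text \<open>For \<open>l \<le> 1\<close> the supports of different lattice translates are disjoint,
  since two points of one support are less than 2 apart and 2 is below 2 pi. At most one summand
  contributes.\<close>

lemma rescale_abs_le:
  assumes \<phi>: "\<phi> \<in> bump_functions" "\<And>z. \<bar>\<phi> z\<bar> \<le> 1" and l: "0 < l" "l \<le> 1"
  shows "\<bar>rescale \<phi> l x y\<bar> \<le> 1 / l\<^sup>2"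
proof -
  let ?g = "\<lambda>y. \<phi> ((y - x) /\<^sub>R l) / l\<^sup>2"
  have supp: "norm (u - x) < 1" if "?g u \<noteq> 0" for u
  proof -
    have "\<phi> ((u - x) /\<^sub>R l) \<noteq> 0" using that by simp
    then have "norm ((u - x) /\<^sub>R l) < 1" using bump_eq_0[OF \<phi>(1)] not_le by blast
    then have "norm (u - x) < l" using l by (simp add: pos_divide_less_eq inverse_eq_divide)
    then show ?thesis using l by linarith
  qed
  have unique: "k = m" if "?g (y + lattice_shift k) \<noteq> 0" "?g (y + lattice_shift m) \<noteq> 0" for k m
  proof (rule ccontr)
    assume "k \<noteq> m"
    then obtain i where i: "(k - m) $ i \<noteq> 0" by (auto simp: vec_eq_iff)
    then have "1 \<le> \<bar>real_of_int ((k - m) $ i)\<bar>" by linarith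
    then have "2 * pi * 1 \<le> 2 * pi * \<bar>real_of_int ((k - m) $ i)\<bar>" by (intro mult_left_mono) auto
    also have "\<dots> = \<bar>lattice_shift (k - m) $ i\<bar>" unfolding lattice_shift_nth by (simp add: abs_mult)
    also have "\<dots> \<le> norm (lattice_shift (k - m))" by (rule component_le_norm_cart)
    also have "lattice_shift (k - m) = (y + lattice_shift k - x) - (y + lattice_shift m - x)" by simp
    also have "norm \<dots> \<le> norm (y + lattice_shift k - x) + norm (y + lattice_shift m - x)" by (rule norm_triangle_ineq4)
    also have "\<dots> < 2" using supp[OF that(1)] supp[OF that(2)] by linarith
    finally show False using pi_ge_two by linarith
  qed
  have le: "\<bar>?g u\<bar> \<le> 1 / l\<^sup>2" for u using \<phi>(2) by (simp add: divide_right_mono)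
  show ?thesis
  proof (cases "\<exists>m. ?g (y + lattice_shift m) \<noteq> 0")
    case True
    then obtain m where m: "?g (y + lattice_shift m) \<noteq> 0" by blast
    have "rescale \<phi> l x y = (\<Sum>k\<in>{m}. ?g (y + lattice_shift k))"
      unfolding rescale_def using unique[OF _ m] by (intro periodize_eq_sum) blast+
    then show ?thesis using le[of "y + lattice_shift m"] by simp
  next
    case False
    have "rescale \<phi> l x y = (\<Sum>k\<in>{}. ?g (y + lattice_shift k))"
      unfolding rescale_def using False by (intro periodize_eq_sum) blast+
    then show ?thesis by simp
  qed
qed

lemma bump_integral_le:
  assumes "\<phi> \<in> bump_functions" "\<And>z. \<bar>\<phi> z\<bar> \<le> 1"
  shows "(LINT z|lborel. \<bar>\<phi> z\<bar>) \<le> 4"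
proof -
  have "\<phi> \<in> test_ball 0" using assms by (simp add: test_ball_def)
  then show ?thesis by (rule test_ball_integral_le)
qed

text \<open>Hoelder's inequality for the exponent \<open>2 * p\<close>, in the weak form that follows from
  \<open>\<bar>h\<bar> \<le> T + h ^ (2 * p) / T ^ (2 * p - 1)\<close>.\<close>

lemma pairing_rescale_Lp_le:
  assumes h: "h \<in> test_functions" and \<phi>: "\<phi> \<in> bump_functions" "\<And>z. \<bar>\<phi> z\<bar> \<le> 1" and l: "0 < l" "l \<le> 1"
    and p: "p \<ge> 1" and \<Lambda>: "\<Lambda> > 0" "(\<integral>x. (h x) ^ (2 * p) \<partial>tor) \<le> \<Lambda> ^ (2 * p)"
  shows "\<bar>pairing h (rescale \<phi> l x)\<bar> \<le> 5 * \<Lambda> * l powr (- 1 / real p)"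
proof -
  define s where "s = l powr (- 1 / real p)"
  have s: "s > 0" "s ^ (2 * p) = 1 / l\<^sup>2"
  proof -
    show "s > 0" unfolding s_def using l by simp
    have "s ^ p = l powr (- 1)" unfolding s_def using l p by (simp add: powr_power)
    then have "s ^ p = 1 / l" using l by (simp add: powr_minus_divide)
    then have "(s ^ p)\<^sup>2 = 1 / l\<^sup>2" by (simp add: power_divide)
    then show "s ^ (2 * p) = 1 / l\<^sup>2" by (simp add: power_mult mult.commute)
  qed
  \<comment> \<open>\<open>s ^ (2 * p)\<close> is the maximal size \<open>1 / l\<^sup>2\<close> of
    the rescaled function. With this threshold the two terms of the weak inequality contribute
    \<open>4 * T\<close> and \<open>T\<close>, whence the factor 5.\<close>
  define T where "T = \<Lambda> * s"
  have T: "T > 0" unfolding T_def using \<Lambda>(1) s(1) by simp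
  define q where "q = 2 * p - 1"
  have q: "2 * p = Suc q" unfolding q_def using p by simp
  have young: "\<bar>y\<bar> \<le> T + y ^ (2 * p) / T ^ q" for y :: real
  proof (cases "\<bar>y\<bar> \<le> T")
    case False
    have "\<bar>y\<bar> * T ^ q \<le> \<bar>y\<bar> * \<bar>y\<bar> ^ q" using False T by (intro mult_left_mono power_mono) auto
    also have "\<dots> = \<bar>y\<bar> ^ (2 * p)" by (simp add: q)
    also have "\<dots> = y ^ (2 * p)" by (simp add: power_even_abs)
    finally have "\<bar>y\<bar> \<le> y ^ (2 * p) / T ^ q" using T by (simp add: pos_le_divide_eq)
    then show ?thesis using T by linarith
  next
    case True
    have "0 \<le> y ^ (2 * p) / T ^ q" using T by (simp add: power_mult)
    then show ?thesis using True by linarith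
  qed
  let ?R = "\<lambda>y. \<bar>rescale \<phi> l x y\<bar>"
  have hp: "(\<lambda>y. (h y) ^ n) \<in> test_functions" for n
    by (induction n) (simp_all add: test_functions_mult h)
  have R: "integrable tor ?R" by (intro integrable_abs integrable_test_function rescale_test_function \<phi> l)
  have Ihp: "integrable tor (\<lambda>y. (h y) ^ (2 * p))" by (rule integrable_test_function[OF hp])
  have "\<bar>pairing h (rescale \<phi> l x)\<bar> \<le> (\<integral>y. \<bar>h y * rescale \<phi> l x y\<bar> \<partial>tor)" unfolding pairing_def by (rule integral_abs_bound)
  also have "\<dots> \<le> (\<integral>y. T * ?R y + (1 / (T ^ q * l\<^sup>2)) * (h y) ^ (2 * p) \<partial>tor)"
  proof (rule integral_mono)
    show "integrable tor (\<lambda>y. \<bar>h y * rescale \<phi> l x y\<bar>)"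
      by (intro integrable_abs integrable_test_function test_functions_mult h rescale_test_function \<phi> l)
    show "integrable tor (\<lambda>y. T * ?R y + (1 / (T ^ q * l\<^sup>2)) * (h y) ^ (2 * p))"
      by (intro Bochner_Integration.integrable_add integrable_mult_right R Ihp)
    fix y
    have "\<bar>h y\<bar> * ?R y \<le> (T + (h y) ^ (2 * p) / T ^ q) * ?R y" by (intro mult_right_mono young) simp
    also have "\<dots> = T * ?R y + (h y) ^ (2 * p) / T ^ q * ?R y" by (simp add: distrib_right)
    also have "\<dots> \<le> T * ?R y + (h y) ^ (2 * p) / T ^ q * (1 / l\<^sup>2)"
      using T by (intro add_left_mono mult_left_mono rescale_abs_le \<phi> l) (simp add: power_mult)
    finally show "\<bar>h y * rescale \<phi> l x y\<bar> \<le> T * ?R y + (1 / (T ^ q * l\<^sup>2)) * (h y) ^ (2 * p)"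
      by (simp add: abs_mult)
  qed
  also have "\<dots> = T * integral\<^sup>L tor ?R + (1 / (T ^ q * l\<^sup>2)) * (\<integral>y. (h y) ^ (2 * p) \<partial>tor)"
    using R Ihp by (subst Bochner_Integration.integral_add) auto
  also have "\<dots> \<le> T * 4 + (1 / (T ^ q * l\<^sup>2)) * \<Lambda> ^ (2 * p)"
    using T \<Lambda>(2) integral_abs_rescale_le[OF \<phi>(1) l(1), of x] bump_integral_le[OF \<phi>]
    by (intro add_mono mult_left_mono) (auto intro: order_trans)
  also have "(1 / (T ^ q * l\<^sup>2)) * \<Lambda> ^ (2 * p) = T"
  proof -
    have "T * (T ^ q * l\<^sup>2) = (T ^ (2 * p)) * l\<^sup>2" unfolding q by simp
    also have "\<dots> = \<Lambda> ^ (2 * p) * (s ^ (2 * p) * l\<^sup>2)" by (simp add: T_def power_mult_distrib)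
    also have "s ^ (2 * p) * l\<^sup>2 = 1" unfolding s(2) using l by simp
    finally show ?thesis using T l by (simp add: field_simps)
  qed
  finally show ?thesis by (simp add: T_def s_def)
qed

section \<open>Fourier series\<close>

definition phase :: "int^2 \<Rightarrow> real^2 \<Rightarrow> real" where
  "phase k x = of_int (k $ 1) * x $ 1 + of_int (k $ 2) * x $ 2"

definition mode :: "complex \<Rightarrow> int^2 \<Rightarrow> real^2 \<Rightarrow> real" where
  "mode z k x = Re (z * fourier_mode k x)"

lemma fourier_mode_phase: "fourier_mode k x = cis (phase k x)"
  by (simp add: fourier_mode_def phase_def cis_conv_exp)

lemma mode_eq: "mode z k x = Re z * cos (phase k x) - Im z * sin (phase k x)"
  by (simp add: mode_def fourier_mode_phase)

lemma bounded_linear_phase: "bounded_linear (phase k)"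
  unfolding phase_def[abs_def]
  by (intro bounded_linear_add bounded_linear_const_mult bounded_linear_vec_nth)

lemma phase_axis: "phase k (axis i 1) = of_int (k $ i)"
  using exhaust_2[of i] by (auto simp: phase_def axis_def)

lemma mode_has_derivative:
  "(mode z k has_derivative (\<lambda>h. phase k h * (- Re z * sin (phase k x) - Im z * cos (phase k x)))) (at x)"
proof -
  have "(phase k has_derivative phase k) (at x)" by (rule bounded_linear_imp_has_derivative[OF bounded_linear_phase])
  then show ?thesis unfolding mode_eq[abs_def]
    by (auto intro!: derivative_eq_intros simp: algebra_simps)
qed

lemma pd_mode: "pd i (mode z k) = mode (z * \<i> * of_int (k $ i)) k"
  by (rule ext) (simp add: pd_eqI[OF mode_has_derivative] phase_axis mode_eq algebra_simps)

lemma mode_test_function: "mode z k \<in> test_functions"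
proof -
  have "smooth (mode z k)"
    by (rule smooth_coinduct[where P = "\<lambda>f. \<exists>z. f = mode z k"])
       (auto simp: pd_mode differentiable_def intro: mode_has_derivative)
  moreover have "periodic (mode z k)"
    unfolding periodic_def
  proof (intro allI)
    fix x m
    have "phase k (x + lattice_shift m) = phase k x + 2 * pi * of_int (k $ 1 * m $ 1 + k $ 2 * m $ 2)"
      by (simp add: phase_def lattice_shift_def algebra_simps)
    then show "mode z k (x + lattice_shift m) = mode z k x"
      by (simp only: mode_eq cos_add sin_add cos_int_2pin sin_int_2pin) simp
  qed
  ultimately show ?thesis by (simp add: test_functions_def)
qed

definition sqf :: "int^2 \<Rightarrow> real" where
  "sqf k = (of_int (k $ 1))\<^sup>2 + (of_int (k $ 2))\<^sup>2"

lemma laplace_mode: "pd 1 (pd 1 (mode z k)) x + pd 2 (pd 2 (mode z k)) x = - sqf k * mode z k x"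
  by (simp add: pd_mode mode_eq sqf_def power2_eq_square algebra_simps)

lemma pairing_mode:
  assumes "\<phi> \<in> test_functions"
  shows "Re (z * fun_dist (fourier_mode k) \<phi>) = pairing (mode z k) \<phi>"
proof -
  obtain B where B: "\<And>x. \<bar>\<phi> x\<bar> \<le> B" using test_functions_bounded[OF assms] by blast
  have "continuous_on UNIV (\<lambda>x. fourier_mode k x)"
    unfolding fourier_mode_def by (intro continuous_intros)
  then have m: "fourier_mode k \<in> borel_measurable borel" by (simp add: borel_measurable_continuous_onI)
  have "(\<lambda>x. fourier_mode k x * of_real (\<phi> x)) \<in> borel_measurable borel"
    using m test_functions_borel[OF assms] by simp
  then have int: "integrable tor (\<lambda>x. fourier_mode k x * of_real (\<phi> x))"
    using B by (intro tor.integrable_const_bound[where B = B] AE_I2 measurable_tor)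
      (simp_all add: fourier_mode_phase norm_mult)
  have "z * fun_dist (fourier_mode k) \<phi> = (\<integral>x. z * (fourier_mode k x * of_real (\<phi> x)) \<partial>tor)"
    unfolding fun_dist_def set_integral_tor by simp
  also have "Re \<dots> = (\<integral>x. Re (z * (fourier_mode k x * of_real (\<phi> x))) \<partial>tor)"
    using int by (intro integral_Re[symmetric] integrable_mult_right)
  also have "\<dots> = pairing (mode z k) \<phi>"
    unfolding pairing_def mode_def mult.assoc[symmetric] by simp
  finally show ?thesis .
qed

definition freq :: "nat \<Rightarrow> (int^2) set" where
  "freq n = {k. k \<noteq> 0 \<and> (\<forall>i. \<bar>k $ i\<bar> < 2 ^ n)}"

text \<open>The dyadic shell of frequencies whose largest coordinate has absolute value at least 2^n
  and below 2^(n+1).\<close>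

definition blk :: "nat \<Rightarrow> (int^2) set" where
  "blk n = freq (Suc n) - freq n"

lemma finite_freq: "finite (freq n)"
  by (rule finite_subset[OF _ finite_index_box[of "2 ^ n"]]) (auto simp: freq_def index_box_def less_imp_le)

lemma freq_mono: "m \<le> n \<Longrightarrow> freq m \<subseteq> freq n"
  unfolding freq_def by (auto intro: less_le_trans power_increasing)

lemma sqf_blk: assumes "k \<in> blk n" shows "sqf k \<ge> 4 ^ n"
proof -
  obtain i where i: "\<bar>k $ i\<bar> \<ge> 2 ^ n" using assms by (auto simp: blk_def freq_def not_less)
  have "(4::real) ^ n = (of_int (2 ^ n))\<^sup>2" by (simp add: power2_eq_square flip: power_mult_distrib)
  also have "\<dots> \<le> (of_int (k $ i))\<^sup>2" using i by (metis abs_le_square_iff abs_of_nonneg of_int_abs of_int_le_iff zero_le_numeral zero_le_power of_int_0_le_iff)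
  also have "\<dots> \<le> sqf k" using exhaust_2[of i] by (auto simp: sqf_def)
  finally show ?thesis .
qed

lemma card_blk: "real (card (blk n)) \<le> 25 * 4 ^ n"
proof -
  define N :: int where "N = 2 * 2 ^ n"
  have N: "N \<ge> 0" by (simp add: N_def)
  have "card (blk n) = card ((\<lambda>k. (k $ 1, k $ 2)) ` blk n)"
    by (rule card_image[symmetric]) (auto simp: inj_on_def vec_eq_iff forall_2)
  also have "\<dots> \<le> card ({- N..N} \<times> {- N..N})"
    by (rule card_mono) (auto simp: blk_def freq_def N_def forall_2)
  also have "\<dots> = nat (2 * N + 1) * nat (2 * N + 1)" by (simp add: card_cartesian_product)
  finally have "real (card (blk n)) \<le> real (nat (2 * N + 1) * nat (2 * N + 1))" by (simp only: of_nat_le_iff)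
  also have "\<dots> = (2 * of_int N + 1) * (2 * of_int N + 1)" using N by simp
  also have "\<dots> = (4 * 2 ^ n + 1) * (4 * 2 ^ n + 1)" by (simp add: N_def)
  also have "\<dots> \<le> (5 * 2 ^ n) * (5 * 2 ^ n)" by (intro mult_mono) simp_all
  also have "\<dots> = 25 * 4 ^ n" by (simp flip: power_mult_distrib)
  finally show ?thesis .
qed

lemma freq_exhaust: assumes "finite F" "F \<subseteq> - {0}" shows "\<exists>n. F \<subseteq> freq n"
  using assms
proof (induction F)
  case (insert k F)
  then obtain n where n: "F \<subseteq> freq n" by auto
  define m where "m = max n (nat (\<bar>k $ 1\<bar> + \<bar>k $ 2\<bar>))"
  have "\<bar>k $ i\<bar> < 2 ^ m" for i
  proof -
    have "\<bar>k $ i\<bar> \<le> int m" using exhaust_2[of i] by (auto simp: m_def)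
    also have "\<dots> < 2 ^ m" using of_nat_less_two_power[of m, where 'a = int] by simp
    finally show ?thesis .
  qed
  then have "k \<in> freq m" using insert.prems by (simp add: freq_def)
  then show ?case using n freq_mono[of n m] by (auto simp: m_def)
qed simp

definition mode_sum :: "(int^2 \<Rightarrow> complex) \<Rightarrow> (int^2) set \<Rightarrow> real^2 \<Rightarrow> real" where
  "mode_sum \<theta> F x = (\<Sum>k\<in>F. mode (\<theta> k) k x)"

lemma mode_sum_test_function: "mode_sum \<theta> F \<in> test_functions"
  unfolding mode_sum_def[abs_def] by (intro test_functions_sum mode_test_function)

text \<open>Each mode is an eigenfunction of the Laplacian with eigenvalue \<open>- sqf k\<close>,
  so on nonzero frequencies the Laplacian is inverted coefficient by coefficient.\<close>

lemma laplace_mode_sum: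
  assumes "0 \<notin> F"
  shows "pd 1 (pd 1 (mode_sum (\<lambda>k. - \<theta> k / of_real (sqf k)) F)) x
       + pd 2 (pd 2 (mode_sum (\<lambda>k. - \<theta> k / of_real (sqf k)) F)) x = mode_sum \<theta> F x"
proof -
  have *: "pd i (pd i (mode_sum c F)) x = (\<Sum>k\<in>F. pd i (pd i (mode (c k) k)) x)" for c i
    unfolding mode_sum_def[abs_def]
    by (simp add: pd_sum test_functionsD mode_test_function test_functions_pd)
  have "sqf k \<noteq> 0" if "k \<in> F" for k
  proof -
    have "k \<noteq> 0" using that assms by auto
    then show ?thesis by (simp add: sqf_def vec_eq_iff forall_2 sum_power2_eq_zero_iff)
  qed
  then have "- sqf k * mode (- \<theta> k / of_real (sqf k)) k x = mode (\<theta> k) k x" if "k \<in> F" for k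
    using that by (simp add: mode_eq right_diff_distrib)
  then show ?thesis
    unfolding * sum.distrib[symmetric] laplace_mode by (simp add: mode_sum_def)
qed

lemma pairing_mode_sum:
  assumes "\<phi> \<in> test_functions"
  shows "pairing (mode_sum \<theta> F) \<phi> = (\<Sum>k\<in>F. pairing (mode (\<theta> k) k) \<phi>)"
proof -
  have "pairing (mode_sum \<theta> F) \<phi> = (\<integral>x. (\<Sum>k\<in>F. mode (\<theta> k) k x * \<phi> x) \<partial>tor)"
    by (simp add: pairing_def mode_sum_def sum_distrib_right)
  also have "\<dots> = (\<Sum>k\<in>F. (\<integral>x. mode (\<theta> k) k x * \<phi> x \<partial>tor))"
    by (rule Bochner_Integration.integral_sum) (intro integrable_pairing integrable_test_function mode_test_function assms)
  finally show ?thesis by (simp add: pairing_def)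
qed

lemma pairing_add_left:
  assumes "f \<in> test_functions" "g \<in> test_functions" "\<phi> \<in> test_functions"
  shows "pairing (\<lambda>x. f x + g x) \<phi> = pairing f \<phi> + pairing g \<phi>"
  unfolding pairing_def distrib_right
  by (rule Bochner_Integration.integral_add) (intro integrable_pairing integrable_test_function assms)+

lemma pairing_laplace:
  assumes "g \<in> test_functions" "\<phi> \<in> test_functions"
  shows "pairing (\<lambda>x. pd 1 (pd 1 g) x + pd 2 (pd 2 g) x) \<phi> = pairing g (pd 1 (pd 1 \<phi>)) + pairing g (pd 2 (pd 2 \<phi>))"
  using assms by (simp add: pairing_add_left test_functions_pd integral_pd_mult)

text \<open>A frequency block is estimated directly at scales below its wave length and as the Laplacian
  of a smoother function above; interpolating the two bounds gains decay in \<open>n\<close>.\<close>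

lemma block_pairing_le:
  assumes h: "h \<in> test_functions" and g: "g \<in> test_functions"
    and lap: "\<And>x. pd 1 (pd 1 g) x + pd 2 (pd 2 g) x = h x"
    and \<phi>: "\<phi> \<in> test_ball 2" and l: "0 < l" "l \<le> 1" and p: "p \<ge> 1"
    and \<delta>: "0 < \<delta>" "\<delta> < 1/2" "2 * \<delta> + 1 / real p \<le> \<alpha>" and d: "d = 2 powr \<delta>" and \<Lambda>: "\<Lambda> > 0"
    and hL: "(\<integral>x. h x ^ (2 * p) \<partial>tor) \<le> (\<Lambda> * (2 * d) ^ n) ^ (2 * p)"
    and gL: "(\<integral>x. g x ^ (2 * p) \<partial>tor) \<le> (\<Lambda> * (d / 2) ^ n) ^ (2 * p)"
  shows "\<bar>pairing h (rescale \<phi> l x)\<bar> \<le> 10 * \<Lambda> * l powr (- 1 - \<alpha>) * (1 / d) ^ n"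
proof -
  have d0: "d > 0" using d by simp
  define X where "X = 10 * \<Lambda> * d ^ n * l powr (- 1 / real p)"
  have X: "X \<ge> 0" using \<Lambda> d0 by (simp add: X_def)
  note b = test_ball_bump[OF \<phi>]
  have Rt: "rescale \<phi> l x \<in> test_functions" by (rule rescale_test_function[OF b l(1)])
  have "\<bar>pairing h (rescale \<phi> l x)\<bar> \<le> 5 * (\<Lambda> * (2 * d) ^ n) * l powr (- 1 / real p)"
    by (rule pairing_rescale_Lp_le[OF h b test_ball_abs_le[OF \<phi>] l p _ hL]) (use \<Lambda> d0 in simp)
  also have "\<dots> \<le> X * 2 ^ n" using \<Lambda> d0 by (simp add: X_def power_mult_distrib mult_ac)
  finally have 1: "\<bar>pairing h (rescale \<phi> l x)\<bar> \<le> X * 2 ^ n" .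
  have pdb: "pd i (pd i \<phi>) \<in> bump_functions" "\<bar>pd i (pd i \<phi>) z\<bar> \<le> 1" for i z
  proof -
    show "pd i (pd i \<phi>) \<in> bump_functions" by (intro bump_pd b)
    have "\<bar>mpd 2 0 \<phi> z\<bar> \<le> 1" "\<bar>mpd 0 2 \<phi> z\<bar> \<le> 1" using \<phi> by (auto simp: test_ball_def)
    then show "\<bar>pd i (pd i \<phi>) z\<bar> \<le> 1" using exhaust_2[of i] by (auto simp: mpd_def numeral_2_eq_2)
  qed
  have pdR: "pd i (pd i (rescale \<phi> l x)) = (\<lambda>y. inverse (l\<^sup>2) * rescale (pd i (pd i \<phi>)) l x y)" for i
    using b l by (simp add: pd_rescale pd_cmult bump_pd test_functionsD rescale_test_function power2_eq_square mult_ac)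
  have pdR2: "\<bar>pairing g (pd i (pd i (rescale \<phi> l x)))\<bar> \<le> inverse (l\<^sup>2) * (5 * (\<Lambda> * (d / 2) ^ n) * l powr (- 1 / real p))" for i
  proof -
    have "pairing g (pd i (pd i (rescale \<phi> l x))) = inverse (l\<^sup>2) * pairing g (rescale (pd i (pd i \<phi>)) l x)"
      unfolding pdR pairing_def mult.left_commute[of "g _"] by (rule integral_mult_right_zero)
    moreover have "\<bar>pairing g (rescale (pd i (pd i \<phi>)) l x)\<bar> \<le> 5 * (\<Lambda> * (d / 2) ^ n) * l powr (- 1 / real p)"
      by (rule pairing_rescale_Lp_le[OF g pdb l p _ gL]) (use \<Lambda> d0 in simp)
    ultimately show ?thesis using l by (simp add: abs_mult mult_left_mono)
  qed
  have "pairing h (rescale \<phi> l x) = pairing g (pd 1 (pd 1 (rescale \<phi> l x))) + pairing g (pd 2 (pd 2 (rescale \<phi> l x)))"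
    using pairing_laplace[OF g Rt] by (simp add: lap)
  then have "\<bar>pairing h (rescale \<phi> l x)\<bar> \<le> 2 * (inverse (l\<^sup>2) * (5 * (\<Lambda> * (d / 2) ^ n) * l powr (- 1 / real p)))"
    using pdR2[of 1] pdR2[of 2] by linarith
  also have "\<dots> = X * (inverse (l\<^sup>2) * (1 / 2) ^ n)" by (simp add: X_def power_divide mult_ac)
  finally have 2: "\<bar>pairing h (rescale \<phi> l x)\<bar> \<le> X * (inverse (l\<^sup>2) * (1 / 2) ^ n)" .
  \<comment> \<open>With weight 1/2 the two bounds combine to X / l, without decay in
    \<open>n\<close>. Moving the weight by \<delta> gains d^(-2n) at the price of l^(-2 \<delta>);
    one factor d^-n is left after the d^n contained in \<open>X\<close> is paid.\<close>
  have "\<bar>pairing h (rescale \<phi> l x)\<bar>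
      \<le> X * ((2 ^ n) powr (1 / 2 - \<delta>) * (inverse (l\<^sup>2) * (1 / 2) ^ n) powr (1 - (1 / 2 - \<delta>)))"
    using \<delta> l by (intro powr_interpolation[OF 1 2 X]) auto
  also have "(inverse (l\<^sup>2) * (1 / 2) ^ n) powr (1 - (1 / 2 - \<delta>)) = l powr (- 1 - 2 * \<delta>) * 2 powr (- real n * (1 / 2 + \<delta>))"
  proof -
    have "inverse (l\<^sup>2) = l powr (- 2)" using l by (simp add: powr_minus powr_realpow)
    moreover have "(1 / 2 :: real) ^ n = 2 powr (- real n)" by (simp add: powr_minus powr_realpow power_divide inverse_eq_divide)
    ultimately show ?thesis by (simp add: powr_mult powr_powr algebra_simps)
  qed
  also have "(2 ^ n) powr (1 / 2 - \<delta>) = (2::real) powr (real n * (1 / 2 - \<delta>))"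
    by (simp add: powr_powr flip: powr_realpow)
  also have "2 powr (real n * (1 / 2 - \<delta>)) * (l powr (- 1 - 2 * \<delta>) * 2 powr (- real n * (1 / 2 + \<delta>)))
      = l powr (- 1 - 2 * \<delta>) * 2 powr (real n * (1 / 2 - \<delta>) + - real n * (1 / 2 + \<delta>))"
    by (simp only: powr_add mult_ac)
  also have "real n * (1 / 2 - \<delta>) + - real n * (1 / 2 + \<delta>) = - (2 * \<delta> * real n)" by (simp add: algebra_simps)
  also have "2 powr - (2 * \<delta> * real n) = (1 / d) ^ n * (1 / d) ^ n"
    by (simp add: d powr_minus power_divide powr_powr inverse_eq_divide algebra_simps flip: powr_realpow powr_add)
  also have "X * (l powr (- 1 - 2 * \<delta>) * ((1 / d) ^ n * (1 / d) ^ n))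
      = 10 * \<Lambda> * l powr (- 1 / real p + (- 1 - 2 * \<delta>)) * (1 / d) ^ n"
    using d0 unfolding powr_add by (simp add: X_def power_divide mult_ac)
  also have "\<dots> \<le> 10 * \<Lambda> * l powr (- 1 - \<alpha>) * (1 / d) ^ n"
    using \<Lambda> d0 l \<delta> by (intro mult_right_mono mult_left_mono powr_mono') auto
  finally show ?thesis .
qed

lemma mode_sum_freq_diff:
  assumes "\<phi> \<in> test_functions" "N \<le> M"
  shows "pairing (mode_sum \<theta> (freq M)) \<phi> = pairing (mode_sum \<theta> (freq N)) \<phi> + (\<Sum>n=N..<M. pairing (mode_sum \<theta> (blk n)) \<phi>)"
  using assms(2)
proof (induction M rule: dec_induct)
  case (step m)
  have "freq (Suc m) = freq m \<union> blk m" "freq m \<inter> blk m = {}" "finite (blk m)"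
    using freq_mono[of m "Suc m"] finite_freq by (auto simp: blk_def)
  then have "pairing (mode_sum \<theta> (freq (Suc m))) \<phi> = pairing (mode_sum \<theta> (freq m)) \<phi> + pairing (mode_sum \<theta> (blk m)) \<phi>"
    by (simp add: pairing_mode_sum assms sum.union_disjoint finite_freq)
  then show ?case using step by simp
qed simp

lemma geometric_sum_from:
  fixes q :: real
  assumes "q \<noteq> 1" "N \<le> M"
  shows "(\<Sum>n=N..<M. q ^ n) = (q ^ N - q ^ M) / (1 - q)"
proof -
  have "(1 - q) * (\<Sum>n=N..<M. q ^ n) = q ^ N - q ^ M"
    using assms(2)
  proof (induction M rule: dec_induct)
    case (step m)
    have "(1 - q) * (\<Sum>n=N..<Suc m. q ^ n) = (1 - q) * (\<Sum>n=N..<m. q ^ n) + (1 - q) * q ^ m"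
      using step(1) by (simp add: distrib_left)
    then show ?case unfolding step(3) by (simp add: left_diff_distrib)
  qed simp
  then show ?thesis using assms(1) by (simp add: nonzero_eq_divide_eq mult.commute)
qed

text \<open>The blocks beyond the cutoff are summed as a geometric series with ratio 1 / d. The
  bound is uniform in the upper cutoff, so it passes to the full series on each test
  function.\<close>

lemma fourier_series_neg_bound:
  assumes T: "\<And>\<phi>. \<phi> \<in> test_functions \<Longrightarrow> ((\<lambda>k. pairing (mode (\<theta> k) k) \<phi>) has_sum T \<phi>) (- {0})"
    and p: "p \<ge> 1" and \<delta>: "0 < \<delta>" "\<delta> < 1/2" "2 * \<delta> + 1 / real p \<le> \<alpha>" and d: "d = 2 powr \<delta>" and \<Lambda>: "\<Lambda> > 0"
    and hL: "\<And>n. (\<integral>x. mode_sum \<theta> (blk n) x ^ (2 * p) \<partial>tor) \<le> (\<Lambda> * (2 * d) ^ n) ^ (2 * p)"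
    and gL: "\<And>n. (\<integral>x. mode_sum (\<lambda>k. - \<theta> k / of_real (sqf k)) (blk n) x ^ (2 * p) \<partial>tor) \<le> (\<Lambda> * (d / 2) ^ n) ^ (2 * p)"
  shows "neg_bound \<alpha> (\<lambda>\<phi>. T \<phi> - pairing (mode_sum \<theta> (freq N)) \<phi>) (10 * \<Lambda> * (1 / d) ^ N / (1 - 1 / d))"
  unfolding neg_bound_def
proof (intro allI impI)
  fix x l \<phi> assume l: "0 < l" "l \<le> (1::real)" and \<phi>: "\<phi> \<in> test_ball 2"
  let ?R = "rescale \<phi> l x"
  have R: "?R \<in> test_functions" by (rule rescale_test_function[OF test_ball_bump[OF \<phi>] l(1)])
  have d1: "1 / d < 1" "1 / d > 0" using d \<delta> by simp_all
  define Q where "Q = 10 * \<Lambda> * l powr (- 1 - \<alpha>)"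
  have Q: "Q \<ge> 0" using \<Lambda> by (simp add: Q_def)
  have blk: "\<bar>pairing (mode_sum \<theta> (blk n)) ?R\<bar> \<le> Q * (1 / d) ^ n" for n
    unfolding Q_def
    by (rule block_pairing_le[OF mode_sum_test_function mode_sum_test_function laplace_mode_sum \<phi> l p \<delta> d \<Lambda> hL gL])
       (simp add: blk_def freq_def)
  have main: "\<bar>pairing (mode_sum \<theta> (freq M)) ?R - pairing (mode_sum \<theta> (freq N)) ?R\<bar> \<le> Q * ((1 / d) ^ N / (1 - 1 / d))"
    if "N \<le> M" for M
  proof -
    have "\<bar>pairing (mode_sum \<theta> (freq M)) ?R - pairing (mode_sum \<theta> (freq N)) ?R\<bar>
        = \<bar>\<Sum>n=N..<M. pairing (mode_sum \<theta> (blk n)) ?R\<bar>" using mode_sum_freq_diff[OF R that] by simp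
    also have "\<dots> \<le> (\<Sum>n=N..<M. Q * (1 / d) ^ n)" by (rule order_trans[OF sum_abs sum_mono]) (rule blk)
    also have "\<dots> = Q * (\<Sum>n=N..<M. (1 / d) ^ n)" by (simp add: sum_distrib_left)
    also have "(\<Sum>n=N..<M. (1 / d) ^ n) = ((1 / d) ^ N - (1 / d) ^ M) / (1 - 1 / d)"
      by (rule geometric_sum_from[OF _ that]) (use d1 in simp)
    also have "Q * \<dots> \<le> Q * ((1 / d) ^ N / (1 - 1 / d))"
      using Q d1 by (intro mult_left_mono divide_right_mono) auto
    finally show ?thesis .
  qed
  \<comment> \<open>The sets \<open>freq n\<close> are cofinal among the finite sets of nonzero
    frequencies, so the unconditional sum is the limit along them.\<close>
  have "filterlim freq (finite_subsets_at_top (- {0})) sequentially"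
    unfolding filterlim_finite_subsets_at_top
  proof (intro allI impI)
    fix F :: "(int^2) set" assume F: "finite F \<and> F \<subseteq> - {0}"
    then obtain m where "F \<subseteq> freq m" using freq_exhaust by blast
    then show "\<forall>\<^sub>F n in sequentially. finite (freq n) \<and> F \<subseteq> freq n \<and> freq n \<subseteq> - {0}"
      unfolding eventually_sequentially
    proof (intro exI allI impI conjI)
      fix n assume "m \<le> n"
      then show "F \<subseteq> freq n" using \<open>F \<subseteq> freq m\<close> freq_mono[of m n] by blast
      show "finite (freq n)" "freq n \<subseteq> - {0}" using finite_freq by (auto simp: freq_def)
    qed
  qed
  then have "(\<lambda>M. pairing (mode_sum \<theta> (freq M)) ?R) \<longlonglongrightarrow> T ?R"
    using filterlim_compose[OF T[OF R, unfolded has_sum_def]] by (simp add: pairing_mode_sum[OF R])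
  then have "(\<lambda>M. \<bar>pairing (mode_sum \<theta> (freq M)) ?R - pairing (mode_sum \<theta> (freq N)) ?R\<bar>)
      \<longlonglongrightarrow> \<bar>T ?R - pairing (mode_sum \<theta> (freq N)) ?R\<bar>" by (intro tendsto_intros)
  then have "\<bar>T ?R - pairing (mode_sum \<theta> (freq N)) ?R\<bar> \<le> Q * ((1 / d) ^ N / (1 - 1 / d))"
    by (rule LIMSEQ_le_const2) (use main in blast)
  also have "\<dots> = 10 * \<Lambda> * (1 / d) ^ N / (1 - 1 / d) * l powr (- 1 - \<alpha>)" by (simp add: Q_def mult_ac)
  finally show "\<bar>T ?R - pairing (mode_sum \<theta> (freq N)) ?R\<bar> \<le> 10 * \<Lambda> * (1 / d) ^ N / (1 - 1 / d) * l powr (- 1 - \<alpha>)" .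
qed

section \<open>Gaussian Fourier series\<close>

text \<open>Completing the square turns the integrand into a multiple of a normal density with
  shifted mean.\<close>

lemma nn_integral_normal_exp:
  fixes \<sigma> t :: real
  assumes "\<sigma> > 0"
  shows "(\<integral>\<^sup>+x. ennreal (normal_density 0 \<sigma> x) * ennreal (exp (t * x)) \<partial>lborel) = ennreal (exp (t\<^sup>2 * \<sigma>\<^sup>2 / 2))"
proof -
  have "normal_density 0 \<sigma> x * exp (t * x) = exp (t\<^sup>2 * \<sigma>\<^sup>2 / 2) * normal_density (t * \<sigma>\<^sup>2) \<sigma> x" for x
  proof -
    have "- (x - 0)\<^sup>2 / (2 * \<sigma>\<^sup>2) + t * x = t\<^sup>2 * \<sigma>\<^sup>2 / 2 + - (x - t * \<sigma>\<^sup>2)\<^sup>2 / (2 * \<sigma>\<^sup>2)"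
      using assms by (simp add: field_simps power2_eq_square)
    then have "exp (- (x - 0)\<^sup>2 / (2 * \<sigma>\<^sup>2)) * exp (t * x) = exp (t\<^sup>2 * \<sigma>\<^sup>2 / 2) * exp (- (x - t * \<sigma>\<^sup>2)\<^sup>2 / (2 * \<sigma>\<^sup>2))"
      by (simp only: exp_add[symmetric])
    then show ?thesis by (simp add: normal_density_def)
  qed
  then have "(\<integral>\<^sup>+x. ennreal (normal_density 0 \<sigma> x) * ennreal (exp (t * x)) \<partial>lborel)
      = (\<integral>\<^sup>+x. ennreal (exp (t\<^sup>2 * \<sigma>\<^sup>2 / 2)) * ennreal (normal_density (t * \<sigma>\<^sup>2) \<sigma> x) \<partial>lborel)"
    by (simp add: normal_density_nonneg flip: ennreal_mult')
  also have "\<dots> = ennreal (exp (t\<^sup>2 * \<sigma>\<^sup>2 / 2)) * (\<integral>\<^sup>+x. ennreal (normal_density (t * \<sigma>\<^sup>2) \<sigma> x) \<partial>lborel)"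
    by (rule nn_integral_cmult) simp
  also have "(\<integral>\<^sup>+x. ennreal (normal_density (t * \<sigma>\<^sup>2) \<sigma> x) \<partial>lborel) = 1"
    using assms by (subst nn_integral_eq_integral) (simp_all add: normal_density_nonneg)
  finally show ?thesis by simp
qed

context prob_space
begin

lemma nn_integral_exp_normal:
  assumes "distributed M lborel X (normal_density 0 \<sigma>)" "\<sigma> > 0"
  shows "(\<integral>\<^sup>+\<omega>. ennreal (exp (t * X \<omega>)) \<partial>M) = ennreal (exp (t\<^sup>2 * \<sigma>\<^sup>2 / 2))"
  using distributed_nn_integral[OF assms(1), of "\<lambda>x. ennreal (exp (t * x))"] nn_integral_normal_exp[OF assms(2), of t]
  by simp

text \<open>Real and imaginary parts are independent with variance v / 2 each, so their generating
  functions multiply.\<close>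

lemma nn_integral_exp_complex_gaussian:
  assumes X: "complex_gaussian M v X" and v: "v > 0"
  shows "(\<integral>\<^sup>+\<omega>. ennreal (exp (Re (z * X \<omega>))) \<partial>M) = ennreal (exp ((norm z)\<^sup>2 * v / 4))"
proof -
  let ?a = "\<lambda>\<omega>. Re z * Re (X \<omega>)" and ?b = "\<lambda>\<omega>. - Im z * Im (X \<omega>)"
  \<comment> \<open>Booleans index the two parts, so that the product rule for independent families
    applies.\<close>
  define Y where "Y b \<omega> = ennreal (exp ((if b then Re z else - Im z) * (if b then Re (X \<omega>) else Im (X \<omega>))))" for b \<omega>
  have "indep_vars (case_bool borel borel) (case_bool (\<lambda>\<omega>. Re (X \<omega>)) (\<lambda>\<omega>. Im (X \<omega>))) UNIV"
    using X by (simp add: complex_gaussian_def indep_var_def)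
  from indep_vars_compose2[OF this, of "\<lambda>b x. ennreal (exp ((if b then Re z else - Im z) * x))" "\<lambda>_. borel"]
  have "indep_vars (\<lambda>_. borel) (\<lambda>b \<omega>. ennreal (exp ((if b then Re z else - Im z) * (case_bool (\<lambda>\<omega>. Re (X \<omega>)) (\<lambda>\<omega>. Im (X \<omega>)) b \<omega>)))) UNIV"
    by (auto split: bool.split)
  then have "indep_vars (\<lambda>_. borel) Y UNIV"
    by (rule back_subst[where P = "\<lambda>Y. indep_vars (\<lambda>_. borel) Y UNIV"]) (auto simp: Y_def fun_eq_iff split: bool.split)
  from indep_vars_nn_integral[OF _ this]
  have "(\<integral>\<^sup>+\<omega>. Y True \<omega> * Y False \<omega> \<partial>M) = (\<integral>\<^sup>+\<omega>. Y True \<omega> \<partial>M) * (\<integral>\<^sup>+\<omega>. Y False \<omega> \<partial>M)"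
    by (simp add: UNIV_bool mult.commute)
  also have "(\<integral>\<^sup>+\<omega>. Y True \<omega> \<partial>M) = ennreal (exp ((Re z)\<^sup>2 * (sqrt (v / 2))\<^sup>2 / 2))"
    unfolding Y_def using X v nn_integral_exp_normal[of "\<lambda>\<omega>. Re (X \<omega>)" "sqrt (v / 2)" "Re z"] by (simp add: complex_gaussian_def)
  also have "(\<integral>\<^sup>+\<omega>. Y False \<omega> \<partial>M) = ennreal (exp ((- Im z)\<^sup>2 * (sqrt (v / 2))\<^sup>2 / 2))"
    unfolding Y_def using X v nn_integral_exp_normal[of "\<lambda>\<omega>. Im (X \<omega>)" "sqrt (v / 2)" "- Im z"] by (simp add: complex_gaussian_def)
  also have "(\<lambda>\<omega>. Y True \<omega> * Y False \<omega>) = (\<lambda>\<omega>. ennreal (exp (Re (z * X \<omega>))))"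
    by (simp add: Y_def fun_eq_iff flip: ennreal_mult exp_add)
  also have "ennreal (exp ((Re z)\<^sup>2 * (sqrt (v / 2))\<^sup>2 / 2)) * ennreal (exp ((- Im z)\<^sup>2 * (sqrt (v / 2))\<^sup>2 / 2))
      = ennreal (exp ((norm z)\<^sup>2 * v / 4))"
    using v by (simp add: cmod_power2 field_simps flip: ennreal_mult exp_add)
  finally show ?thesis .
qed

lemma complex_gaussian_measurable:
  assumes "complex_gaussian M v X" shows "X \<in> borel_measurable M"
proof -
  have "(\<lambda>\<omega>. Re (X \<omega>)) \<in> borel_measurable M" "(\<lambda>\<omega>. Im (X \<omega>)) \<in> borel_measurable M"
    using assms unfolding complex_gaussian_def by (auto dest: distributed_measurable)
  then show ?thesis by (subst borel_measurable_complex_iff) simp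
qed

lemma nn_integral_exp_gaussian_sum:
  assumes A: "finite A" "indep_vars (\<lambda>_. borel) X A" "\<And>k. k \<in> A \<Longrightarrow> complex_gaussian M v (X k)" and v: "v > 0"
  shows "(\<integral>\<^sup>+\<omega>. ennreal (exp (\<Sum>k\<in>A. Re (z k * X k \<omega>))) \<partial>M) = ennreal (exp ((\<Sum>k\<in>A. (norm (z k))\<^sup>2) * v / 4))"
proof -
  have "indep_vars (\<lambda>_. borel) (\<lambda>k \<omega>. ennreal (exp (Re (z k * X k \<omega>)))) A"
    by (rule indep_vars_compose2[OF A(2), of "\<lambda>k x. ennreal (exp (Re (z k * x)))" "\<lambda>_. borel"]) measurable
  from indep_vars_nn_integral[OF A(1) this]
  have "(\<integral>\<^sup>+\<omega>. (\<Prod>k\<in>A. ennreal (exp (Re (z k * X k \<omega>)))) \<partial>M) = (\<Prod>k\<in>A. ennreal (exp ((norm (z k))\<^sup>2 * v / 4)))"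
    by (simp only: nn_integral_exp_complex_gaussian[OF A(3) v] cong: prod.cong) simp
  then show ?thesis
    by (simp add: prod_ennreal exp_sum[OF A(1)] sum_distrib_right sum_divide_distrib)
qed

end

text \<open>A power is compared with a single term of the exponential series; adding both
  exponentials removes the absolute value.\<close>

lemma even_power_le_exp:
  fixes u :: real
  shows "u ^ (2 * p) \<le> fact (2 * p) * (exp u + exp (- u))"
proof -
  have *: "x ^ n \<le> fact n * exp x" if "x \<ge> 0" for x :: real and n
  proof -
    have "x ^ n /\<^sub>R fact n = (\<Sum>k\<in>{n}. x ^ k /\<^sub>R fact k)" by simp
    also have "\<dots> \<le> exp x"
      unfolding exp_def by (rule sum_le_suminf[OF summable_exp_generic]) (use that in auto)
    finally show ?thesis by (simp add: field_simps)
  qed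
  have "u ^ (2 * p) = \<bar>u\<bar> ^ (2 * p)" by (simp add: power_mult)
  also have "\<dots> \<le> fact (2 * p) * exp \<bar>u\<bar>" by (rule *) simp
  also have "\<dots> \<le> fact (2 * p) * (exp u + exp (- u))"
    by (intro mult_left_mono) (auto simp: abs_if)
  finally show ?thesis .
qed

text \<open>The factorial comes from \<open>even_power_le_exp\<close>;
  \<open>2 * exp (1 / 2)\<close> bounds the generating function of a centred Gaussian of variance at
  most one at 1 and at -1, added up.\<close>

definition gauss_const :: "nat \<Rightarrow> real" where
  "gauss_const p = fact (2 * p) * (2 * exp (1 / 2))"

text \<open>After division by \<open>s\<close> the sum has variance at most one, and its moments are
  bounded through its generating function. The law of the sum never has to be identified.\<close>

lemma (in prob_space) gaussian_sum_moment:
  assumes A: "finite A" "indep_vars (\<lambda>_. borel) X A" "\<And>k. k \<in> A \<Longrightarrow> complex_gaussian M v (X k)" and v: "v > 0"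
    and s: "s > 0" "(\<Sum>k\<in>A. (norm (z k))\<^sup>2) * v / 2 \<le> s\<^sup>2"
  shows "(\<integral>\<^sup>+\<omega>. ennreal ((\<Sum>k\<in>A. Re (z k * X k \<omega>)) ^ (2 * p)) \<partial>M) \<le> ennreal (gauss_const p * s ^ (2 * p))"
proof -
  have [measurable]: "X k \<in> borel_measurable M" if "k \<in> A" for k
    by (rule complex_gaussian_measurable[OF A(3)[OF that]])
  define h where "h \<omega> = (\<Sum>k\<in>A. Re (z k * X k \<omega>))" for \<omega>
  have [measurable]: "h \<in> borel_measurable M" unfolding h_def[abs_def] by (intro borel_measurable_sum) measurable
  have mgf: "(\<integral>\<^sup>+\<omega>. ennreal (exp (c / s * h \<omega>)) \<partial>M) \<le> ennreal (exp (1 / 2))" if "c\<^sup>2 = 1" for c :: real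
  proof -
    have "(\<integral>\<^sup>+\<omega>. ennreal (exp (c / s * h \<omega>)) \<partial>M) = (\<integral>\<^sup>+\<omega>. ennreal (exp (\<Sum>k\<in>A. Re (of_real (c / s) * z k * X k \<omega>))) \<partial>M)"
      by (simp add: h_def sum_distrib_left mult.assoc del: of_real_divide)
    also have "\<dots> = ennreal (exp ((\<Sum>k\<in>A. (norm (of_real (c / s) * z k))\<^sup>2) * v / 4))"
      by (rule nn_integral_exp_gaussian_sum[OF A v])
    also have "(\<Sum>k\<in>A. (norm (of_real (c / s) * z k))\<^sup>2) = (\<Sum>k\<in>A. (norm (z k))\<^sup>2) / s\<^sup>2"
      using that by (simp add: norm_mult norm_divide power_mult_distrib power_divide sum_divide_distrib)
    also have "(\<Sum>k\<in>A. (norm (z k))\<^sup>2) / s\<^sup>2 * v / 4 \<le> 1 / 2"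
      using s by (simp add: field_simps)
    finally show ?thesis by (simp add: ennreal_leI)
  qed
  have "(\<integral>\<^sup>+\<omega>. ennreal (h \<omega> ^ (2 * p)) \<partial>M)
      \<le> (\<integral>\<^sup>+\<omega>. ennreal (fact (2 * p) * s ^ (2 * p)) * (ennreal (exp (1 / s * h \<omega>)) + ennreal (exp ((- 1) / s * h \<omega>))) \<partial>M)"
  proof (rule nn_integral_mono)
    fix \<omega>
    have "h \<omega> ^ (2 * p) = s ^ (2 * p) * (h \<omega> / s) ^ (2 * p)" using s by (simp add: power_divide)
    also have "\<dots> \<le> s ^ (2 * p) * (fact (2 * p) * (exp (h \<omega> / s) + exp (- (h \<omega> / s))))"
      using s by (intro mult_left_mono even_power_le_exp) simp
    finally show "ennreal (h \<omega> ^ (2 * p)) \<le> ennreal (fact (2 * p) * s ^ (2 * p)) * (ennreal (exp (1 / s * h \<omega>)) + ennreal (exp ((- 1) / s * h \<omega>)))"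
      using s by (simp add: ennreal_leI mult_ac flip: ennreal_plus ennreal_mult)
  qed
  also have "\<dots> = ennreal (fact (2 * p) * s ^ (2 * p)) * ((\<integral>\<^sup>+\<omega>. ennreal (exp (1 / s * h \<omega>)) \<partial>M) + (\<integral>\<^sup>+\<omega>. ennreal (exp ((- 1) / s * h \<omega>)) \<partial>M))"
    by (subst nn_integral_cmult, measurable) (subst nn_integral_add, measurable)
  also have "\<dots> \<le> ennreal (fact (2 * p) * s ^ (2 * p)) * (ennreal (exp (1 / 2)) + ennreal (exp (1 / 2)))"
    by (intro mult_left_mono add_mono mgf) auto
  also have "\<dots> = ennreal (gauss_const p * s ^ (2 * p))"
    using s by (simp add: gauss_const_def mult_ac flip: ennreal_plus ennreal_mult)
  finally show ?thesis by (simp add: h_def)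
qed

text \<open>The expectations are summable, so almost surely the sum of all the \<open>Y n\<close> is
  finite, and it dominates each of them. The lower bound 1 on \<open>L\<close> lets the constant
  later be raised to a power.\<close>

lemma AE_bounded_geometric:
  fixes Y :: "nat \<Rightarrow> 'a \<Rightarrow> ennreal"
  assumes m: "\<And>n. Y n \<in> borel_measurable M" and Y: "\<And>n. (\<integral>\<^sup>+\<omega>. Y n \<omega> \<partial>M) \<le> ennreal (C * q ^ n)"
    and q: "0 \<le> q" "q < 1" "C \<ge> 0"
  shows "AE \<omega> in M. \<exists>L\<ge>1. \<forall>n. Y n \<omega> \<le> ennreal L"
proof -
  have "(\<integral>\<^sup>+\<omega>. (\<Sum>n. Y n \<omega>) \<partial>M) = (\<Sum>n. \<integral>\<^sup>+\<omega>. Y n \<omega> \<partial>M)" by (rule nn_integral_suminf[OF m])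
  also have "\<dots> \<le> (\<Sum>n. ennreal (C * q ^ n))" by (intro suminf_le Y) auto
  also have "\<dots> = ennreal (\<Sum>n. C * q ^ n)"
    using q by (intro suminf_ennreal2 summable_mult summable_geometric) auto
  finally have "(\<integral>\<^sup>+\<omega>. (\<Sum>n. Y n \<omega>) \<partial>M) \<noteq> \<infinity>" by (auto simp: top_unique)
  then have "AE \<omega> in M. (\<Sum>n. Y n \<omega>) \<noteq> \<infinity>"
    using m by (intro nn_integral_PInf_AE borel_measurable_suminf_order)
  then show ?thesis
  proof eventually_elim
    case (elim \<omega>)
    define L where "L = max 1 (enn2real (\<Sum>n. Y n \<omega>))"
    have "Y n \<omega> \<le> ennreal L" for n
    proof -
      have "Y n \<omega> \<le> (\<Sum>n. Y n \<omega>)" using sum_le_suminf[of "\<lambda>n. Y n \<omega>" "{n}"] by simp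
      also have "\<dots> = ennreal (enn2real (\<Sum>n. Y n \<omega>))" using elim by (simp add: less_top)
      also have "\<dots> \<le> ennreal L" by (intro ennreal_leI) (simp add: L_def)
      finally show ?thesis .
    qed
    then show ?case by (intro exI[of _ L]) (simp add: L_def)
  qed
qed

lemma fourier_mode_borel [measurable]: "fourier_mode k \<in> borel_measurable borel"
  unfolding fourier_mode_def[abs_def]
  by (intro borel_measurable_continuous_onI continuous_intros)

lemma norm_fourier_mode: "norm (fourier_mode k x) = 1"
  by (simp add: fourier_mode_phase)

context prob_space
begin

text \<open>Exchanging the integrals reduces the claim to a fixed point of the torus. The phases
  have modulus one, so the same variance bound holds at every point and
  \<open>gaussian_sum_moment\<close> applies.\<close>

lemma gaussian_mode_sum_moment:
  fixes \<theta> :: "int^2 \<Rightarrow> 3 \<Rightarrow> 'a \<Rightarrow> complex"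
  assumes F: "finite F" and ind: "indep_vars (\<lambda>_. borel) (\<lambda>(k, i). \<theta> k i) ((\<lambda>k. (k, j)) ` F)"
    and g: "\<And>k. k \<in> F \<Longrightarrow> complex_gaussian M v (\<theta> k j)" and v: "v > 0"
    and s: "s > 0" "(\<Sum>k\<in>F. (norm (c k))\<^sup>2) * v / 2 \<le> s\<^sup>2"
  shows "(\<integral>\<^sup>+\<omega>. \<integral>\<^sup>+x. ennreal (mode_sum (\<lambda>k. c k * \<theta> k j \<omega>) F x ^ (2 * p)) \<partial>tor \<partial>M)
      \<le> ennreal (4 * pi\<^sup>2 * gauss_const p * s ^ (2 * p))" (is "?l \<le> _")
    and "(\<lambda>\<omega>. \<integral>\<^sup>+x. ennreal (mode_sum (\<lambda>k. c k * \<theta> k j \<omega>) F x ^ (2 * p)) \<partial>tor) \<in> borel_measurable M"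
proof -
  interpret pair_sigma_finite M tor
    by (intro pair_sigma_finite.intro sigma_finite_measure_axioms tor.sigma_finite_measure_axioms)
  have [measurable]: "\<theta> k j \<in> borel_measurable M" if "k \<in> F" for k
    by (rule complex_gaussian_measurable[OF g[OF that]])
  have [measurable]: "fourier_mode k \<in> borel_measurable tor" for k
    by (intro measurable_tor fourier_mode_borel)
  have m [measurable]: "(\<lambda>(\<omega>, x). ennreal (mode_sum (\<lambda>k. c k * \<theta> k j \<omega>) F x ^ (2 * p))) \<in> borel_measurable (M \<Otimes>\<^sub>M tor)"
    unfolding mode_sum_def mode_def by measurable
  show "(\<lambda>\<omega>. \<integral>\<^sup>+x. ennreal (mode_sum (\<lambda>k. c k * \<theta> k j \<omega>) F x ^ (2 * p)) \<partial>tor) \<in> borel_measurable M"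
    using tor.borel_measurable_nn_integral_fst[OF m] by simp
  have "?l = (\<integral>\<^sup>+x. \<integral>\<^sup>+\<omega>. ennreal (mode_sum (\<lambda>k. c k * \<theta> k j \<omega>) F x ^ (2 * p)) \<partial>M \<partial>tor)"
    using Fubini'[OF m] by simp
  also have "\<dots> \<le> (\<integral>\<^sup>+x. ennreal (gauss_const p * s ^ (2 * p)) \<partial>tor)"
  proof (rule nn_integral_mono)
    fix x
    have inj: "inj_on (\<lambda>k. (k, j)) F" by (simp add: inj_on_def)
    have "(\<integral>\<^sup>+\<omega>. ennreal ((\<Sum>a\<in>(\<lambda>k. (k, j)) ` F. Re (c (fst a) * fourier_mode (fst a) x * (case a of (k, i) \<Rightarrow> \<theta> k i) \<omega>)) ^ (2 * p)) \<partial>M)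
        \<le> ennreal (gauss_const p * s ^ (2 * p))"
    proof (rule gaussian_sum_moment[OF _ ind _ v s(1)])
      show "(\<Sum>a\<in>(\<lambda>k. (k, j)) ` F. (cmod (c (fst a) * fourier_mode (fst a) x))\<^sup>2) * v / 2 \<le> s\<^sup>2"
        using s(2) by (simp add: sum.reindex[OF inj] norm_mult norm_fourier_mode)
    qed (use F g in auto)
    then show "(\<integral>\<^sup>+\<omega>. ennreal (mode_sum (\<lambda>k. c k * \<theta> k j \<omega>) F x ^ (2 * p)) \<partial>M) \<le> ennreal (gauss_const p * s ^ (2 * p))"
      unfolding mode_sum_def mode_def by (simp only: sum.reindex[OF inj] o_def fst_conv case_prod_conv mult_ac)
  qed
  also have "\<dots> = ennreal (4 * pi\<^sup>2 * gauss_const p * s ^ (2 * p))"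
    using s by (simp add: emeasure_tor gauss_const_def mult_ac flip: ennreal_mult')
  finally show "?l \<le> ennreal (4 * pi\<^sup>2 * gauss_const p * s ^ (2 * p))" .
qed

text \<open>A block has at most 25 * 4^n modes; with coefficients of size (t/2)^n the standard
  deviation is at most 5 t^n. The extra factor d^n makes the normalized moments summable in
  \<open>n\<close>. The cases of interest are t = 2 for the noise and t = 1/2 for its inverse
  Laplacian.\<close>

lemma gaussian_blocks_AE:
  fixes \<theta> :: "int^2 \<Rightarrow> 3 \<Rightarrow> 'a \<Rightarrow> complex"
  assumes ind: "indep_vars (\<lambda>_. borel) (\<lambda>(k, i). \<theta> k i) ((- {0}) \<times> {j})"
    and g: "\<And>k. k \<noteq> 0 \<Longrightarrow> complex_gaussian M v (\<theta> k j)" and v: "v > 0" "v \<le> 2"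
    and t: "t > 0" "\<And>n k. k \<in> blk n \<Longrightarrow> norm (c k) \<le> (t / 2) ^ n" and d: "d > 1" and p: "p \<ge> 1"
  shows "AE \<omega> in M. \<exists>L\<ge>1. \<forall>n. (\<integral>x. mode_sum (\<lambda>k. c k * \<theta> k j \<omega>) (blk n) x ^ (2 * p) \<partial>tor) \<le> (L * (t * d) ^ n) ^ (2 * p)"
proof -
  have b0: "k \<noteq> 0" if "k \<in> blk n" for k n using that by (auto simp: blk_def freq_def)
  have fin: "finite (blk n)" for n using finite_freq[of "Suc n"] by (simp add: blk_def)
  have var: "(\<Sum>k\<in>blk n. (norm (c k))\<^sup>2) * v / 2 \<le> (5 * t ^ n)\<^sup>2" for n
  proof -
    have "(\<Sum>k\<in>blk n. (norm (c k))\<^sup>2) \<le> (\<Sum>k\<in>blk n. ((t / 2) ^ n)\<^sup>2)"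
      by (intro sum_mono power_mono t) auto
    also have "\<dots> = real (card (blk n)) * ((t / 2) ^ n)\<^sup>2" by simp
    also have "\<dots> \<le> (25 * 4 ^ n) * ((t / 2) ^ n)\<^sup>2" by (intro mult_right_mono card_blk) simp
    also have "\<dots> = (5 * t ^ n)\<^sup>2"
      by (simp add: power2_eq_square flip: power_mult_distrib)
    finally have "(\<Sum>k\<in>blk n. (norm (c k))\<^sup>2) \<le> (5 * t ^ n)\<^sup>2" .
    then have "(\<Sum>k\<in>blk n. (norm (c k))\<^sup>2) * (v / 2) \<le> (5 * t ^ n)\<^sup>2 * 1"
      using v by (intro mult_mono) (auto intro: sum_nonneg)
    then show ?thesis by simp
  qed
  let ?I = "\<lambda>n \<omega>. \<integral>\<^sup>+x. ennreal (mode_sum (\<lambda>k. c k * \<theta> k j \<omega>) (blk n) x ^ (2 * p)) \<partial>tor"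
  have ind': "indep_vars (\<lambda>_. borel) (\<lambda>(k, i). \<theta> k i) ((\<lambda>k. (k, j)) ` blk n)" for n
    by (rule indep_vars_subset[OF ind]) (use b0 in auto)
  have s0: "5 * t ^ n > 0" for n using t by simp
  note mom = gaussian_mode_sum_moment[OF fin ind' g[OF b0] v(1) s0 var]
  let ?C = "4 * pi\<^sup>2 * gauss_const p * 5 ^ (2 * p)"
  have C: "?C \<ge> 0" by (simp add: gauss_const_def)
  have "AE \<omega> in M. \<exists>L\<ge>1. \<forall>n. ennreal (1 / ((t * d) ^ n) ^ (2 * p)) * ?I n \<omega> \<le> ennreal L"
  proof (rule AE_bounded_geometric)
    show "(\<lambda>\<omega>. ennreal (1 / ((t * d) ^ n) ^ (2 * p)) * ?I n \<omega>) \<in> borel_measurable M" for n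
      by (intro borel_measurable_times_ennreal borel_measurable_const mom(2))
    show "(\<integral>\<^sup>+\<omega>. ennreal (1 / ((t * d) ^ n) ^ (2 * p)) * ?I n \<omega> \<partial>M) \<le> ennreal (?C * (1 / d ^ (2 * p)) ^ n)" for n
    proof -
      have "(\<integral>\<^sup>+\<omega>. ennreal (1 / ((t * d) ^ n) ^ (2 * p)) * ?I n \<omega> \<partial>M) = ennreal (1 / ((t * d) ^ n) ^ (2 * p)) * (\<integral>\<^sup>+\<omega>. ?I n \<omega> \<partial>M)"
        by (rule nn_integral_cmult[OF mom(2)])
      also have "\<dots> \<le> ennreal (1 / ((t * d) ^ n) ^ (2 * p)) * ennreal (4 * pi\<^sup>2 * gauss_const p * (5 * t ^ n) ^ (2 * p))"
        by (rule mult_left_mono[OF mom(1) zero_le])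
      also have "\<dots> = ennreal (1 / ((t * d) ^ n) ^ (2 * p) * (4 * pi\<^sup>2 * gauss_const p * (5 * t ^ n) ^ (2 * p)))"
        using t d by (intro ennreal_mult[symmetric]) (simp_all add: gauss_const_def)
      also have "1 / ((t * d) ^ n) ^ (2 * p) * (4 * pi\<^sup>2 * gauss_const p * (5 * t ^ n) ^ (2 * p)) = ?C * (1 / d ^ (2 * p)) ^ n"
        using t d by (simp add: power_mult_distrib power_divide power_commutes mult_ac flip: power_mult)
      finally show ?thesis .
    qed
    show "0 \<le> 1 / d ^ (2 * p)" "1 / d ^ (2 * p) < 1" using d p one_less_power[of d "2 * p"] by auto
  qed (rule C)
  then show ?thesis
  proof eventually_elim
    case (elim \<omega>)
    then obtain L where L: "L \<ge> 1" "\<And>n. ennreal (1 / ((t * d) ^ n) ^ (2 * p)) * ?I n \<omega> \<le> ennreal L" by blast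
    have "(\<integral>x. mode_sum (\<lambda>k. c k * \<theta> k j \<omega>) (blk n) x ^ (2 * p) \<partial>tor) \<le> (L * (t * d) ^ n) ^ (2 * p)" for n
    proof -
      let ?h = "mode_sum (\<lambda>k. c k * \<theta> k j \<omega>) (blk n)" and ?J = "\<integral>x. mode_sum (\<lambda>k. c k * \<theta> k j \<omega>) (blk n) x ^ (2 * p) \<partial>tor"
      let ?a = "((t * d) ^ n) ^ (2 * p)"
      have a: "?a > 0" using t d by simp
      have int: "integrable tor (\<lambda>x. ?h x ^ (2 * p))"
        by (intro tor_integrable_continuous continuous_intros test_functions_continuous mode_sum_test_function)
      have "?I n \<omega> = ennreal ?J"
        by (rule nn_integral_eq_integral[OF int]) (simp add: power_mult)
      then have "ennreal (1 / ?a * ?J) \<le> ennreal L"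
        using L(2)[of n] a ennreal_mult'[of "1 / ?a" ?J] by simp
      then have "1 / ?a * ?J \<le> L" using L(1) by (subst (asm) ennreal_le_iff) auto
      then have "?J \<le> L * ?a" using a by (simp add: field_simps)
      \<comment> \<open>Since \<open>L \<ge> 1\<close>, the random constant may be moved inside the
        power.\<close>
      also have "\<dots> \<le> L ^ (2 * p) * ?a"
        using L(1) a p self_le_power[of L "2 * p"] by (intro mult_right_mono) auto
      finally show ?thesis by (simp add: power_mult_distrib)
    qed
    then show ?case using L(1) by blast
  qed
qed

text \<open>The smooth approximations required by \<open>mollified_converges\<close> are the dyadic
  partial sums of the Fourier series together with the constant mode. On the event where all blocks
  obey their moment bounds, their errors decay geometrically by
  \<open>fourier_series_neg_bound\<close>.\<close>

lemma white_noise_regularity: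
  assumes wn: "white_noise M v W" and v: "v \<in> {1, 2}" and \<rho>: "mollifier \<rho>" and \<alpha>: "0 < \<alpha>" "\<alpha> < 1"
  shows "AE \<omega> in M. \<forall>j. is_dist (W \<omega> j) \<and> (\<forall>\<phi>\<in>test_functions. Im (W \<omega> j \<phi>) = 0) \<and>
     (\<exists>A. neg_bound \<alpha> (\<lambda>\<phi>. Re (W \<omega> j \<phi>)) A) \<and>
     (\<forall>\<eta>>0. \<forall>\<^sub>F e in at_right 0.
        neg_bound \<alpha> (\<lambda>\<phi>. pairing (cv (\<lambda>\<phi>. Re (W \<omega> j \<phi>)) (rescale \<rho> e 0)) \<phi> - Re (W \<omega> j \<phi>)) \<eta>)"
proof -
  obtain \<eta> :: "3 \<Rightarrow> 'a \<Rightarrow> real" and \<theta> :: "int^2 \<Rightarrow> 3 \<Rightarrow> 'a \<Rightarrow> complex" where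
    ind: "indep_vars (\<lambda>_. borel) (\<lambda>(k, j) \<omega>. if k = 0 then of_real (\<eta> j \<omega>) else \<theta> k j \<omega>) UNIV"
    and g: "\<And>j k. k \<noteq> 0 \<Longrightarrow> complex_gaussian M v (\<theta> k j)"
    and W: "AE \<omega> in M. \<forall>j. is_dist (W \<omega> j) \<and>
           (\<exists>S. dist_has_sum (\<lambda>k \<phi>. \<theta> k j \<omega> * fun_dist (fourier_mode k) \<phi>) S (- {0}) \<and>
                (\<forall>\<phi>\<in>test_functions. W \<omega> j \<phi> = fun_dist (\<lambda>x. of_real (\<eta> j \<omega>)) \<phi> + of_real (Re (S \<phi>))))"
    using wn unfolding white_noise_def by blast
  have ind': "indep_vars (\<lambda>_. borel) (\<lambda>(k, i). \<theta> k i) ((- {0}) \<times> {j})" for j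
  proof -
    have "indep_vars (\<lambda>_. borel) (\<lambda>(k, j) \<omega>. if k = 0 then of_real (\<eta> j \<omega>) else \<theta> k j \<omega>) ((- {0}) \<times> {j})"
      by (rule indep_vars_subset[OF ind]) simp
    then show ?thesis by (subst indep_vars_cong) auto
  qed
  have v': "v > 0" "v \<le> 2" using v by auto
  \<comment> \<open>With these values 2 \<delta> = \<alpha>/2 and 1/p is at most \<alpha>/2, which
    together is the loss that \<open>fourier_series_neg_bound\<close> admits.\<close>
  define \<delta> where "\<delta> = \<alpha> / 4"
  define p where "p = nat \<lceil>2 / \<alpha>\<rceil>"
  define d where "d = 2 powr \<delta>"
  have p: "p \<ge> 1" and p2: "real p \<ge> 2 / \<alpha>"
    using \<alpha> real_nat_ceiling_ge[of "2 / \<alpha>"] unfolding p_def by (simp_all add: Suc_le_eq)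
  have \<delta>: "0 < \<delta>" "\<delta> < 1/2" "2 * \<delta> + 1 / real p \<le> \<alpha>"
    using \<alpha> p p2 by (simp_all add: \<delta>_def field_simps)
  have d1: "d > 1" using \<delta> by (simp add: d_def)
  have h: "AE \<omega> in M. \<forall>j. \<exists>L\<ge>1. \<forall>n. (\<integral>x. mode_sum (\<lambda>k. 1 * \<theta> k j \<omega>) (blk n) x ^ (2 * p) \<partial>tor) \<le> (L * (2 * d) ^ n) ^ (2 * p)"
    by (rule eventually_all_finite, rule gaussian_blocks_AE[OF ind' g v' _ _ d1 p]) auto
  \<comment> \<open>On the n-th block the inverse Laplacian multiplies coefficients by at most 4^-n,
    which is (t/2)^n with t = 1/2.\<close>
  have g: "AE \<omega> in M. \<forall>j. \<exists>L\<ge>1. \<forall>n. (\<integral>x. mode_sum (\<lambda>k. of_real (- 1 / sqf k) * \<theta> k j \<omega>) (blk n) x ^ (2 * p) \<partial>tor) \<le> (L * (1 / 2 * d) ^ n) ^ (2 * p)"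
  proof (rule eventually_all_finite, rule gaussian_blocks_AE[OF ind' g v' _ _ d1 p])
    fix n k assume "k \<in> blk n"
    then have "4 ^ n \<le> sqf k" by (rule sqf_blk)
    moreover have "sqf k > 0" using calculation by (rule less_le_trans[rotated]) simp
    ultimately have "1 / sqf k \<le> 1 / 4 ^ n" "sqf k > 0" by (simp_all add: frac_le)
    then show "norm (complex_of_real (- 1 / sqf k)) \<le> (1 / 2 / 2) ^ n"
      by (simp add: norm_divide power_divide)
  qed simp_all
  from W h g show ?thesis
  proof eventually_elim
    case (elim \<omega>)
    show ?case
    proof
      fix j
      let ?w = "\<lambda>\<phi>. Re (W \<omega> j \<phi>)"
      obtain S where isd: "is_dist (W \<omega> j)" and S: "dist_has_sum (\<lambda>k \<phi>. \<theta> k j \<omega> * fun_dist (fourier_mode k) \<phi>) S (- {0})"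
        and WS: "\<And>\<phi>. \<phi> \<in> test_functions \<Longrightarrow> W \<omega> j \<phi> = fun_dist (\<lambda>x. of_real (\<eta> j \<omega>)) \<phi> + of_real (Re (S \<phi>))"
        using elim(1) by blast
      obtain L1 where L1: "L1 \<ge> 1" "\<And>n. (\<integral>x. mode_sum (\<lambda>k. \<theta> k j \<omega>) (blk n) x ^ (2 * p) \<partial>tor) \<le> (L1 * (2 * d) ^ n) ^ (2 * p)"
        using elim(2) by auto
      obtain L2 where L2: "L2 \<ge> 1" "\<And>n. (\<integral>x. mode_sum (\<lambda>k. of_real (- 1 / sqf k) * \<theta> k j \<omega>) (blk n) x ^ (2 * p) \<partial>tor) \<le> (L2 * (1 / 2 * d) ^ n) ^ (2 * p)"
        using elim(3) by blast
      define L where "L = max L1 L2"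
      have L: "L > 0" "L \<ge> L1" "L \<ge> L2" using L1(1) by (auto simp: L_def)
      have hL: "(\<integral>x. mode_sum (\<lambda>k. \<theta> k j \<omega>) (blk n) x ^ (2 * p) \<partial>tor) \<le> (L * (2 * d) ^ n) ^ (2 * p)" for n
        by (rule order_trans[OF L1(2) power_mono[OF mult_right_mono[OF L(2)]]]) (use L1(1) d1 in auto)
      have gL: "(\<integral>x. mode_sum (\<lambda>k. - \<theta> k j \<omega> / of_real (sqf k)) (blk n) x ^ (2 * p) \<partial>tor) \<le> (L * (d / 2) ^ n) ^ (2 * p)" for n
      proof -
        have "mode_sum (\<lambda>k. - \<theta> k j \<omega> / of_real (sqf k)) (blk n) = mode_sum (\<lambda>k. of_real (- 1 / sqf k) * \<theta> k j \<omega>) (blk n)"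
          by simp
        then show ?thesis
          using order_trans[OF L2(2)[of n] power_mono[OF mult_right_mono[OF L(3)], of "(1 / 2 * d) ^ n" "2 * p"]] L2(1) d1 by simp
      qed
      have T: "((\<lambda>k. pairing (mode (\<theta> k j \<omega>) k) \<phi>) has_sum Re (S \<phi>)) (- {0})" if "\<phi> \<in> test_functions" for \<phi>
      proof -
        have "((\<lambda>k. \<theta> k j \<omega> * fun_dist (fourier_mode k) \<phi>) has_sum S \<phi>) (- {0})"
          using S that unfolding dist_has_sum_def by blast
        from has_sum_Re[OF this] show ?thesis by (simp only: pairing_mode[OF that])
      qed
      let ?g = "\<lambda>N x. \<eta> j \<omega> + mode_sum (\<lambda>k. \<theta> k j \<omega>) (freq N) x"
      let ?B = "\<lambda>N. 10 * L * (1 / d) ^ N / (1 - 1 / d)"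
      have Wre: "W \<omega> j \<phi> = of_real (pairing (\<lambda>_. \<eta> j \<omega>) \<phi> + Re (S \<phi>))" if "\<phi> \<in> test_functions" for \<phi>
        using WS[OF that] by (simp add: fun_dist_of_real)
      have gt: "?g N \<in> test_functions" for N by (intro test_functions_add test_functions_const mode_sum_test_function)
      have nb: "neg_bound \<alpha> (\<lambda>\<phi>. ?w \<phi> - pairing (?g N) \<phi>) (?B N)" for N
      proof (subst neg_bound_cong)
        show "\<bar>?w \<phi> - pairing (?g N) \<phi>\<bar> = \<bar>Re (S \<phi>) - pairing (mode_sum (\<lambda>k. \<theta> k j \<omega>) (freq N)) \<phi>\<bar>" if "\<phi> \<in> test_functions" for \<phi>
          by (simp add: Wre that pairing_add_left mode_sum_test_function)
        show "neg_bound \<alpha> (\<lambda>\<phi>. Re (S \<phi>) - pairing (mode_sum (\<lambda>k. \<theta> k j \<omega>) (freq N)) \<phi>) (?B N)"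
          by (rule fourier_series_neg_bound[OF T p \<delta> d_def L(1) hL gL])
      qed
      have lim: "?B \<longlonglongrightarrow> 0"
        using d1 by (intro tendsto_eq_intros LIMSEQ_power_zero | simp)+
      note mc = mollified_converges[OF is_dist_real_dist(1)[OF isd] \<rho> \<alpha>(1) gt nb lim]
      show "is_dist (W \<omega> j) \<and> (\<forall>\<phi>\<in>test_functions. Im (W \<omega> j \<phi>) = 0) \<and> (\<exists>A. neg_bound \<alpha> ?w A) \<and>
          (\<forall>\<eta>>0. \<forall>\<^sub>F e in at_right 0. neg_bound \<alpha> (\<lambda>\<phi>. pairing (cv ?w (rescale \<rho> e 0)) \<phi> - ?w \<phi>) \<eta>)"
        using isd mc by (simp add: Wre)
    qed
  qed
qed

end

theorem corollary4p9:
  fixes M :: "'a measure" and W \<zeta> :: "'a \<Rightarrow> 3 \<Rightarrow> dist"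
    and K \<rho> :: "real^2 \<Rightarrow> real" and \<kappa> v :: real
  assumes "prob_space M"
    and "green_function K"
    and "mollifier \<rho>"
    and "v \<in> {1, 2}"
    and "white_noise M v W"
    and "AE \<omega> in M. \<forall>j. dist_tendsto (\<lambda>e. zeta_eps K \<rho> (W \<omega>) e j) (\<zeta> \<omega> j) (at_right 0)"
    and "0 < \<kappa>" and "\<kappa> < 1/2"
  shows "(AE \<omega> in M. \<zeta> \<omega> \<in> E_space (1 - \<kappa>)) \<and>
    (\<exists>C>0. AE \<omega> in M. \<forall>e\<ge>0. \<forall>j.
       vec_norm (1 - \<kappa>) (zeta_ext K \<rho> (W \<omega>) (\<zeta> \<omega>) e)
         \<le> ennreal C * (vec_norm (- 1 - \<kappa>/4) (W \<omega>))\<^sup>2 \<and>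
       dist_norm (1 - \<kappa>) (\<lambda>\<phi>. zeta_ext K \<rho> (W \<omega>) (\<zeta> \<omega>) e j \<phi> - \<zeta> \<omega> j \<phi>)
         \<le> ennreal C *
           (dist_norm (- 1 - \<kappa>/4) (\<lambda>\<phi>. W_eps \<rho> (W \<omega>) e (j + 1) \<phi> - W \<omega> (j + 1) \<phi>)
              * dist_norm (- 1 - \<kappa>/4) (W \<omega> (j + 2))
            + dist_norm (- 1 - \<kappa>/4) (\<lambda>\<phi>. W_eps \<rho> (W \<omega>) e (j + 2) \<phi> - W \<omega> (j + 2) \<phi>)
              * dist_norm (- 1 - \<kappa>/4) (W \<omega> (j + 1))))"
proof -
  obtain k r where "k \<in> bump_functions" "r \<in> bump_functions" "integral\<^sup>L lborel r = 1"
    "\<And>x. pd 1 (pd 1 k) x + pd 2 (pd 2 k) x = r x - 4 * r (2 *\<^sub>R x)"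
    using ex_green_kernel[OF assms(3)] by blast
  then interpret green_kernel K k r by (intro green_kernel.intro assms(2))
  \<comment> \<open>With a quarter of the exponent as \<alpha>, the indices 1 - 4 \<alpha> and - 1 -
    \<alpha> of \<open>zeta_bounds\<close> become those of the statement. Its constant is fixed
    before any realization of the noise, hence deterministic.\<close>
  have \<alpha>: "0 < \<kappa> / 4" "4 * (\<kappa> / 4) < 1" "\<kappa> / 4 < 1" using assms(7,8) by auto
  obtain C where C: "C > 0"
    "\<And>w z. (\<And>j. is_dist (w j)) \<Longrightarrow> (\<And>j \<phi>. \<phi> \<in> test_functions \<Longrightarrow> Im (w j \<phi>) = 0) \<Longrightarrow>
      (\<And>j. \<exists>A. neg_bound (\<kappa> / 4) (\<lambda>\<phi>. Re (w j \<phi>)) A) \<Longrightarrow>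
      (\<And>j \<eta>. \<eta> > 0 \<Longrightarrow> \<forall>\<^sub>F e in at_right 0.
        neg_bound (\<kappa> / 4) (\<lambda>\<phi>. pairing (cv (\<lambda>\<phi>. Re (w j \<phi>)) (rescale \<rho> e 0)) \<phi> - Re (w j \<phi>)) \<eta>) \<Longrightarrow>
      (\<And>j. dist_tendsto (\<lambda>e. zeta_eps K \<rho> w e j) (z j) (at_right 0)) \<Longrightarrow>
      z \<in> E_space (1 - \<kappa>) \<and>
      (\<forall>e\<ge>0. \<forall>j.
       vec_norm (1 - \<kappa>) (zeta_ext K \<rho> w z e)
         \<le> ennreal C * (vec_norm (- 1 - \<kappa>/4) w)\<^sup>2 \<and>
       dist_norm (1 - \<kappa>) (\<lambda>\<phi>. zeta_ext K \<rho> w z e j \<phi> - z j \<phi>)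
         \<le> ennreal C *
           (dist_norm (- 1 - \<kappa>/4) (\<lambda>\<phi>. W_eps \<rho> w e (j + 1) \<phi> - w (j + 1) \<phi>)
              * dist_norm (- 1 - \<kappa>/4) (w (j + 2))
            + dist_norm (- 1 - \<kappa>/4) (\<lambda>\<phi>. W_eps \<rho> w e (j + 2) \<phi> - w (j + 2) \<phi>)
              * dist_norm (- 1 - \<kappa>/4) (w (j + 1))))"
    using zeta_bounds[OF \<alpha>(1,2) assms(3)] by simp blast
  have "AE \<omega> in M. \<zeta> \<omega> \<in> E_space (1 - \<kappa>) \<and> (\<forall>e\<ge>0. \<forall>j.
       vec_norm (1 - \<kappa>) (zeta_ext K \<rho> (W \<omega>) (\<zeta> \<omega>) e)
         \<le> ennreal C * (vec_norm (- 1 - \<kappa>/4) (W \<omega>))\<^sup>2 \<and>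
       dist_norm (1 - \<kappa>) (\<lambda>\<phi>. zeta_ext K \<rho> (W \<omega>) (\<zeta> \<omega>) e j \<phi> - \<zeta> \<omega> j \<phi>)
         \<le> ennreal C *
           (dist_norm (- 1 - \<kappa>/4) (\<lambda>\<phi>. W_eps \<rho> (W \<omega>) e (j + 1) \<phi> - W \<omega> (j + 1) \<phi>)
              * dist_norm (- 1 - \<kappa>/4) (W \<omega> (j + 2))
            + dist_norm (- 1 - \<kappa>/4) (\<lambda>\<phi>. W_eps \<rho> (W \<omega>) e (j + 2) \<phi> - W \<omega> (j + 2) \<phi>)
              * dist_norm (- 1 - \<kappa>/4) (W \<omega> (j + 1))))"
    using prob_space.white_noise_regularity[OF assms(1,5,4,3) \<alpha>(1,3)] assms(6)
  proof eventually_elim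
    case (elim \<omega>)
    note e = elim(1)[rule_format]
    show ?case
    proof (rule C(2))
      show "is_dist (W \<omega> j)" for j using e[of j] by (elim conjE)
      show "Im (W \<omega> j \<phi>) = 0" if "\<phi> \<in> test_functions" for j \<phi> using elim(1) that by blast
      show "\<exists>A. neg_bound (\<kappa> / 4) (\<lambda>\<phi>. Re (W \<omega> j \<phi>)) A" for j using elim(1) by blast
      show "\<forall>\<^sub>F e in at_right 0. neg_bound (\<kappa> / 4) (\<lambda>\<phi>. pairing (cv (\<lambda>\<phi>. Re (W \<omega> j \<phi>)) (rescale \<rho> e 0)) \<phi> - Re (W \<omega> j \<phi>)) \<eta>"
        if "\<eta> > 0" for j \<eta> using elim(1) that by blast
      show "dist_tendsto (\<lambda>e. zeta_eps K \<rho> (W \<omega>) e j) (\<zeta> \<omega> j) (at_right 0)" for j using elim(2) by blast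
    qed
  qed
  then have A: "AE \<omega> in M. \<zeta> \<omega> \<in> E_space (1 - \<kappa>)" and
    B: "AE \<omega> in M. \<forall>e\<ge>0. \<forall>j.
       vec_norm (1 - \<kappa>) (zeta_ext K \<rho> (W \<omega>) (\<zeta> \<omega>) e)
         \<le> ennreal C * (vec_norm (- 1 - \<kappa>/4) (W \<omega>))\<^sup>2 \<and>
       dist_norm (1 - \<kappa>) (\<lambda>\<phi>. zeta_ext K \<rho> (W \<omega>) (\<zeta> \<omega>) e j \<phi> - \<zeta> \<omega> j \<phi>)
         \<le> ennreal C *
           (dist_norm (- 1 - \<kappa>/4) (\<lambda>\<phi>. W_eps \<rho> (W \<omega>) e (j + 1) \<phi> - W \<omega> (j + 1) \<phi>)
              * dist_norm (- 1 - \<kappa>/4) (W \<omega> (j + 2))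
            + dist_norm (- 1 - \<kappa>/4) (\<lambda>\<phi>. W_eps \<rho> (W \<omega>) e (j + 2) \<phi> - W \<omega> (j + 2) \<phi>)
              * dist_norm (- 1 - \<kappa>/4) (W \<omega> (j + 1)))"
    by (simp_all only: AE_conj_iff)
  from A B C(1) show ?thesis by blast
qed

end
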